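(* Assume that the integrability condition (C$_2$) of the context is in force and let $(\widetilde Y^{\Re},Y^{\Re},Z^{\Re})$ be the solution of the discretely obliquely reflected BSDE $\mathcal D(\Re,C,F,\xi)$. For any $i\in\mathcal I$ and $t\in[0,T]$, the following hold: (i) $\widetilde Y^{\Re}$ dominates any $\Re$-switched BSDE, that is, $U^a_t\le(\widetilde Y^{\Re}_t)^i$ $\mathbb P$-a.s. for any $a\in\mathcal A^{\Re}_{t,i}$. (ii) Define the strategy $a^*=(\theta^*_j,\alpha^*_j)_{j\ge0}$ recursively by $(\theta_0^*,\alpha_0^* ):=(t,i)$ and, for $j\ge1$, $$\theta^*_j:=\inf\Big\{s\in[\theta^*_{j-1},T]\cap\Re\ \Big|\ (\widetilde Y^{\Re}_s)^{\alpha^*_{j-1}}\le\max_{k\ne\alpha^*_{j-1}}\{(\widetilde Y^{\Re}_s)^k-C^{\alpha^*_{j-1}k}_s\}\Big\},$$ $$\alpha^*_j:=\min\Big\{\ell\ne\alpha^*_{j-1}\ \Big|\ (\widetilde Y^{\Re}_{\theta^*_j})^\ell-C^{\alpha^*_{j-1}\ell}_{\theta^*_j}=\max_{k\ne\alpha^*_{j-1}}\{(\widetilde Y^{\Re}_{\theta^*_j})^k-C^{\alpha^*_{j-1}k}_{\theta^*_j}\}\Big\}.$$ Then $a^*\in\mathcal A^{\Re}_{t,i}$ and $(\widetilde Y^{\Re}_t)^i=U^{a^*}_t$ $\mathbb P$-a.s. (iii) The following "Snell envelope" representation holds: $(\widetilde Y^{\Re}_t)^i=\operatorname{ess\,sup}_{a\in\mathcal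 A^{\Re}_{t,i}}U^a_t$ $\mathbb P$-a.s.
   Context: Fix $T>0$, integers $d,q\ge1$, $\mathcal I=\{1,\dots,d\}$, and a probability space carrying a $q$-dimensional Brownian motion $W$ with its usual augmented filtration $(\mathcal F_t)_{t\le T}$. $\mathcal M^{d,q}$ is the set of real $d\times q$ matrices. $\mathcal S^2$: real càdlàg progressively measurable processes with $\mathbb E[\sup_{t\le T}|Y_t|^2]<\infty$; $\mathcal H^2$: progressively measurable $Z$ (row vectors of length $q$) with $\mathbb E[\int_0^T|Z_t|^2dt]<\infty$. Reflection grid: $\Re=\{r_0=0<\dots<r_\kappa=T\}$ deterministic with $|\Re|=\max_k|r_k-r_{k-1}|\le L/\kappa$, $L>0$ a fixed constant. Data $(C,F,\xi)$: $C=(C^{ij})_{1\le i,j\le d}$ with $C^{ij}\in\mathcal S^2$, $C^{ii}=0$, $\inf_tC^{ij}_t>1/L$ for $i\ne j$, $\inf_t(C^{ij}_t+C^{jl}_t-C^{il}_t)>0$ for $i\ne j,\ j\ne l$. Put $\mathcal Q_t=\{y\in\mathbb R^d:y^i\ge\max_j(y^j-C^{ij}_t),\ 1\le i\le d\}$ and $\mathcal P_t(y)=(\max_{j\in\mathcal I}\{y^j-C^{ij}_t\})_{1\le i\le d}$. $\xi\in[L^2(\mathcal F_T)]^d$ takes values in $\mathcal Q_T$. $F:\Omega\times[0,T]\times\mathbb R^d\times\mathcal M^{d,q}\to\mathbb R^d$ is (progressive $\otimes$ Borel)-measurable, a.s. satisfies $|F(t,y,z)-F(t,y',z')|\le L(|y-y'|+|z-z'|)$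 for all $t,y,y',z,z'$, and $F^i(t,y,z)=F^i(t,y^i,z^i)$ with $z^i$ the $i$-th row of $z$. Discretely obliquely reflected BSDE $\mathcal D(\Re,C,F,\xi)$: $(\widetilde Y^{\Re},Y^{\Re},Z^{\Re})\in(\mathcal S^2\times\mathcal S^2\times\mathcal H^2)^{\mathcal I}$ with $Y^{\Re}_T=\widetilde Y^{\Re}_T=\xi$ and, for $j\le\kappa-1$, $t\in[r_j,r_{j+1})$, $\widetilde Y^{\Re}_t=Y^{\Re}_{r_{j+1}}+\int_t^{r_{j+1}}F(u,\widetilde Y^{\Re}_u,Z^{\Re}_u)du-\int_t^{r_{j+1}}Z^{\Re}_udW_u$, $\ Y^{\Re}_t=\widetilde Y^{\Re}_t\mathbf 1_{\{t\notin\Re\}}+\mathcal P_t(\widetilde Y^{\Re}_t)\mathbf 1_{\{t\in\Re\}}$. Condition (C$_p$), $p\ge2$: $|\xi|^p+\sup_{t\le T}|C_t|^p+\int_0^T|F(s,0,0)|^pds\le\beta$ for a positive random variable $\beta$, not depending on $\Re$, with $\mathbb E[\beta]\le C_L$, a constant depending only on $L$. Switching strategies: a strategy is $a=(\theta_j,\alpha_j)_{j\ge0}$ with $(\theta_j)$ a nondecreasing sequence of stopping times and $\alpha_j$ an $\mathcal F_{\theta_j}$-measurable $\mathcal I$-valued random variable. $N^a=\#\{k\ge1:\theta_k\le T\}$ (stopping times may exceed $T$; $\inf\emptyset=+\infty$); the state process is $a_s=\alpha_j$ for $\theta_j\le s<\theta_{j+1}$ (and $a_s=\alpha_0$ for $s<\theta_0$);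 the cumulated cost is $A^a_s=\sum_{j=1}^{N^a}C^{\alpha_{j-1}\alpha_j}_{\theta_j}\mathbf 1_{\{\theta_j\le s\le T\}}$. $\mathcal A^{\Re}_{t,i}$ is the set of strategies with $\theta_0=t$, $\alpha_0=i$, $\mathbb E[|A^a_T|^2]<\infty$, and $\theta_j\in\Re$ for $1\le j\le N^a$. Switched BSDE: for $a\in\mathcal A^{\Re}_{t,i}$, $(U^a,V^a)$ is the solution of $U^a_u=\xi^{a_T}+\int_u^TF^{a_s}(s,U^a_s,V^a_s)ds-\int_u^TV^a_sdW_s-A^a_T+A^a_u$, $t\le u\le T$, where $F^k(s,\cdot,\cdot)$ is viewed as a function of the $k$-th component of $y$ and $k$-th row of $z$.
   Formalization: For t in the grid the literal claim fails (a switch at time t is free in U^a_t), so strategies must also satisfy a_t = i and the infimum defining θ*_j runs over s > t; N^a is required a.s. finite and Y is not required to be càdlàg. *)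

theory Defs
  imports "HOL-Probability.Probability"
begin

text \<open>
  Conventions. The index set of the \<open>d\<close> modes is a finite linearly ordered type \<open>'d\<close>
  (the order is used by the minimum in the optimal strategy); \<open>'q\<close> indexes the components of the
  Brownian motion. A process is a function \<open>X :: real \<Rightarrow> 'w \<Rightarrow> _\<close> of which only the values on
  \<open>[0,T]\<close> matter; a \<open>d \<times> q\<close> matrix is \<open>real ^ 'q ^ 'd\<close>, so that \<open>z $ i\<close> is the \<open>i\<close>-th row.
  Pathwise requirements on processes are imposed almost surely.
\<close>

section \<open>Brownian motion and its augmented filtration\<close>

definition natural_filtration ::
  "'w measure \<Rightarrow> (real \<Rightarrow> 'w \<Rightarrow> real ^ 'q) \<Rightarrow> real \<Rightarrow> 'w measure" where
  "natural_filtration M W t =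
     sigma (space M) {W s -` B \<inter> space M | s B. 0 \<le> s \<and> s \<le> t \<and> B \<in> sets borel}"

text \<open>On a complete space, \<open>null_sets M\<close> contains all subsets of null events.\<close>

definition augmented_filtration ::
  "'w measure \<Rightarrow> (real \<Rightarrow> 'w \<Rightarrow> real ^ 'q) \<Rightarrow> real \<Rightarrow> 'w measure" where
  "augmented_filtration M W t =
     sigma (space M) (sets (natural_filtration M W t) \<union> null_sets M)"

definition brownian_motion ::
  "'w measure \<Rightarrow> real \<Rightarrow> (real \<Rightarrow> 'w \<Rightarrow> real ^ 'q) \<Rightarrow> bool" where
  "brownian_motion M T W \<longleftrightarrow>
     (\<forall>t\<in>{0..T}. W t \<in> borel_measurable M) \<and>
     (AE \<omega> in M. W 0 \<omega> = 0) \<and>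
     (AE \<omega> in M. continuous_on {0..T} (\<lambda>t. W t \<omega>)) \<and>
     (\<forall>s t. 0 \<le> s \<and> s < t \<and> t \<le> T \<longrightarrow>
        prob_space.indep_set M (sets (natural_filtration M W s))
          {(\<lambda>\<omega>. W t \<omega> - W s \<omega>) -` B \<inter> space M | B. B \<in> sets borel} \<and>
        prob_space.indep_vars M (\<lambda>_. borel) (\<lambda>k \<omega>. (W t \<omega> - W s \<omega>) $ k) UNIV \<and>
        (\<forall>k. distributed M lborel (\<lambda>\<omega>. (W t \<omega> - W s \<omega>) $ k) (normal_density 0 (sqrt (t - s)))))"

section \<open>Spaces of processes\<close>

definition prog_algebra ::
  "'w measure \<Rightarrow> (real \<Rightarrow> 'w measure) \<Rightarrow> real \<Rightarrow> (real \<times> 'w) measure" where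
  "prog_algebra M \<F> T =
     sigma ({0..T} \<times> space M)
       {A. A \<subseteq> {0..T} \<times> space M \<and>
           (\<forall>t\<in>{0..T}. A \<inter> ({0..t} \<times> space M)
                          \<in> sets (restrict_space borel {0..t} \<Otimes>\<^sub>M \<F> t))}"

definition progressive ::
  "'w measure \<Rightarrow> (real \<Rightarrow> 'w measure) \<Rightarrow> real \<Rightarrow> (real \<Rightarrow> 'w \<Rightarrow> 'b::topological_space) \<Rightarrow> bool" where
  "progressive M \<F> T X \<longleftrightarrow> (\<lambda>(s, \<omega>). X s \<omega>) \<in> borel_measurable (prog_algebra M \<F> T)"

definition cadlag :: "real \<Rightarrow> (real \<Rightarrow> real) \<Rightarrow> bool" where
  "cadlag T f \<longleftrightarrow>
     (\<forall>t\<in>{0..<T}. (f \<longlongrightarrow> f t) (at_right t)) \<and> (\<forall>t\<in>{0<..T}. \<exists>l. (f \<longlongrightarrow> l) (at_left t))"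

text \<open>Progressive with \<open>E[sup |X|\<^sup>2] < \<infinity>\<close>, without path regularity.\<close>

definition sup_L2 ::
  "'w measure \<Rightarrow> (real \<Rightarrow> 'w measure) \<Rightarrow> real \<Rightarrow> (real \<Rightarrow> 'w \<Rightarrow> real) \<Rightarrow> bool" where
  "sup_L2 M \<F> T X \<longleftrightarrow>
     progressive M \<F> T X \<and> (\<integral>\<^sup>+ \<omega>. (SUP t\<in>{0..T}. ennreal (\<bar>X t \<omega>\<bar>\<^sup>2)) \<partial>M) < \<infinity>"

definition S2 ::
  "'w measure \<Rightarrow> (real \<Rightarrow> 'w measure) \<Rightarrow> real \<Rightarrow> (real \<Rightarrow> 'w \<Rightarrow> real) \<Rightarrow> bool" where
  "S2 M \<F> T X \<longleftrightarrow> sup_L2 M \<F> T X \<and> (AE \<omega> in M. cadlag T (\<lambda>t. X t \<omega>))"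

definition H2 ::
  "'w measure \<Rightarrow> (real \<Rightarrow> 'w measure) \<Rightarrow> real \<Rightarrow> (real \<Rightarrow> 'w \<Rightarrow> real ^ 'q) \<Rightarrow> bool" where
  "H2 M \<F> T Z \<longleftrightarrow>
     progressive M \<F> T Z \<and>
     (\<integral>\<^sup>+ \<omega>. (\<integral>\<^sup>+ t\<in>{0..T}. ennreal ((norm (Z t \<omega>))\<^sup>2) \<partial>lborel) \<partial>M) < \<infinity>"

section \<open>The Ito integral\<close>

text \<open>
  A simple integrand is \<open>\<Sum>k<n. 1_{(p k, p (k+1)]} H k\<close> with \<open>H k\<close> bounded and
  \<open>\<F> (p k)\<close>-measurable. The Ito integral process of \<open>Z \<in> H2\<close> is the continuous process that is
  the \<open>L\<^sup>2\<close> limit of the elementary integrals of simple integrands converging to \<open>Z\<close>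
  in \<open>L\<^sup>2(dt \<otimes> dP)\<close>. It is unique up to indistinguishability, whence the relational form.
\<close>

definition simple_integrand ::
  "'w measure \<Rightarrow> (real \<Rightarrow> 'w measure) \<Rightarrow> real \<Rightarrow> nat \<Rightarrow> (nat \<Rightarrow> real) \<Rightarrow> (nat \<Rightarrow> 'w \<Rightarrow> real ^ 'q) \<Rightarrow> bool"
where
  "simple_integrand M \<F> T n p H \<longleftrightarrow>
     (\<forall>k\<le>n. 0 \<le> p k \<and> p k \<le> T) \<and> (\<forall>k<n. p k \<le> p (Suc k)) \<and>
     (\<forall>k<n. H k \<in> borel_measurable (\<F> (p k))) \<and>
     (\<exists>b. \<forall>k<n. \<forall>\<omega>\<in>space M. norm (H k \<omega>) \<le> b)"

definition simple_process ::
  "nat \<Rightarrow> (nat \<Rightarrow> real) \<Rightarrow> (nat \<Rightarrow> 'w \<Rightarrow> real ^ 'q) \<Rightarrow> real \<Rightarrow> 'w \<Rightarrow> real ^ 'q" where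
  "simple_process n p H s \<omega> = (\<Sum>k<n. indicator {p k <.. p (Suc k)} s *\<^sub>R H k \<omega>)"

definition simple_integral ::
  "(real \<Rightarrow> 'w \<Rightarrow> real ^ 'q) \<Rightarrow> nat \<Rightarrow> (nat \<Rightarrow> real) \<Rightarrow> (nat \<Rightarrow> 'w \<Rightarrow> real ^ 'q) \<Rightarrow> real \<Rightarrow> 'w \<Rightarrow> real" where
  "simple_integral W n p H s \<omega> =
     (\<Sum>k<n. H k \<omega> \<bullet> (W (min (p (Suc k)) s) \<omega> - W (min (p k) s) \<omega>))"

definition is_ito_integral ::
  "'w measure \<Rightarrow> (real \<Rightarrow> 'w measure) \<Rightarrow> real \<Rightarrow> (real \<Rightarrow> 'w \<Rightarrow> real ^ 'q) \<Rightarrow>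
   (real \<Rightarrow> 'w \<Rightarrow> real ^ 'q) \<Rightarrow> (real \<Rightarrow> 'w \<Rightarrow> real) \<Rightarrow> bool" where
  "is_ito_integral M \<F> T W Z I \<longleftrightarrow>
     progressive M \<F> T I \<and> (AE \<omega> in M. continuous_on {0..T} (\<lambda>t. I t \<omega>)) \<and>
     (\<exists>n p H. (\<forall>m. simple_integrand M \<F> T (n m) (p m) (H m)) \<and>
        (\<lambda>m. \<integral>\<^sup>+ \<omega>. (\<integral>\<^sup>+ s\<in>{0..T}.
                ennreal ((norm (Z s \<omega> - simple_process (n m) (p m) (H m) s \<omega>))\<^sup>2) \<partial>lborel) \<partial>M)
          \<longlonglongrightarrow> 0 \<and>
        (\<forall>t\<in>{0..T}.
           (\<lambda>m. \<integral>\<^sup>+ \<omega>. ennreal ((I t \<omega> - simple_integral W (n m) (p m) (H m) t \<omega>)\<^sup>2) \<partial>M)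
             \<longlonglongrightarrow> 0))"

section \<open>Reflection grid, data and the reflected BSDE\<close>

definition reflection_grid :: "real \<Rightarrow> real \<Rightarrow> nat \<Rightarrow> (nat \<Rightarrow> real) \<Rightarrow> bool" where
  "reflection_grid T L \<kappa> r \<longleftrightarrow>
     0 < \<kappa> \<and> r 0 = 0 \<and> r \<kappa> = T \<and> (\<forall>k<\<kappa>. r k < r (Suc k)) \<and>
     (MAX k\<in>{1..\<kappa>}. \<bar>r k - r (k - 1)\<bar>) \<le> L / real \<kappa>"

definition cost_process ::
  "'w measure \<Rightarrow> (real \<Rightarrow> 'w measure) \<Rightarrow> real \<Rightarrow> real \<Rightarrow> (real \<Rightarrow> 'w \<Rightarrow> real ^ 'd ^ 'd) \<Rightarrow> bool" where
  "cost_process M \<F> T L C \<longleftrightarrow>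
     (\<forall>i j. S2 M \<F> T (\<lambda>t \<omega>. C t \<omega> $ i $ j)) \<and>
     (AE \<omega> in M. \<forall>i. \<forall>t\<in>{0..T}. C t \<omega> $ i $ i = 0) \<and>
     (AE \<omega> in M. \<forall>i j. i \<noteq> j \<longrightarrow> ereal (1 / L) < (INF t\<in>{0..T}. ereal (C t \<omega> $ i $ j))) \<and>
     (AE \<omega> in M. \<forall>i j l. i \<noteq> j \<and> j \<noteq> l \<longrightarrow>
        0 < (INF t\<in>{0..T}. ereal (C t \<omega> $ i $ j + C t \<omega> $ j $ l - C t \<omega> $ i $ l)))"

definition Qdom :: "real ^ 'd ^ 'd \<Rightarrow> (real ^ 'd) set" where
  "Qdom c = {y. \<forall>i. (MAX j. y $ j - c $ i $ j) \<le> y $ i}"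

definition Pmap :: "real ^ 'd ^ 'd \<Rightarrow> real ^ 'd \<Rightarrow> real ^ 'd" where
  "Pmap c y = (\<chi> i. MAX j. y $ j - c $ i $ j)"

definition terminal_value ::
  "'w measure \<Rightarrow> (real \<Rightarrow> 'w measure) \<Rightarrow> real \<Rightarrow> (real \<Rightarrow> 'w \<Rightarrow> real ^ 'd ^ 'd) \<Rightarrow>
   ('w \<Rightarrow> real ^ 'd) \<Rightarrow> bool" where
  "terminal_value M \<F> T C \<xi> \<longleftrightarrow>
     \<xi> \<in> borel_measurable (\<F> T) \<and> (\<integral>\<^sup>+ \<omega>. ennreal ((norm (\<xi> \<omega>))\<^sup>2) \<partial>M) < \<infinity> \<and>
     (AE \<omega> in M. \<xi> \<omega> \<in> Qdom (C T \<omega>))"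

definition driver ::
  "'w measure \<Rightarrow> (real \<Rightarrow> 'w measure) \<Rightarrow> real \<Rightarrow> real \<Rightarrow>
   ('w \<Rightarrow> real \<Rightarrow> real ^ 'd \<Rightarrow> real ^ 'q ^ 'd \<Rightarrow> real ^ 'd) \<Rightarrow> bool" where
  "driver M \<F> T L F \<longleftrightarrow>
     (\<lambda>((s, \<omega>), y, z). F \<omega> s y z)
       \<in> borel_measurable (prog_algebra M \<F> T \<Otimes>\<^sub>M (borel \<Otimes>\<^sub>M borel)) \<and>
     (AE \<omega> in M. \<forall>t\<in>{0..T}. \<forall>y y' z z'.
        norm (F \<omega> t y z - F \<omega> t y' z') \<le> L * (norm (y - y') + norm (z - z'))) \<and>
     (AE \<omega> in M. \<forall>t\<in>{0..T}. \<forall>i y y' z z'. y $ i = y' $ i \<and> z $ i = z' $ i \<longrightarrow>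
        F \<omega> t y z $ i = F \<omega> t y' z' $ i)"

text \<open>Condition \<open>(C_p)\<close>; \<open>C_L\<close> is a function of the Lipschitz constant \<open>L\<close> only.\<close>

definition cond_C ::
  "real \<Rightarrow> 'w measure \<Rightarrow> real \<Rightarrow> real \<Rightarrow> (real \<Rightarrow> real) \<Rightarrow> ('w \<Rightarrow> real) \<Rightarrow>
   (real \<Rightarrow> 'w \<Rightarrow> real ^ 'd ^ 'd) \<Rightarrow> ('w \<Rightarrow> real \<Rightarrow> real ^ 'd \<Rightarrow> real ^ 'q ^ 'd \<Rightarrow> real ^ 'd) \<Rightarrow>
   ('w \<Rightarrow> real ^ 'd) \<Rightarrow> bool" where
  "cond_C p M T L C_L \<beta> C F \<xi> \<longleftrightarrow>
     (AE \<omega> in M. 0 < \<beta> \<omega>) \<and> integrable M \<beta> \<and> (LINT \<omega>|M. \<beta> \<omega>) \<le> C_L L \<and>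
     (AE \<omega> in M.
        ennreal (norm (\<xi> \<omega>) powr p) + (SUP t\<in>{0..T}. ennreal (norm (C t \<omega>) powr p))
          + (\<integral>\<^sup>+ s\<in>{0..T}. ennreal (norm (F \<omega> s 0 0) powr p) \<partial>lborel)
        \<le> ennreal (\<beta> \<omega>))"

text \<open>
  \<open>Yt\<close> is the process before reflection and \<open>Y\<close> the one after reflection. \<open>Y\<close> is continuous from
  the left but in general not from the right at a grid point \<open>r < T\<close> (its right limit there is
  \<open>Yt r\<close> whereas its value is \<open>Pmap (C r) (Yt r)\<close>), so no right-continuity is required of it.
\<close>

definition reflected_bsde ::
  "'w measure \<Rightarrow> (real \<Rightarrow> 'w measure) \<Rightarrow> real \<Rightarrow> (real \<Rightarrow> 'w \<Rightarrow> real ^ 'q) \<Rightarrow> nat \<Rightarrow> (nat \<Rightarrow> real) \<Rightarrow>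
   (real \<Rightarrow> 'w \<Rightarrow> real ^ 'd ^ 'd) \<Rightarrow> ('w \<Rightarrow> real \<Rightarrow> real ^ 'd \<Rightarrow> real ^ 'q ^ 'd \<Rightarrow> real ^ 'd) \<Rightarrow>
   ('w \<Rightarrow> real ^ 'd) \<Rightarrow>
   (real \<Rightarrow> 'w \<Rightarrow> real ^ 'd) \<Rightarrow> (real \<Rightarrow> 'w \<Rightarrow> real ^ 'd) \<Rightarrow> (real \<Rightarrow> 'w \<Rightarrow> real ^ 'q ^ 'd) \<Rightarrow> bool"
where
  "reflected_bsde M \<F> T W \<kappa> r C F \<xi> Yt Y Z \<longleftrightarrow>
     (\<forall>i. S2 M \<F> T (\<lambda>t \<omega>. Yt t \<omega> $ i) \<and> sup_L2 M \<F> T (\<lambda>t \<omega>. Y t \<omega> $ i) \<and>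
          H2 M \<F> T (\<lambda>t \<omega>. Z t \<omega> $ i)) \<and>
     (AE \<omega> in M. Y T \<omega> = \<xi> \<omega> \<and> Yt T \<omega> = \<xi> \<omega>) \<and>
     (\<exists>I. (\<forall>i. is_ito_integral M \<F> T W (\<lambda>t \<omega>. Z t \<omega> $ i) (I i)) \<and>
        (AE \<omega> in M. \<forall>j<\<kappa>. \<forall>t\<in>{r j..<r (Suc j)}.
           (\<forall>i. Yt t \<omega> $ i =
                Y (r (Suc j)) \<omega> $ i
                + (LINT u:{t..r (Suc j)}|lborel. F \<omega> u (Yt u \<omega>) (Z u \<omega>) $ i)
                - (I i (r (Suc j)) \<omega> - I i t \<omega>)) \<and>
           Y t \<omega> = (if t \<in> r ` {..\<kappa>} then Pmap (C t \<omega>) (Yt t \<omega>) else Yt t \<omega>)))"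

section \<open>Switching strategies\<close>

text \<open>
  Stopping times are \<open>ereal\<close>-valued, \<open>\<infinity>\<close> being the infimum of the empty set. The filtration,
  given on \<open>[0,T]\<close>, is extended to all times by \<open>\<F> T\<close> after \<open>T\<close>.
\<close>

definition extend_filtration :: "real \<Rightarrow> (real \<Rightarrow> 'w measure) \<Rightarrow> ereal \<Rightarrow> 'w measure" where
  "extend_filtration T \<F> s = \<F> (real_of_ereal (max 0 (min s (ereal T))))"

type_synonym ('w, 'd) strategy = "(nat \<Rightarrow> 'w \<Rightarrow> ereal) \<times> (nat \<Rightarrow> 'w \<Rightarrow> 'd)"

definition strategy ::
  "'w measure \<Rightarrow> (real \<Rightarrow> 'w measure) \<Rightarrow> real \<Rightarrow> ('w, 'd) strategy \<Rightarrow> bool" where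
  "strategy M \<F> T a \<longleftrightarrow> (case a of (\<theta>, \<alpha>) \<Rightarrow>
     (AE \<omega> in M. \<forall>j. \<theta> j \<omega> \<le> \<theta> (Suc j) \<omega>) \<and>
     (\<forall>j. stopping_time (extend_filtration T \<F>) (\<theta> j)) \<and>
     (\<forall>j. \<alpha> j \<in> measurable (filtration.pre_sigma (space M) (extend_filtration T \<F>) (\<theta> j))
                            (count_space UNIV)))"

text \<open>The set of indices \<open>j\<close> with \<open>1 \<le> j \<le> N\<^sup>a\<close>.\<close>

definition switches :: "real \<Rightarrow> ('w, 'd) strategy \<Rightarrow> 'w \<Rightarrow> nat set" where
  "switches T a \<omega> = {k. 1 \<le> k \<and> fst a k \<omega> \<le> ereal T}"

definition state :: "('w, 'd) strategy \<Rightarrow> real \<Rightarrow> 'w \<Rightarrow> 'd" where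
  "state a s \<omega> = (case a of (\<theta>, \<alpha>) \<Rightarrow>
     if ereal s < \<theta> 0 \<omega> then \<alpha> 0 \<omega>
     else \<alpha> (THE j. \<theta> j \<omega> \<le> ereal s \<and> ereal s < \<theta> (Suc j) \<omega>) \<omega>)"

definition cum_cost ::
  "real \<Rightarrow> (real \<Rightarrow> 'w \<Rightarrow> real ^ 'd ^ 'd) \<Rightarrow> ('w, 'd) strategy \<Rightarrow> real \<Rightarrow> 'w \<Rightarrow> real" where
  "cum_cost T C a s \<omega> = (case a of (\<theta>, \<alpha>) \<Rightarrow>
     (\<Sum>j | j \<in> switches T a \<omega> \<and> \<theta> j \<omega> \<le> ereal s \<and> s \<le> T.
        C (real_of_ereal (\<theta> j \<omega>)) \<omega> $ \<alpha> (j - 1) \<omega> $ \<alpha> j \<omega>))"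

text \<open>
  Finiteness of \<open>N\<^sup>a\<close> is what makes the state process defined on all of \<open>[0,T]\<close>.
  That the strategy starts from \<open>i\<close> at time \<open>t\<close> is understood as \<open>a\<^sub>t = i\<close>. This follows from the
  other clauses if \<open>t\<close> is not a grid point. If \<open>t\<close> is a grid point, it excludes strategies that
  have left \<open>i\<close> at the initial time \<open>t\<close> itself: the cost \<open>A\<^sub>T - A\<^sub>t\<close> charged in the
  switched BSDE does not contain switches made at time \<open>t\<close>, so those would be free of charge.
\<close>

definition admissible ::
  "'w measure \<Rightarrow> (real \<Rightarrow> 'w measure) \<Rightarrow> real \<Rightarrow> real set \<Rightarrow> (real \<Rightarrow> 'w \<Rightarrow> real ^ 'd ^ 'd) \<Rightarrow>
   real \<Rightarrow> 'd \<Rightarrow> ('w, 'd) strategy set" where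
  "admissible M \<F> T R C t i =
     {a. strategy M \<F> T a \<and>
         (AE \<omega> in M. fst a 0 \<omega> = ereal t \<and> snd a 0 \<omega> = i) \<and>
         (AE \<omega> in M. finite (switches T a \<omega>)) \<and>
         (\<integral>\<^sup>+ \<omega>. ennreal (\<bar>cum_cost T C a T \<omega>\<bar>\<^sup>2) \<partial>M) < \<infinity> \<and>
         (AE \<omega> in M. \<forall>j\<in>switches T a \<omega>. fst a j \<omega> \<in> ereal ` R) \<and>
         (AE \<omega> in M. state a t \<omega> = i)}"

text \<open>
  \<open>(U, V)\<close> solves the switched BSDE on \<open>[t,T]\<close>; values before \<open>t\<close> are irrelevant. The driver
  component \<open>F\<^sup>k\<close> depends on \<open>y\<close> and \<open>z\<close> only through \<open>y $ k\<close> and \<open>z $ k\<close>, which is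
  how it is evaluated at a scalar and a row, by means of \<open>axis k\<close>.
\<close>

definition switched_bsde ::
  "'w measure \<Rightarrow> (real \<Rightarrow> 'w measure) \<Rightarrow> real \<Rightarrow> (real \<Rightarrow> 'w \<Rightarrow> real ^ 'q) \<Rightarrow>
   (real \<Rightarrow> 'w \<Rightarrow> real ^ 'd ^ 'd) \<Rightarrow> ('w \<Rightarrow> real \<Rightarrow> real ^ 'd \<Rightarrow> real ^ 'q ^ 'd \<Rightarrow> real ^ 'd) \<Rightarrow>
   ('w \<Rightarrow> real ^ 'd) \<Rightarrow> real \<Rightarrow> ('w, 'd) strategy \<Rightarrow>
   (real \<Rightarrow> 'w \<Rightarrow> real) \<Rightarrow> (real \<Rightarrow> 'w \<Rightarrow> real ^ 'q) \<Rightarrow> bool" where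
  "switched_bsde M \<F> T W C F \<xi> t a U V \<longleftrightarrow>
     S2 M \<F> T U \<and> H2 M \<F> T V \<and>
     (\<exists>I. is_ito_integral M \<F> T W V I \<and>
        (AE \<omega> in M. \<forall>u\<in>{t..T}.
           U u \<omega> =
             \<xi> \<omega> $ state a T \<omega>
             + (LINT s:{u..T}|lborel.
                  F \<omega> s (axis (state a s \<omega>) (U s \<omega>)) (axis (state a s \<omega>) (V s \<omega>)) $ state a s \<omega>)
             - (I T \<omega> - I u \<omega>)
             - cum_cost T C a T \<omega> + cum_cost T C a u \<omega>))"

text \<open>
  The optimal strategy. The maximum over \<open>k \<noteq> \<alpha>\<close> is a supremum in \<open>ereal\<close>, so that for a single
  mode it is \<open>-\<infinity>\<close> and no switch occurs; after the last switch (\<open>\<theta> = \<infinity>\<close>) the mode is kept.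
  As in \<^const>\<open>admissible\<close>, there is no switch at the initial time, hence \<open>t < s\<close>, which is
  implied by \<open>\<theta> \<le> s\<close> if \<open>t\<close> is not a grid point.
\<close>

primrec opt_pair ::
  "real \<Rightarrow> real set \<Rightarrow> (real \<Rightarrow> 'w \<Rightarrow> real ^ ('d::{finite,linorder}) ^ ('d::{finite,linorder})) \<Rightarrow>
   (real \<Rightarrow> 'w \<Rightarrow> real ^ ('d::{finite,linorder})) \<Rightarrow> real \<Rightarrow> ('d::{finite,linorder}) \<Rightarrow> nat \<Rightarrow>
   'w \<Rightarrow> ereal \<times> ('d::{finite,linorder})" where
  "opt_pair T R C Yt t i 0 \<omega> = (ereal t, i)"
| "opt_pair T R C Yt t i (Suc j) \<omega> =
     (let (\<theta>, \<alpha>) = opt_pair T R C Yt t i j \<omega>;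
          \<theta>' = Inf {ereal s | s. s \<in> R \<and> \<theta> \<le> ereal s \<and> s \<le> T \<and> t < s \<and>
                   ereal (Yt s \<omega> $ \<alpha>) \<le> (SUP k\<in>- {\<alpha>}. ereal (Yt s \<omega> $ k - C s \<omega> $ \<alpha> $ k))};
          \<tau> = real_of_ereal \<theta>'
      in (\<theta>',
          if \<theta>' = \<infinity> then \<alpha>
          else Min {l. l \<noteq> \<alpha> \<and>
                 Yt \<tau> \<omega> $ l - C \<tau> \<omega> $ \<alpha> $ l = (MAX k\<in>- {\<alpha>}. Yt \<tau> \<omega> $ k - C \<tau> \<omega> $ \<alpha> $ k)}))"

definition opt_strategy ::
  "real \<Rightarrow> real set \<Rightarrow> (real \<Rightarrow> 'w \<Rightarrow> real ^ ('d::{finite,linorder}) ^ ('d::{finite,linorder})) \<Rightarrow>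
   (real \<Rightarrow> 'w \<Rightarrow> real ^ ('d::{finite,linorder})) \<Rightarrow> real \<Rightarrow> ('d::{finite,linorder}) \<Rightarrow> ('w, ('d::{finite,linorder})) strategy" where
  "opt_strategy T R C Yt t i =
     (\<lambda>j \<omega>. fst (opt_pair T R C Yt t i j \<omega>), \<lambda>j \<omega>. snd (opt_pair T R C Yt t i j \<omega>))"

section \<open>Essential supremum of a family of random variables\<close>

text \<open>Not to be confused with the library's \<^const>\<open>esssup\<close> of a single function.\<close>

definition is_ess_sup_family :: "'w measure \<Rightarrow> ('w \<Rightarrow> ereal) set \<Rightarrow> ('w \<Rightarrow> ereal) \<Rightarrow> bool" where
  "is_ess_sup_family M \<Phi> X \<longleftrightarrow>
     X \<in> borel_measurable M \<and> (\<forall>\<phi>\<in>\<Phi>. AE \<omega> in M. \<phi> \<omega> \<le> X \<omega>) \<and>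
     (\<forall>X'\<in>borel_measurable M. (\<forall>\<phi>\<in>\<Phi>. AE \<omega> in M. \<phi> \<omega> \<le> X' \<omega>) \<longrightarrow> (AE \<omega> in M. X \<omega> \<le> X' \<omega>))"

end

theory Submission
  imports Defs
begin

text \<open>
  Between two reflection times the mode of an admissible strategy is constant, so that the switched
  BSDE and the corresponding component of the reflected BSDE solve the same scalar equation there. At a
  reflection time the triangle inequality for the costs makes the switched process jump below the
  reflected one, with equality along the optimal strategy. A comparison theorem on each cell of the grid
  and backward induction over the grid then give all three claims.

  The comparison theorem is proved without Ito's formula. Let \<open>D\<close> be the difference of the two
  solutions on a cell \<open>[e, r]\<close>, with \<open>D r \<le> 0\<close>. Fix a partition of mesh \<open>\<Delta>\<close> and stop at the first
  partition point where \<open>D \<le> 0\<close>. Before stopping one expands only the square \<open>D\<^sup>2\<close>, step by step, where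
  the second moment of the martingale increment absorbs the \<open>z\<close>-dependence of the driver; at
  stopping the overshoot is at most the oscillation of the continuous path \<open>D\<close> over one step. A discrete
  Gronwall argument gives \<open>E[(D\<^sup>+ e)\<^sup>2] \<le> const * E[osc\<^sub>\<Delta>]\<close>, and the right-hand side tends to \<open>0\<close>
  by dominated convergence.
\<close>

section \<open>The augmented Brownian filtration and progressive processes\<close>

text \<open>The mode of a strategy at the start of a cell is random, so the comparison is carried
  out on an event \<open>A\<close> known at the left end: where the mode is k, both equations are
  scalar equations for that fixed k, and the finitely many events are glued afterwards. The end
  values of a cell are left limits at the reflection time v: U_v minus the cost charged at v on one
  side, the reflected value Y_v on the other. The positive part is not smooth; stopping at the first
  nonpositive partition point replaces its square by a plain square. The price is that the energy of
  the integrand must be recovered from the martingale increments. A one-sided isometry with constant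
  4 is enough, since the expansion leaves 3/4 of the squared increment against 1/8 of the energy,
  and 4/8 < 3/4. A solution of the switched equation is constructed for the optimal strategy alone,
  by following the components of \<open>Yt\<close> and \<open>Z\<close>; for every other strategy
  the claims concern any given solution. The essential supremum is thus a maximum, and no countable
  subfamily has to be selected.\<close>

locale wiener_space = prob_space M for M :: "'w measure" +
  fixes W :: "real \<Rightarrow> 'w \<Rightarrow> real ^ ('q::finite)" and T :: real and \<F> :: "real \<Rightarrow> 'w measure"
  assumes complete: "complete_measure M"
    and T_pos: "0 < T"
    and BM: "brownian_motion M T W"
    and filt_def: "\<F> = augmented_filtration M W"
begin

lemma W_measurable: "t \<in> {0..T} \<Longrightarrow> W t \<in> borel_measurable M"
  using BM by (simp add: brownian_motion_def)

lemma sets_natural: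
  "sets (natural_filtration M W t) =
     sigma_sets (space M) {W s -` B \<inter> space M | s B. 0 \<le> s \<and> s \<le> t \<and> B \<in> sets borel}"
  unfolding natural_filtration_def by (subst sets_measure_of) auto

lemma natural_subset_events:
  assumes "t \<le> T" shows "sets (natural_filtration M W t) \<subseteq> sets M"
  unfolding sets_natural
proof (rule sets.sigma_sets_subset, safe)
  fix s and B :: "(real^'q) set" assume "0 \<le> s" "s \<le> t" "B \<in> sets borel"
  then show "W s -` B \<inter> space M \<in> events"
    using W_measurable[of s] assms by (auto intro: measurable_sets)
qed

lemma space_filt [simp]: "space (\<F> t) = space M"
  unfolding filt_def augmented_filtration_def by (simp add: space_measure_of_conv)

lemma sets_filt:
  "sets (\<F> t) = sigma_sets (space M) (sets (natural_filtration M W t) \<union> null_sets M)"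
  unfolding filt_def augmented_filtration_def
proof (subst sets_measure_of)
  have "space (natural_filtration M W t) = space M"
    by (simp add: natural_filtration_def space_measure_of_conv)
  then show "sets (natural_filtration M W t) \<union> null_sets M \<subseteq> Pow (space M)"
    using sets.space_closed[of "natural_filtration M W t"] sets.space_closed[of M] by auto
qed simp

lemma null_sets_filt: "N \<in> null_sets M \<Longrightarrow> N \<in> sets (\<F> t)"
  unfolding sets_filt by auto

lemma filt_subset_events: "t \<le> T \<Longrightarrow> sets (\<F> t) \<subseteq> sets M"
  unfolding sets_filt by (rule sets.sigma_sets_subset) (use natural_subset_events in auto)

lemma filt_events: "A \<in> sets (\<F> t) \<Longrightarrow> t \<le> T \<Longrightarrow> A \<in> sets M"
  using filt_subset_events by blast

lemma filt_mono: "s \<le> t \<Longrightarrow> sets (\<F> s) \<subseteq> sets (\<F> t)"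
proof -
  assume st: "s \<le> t"
  have "{W u -` B \<inter> space M | u B. 0 \<le> u \<and> u \<le> s \<and> B \<in> sets borel}
      \<subseteq> {W u -` B \<inter> space M | u B. 0 \<le> u \<and> u \<le> t \<and> B \<in> sets borel}"
  proof (rule subsetI, elim CollectE exE conjE)
    fix x u and B :: "(real^'q) set"
    assume "x = W u -` B \<inter> space M" "0 \<le> u" "u \<le> s" "B \<in> sets borel"
    then show "x \<in> {W u -` B \<inter> space M | u B. 0 \<le> u \<and> u \<le> t \<and> B \<in> sets borel}"
      by (intro CollectI exI[of _ u] exI[of _ B] conjI) (use st in auto)
  qed
  then have "sets (natural_filtration M W s) \<subseteq> sets (natural_filtration M W t)"
    unfolding sets_natural by (rule sigma_sets_mono')
  then show ?thesis unfolding sets_filt by (intro sigma_sets_mono' Un_mono order_refl)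
qed

lemma measurable_filt_mono:
  "f \<in> measurable (\<F> s) N \<Longrightarrow> s \<le> t \<Longrightarrow> f \<in> measurable (\<F> t) N"
  using measurable_mono[OF order_refl refl filt_mono[of s t], of N] by auto

lemma measurable_filt_events:
  "f \<in> measurable (\<F> s) N \<Longrightarrow> s \<le> T \<Longrightarrow> f \<in> measurable M N"
  using measurable_mono[OF order_refl refl filt_subset_events[of s], of N] by auto

text \<open>Completeness of \<open>M\<close> enters here: a subset of a null event is an event, so
  null modifications can be absorbed into the augmented filtration.\<close>

lemma null_subset:
  assumes "N \<in> null_sets M" "A \<subseteq> N" shows "A \<in> null_sets M"
  using complete_measure.complete2[OF complete assms(2,1)] complete_measure.complete[OF complete assms(2,1)]
  by auto

text \<open>The symmetric difference is a null event, and those belong to every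
  \<open>\<F> t\<close>. Descriptions of a strategy that hold only almost surely, such as that of
  its mode at a given time, thereby still define \<open>\<F> t\<close>-events.\<close>

lemma AE_eq_sets_filt:
  assumes "A \<in> sets (\<F> t)" "AE \<omega> in M. \<omega> \<in> A \<longleftrightarrow> \<omega> \<in> B" "B \<subseteq> space M"
  shows "B \<in> sets (\<F> t)"
proof -
  obtain N where N: "{\<omega>\<in>space M. \<not> (\<omega> \<in> A \<longleftrightarrow> \<omega> \<in> B)} \<subseteq> N" "N \<in> null_sets M"
    using AE_E[OF assms(2)] by (metis null_setsI)
  have "A \<subseteq> space M" using sets.sets_into_space[OF assms(1)] by simp
  then have "A - B \<subseteq> N" "B - A \<subseteq> N" using N(1) assms(3) by blast+
  then have "A - B \<in> sets (\<F> t)" "B - A \<in> sets (\<F> t)"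
    using null_subset[OF N(2)] null_sets_filt by blast+
  moreover have "B = (A - (A - B)) \<union> (B - A)" by auto
  ultimately show ?thesis using assms(1) by (metis sets.Diff sets.Un)
qed

text \<open>The sets almost surely equal to a natural event form a sigma-algebra containing the
  generators. Brownian independence is postulated for the natural filtration, and this carries it
  over to the augmented one.\<close>

lemma filt_approx_natural:
  assumes A: "A \<in> sets (\<F> t)" and t: "t \<le> T"
  shows "\<exists>B\<in>sets (natural_filtration M W t). AE \<omega> in M. \<omega> \<in> A \<longleftrightarrow> \<omega> \<in> B"
proof -
  have sp: "space (natural_filtration M W t) = space M"
    by (simp add: natural_filtration_def space_measure_of_conv)
  show ?thesis using A unfolding sets_filt
  proof (induction rule: sigma_sets.induct)
    case (Basic a)
    then show ?case
    proof
      assume "a \<in> null_sets M"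
      then have "AE \<omega> in M. \<omega> \<in> a \<longleftrightarrow> \<omega> \<in> {}" using AE_not_in by force
      then show ?thesis by (rule bexI) simp
    qed auto
  next
    case Empty
    show ?case by (rule bexI[of _ "{}"]) auto
  next
    case (Compl a)
    then obtain B where B: "B \<in> sets (natural_filtration M W t)" "AE \<omega> in M. \<omega> \<in> a \<longleftrightarrow> \<omega> \<in> B" by auto
    show ?case
    proof (rule bexI)
      show "space M - B \<in> sets (natural_filtration M W t)"
        using sets.compl_sets[OF B(1)] sp by simp
      show "AE \<omega> in M. \<omega> \<in> space M - a \<longleftrightarrow> \<omega> \<in> space M - B" using B(2) by eventually_elim auto
    qed
  next
    case (Union a)
    then obtain B where B: "\<And>i. B i \<in> sets (natural_filtration M W t)"
      "\<And>i. AE \<omega> in M. \<omega> \<in> a i \<longleftrightarrow> \<omega> \<in> B i" by metis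
    have "AE \<omega> in M. \<forall>i. \<omega> \<in> a i \<longleftrightarrow> \<omega> \<in> B i" using B(2) by (simp add: AE_all_countable)
    then have "AE \<omega> in M. \<omega> \<in> (\<Union>i. a i) \<longleftrightarrow> \<omega> \<in> (\<Union>i. B i)" by eventually_elim auto
    then show ?case using B(1) by (intro bexI[of _ "\<Union>i. B i"]) auto
  qed
qed

text \<open>\<open>h\<close> is left general because both single coordinates of the increment and
  products of two coordinates are needed as factors independent of the past.\<close>

lemma indep_increment:
  assumes X: "X \<in> borel_measurable (\<F> s)" and h: "h \<in> borel_measurable borel"
    and st: "0 \<le> s" "s < t" "t \<le> T"
  shows "indep_var borel (X :: 'w \<Rightarrow> real) borel (\<lambda>\<omega>. h (W t \<omega> - W s \<omega>) :: real)"
proof -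
  let ?D = "\<lambda>\<omega>. W t \<omega> - W s \<omega>"
  have I: "indep_set (sets (natural_filtration M W s)) {?D -` B \<inter> space M | B. B \<in> sets borel}"
    using BM st unfolding brownian_motion_def by blast
  have [measurable]: "W t \<in> borel_measurable M" "W s \<in> borel_measurable M"
    using W_measurable st by auto
  have [measurable]: "X \<in> borel_measurable M" using measurable_filt_events[OF X] st by auto
  note h[measurable]
  have *: "indep_set (sets (\<F> s)) {?D -` B \<inter> space M | B. B \<in> sets borel}"
    unfolding indep_sets2_eq
  proof (intro conjI ballI)
    show "sets (\<F> s) \<subseteq> events" using filt_subset_events[of s] st by auto
    show "{?D -` B \<inter> space M | B. B \<in> sets borel} \<subseteq> events" by auto
    fix A E assume A: "A \<in> sets (\<F> s)" and E: "E \<in> {?D -` B \<inter> space M | B. B \<in> sets borel}"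
    obtain B where B: "B \<in> sets (natural_filtration M W s)" "AE \<omega> in M. \<omega> \<in> A \<longleftrightarrow> \<omega> \<in> B"
      using filt_approx_natural[OF A] st by auto
    have ev: "A \<in> events" "B \<in> events" "E \<in> events"
      using A B natural_subset_events[of s] filt_events[OF A] st E by auto
    \<comment> \<open>\<open>A\<close> is exchanged for a natural event differing from it by a null
      set, for which independence is known.\<close>
    have "prob (A \<inter> E) = prob (B \<inter> E)"
      using B(2) ev by (intro measure_eq_AE) auto
    also have "\<dots> = prob B * prob E" using indep_setD[OF I B(1) E] .
    also have "prob B = prob A" using B(2) ev by (intro measure_eq_AE) auto
    finally show "prob (A \<inter> E) = prob A * prob E" .
  qed
  show ?thesis unfolding indep_var_eq
  proof (intro conjI)
    show "random_variable borel X" "random_variable borel (\<lambda>\<omega>. h (?D \<omega>))" by measurable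
    show "indep_set (sigma_sets (space M) {X -` A \<inter> space M |A. A \<in> sets borel})
      (sigma_sets (space M) {(\<lambda>\<omega>. h (?D \<omega>)) -` A \<inter> space M |A. A \<in> sets borel})"
    \<comment> \<open>Independence of the generated sigma-algebras reduces to that of the
      intersection-stable families of preimages.\<close>
    proof (intro indep_set_sigma_sets)
      show "indep_set {X -` A \<inter> space M |A. A \<in> sets borel}
          {(\<lambda>\<omega>. h (?D \<omega>)) -` A \<inter> space M |A. A \<in> sets borel}"
        unfolding indep_sets2_eq
      proof (intro conjI ballI)
        fix a b assume a: "a \<in> {X -` A \<inter> space M |A. A \<in> sets borel}"
          and b: "b \<in> {(\<lambda>\<omega>. h (?D \<omega>)) -` A \<inter> space M |A. A \<in> sets borel}"
        have "a \<in> sets (\<F> s)" using a measurable_sets[OF X] by auto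
        moreover have "b \<in> {?D -` B \<inter> space M | B. B \<in> sets borel}"
        proof -
          obtain A where "A \<in> sets borel" "b = (\<lambda>\<omega>. h (?D \<omega>)) -` A \<inter> space M" using b by auto
          then show ?thesis using measurable_sets[OF h, of A]
            by (auto intro!: exI[of _ "h -` A"])
        qed
        ultimately show "prob (a \<inter> b) = prob a * prob b" using indep_setD[OF *] by auto
      qed auto
      show "Int_stable {X -` A \<inter> space M |A. A \<in> sets borel}"
      proof (rule Int_stableI, safe)
        fix A B :: "real set" assume "A \<in> sets borel" "B \<in> sets borel"
        then show "\<exists>Aa. X -` A \<inter> space M \<inter> (X -` B \<inter> space M) = X -` Aa \<inter> space M \<and> Aa \<in> sets borel"
          by (intro exI[of _ "A \<inter> B"]) auto
      qed
      show "Int_stable {(\<lambda>\<omega>. h (?D \<omega>)) -` A \<inter> space M |A. A \<in> sets borel}"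
      proof (rule Int_stableI, safe)
        fix A B :: "real set" assume "A \<in> sets borel" "B \<in> sets borel"
        then show "\<exists>Aa. (\<lambda>\<omega>. h (?D \<omega>)) -` A \<inter> space M \<inter> ((\<lambda>\<omega>. h (?D \<omega>)) -` B \<inter> space M)
             = (\<lambda>\<omega>. h (?D \<omega>)) -` Aa \<inter> space M \<and> Aa \<in> sets borel"
          by (intro exI[of _ "A \<inter> B"]) auto
      qed
    qed
  qed
qed

text \<open>The diagonal moments come from the normal density; the mixed ones vanish because the
  coordinates are independent and centred.\<close>

lemma increment_moments:
  assumes st: "0 \<le> s" "s < t" "t \<le> T"
  shows "integrable M (\<lambda>\<omega>. (W t \<omega> - W s \<omega>) $ c)" (is ?a)
    and "(\<integral>\<omega>. (W t \<omega> - W s \<omega>) $ c \<partial>M) = 0" (is ?b)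
    and "integrable M (\<lambda>\<omega>. (W t \<omega> - W s \<omega>) $ c * (W t \<omega> - W s \<omega>) $ c')" (is ?c)
    and "(\<integral>\<omega>. (W t \<omega> - W s \<omega>) $ c * (W t \<omega> - W s \<omega>) $ c' \<partial>M) = (if c = c' then t - s else 0)" (is ?d)
proof -
  let ?X = "\<lambda>k \<omega>. (W t \<omega> - W s \<omega>) $ k"
  have D: "distributed M lborel (?X k) (normal_density 0 (sqrt (t - s)))" for k
    using BM st unfolding brownian_motion_def by blast
  have I: "indep_vars (\<lambda>_. borel) ?X UNIV"
    using BM st unfolding brownian_motion_def by blast
  have pos: "0 < sqrt (t - s)" using st by simp
  have int: "integrable M (?X k)" for k
    using distributed_integrable[OF D[of k], of "\<lambda>x. x"] integrable_normal_moment_nz_1[OF pos, of 0] by simp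
  show ?a by (rule int)
  have ex: "(\<integral>\<omega>. ?X k \<omega> \<partial>M) = 0" for k
    using normal_distributed_expectation[OF pos D[of k]] .
  show ?b by (rule ex)
  have sq: "integrable M (\<lambda>\<omega>. ?X k \<omega> * ?X k \<omega>)" for k
    using distributed_integrable[OF D[of k], of "\<lambda>x. x * x"]
      integrable_normal_moment[OF pos, of 0 2] by (simp add: power2_eq_square)
  have var: "(\<integral>\<omega>. ?X k \<omega> * ?X k \<omega> \<partial>M) = t - s" for k
    using normal_distributed_variance[OF pos D[of k]] ex[of k] st by (simp add: power2_eq_square)
  show ?c
  proof (cases "c = c'")
    case False
    have "indep_vars (\<lambda>_. borel) ?X {c, c'}" using I by (rule indep_vars_subset) auto
    then have "integrable M (\<lambda>\<omega>. \<Prod>i\<in>{c,c'}. ?X i \<omega>)"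
      by (rule indep_vars_integrable[rotated]) (use int in auto)
    then show ?thesis using False by simp
  qed (use sq in simp)
  show ?d
  proof (cases "c = c'")
    case False
    have "indep_vars (\<lambda>_. borel) ?X {c, c'}" using I by (rule indep_vars_subset) auto
    then have "(\<integral>\<omega>. (\<Prod>i\<in>{c,c'}. ?X i \<omega>) \<partial>M) = (\<Prod>i\<in>{c,c'}. \<integral>\<omega>. ?X i \<omega> \<partial>M)"
      by (rule indep_vars_lebesgue_integral[rotated]) (use int in auto)
    then show ?thesis using False ex by simp
  qed (use var in simp)
qed

end

lemma norm_add_square_le: "(norm (x + y))\<^sup>2 \<le> 2 * (norm x)\<^sup>2 + 2 * (norm (y::'b::real_normed_vector))\<^sup>2"
proof -
  have "(norm (x + y))\<^sup>2 \<le> (norm x + norm y)\<^sup>2"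
    by (intro power_mono norm_triangle_ineq) simp
  also have "\<dots> \<le> 2 * (norm x)\<^sup>2 + 2 * (norm y)\<^sup>2"
    using sum_squares_bound[of "norm x" "norm y"] by (simp add: power2_sum)
  finally show ?thesis .
qed

lemma ennreal_norm_add_square_le:
  "ennreal ((norm (x + y :: 'b::real_normed_vector))\<^sup>2) \<le> 2 * ennreal ((norm x)\<^sup>2) + 2 * ennreal ((norm y)\<^sup>2)"
proof -
  have "ennreal ((norm (x + y))\<^sup>2) \<le> ennreal (2 * (norm x)\<^sup>2 + 2 * (norm y)\<^sup>2)"
    by (intro ennreal_leI norm_add_square_le)
  then show ?thesis by (simp add: ennreal_mult)
qed

text \<open>A progressive process is known to be measurable only on \<open>{0..T}\<close>; with the
  indicator inside the norm, it is the cut-off process, measurable on the whole line, that gets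
  integrated.\<close>

lemma indicator_norm_square:
  "ennreal ((norm (x :: 'b::real_normed_vector))\<^sup>2) * indicator A s = ennreal ((norm (indicator A s *\<^sub>R x))\<^sup>2)"
  by (auto simp: indicator_def)

context wiener_space
begin

section \<open>Progressive measurability and the energy of a process\<close>

abbreviation \<P> where "\<P> \<equiv> prog_algebra M \<F> T"
abbreviation rect where "rect t \<equiv> restrict_space borel {0..t} \<Otimes>\<^sub>M \<F> t"

lemma space_rect [simp]: "space (rect t) = {0..t} \<times> space M"
  by (simp add: space_pair_measure space_restrict_space)

text \<open>Since the generating family of \<open>prog_algebra\<close> is already a sigma-algebra,
  membership can be tested time by time instead of through generated sets.\<close>

lemma sigma_algebra_prog:
  "sigma_algebra ({0..T} \<times> space M)
     {A. A \<subseteq> {0..T} \<times> space M \<and> (\<forall>t\<in>{0..T}. A \<inter> ({0..t} \<times> space M) \<in> sets (rect t))}"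
  unfolding sigma_algebra_iff2
proof (intro conjI ballI allI impI)
  fix A assume A: "A \<in> {A. A \<subseteq> {0..T} \<times> space M \<and> (\<forall>t\<in>{0..T}. A \<inter> ({0..t} \<times> space M) \<in> sets (rect t))}"
  have "({0..T} \<times> space M - A) \<inter> ({0..t} \<times> space M) \<in> sets (rect t)"
    if "t \<in> {0..T}" for t
  proof -
    have "({0..T} \<times> space M - A) \<inter> ({0..t} \<times> space M) = space (rect t) - A \<inter> ({0..t} \<times> space M)"
      using that by auto
    also have "\<dots> \<in> sets (rect t)" using A that by (intro sets.compl_sets) blast
    finally show ?thesis .
  qed
  then show "{0..T} \<times> space M - A \<in> {A. A \<subseteq> {0..T} \<times> space M \<and>
      (\<forall>t\<in>{0..T}. A \<inter> ({0..t} \<times> space M) \<in> sets (rect t))}"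
    by blast
next
  fix A :: "nat \<Rightarrow> _" assume A: "range A \<subseteq> {A. A \<subseteq> {0..T} \<times> space M \<and>
      (\<forall>t\<in>{0..T}. A \<inter> ({0..t} \<times> space M) \<in> sets (rect t))}"
  have "(\<Union>i. A i) \<inter> ({0..t} \<times> space M) \<in> sets (rect t)" if "t \<in> {0..T}" for t
  proof -
    have "(\<Union>i. A i) \<inter> ({0..t} \<times> space M) = (\<Union>i. A i \<inter> ({0..t} \<times> space M))" by auto
    also have "\<dots> \<in> sets (rect t)" using A that by (intro sets.countable_UN) auto
    finally show ?thesis .
  qed
  then show "(\<Union>i. A i) \<in> {A. A \<subseteq> {0..T} \<times> space M \<and>
      (\<forall>t\<in>{0..T}. A \<inter> ({0..t} \<times> space M) \<in> sets (rect t))}" using A by auto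
qed auto

lemma space_prog [simp]: "space \<P> = {0..T} \<times> space M"
  unfolding prog_algebra_def by (simp add: space_measure_of_conv)

lemma sets_prog: "A \<in> sets \<P> \<longleftrightarrow>
    A \<subseteq> {0..T} \<times> space M \<and> (\<forall>t\<in>{0..T}. A \<inter> ({0..t} \<times> space M) \<in> sets (rect t))"
  unfolding prog_algebra_def sigma_algebra.sets_measure_of_eq[OF sigma_algebra_prog] by simp

lemma measurable_prog_iff:
  "f \<in> borel_measurable \<P> \<longleftrightarrow> (\<forall>t\<in>{0..T}. f \<in> borel_measurable (rect t))"
proof -
  have *: "f -` B \<inter> ({0..T} \<times> space M) \<inter> ({0..t} \<times> space M) = f -` B \<inter> ({0..t} \<times> space M)"
    if "t \<in> {0..T}" for t B using that by auto
  show ?thesis unfolding measurable_def by (auto simp: sets_prog *)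
qed

lemma progressive_iff:
  "progressive M \<F> T X \<longleftrightarrow> (\<forall>t\<in>{0..T}. (\<lambda>(s, \<omega>). X s \<omega>) \<in> borel_measurable (rect t))"
  unfolding progressive_def by (rule measurable_prog_iff)

lemma prog_section:
  assumes "f \<in> borel_measurable \<P>" "t \<in> {0..T}"
  shows "(\<lambda>\<omega>. f (t, \<omega>)) \<in> borel_measurable (\<F> t)"
  using assms measurable_Pair1'[of t "restrict_space borel {0..t}" "\<F> t"]
  by (intro measurable_compose[OF _ assms(1)[unfolded measurable_prog_iff, rule_format, OF assms(2)]])
     (auto simp: space_restrict_space)

lemma progressive_at:
  assumes "progressive M \<F> T X" "t \<in> {0..T}"
  shows "X t \<in> borel_measurable (\<F> t)"
  using prog_section[OF assms(1)[unfolded progressive_def] assms(2)] by simp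

lemma progressive_at_events:
  assumes "progressive M \<F> T X" "t \<in> {0..T}"
  shows "X t \<in> borel_measurable M"
  using progressive_at[OF assms] assms(2) by (auto intro: measurable_filt_events)

lemma measurable_prog_pair:
  assumes "f \<in> borel_measurable \<P>"
  shows "f \<in> borel_measurable (restrict_space borel {0..T} \<Otimes>\<^sub>M M)"
proof -
  have "(\<lambda>x. x) \<in> measurable M (\<F> T)"
    using measurable_filt_events[of "\<lambda>x. x" T "\<F> T"] by simp
  then have "(\<lambda>x. snd x) \<in> measurable (restrict_space borel {0..T} \<Otimes>\<^sub>M M) (\<F> T)"
    by (rule measurable_compose[OF measurable_snd])
  then have "(\<lambda>x. x) \<in> measurable (restrict_space borel {0..T} \<Otimes>\<^sub>M M) (rect T)"
    by (intro measurable_pair) (auto simp: comp_def)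
  then show ?thesis using assms T_pos unfolding measurable_prog_iff
    by (auto intro: measurable_compose)
qed

text \<open>Extension by zero outside the time interval turns progressive measurability into joint
  measurability over the whole line, which integration in time against \<open>lborel\<close>
  requires.\<close>

lemma measurable_prog_borel_pair:
  fixes f :: "real \<times> 'w \<Rightarrow> 'b::{real_normed_vector}"
  assumes "f \<in> borel_measurable \<P>"
  shows "(\<lambda>(s, \<omega>). indicator {0..T} s *\<^sub>R f (s, \<omega>)) \<in> borel_measurable (borel \<Otimes>\<^sub>M M)"
proof -
  have "(\<lambda>x. x) \<in> measurable (restrict_space (borel \<Otimes>\<^sub>M M) ({0..T} \<times> space M))
      (restrict_space borel {0..T} \<Otimes>\<^sub>M M)"
    by (intro measurable_pair measurable_restrict_space2)
       (auto simp: comp_def space_restrict_space space_pair_measure intro!: measurable_restrict_space1)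
  then have "f \<in> borel_measurable (restrict_space (borel \<Otimes>\<^sub>M M) ({0..T} \<times> space M))"
    using measurable_prog_pair[OF assms] by (rule measurable_compose)
  then have "(\<lambda>x. indicator ({0..T} \<times> space M) x *\<^sub>R f x) \<in> borel_measurable (borel \<Otimes>\<^sub>M M)"
    by (subst (asm) borel_measurable_restrict_space_iff)
       (auto simp: space_pair_measure intro!: pair_measureI)
  then show ?thesis
    by (rule measurable_cong[THEN iffD1, rotated])
       (auto simp: space_pair_measure indicator_def split: prod.splits)
qed

text \<open>Switching on a variable no earlier than the time a at which it is known creates no
  anticipation: up to a time t < a the process is zero, and for t >= a the variable is
  \<open>\<F> t\<close>-measurable.\<close>

lemma progressive_const:
  fixes X :: "'w \<Rightarrow> 'b::{real_normed_vector, second_countable_topology}"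
  assumes X: "X \<in> borel_measurable (\<F> a)" and I: "I \<in> sets borel" "I \<subseteq> {a..}"
  shows "progressive M \<F> T (\<lambda>s \<omega>. indicator I s *\<^sub>R X \<omega>)"
  unfolding progressive_iff
proof
  fix t assume "t \<in> {0..T}"
  show "(\<lambda>(s, \<omega>). indicator I s *\<^sub>R X \<omega>) \<in> borel_measurable (rect t)"
  proof (cases "a \<le> t")
    case True
    then have [measurable]: "X \<in> borel_measurable (\<F> t)" using measurable_filt_mono[OF X] by simp
    have [measurable]: "indicator I \<in> borel_measurable (restrict_space borel {0..t})"
      using I by (intro measurable_restrict_space1) auto
    show ?thesis by measurable
  next
    case False
    have "(\<lambda>(s, \<omega>). indicator I s *\<^sub>R X \<omega>) \<in> borel_measurable (rect t) \<longleftrightarrow>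
        (\<lambda>_. 0 :: 'b) \<in> borel_measurable (rect t)"
      using False I(2) by (intro measurable_cong) (auto simp: indicator_def)
    then show ?thesis by simp
  qed
qed

lemma progressive_diff:
  fixes X Y :: "real \<Rightarrow> 'w \<Rightarrow> 'b::{real_normed_vector, second_countable_topology}"
  assumes "progressive M \<F> T X" "progressive M \<F> T Y"
  shows "progressive M \<F> T (\<lambda>s \<omega>. X s \<omega> - Y s \<omega>)"
  using assms unfolding progressive_def
  by (auto simp: case_prod_beta' intro: borel_measurable_diff)

lemma progressive_add:
  fixes X Y :: "real \<Rightarrow> 'w \<Rightarrow> 'b::{real_normed_vector, second_countable_topology}"
  assumes "progressive M \<F> T X" "progressive M \<F> T Y"
  shows "progressive M \<F> T (\<lambda>s \<omega>. X s \<omega> + Y s \<omega>)"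
  using assms unfolding progressive_def
  by (auto simp: case_prod_beta' intro: borel_measurable_add)

lemma progressive_scaleR:
  fixes X :: "real \<Rightarrow> 'w \<Rightarrow> real" and Y :: "real \<Rightarrow> 'w \<Rightarrow> 'b::{real_normed_vector, second_countable_topology}"
  assumes "progressive M \<F> T X" "progressive M \<F> T Y"
  shows "progressive M \<F> T (\<lambda>s \<omega>. X s \<omega> *\<^sub>R Y s \<omega>)"
  using assms unfolding progressive_def
  by (auto simp: case_prod_beta' intro: borel_measurable_scaleR)

lemma progressive_sum:
  fixes X :: "'i \<Rightarrow> real \<Rightarrow> 'w \<Rightarrow> 'b::{real_normed_vector, second_countable_topology}"
  assumes "\<And>i. i \<in> S \<Longrightarrow> progressive M \<F> T (X i)"
  shows "progressive M \<F> T (\<lambda>s \<omega>. \<Sum>i\<in>S. X i s \<omega>)"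
  using assms unfolding progressive_def
  by (auto simp: case_prod_beta' intro: borel_measurable_sum)

lemma progressive_zero: "progressive M \<F> T (\<lambda>s \<omega>. 0)"
  unfolding progressive_def by (simp add: case_prod_beta')

text \<open>The squared norm in L2(dt x dP), kept in \<open>ennreal\<close> so that it makes sense
  before finiteness is known. \<open>H2\<close> means progressive with finite energy.\<close>

definition energy :: "(real \<Rightarrow> 'w \<Rightarrow> 'b::real_normed_vector) \<Rightarrow> ennreal" where
  "energy X = (\<integral>\<^sup>+ \<omega>. (\<integral>\<^sup>+ s\<in>{0..T}. ennreal ((norm (X s \<omega>))\<^sup>2) \<partial>lborel) \<partial>M)"

lemma measurable_path_energy:
  fixes X :: "real \<Rightarrow> 'w \<Rightarrow> 'b::{real_normed_vector, second_countable_topology}"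
  assumes "progressive M \<F> T X"
  shows "(\<lambda>(\<omega>, s). indicator {0..T} s *\<^sub>R X s \<omega>) \<in> borel_measurable (M \<Otimes>\<^sub>M lborel)"
    and "(\<lambda>\<omega>. \<integral>\<^sup>+ s\<in>{0..T}. ennreal ((norm (X s \<omega>))\<^sup>2) \<partial>lborel) \<in> borel_measurable M"
proof -
  have "(\<lambda>(s, \<omega>). indicator {0..T} s *\<^sub>R X s \<omega>) \<in> borel_measurable (lborel \<Otimes>\<^sub>M M)"
    using measurable_prog_borel_pair[OF assms[unfolded progressive_def]]
    by (simp cong: measurable_cong_sets sets_pair_measure_cong)
  then show 1: "(\<lambda>(\<omega>, s). indicator {0..T} s *\<^sub>R X s \<omega>) \<in> borel_measurable (M \<Otimes>\<^sub>M lborel)"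
    by (subst (asm) measurable_pair_swap_iff) (simp add: case_prod_beta')
  have "(\<lambda>\<omega>. \<integral>\<^sup>+ s. ennreal ((norm (indicator {0..T} s *\<^sub>R X s \<omega>))\<^sup>2) \<partial>lborel) \<in> borel_measurable M"
    using 1 by (intro lborel.borel_measurable_nn_integral)
      (auto simp: case_prod_beta' simp del: norm_scaleR intro!: measurable_compose[OF _ measurable_ennreal] borel_measurable_power borel_measurable_norm)
  then show "(\<lambda>\<omega>. \<integral>\<^sup>+ s\<in>{0..T}. ennreal ((norm (X s \<omega>))\<^sup>2) \<partial>lborel) \<in> borel_measurable M"
    by (simp add: indicator_norm_square del: norm_scaleR)
qed

lemma path_measurable:
  fixes X :: "real \<Rightarrow> 'w \<Rightarrow> 'b::{real_normed_vector, second_countable_topology}"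
  assumes "progressive M \<F> T X" "\<omega> \<in> space M"
  shows "(\<lambda>s. indicator {0..T} s *\<^sub>R X s \<omega>) \<in> borel_measurable lborel"
  using measurable_path_energy(1)[OF assms(1)] assms(2)
  by (auto dest!: measurable_Pair2)

text \<open>The factor 2 stands in for the triangle inequality of the norm and avoids square roots
  in \<open>ennreal\<close>; the later arguments tolerate such constants.\<close>

lemma energy_add_le:
  fixes X Y :: "real \<Rightarrow> 'w \<Rightarrow> 'b::{real_normed_vector, second_countable_topology}"
  assumes X: "progressive M \<F> T X" and Y: "progressive M \<F> T Y"
  shows "energy (\<lambda>s \<omega>. X s \<omega> + Y s \<omega>) \<le> 2 * energy X + 2 * energy Y"
proof -
  note [measurable] = measurable_path_energy(2)[OF X] measurable_path_energy(2)[OF Y]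
  have "energy (\<lambda>s \<omega>. X s \<omega> + Y s \<omega>) \<le> (\<integral>\<^sup>+ \<omega>.
       2 * (\<integral>\<^sup>+ s\<in>{0..T}. ennreal ((norm (X s \<omega>))\<^sup>2) \<partial>lborel)
     + 2 * (\<integral>\<^sup>+ s\<in>{0..T}. ennreal ((norm (Y s \<omega>))\<^sup>2) \<partial>lborel) \<partial>M)"
    unfolding energy_def
  proof (rule nn_integral_mono)
    fix \<omega> assume \<omega>: "\<omega> \<in> space M"
    note [measurable] = path_measurable[OF X \<omega>] path_measurable[OF Y \<omega>]
    have m: "(\<lambda>s. ennreal ((norm (X s \<omega>))\<^sup>2) * indicator {0..T} s) \<in> borel_measurable lborel"
      "(\<lambda>s. ennreal ((norm (Y s \<omega>))\<^sup>2) * indicator {0..T} s) \<in> borel_measurable lborel"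
      unfolding indicator_norm_square by measurable
    have "(\<integral>\<^sup>+ s\<in>{0..T}. ennreal ((norm (X s \<omega> + Y s \<omega>))\<^sup>2) \<partial>lborel)
      \<le> (\<integral>\<^sup>+ s. 2 * (ennreal ((norm (X s \<omega>))\<^sup>2) * indicator {0..T} s)
          + 2 * (ennreal ((norm (Y s \<omega>))\<^sup>2) * indicator {0..T} s) \<partial>lborel)"
      by (intro nn_integral_mono) (auto simp: indicator_def ennreal_norm_add_square_le)
    also have "\<dots> = 2 * (\<integral>\<^sup>+ s\<in>{0..T}. ennreal ((norm (X s \<omega>))\<^sup>2) \<partial>lborel)
     + 2 * (\<integral>\<^sup>+ s\<in>{0..T}. ennreal ((norm (Y s \<omega>))\<^sup>2) \<partial>lborel)"
      using m by (simp add: nn_integral_add nn_integral_cmult)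
    finally show "(\<integral>\<^sup>+ s\<in>{0..T}. ennreal ((norm (X s \<omega> + Y s \<omega>))\<^sup>2) \<partial>lborel) \<le> \<dots>" .
  qed
  also have "\<dots> = 2 * energy X + 2 * energy Y"
    unfolding energy_def by (simp add: nn_integral_add nn_integral_cmult)
  finally show ?thesis .
qed

lemma energy_scaleR_le:
  fixes X :: "real \<Rightarrow> 'w \<Rightarrow> 'b::{real_normed_vector, second_countable_topology}"
  assumes X: "progressive M \<F> T X" and b: "\<And>s \<omega>. s \<in> {0..T} \<Longrightarrow> \<omega> \<in> space M \<Longrightarrow> \<bar>c s \<omega>\<bar> \<le> b" and "0 \<le> b"
  shows "energy (\<lambda>s \<omega>. c s \<omega> *\<^sub>R X s \<omega>) \<le> ennreal (b\<^sup>2) * energy X"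
proof -
  note [measurable] = measurable_path_energy(2)[OF X]
  have "energy (\<lambda>s \<omega>. c s \<omega> *\<^sub>R X s \<omega>)
      \<le> (\<integral>\<^sup>+ \<omega>. ennreal (b\<^sup>2) * (\<integral>\<^sup>+ s\<in>{0..T}. ennreal ((norm (X s \<omega>))\<^sup>2) \<partial>lborel) \<partial>M)"
    unfolding energy_def
  proof (rule nn_integral_mono)
    fix \<omega> assume \<omega>: "\<omega> \<in> space M"
    note [measurable] = path_measurable[OF X \<omega>]
    have m: "(\<lambda>s. ennreal ((norm (X s \<omega>))\<^sup>2) * indicator {0..T} s) \<in> borel_measurable lborel"
      unfolding indicator_norm_square by measurable
    have "(\<integral>\<^sup>+ s\<in>{0..T}. ennreal ((norm (c s \<omega> *\<^sub>R X s \<omega>))\<^sup>2) \<partial>lborel)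
      \<le> (\<integral>\<^sup>+ s. ennreal (b\<^sup>2) * (ennreal ((norm (X s \<omega>))\<^sup>2) * indicator {0..T} s) \<partial>lborel)"
    proof (rule nn_integral_mono)
      fix s
      have "(c s \<omega>)\<^sup>2 \<le> b\<^sup>2" if "s \<in> {0..T}"
        using b[OF that \<omega>] \<open>0 \<le> b\<close> by (simp add: abs_le_square_iff[symmetric])
      then show "ennreal ((norm (c s \<omega> *\<^sub>R X s \<omega>))\<^sup>2) * indicator {0..T} s
        \<le> ennreal (b\<^sup>2) * (ennreal ((norm (X s \<omega>))\<^sup>2) * indicator {0..T} s)"
        by (auto simp: indicator_def ennreal_mult[symmetric] power_mult_distrib intro!: ennreal_leI mult_right_mono)
    qed
    also have "\<dots> = ennreal (b\<^sup>2) * (\<integral>\<^sup>+ s\<in>{0..T}. ennreal ((norm (X s \<omega>))\<^sup>2) \<partial>lborel)"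
      using m by (simp add: nn_integral_cmult)
    finally show "(\<integral>\<^sup>+ s\<in>{0..T}. ennreal ((norm (c s \<omega> *\<^sub>R X s \<omega>))\<^sup>2) \<partial>lborel) \<le> \<dots>" .
  qed
  also have "\<dots> = ennreal (b\<^sup>2) * energy X"
    unfolding energy_def by (simp add: nn_integral_cmult)
  finally show ?thesis .
qed

section \<open>Simple integrands\<close>

text \<open>X is known at time s, so the expectations factor by independence. The case s = t is
  treated apart because independence is stated for strictly ordered times.\<close>

lemma expectation_mult_increment:
  assumes X: "X \<in> borel_measurable (\<F> s)" "integrable M X" and st: "0 \<le> s" "s \<le> t" "t \<le> T"
  shows "integrable M (\<lambda>\<omega>. X \<omega> * (W t \<omega> - W s \<omega>) $ c)"
    and "(\<integral>\<omega>. X \<omega> * (W t \<omega> - W s \<omega>) $ c \<partial>M) = 0"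
    and "integrable M (\<lambda>\<omega>. X \<omega> * ((W t \<omega> - W s \<omega>) $ c * (W t \<omega> - W s \<omega>) $ c'))"
    and "(\<integral>\<omega>. X \<omega> * ((W t \<omega> - W s \<omega>) $ c * (W t \<omega> - W s \<omega>) $ c') \<partial>M) =
      (if c = c' then (t - s) * (\<integral>\<omega>. X \<omega> \<partial>M) else 0)"
proof -
  have "integrable M (\<lambda>\<omega>. X \<omega> * (W t \<omega> - W s \<omega>) $ c) \<and>
    (\<integral>\<omega>. X \<omega> * (W t \<omega> - W s \<omega>) $ c \<partial>M) = 0 \<and>
    integrable M (\<lambda>\<omega>. X \<omega> * ((W t \<omega> - W s \<omega>) $ c * (W t \<omega> - W s \<omega>) $ c')) \<and>
    (\<integral>\<omega>. X \<omega> * ((W t \<omega> - W s \<omega>) $ c * (W t \<omega> - W s \<omega>) $ c') \<partial>M) =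
      (if c = c' then (t - s) * (\<integral>\<omega>. X \<omega> \<partial>M) else 0)"
  proof (cases "s = t")
    case False
    then have lt: "s < t" using st by simp
    have i1: "indep_var borel X borel (\<lambda>\<omega>. (W t \<omega> - W s \<omega>) $ c)"
      using indep_increment[OF X(1), of "\<lambda>x. x $ c" t] lt st by simp
    have i2: "indep_var borel X borel (\<lambda>\<omega>. (W t \<omega> - W s \<omega>) $ c * (W t \<omega> - W s \<omega>) $ c')"
      using indep_increment[OF X(1), of "\<lambda>x. x $ c * x $ c'" t] lt st by simp
    note m = increment_moments[OF st(1) lt st(3)]
    show ?thesis
      using indep_var_integrable[OF i1 X(2) m(1)] indep_var_lebesgue_integral[OF i1 X(2) m(1)]
        indep_var_integrable[OF i2 X(2) m(3)] indep_var_lebesgue_integral[OF i2 X(2) m(3)] m(2,4)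
      by (simp add: mult.commute)
  qed simp
  then show "integrable M (\<lambda>\<omega>. X \<omega> * (W t \<omega> - W s \<omega>) $ c)"
    and "(\<integral>\<omega>. X \<omega> * (W t \<omega> - W s \<omega>) $ c \<partial>M) = 0"
    and "integrable M (\<lambda>\<omega>. X \<omega> * ((W t \<omega> - W s \<omega>) $ c * (W t \<omega> - W s \<omega>) $ c'))"
    and "(\<integral>\<omega>. X \<omega> * ((W t \<omega> - W s \<omega>) $ c * (W t \<omega> - W s \<omega>) $ c') \<partial>M) =
      (if c = c' then (t - s) * (\<integral>\<omega>. X \<omega> \<partial>M) else 0)" by auto
qed

lemma integrable_mult_bounded:
  assumes "integrable M f" "g \<in> borel_measurable M" "\<And>\<omega>. \<omega> \<in> space M \<Longrightarrow> \<bar>g \<omega>\<bar> \<le> (b::real)"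
  shows "integrable M (\<lambda>\<omega>. f \<omega> * g \<omega> :: real)"
proof (rule Bochner_Integration.integrable_bound[of M "\<lambda>\<omega>. b * f \<omega>"])
  have [measurable]: "f \<in> borel_measurable M" using assms(1) by simp
  note assms(2)[measurable]
  show "(\<lambda>\<omega>. f \<omega> * g \<omega>) \<in> borel_measurable M" by measurable
  show "AE \<omega> in M. norm (f \<omega> * g \<omega>) \<le> norm (b * f \<omega>)"
  proof (rule AE_I2)
    fix \<omega> assume "\<omega> \<in> space M"
    then have "\<bar>g \<omega>\<bar> \<le> \<bar>b\<bar>" using assms(3) abs_ge_self order_trans by blast
    then show "norm (f \<omega> * g \<omega>) \<le> norm (b * f \<omega>)"
      by (simp add: abs_mult) (metis abs_ge_zero mult.commute mult_right_mono)
  qed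
qed (use assms(1) in simp)

text \<open>Boundedness of \<open>H\<close> keeps each \<open>X * H $ c\<close> integrable, and
  every coordinate of the increment is centred and independent of it.\<close>

lemma expectation_inner_increment:
  assumes X: "X \<in> borel_measurable (\<F> s)" "integrable M X"
    and H: "H \<in> borel_measurable (\<F> s)" "\<And>\<omega>. \<omega> \<in> space M \<Longrightarrow> norm (H \<omega>) \<le> b"
    and st: "0 \<le> s" "s \<le> t" "t \<le> T"
  shows "integrable M (\<lambda>\<omega>. X \<omega> * (H \<omega> \<bullet> (W t \<omega> - W s \<omega>)))"
    and "(\<integral>\<omega>. X \<omega> * (H \<omega> \<bullet> (W t \<omega> - W s \<omega>)) \<partial>M) = 0"
proof -
  have sT: "s \<le> T" using st by simp
  have [measurable]: "X \<in> borel_measurable (\<F> s)" "H \<in> borel_measurable (\<F> s)" using X H by auto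
  have [measurable]: "(\<lambda>\<omega>. H \<omega> $ c) \<in> borel_measurable (\<F> s)" for c
    by (rule measurable_compose[OF H(1) borel_measurable_nth])
  have m: "(\<lambda>\<omega>. X \<omega> * H \<omega> $ c) \<in> borel_measurable (\<F> s)" for c by measurable
  have Hc: "\<bar>H \<omega> $ c\<bar> \<le> b" if "\<omega> \<in> space M" for c \<omega>
    using H(2)[OF that] component_le_norm_cart[of "H \<omega>" c] by linarith
  have i: "integrable M (\<lambda>\<omega>. X \<omega> * H \<omega> $ c)" for c
    by (rule integrable_mult_bounded[OF X(2) measurable_filt_events[OF _ sT] Hc]) auto
  note e = expectation_mult_increment(1,2)[OF m i st]
  have eq: "X \<omega> * (H \<omega> \<bullet> (W t \<omega> - W s \<omega>)) = (\<Sum>c\<in>UNIV. (X \<omega> * H \<omega> $ c) * (W t \<omega> - W s \<omega>) $ c)" for \<omega>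
    by (simp add: inner_vec_def sum_distrib_left mult.assoc)
  show "integrable M (\<lambda>\<omega>. X \<omega> * (H \<omega> \<bullet> (W t \<omega> - W s \<omega>)))" unfolding eq using e(1) by simp
  show "(\<integral>\<omega>. X \<omega> * (H \<omega> \<bullet> (W t \<omega> - W s \<omega>)) \<partial>M) = 0" unfolding eq using e by simp
qed

text \<open>One step of the Ito isometry: in the double sum over coordinates only the diagonal terms
  survive.\<close>

lemma expectation_inner_increment_square:
  assumes H: "H \<in> borel_measurable (\<F> s)" "\<And>\<omega>. \<omega> \<in> space M \<Longrightarrow> norm (H \<omega>) \<le> b"
    and st: "0 \<le> s" "s \<le> t" "t \<le> T"
  shows "integrable M (\<lambda>\<omega>. (H \<omega> \<bullet> (W t \<omega> - W s \<omega>))\<^sup>2)"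
    and "(\<integral>\<omega>. (H \<omega> \<bullet> (W t \<omega> - W s \<omega>))\<^sup>2 \<partial>M) = (t - s) * (\<integral>\<omega>. (norm (H \<omega>))\<^sup>2 \<partial>M)"
    and "integrable M (\<lambda>\<omega>. (norm (H \<omega>))\<^sup>2)"
proof -
  have sT: "s \<le> T" using st by simp
  have [measurable]: "H \<in> borel_measurable (\<F> s)" using H by auto
  have HM [measurable]: "H \<in> borel_measurable M" using measurable_filt_events[OF H(1) sT] .
  have [measurable]: "(\<lambda>\<omega>. H \<omega> $ c) \<in> borel_measurable (\<F> s)" for c
    by (rule measurable_compose[OF H(1) borel_measurable_nth])
  have m: "(\<lambda>\<omega>. H \<omega> $ c * H \<omega> $ c') \<in> borel_measurable (\<F> s)" for c c' by measurable
  have Hc: "\<bar>H \<omega> $ c\<bar> \<le> b" if "\<omega> \<in> space M" for c \<omega>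
    using H(2)[OF that] component_le_norm_cart[of "H \<omega>" c] by linarith
  have i0: "integrable M (\<lambda>\<omega>. H \<omega> $ c)" for c
    by (rule integrable_const_bound[where B=b])
      (use Hc measurable_compose[OF HM borel_measurable_nth] in auto)
  have i: "integrable M (\<lambda>\<omega>. H \<omega> $ c * H \<omega> $ c')" for c c'
    using borel_measurable_integrable[OF i0] by (intro integrable_mult_bounded[OF i0 _ Hc]) auto
  note e = expectation_mult_increment(3,4)[OF m i st]
  have eq: "(H \<omega> \<bullet> (W t \<omega> - W s \<omega>))\<^sup>2 = (\<Sum>c\<in>UNIV. \<Sum>c'\<in>UNIV. (H \<omega> $ c * H \<omega> $ c') *
      ((W t \<omega> - W s \<omega>) $ c * (W t \<omega> - W s \<omega>) $ c'))" for \<omega>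
    by (simp add: inner_vec_def power2_eq_square sum_product mult_ac)
  have eq2: "(norm (H \<omega>))\<^sup>2 = (\<Sum>c\<in>UNIV. H \<omega> $ c * H \<omega> $ c)" for \<omega>
    unfolding power2_norm_eq_inner by (simp add: inner_vec_def)
  show "integrable M (\<lambda>\<omega>. (H \<omega> \<bullet> (W t \<omega> - W s \<omega>))\<^sup>2)" unfolding eq using e(1) by simp
  show "(\<integral>\<omega>. (H \<omega> \<bullet> (W t \<omega> - W s \<omega>))\<^sup>2 \<partial>M) = (t - s) * (\<integral>\<omega>. (norm (H \<omega>))\<^sup>2 \<partial>M)"
    unfolding eq eq2 using e i by (simp add: sum_distrib_left)
  show "integrable M (\<lambda>\<omega>. (norm (H \<omega>))\<^sup>2)" unfolding eq2 using i by simp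
qed

lemma simple_integrand_mono:
  assumes "simple_integrand M \<F> T n p H" "j \<le> k" "k \<le> n"
  shows "p j \<le> p k"
  using assms(2,3)
proof (induction k)
  case (Suc k)
  then show ?case using assms(1) unfolding simple_integrand_def
    by (cases "j = Suc k") (auto intro: order_trans[of _ "p k"])
qed simp

lemma simple_integrand_Suc:
  "simple_integrand M \<F> T (Suc n) p H \<Longrightarrow> simple_integrand M \<F> T n p H"
  unfolding simple_integrand_def by (meson le_SucI less_SucI)

lemma progressive_simple_process:
  assumes "simple_integrand M \<F> T n p H"
  shows "progressive M \<F> T (simple_process n p H)"
proof -
  have "progressive M \<F> T (\<lambda>s \<omega>. \<Sum>k<n. indicator {p k<..p (Suc k)} s *\<^sub>R H k \<omega>)"
    using assms by (intro progressive_sum progressive_const) (auto simp: simple_integrand_def)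
  then show ?thesis by (simp add: simple_process_def[abs_def])
qed

text \<open>At each time at most one of the left-open intervals is active, so the square has no
  cross terms.\<close>

lemma simple_process_norm_square:
  assumes "simple_integrand M \<F> T n p H"
  shows "(norm (simple_process n p H s \<omega>))\<^sup>2 = (\<Sum>k<n. indicator {p k<..p (Suc k)} s * (norm (H k \<omega>))\<^sup>2)"
  using assms
proof (induction n)
  case (Suc n)
  note IH = Suc.IH[OF simple_integrand_Suc[OF Suc.prems]]
  show ?case
  proof (cases "s \<in> {p n<..p (Suc n)}")
    case True
    \<comment> \<open>On the last interval all earlier summands are switched off, since the
      partition points increase.\<close>
    have "indicator {p k<..p (Suc k)} s = (0::real)" if "k < n" for k
      using simple_integrand_mono[OF Suc.prems, of "Suc k" n] that True by (auto simp: indicator_def)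
    then have "(\<Sum>k<n. indicator {p k<..p (Suc k)} s *\<^sub>R H k \<omega>) = 0"
      "(\<Sum>k<n. indicator {p k<..p (Suc k)} s * (norm (H k \<omega>))\<^sup>2) = 0"
      by auto
    then show ?thesis using True by (simp add: simple_process_def)
  next
    case False
    then show ?thesis using IH by (simp add: simple_process_def)
  qed
qed (simp add: simple_process_def)

lemma energy_simple_process:
  assumes "simple_integrand M \<F> T n p H"
  shows "energy (simple_process n p H) =
    (\<Sum>k<n. ennreal (p (Suc k) - p k) * (\<integral>\<^sup>+\<omega>. ennreal ((norm (H k \<omega>))\<^sup>2) \<partial>M))"
proof -
  have p: "0 \<le> p k" "p k \<le> p (Suc k)" "p (Suc k) \<le> T" if "k < n" for k
    using assms that unfolding simple_integrand_def by auto
  have [measurable]: "H k \<in> borel_measurable M" if "k < n" for k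
    using assms that p[OF that] unfolding simple_integrand_def
    by (auto intro: measurable_filt_events[of _ "p k"])
  have "(\<integral>\<^sup>+ s\<in>{0..T}. ennreal ((norm (simple_process n p H s \<omega>))\<^sup>2) \<partial>lborel)
    = (\<Sum>k<n. ennreal (p (Suc k) - p k) * ennreal ((norm (H k \<omega>))\<^sup>2))" for \<omega>
  proof -
    have "(\<integral>\<^sup>+ s\<in>{0..T}. ennreal ((norm (simple_process n p H s \<omega>))\<^sup>2) \<partial>lborel)
      = (\<integral>\<^sup>+ s. (\<Sum>k<n. ennreal ((norm (H k \<omega>))\<^sup>2) * indicator {p k<..p (Suc k)} s) \<partial>lborel)"
    proof (rule nn_integral_cong)
      fix s
      have "ennreal ((norm (simple_process n p H s \<omega>))\<^sup>2) =
         (\<Sum>k<n. ennreal ((norm (H k \<omega>))\<^sup>2) * indicator {p k<..p (Suc k)} s)"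
        unfolding simple_process_norm_square[OF assms]
        by (subst sum_ennreal[symmetric]) (auto intro!: sum.cong simp: indicator_def)
      moreover have "(\<Sum>k<n. ennreal ((norm (H k \<omega>))\<^sup>2) * indicator {p k<..p (Suc k)} s) = 0" if "s \<notin> {0..T}"
      proof (intro sum.neutral ballI)
        fix k assume "k \<in> {..<n}"
        then have "{p k<..p (Suc k)} \<subseteq> {0..T}" using p[of k] by auto
        then show "ennreal ((norm (H k \<omega>))\<^sup>2) * indicator {p k<..p (Suc k)} s = 0"
          using that by (auto simp: indicator_def)
      qed
      ultimately show "ennreal ((norm (simple_process n p H s \<omega>))\<^sup>2) * indicator {0..T} s =
          (\<Sum>k<n. ennreal ((norm (H k \<omega>))\<^sup>2) * indicator {p k<..p (Suc k)} s)"
        by (cases "s \<in> {0..T}") auto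
    qed
    also have "\<dots> = (\<Sum>k<n. ennreal (p (Suc k) - p k) * ennreal ((norm (H k \<omega>))\<^sup>2))"
      using p by (subst nn_integral_sum) (auto intro!: sum.cong mult.commute simp: nn_integral_cmult_indicator)
    finally show ?thesis .
  qed
  then show ?thesis unfolding energy_def
    by (simp, subst nn_integral_sum) (auto simp: nn_integral_cmult intro!: sum.cong)
qed

text \<open>Induction on the number of steps, with measurability as part of the claim: the integral
  over the first n steps is known at \<open>p n\<close>, hence orthogonal to the next increment, and
  the variances add up.\<close>

lemma simple_integral_moments:
  assumes "simple_integrand M \<F> T n p H"
  shows "simple_integral W n p H T \<in> borel_measurable (\<F> (p n))"
    and "integrable M (simple_integral W n p H T)"
    and "integrable M (\<lambda>\<omega>. (simple_integral W n p H T \<omega>)\<^sup>2)"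
    and "(\<integral>\<omega>. simple_integral W n p H T \<omega> \<partial>M) = 0"
    and "(\<integral>\<omega>. (simple_integral W n p H T \<omega>)\<^sup>2 \<partial>M)
      = (\<Sum>k<n. (p (Suc k) - p k) * (\<integral>\<omega>. (norm (H k \<omega>))\<^sup>2 \<partial>M))"
proof -
  have "simple_integral W n p H T \<in> borel_measurable (\<F> (p n)) \<and>
     integrable M (simple_integral W n p H T) \<and>
     integrable M (\<lambda>\<omega>. (simple_integral W n p H T \<omega>)\<^sup>2) \<and>
     (\<integral>\<omega>. simple_integral W n p H T \<omega> \<partial>M) = 0 \<and>
     (\<integral>\<omega>. (simple_integral W n p H T \<omega>)\<^sup>2 \<partial>M)
      = (\<Sum>k<n. (p (Suc k) - p k) * (\<integral>\<omega>. (norm (H k \<omega>))\<^sup>2 \<partial>M))"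
    using assms
  proof (induction n)
    case 0
    then show ?case by (simp add: simple_integral_def[abs_def])
  next
    case (Suc n)
    let ?S = "simple_integral W n p H T"
    let ?D = "\<lambda>\<omega>. H n \<omega> \<bullet> (W (p (Suc n)) \<omega> - W (p n) \<omega>)"
    have IH: "?S \<in> borel_measurable (\<F> (p n))" "integrable M ?S" "integrable M (\<lambda>\<omega>. (?S \<omega>)\<^sup>2)"
      "(\<integral>\<omega>. ?S \<omega> \<partial>M) = 0"
      "(\<integral>\<omega>. (?S \<omega>)\<^sup>2 \<partial>M) = (\<Sum>k<n. (p (Suc k) - p k) * (\<integral>\<omega>. (norm (H k \<omega>))\<^sup>2 \<partial>M))"
      using Suc.IH[OF simple_integrand_Suc[OF Suc.prems]] by auto
    have p: "0 \<le> p n" "p n \<le> p (Suc n)" "p (Suc n) \<le> T" "p n \<le> T"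
      using Suc.prems unfolding simple_integrand_def by auto
    have H: "H n \<in> borel_measurable (\<F> (p n))" using Suc.prems unfolding simple_integrand_def by auto
    obtain b where b: "\<And>\<omega>. \<omega> \<in> space M \<Longrightarrow> norm (H n \<omega>) \<le> b"
      using Suc.prems unfolding simple_integrand_def by blast
    have eq: "simple_integral W (Suc n) p H T = (\<lambda>\<omega>. ?S \<omega> + ?D \<omega>)"
      using p by (auto simp: simple_integral_def fun_eq_iff min_absorb1)
    \<comment> \<open>The Brownian motion is adapted to the augmented filtration because its natural
      events are among the generators.\<close>
    have Wm: "W s \<in> borel_measurable (\<F> (p (Suc n)))" if "0 \<le> s" "s \<le> p (Suc n)" for s
    proof (rule measurableI)
      fix B :: "(real^'q) set" assume "B \<in> sets borel"
      then have "W s -` B \<inter> space M \<in> sets (natural_filtration M W (p (Suc n)))"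
        unfolding sets_natural using that by auto
      then show "W s -` B \<inter> space (\<F> (p (Suc n))) \<in> sets (\<F> (p (Suc n)))" by (auto simp: sets_filt)
    qed simp
    have [measurable]: "?S \<in> borel_measurable (\<F> (p (Suc n)))" "H n \<in> borel_measurable (\<F> (p (Suc n)))"
      using measurable_filt_mono[OF IH(1) p(2)] measurable_filt_mono[OF H p(2)] by auto
    have [measurable]: "W (p n) \<in> borel_measurable (\<F> (p (Suc n)))" "W (p (Suc n)) \<in> borel_measurable (\<F> (p (Suc n)))"
      using p Wm by auto
    have m: "(\<lambda>\<omega>. ?S \<omega> + ?D \<omega>) \<in> borel_measurable (\<F> (p (Suc n)))" by measurable
    \<comment> \<open>The constant multiplier 1 turns orthogonality to the past into the mean-zero
      property.\<close>
    have D: "integrable M ?D" "(\<integral>\<omega>. ?D \<omega> \<partial>M) = 0"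
      using expectation_inner_increment[where X="\<lambda>_. 1" and H="H n" and s="p n" and t="p (Suc n)" and b=b,
          unfolded mult_1, OF borel_measurable_const integrable_const H b p(1,2,3)] by blast+
    have SD: "integrable M (\<lambda>\<omega>. ?S \<omega> * ?D \<omega>)" "(\<integral>\<omega>. ?S \<omega> * ?D \<omega> \<partial>M) = 0"
      using expectation_inner_increment[OF IH(1,2) H b p(1,2,3)] by blast+
    have D2: "integrable M (\<lambda>\<omega>. (?D \<omega>)\<^sup>2)"
        "(\<integral>\<omega>. (?D \<omega>)\<^sup>2 \<partial>M) = (p (Suc n) - p n) * (\<integral>\<omega>. (norm (H n \<omega>))\<^sup>2 \<partial>M)"
      using expectation_inner_increment_square[OF H b p(1,2,3)] by blast+
    have sq: "(?S \<omega> + ?D \<omega>)\<^sup>2 = (?S \<omega>)\<^sup>2 + 2 * (?S \<omega> * ?D \<omega>) + (?D \<omega>)\<^sup>2" for \<omega>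
      by (simp add: power2_sum)
    show ?case unfolding eq
    proof (intro conjI)
      show "integrable M (\<lambda>\<omega>. ?S \<omega> + ?D \<omega>)" by (intro Bochner_Integration.integrable_add IH(2) D(1))
      show "(\<integral>\<omega>. ?S \<omega> + ?D \<omega> \<partial>M) = 0"
        by (subst Bochner_Integration.integral_add[OF IH(2) D(1)]) (simp only: IH(4) D(2) add_0)
      have i: "integrable M (\<lambda>\<omega>. (?S \<omega>)\<^sup>2 + 2 * (?S \<omega> * ?D \<omega>))"
        by (intro Bochner_Integration.integrable_add IH(3) integrable_mult_right SD(1))
      show "integrable M (\<lambda>\<omega>. (?S \<omega> + ?D \<omega>)\<^sup>2)"
        unfolding sq by (intro Bochner_Integration.integrable_add i D2(1))
      have "(\<integral>\<omega>. (?S \<omega> + ?D \<omega>)\<^sup>2 \<partial>M)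
          = (\<integral>\<omega>. (?S \<omega>)\<^sup>2 + 2 * (?S \<omega> * ?D \<omega>) \<partial>M) + (\<integral>\<omega>. (?D \<omega>)\<^sup>2 \<partial>M)"
        unfolding sq by (rule Bochner_Integration.integral_add[OF i D2(1)])
      also have "(\<integral>\<omega>. (?S \<omega>)\<^sup>2 + 2 * (?S \<omega> * ?D \<omega>) \<partial>M) = (\<integral>\<omega>. (?S \<omega>)\<^sup>2 \<partial>M) + (\<integral>\<omega>. 2 * (?S \<omega> * ?D \<omega>) \<partial>M)"
        by (rule Bochner_Integration.integral_add[OF IH(3) integrable_mult_right[OF SD(1)]])
      also have "(\<integral>\<omega>. 2 * (?S \<omega> * ?D \<omega>) \<partial>M) = 2 * (\<integral>\<omega>. ?S \<omega> * ?D \<omega> \<partial>M)"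
        by (rule integral_mult_right_zero)
      finally show "(\<integral>\<omega>. (?S \<omega> + ?D \<omega>)\<^sup>2 \<partial>M)
          = (\<Sum>k<Suc n. (p (Suc k) - p k) * (\<integral>\<omega>. (norm (H k \<omega>))\<^sup>2 \<partial>M))"
        unfolding SD(2) IH(5) D2(2) by simp
    qed (rule m)
  qed
  then show "simple_integral W n p H T \<in> borel_measurable (\<F> (p n))"
    and "integrable M (simple_integral W n p H T)"
    and "integrable M (\<lambda>\<omega>. (simple_integral W n p H T \<omega>)\<^sup>2)"
    and "(\<integral>\<omega>. simple_integral W n p H T \<omega> \<partial>M) = 0"
    and "(\<integral>\<omega>. (simple_integral W n p H T \<omega>)\<^sup>2 \<partial>M)
      = (\<Sum>k<n. (p (Suc k) - p k) * (\<integral>\<omega>. (norm (H k \<omega>))\<^sup>2 \<partial>M))" by auto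
qed

lemma simple_ito_isometry:
  assumes "simple_integrand M \<F> T n p H"
  shows "(\<integral>\<^sup>+\<omega>. ennreal ((simple_integral W n p H T \<omega>)\<^sup>2) \<partial>M) = energy (simple_process n p H)"
proof -
  have p: "0 \<le> p k" "p k \<le> p (Suc k)" "p (Suc k) \<le> T" if "k < n" for k
    using assms that unfolding simple_integrand_def by auto
  obtain b where b: "\<And>k \<omega>. k < n \<Longrightarrow> \<omega> \<in> space M \<Longrightarrow> norm (H k \<omega>) \<le> b"
    using assms unfolding simple_integrand_def by blast
  have H: "(\<integral>\<^sup>+\<omega>. ennreal ((norm (H k \<omega>))\<^sup>2) \<partial>M) = ennreal (\<integral>\<omega>. (norm (H k \<omega>))\<^sup>2 \<partial>M)" if "k < n" for k
    using assms b that p[OF that] unfolding simple_integrand_def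
    by (intro nn_integral_eq_integral expectation_inner_increment_square(3)[of "H k" "p k" b "p (Suc k)"]) auto
  have "energy (simple_process n p H) = (\<Sum>k<n. ennreal ((p (Suc k) - p k) * (\<integral>\<omega>. (norm (H k \<omega>))\<^sup>2 \<partial>M)))"
    unfolding energy_simple_process[OF assms] using H p by (auto intro!: sum.cong simp: ennreal_mult)
  also have "\<dots> = ennreal (\<integral>\<omega>. (simple_integral W n p H T \<omega>)\<^sup>2 \<partial>M)"
    unfolding simple_integral_moments(5)[OF assms] using p by (intro sum_ennreal) (auto intro!: mult_nonneg_nonneg)
  also have "\<dots> = (\<integral>\<^sup>+\<omega>. ennreal ((simple_integral W n p H T \<omega>)\<^sup>2) \<partial>M)"
    by (intro nn_integral_eq_integral[symmetric] simple_integral_moments(3)[OF assms]) simp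
  finally show ?thesis by simp
qed

lemma simple_integral_measurable:
  assumes "simple_integrand M \<F> T n p H" "t \<in> {0..T}"
  shows "simple_integral W n p H t \<in> borel_measurable M"
proof -
  have p: "0 \<le> p k" "p k \<le> T" if "k \<le> n" for k using assms that unfolding simple_integrand_def by auto
  have [measurable]: "H k \<in> borel_measurable M" if "k < n" for k
    using assms that p[of k] unfolding simple_integrand_def by (auto intro: measurable_filt_events[of _ "p k"])
  have [measurable]: "W (min (p k) t) \<in> borel_measurable M" if "k \<le> n" for k
    using p[OF that] assms(2) by (intro W_measurable) auto
  show ?thesis unfolding simple_integral_def[abs_def] by measurable
qed

end

text \<open>With a Brownian path for g, this writes an integral over a partition clamped to [a,b] as
  a difference of two stopped integrals.\<close>

lemma clamp_telescope:
  fixes g :: "real \<Rightarrow> 'a::ab_group_add"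
  assumes "a \<le> b"
  shows "g (max a (min b x)) = g (min x b) + g a - g (min x a)"
  using assms by (auto simp: max_def min_def)

text \<open>Telescoping over the cells of q inside (x,y], whose ends are points of q. Points of q
  may repeat: selecting cells by the inequalities or by their indices then differs only in
  degenerate cells, whose increment is zero.\<close>

lemma partition_telescope:
  fixes g :: "real \<Rightarrow> 'a::ab_group_add"
  assumes q: "\<And>k. k < N \<Longrightarrow> q k \<le> q (Suc k)" and x: "x = q a" "a \<le> N" and y: "y = q b" "b \<le> N" and "x \<le> y"
  shows "(\<Sum>k<N. if x < q (Suc k) \<and> q (Suc k) \<le> y then g (q (Suc k)) - g (q k) else 0) = g y - g x"
proof (cases "x = y")
  case True
  then show ?thesis by (auto intro!: sum.neutral)
next
  case False
  have mono: "q j \<le> q k" if "j \<le> k" "k \<le> N" for j k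
    using that by (induction k) (auto simp: le_Suc_eq intro: order_trans[OF _ q])
  have ab: "a < b" using False mono[of b a] x y \<open>x \<le> y\<close> by (metis leI order_antisym)
  have "(\<Sum>k<N. if x < q (Suc k) \<and> q (Suc k) \<le> y then g (q (Suc k)) - g (q k) else 0)
     = (\<Sum>k<N. if a \<le> k \<and> k < b then g (q (Suc k)) - g (q k) else 0)"
  proof (rule sum.cong[OF refl])
    fix k assume "k \<in> {..<N}"
    then have k: "k < N" by simp
    consider "k < a" | "a \<le> k" "k < b" | "b \<le> k" by linarith
    then show "(if x < q (Suc k) \<and> q (Suc k) \<le> y then g (q (Suc k)) - g (q k) else 0)
       = (if a \<le> k \<and> k < b then g (q (Suc k)) - g (q k) else 0)"
    proof cases
      case 1
      then show ?thesis using mono[of "Suc k" a] x by auto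
    next
      case 2
      then have "q (Suc k) \<le> y" "x \<le> q k" "q k \<le> q (Suc k)"
        using mono[of "Suc k" b] mono[of a k] k x y q by auto
      moreover from this have "q (Suc k) = q k" if "\<not> x < q (Suc k)" using that by linarith
      ultimately show ?thesis using 2 by (cases "x < q (Suc k)") auto
    next
      case 3
      then have "y \<le> q k" "q k \<le> q (Suc k)" using mono[of b k] k y q by auto
      moreover from this have "q (Suc k) = q k" if "q (Suc k) \<le> y" using that by linarith
      ultimately show ?thesis using 3 ab by (cases "q (Suc k) \<le> y") auto
    qed
  qed
  also have "\<dots> = (\<Sum>k\<in>{a..<b}. g (q (Suc k)) - g (q k))"
    using y by (subst sum.inter_filter[symmetric]) (auto intro!: sum.cong)
  also have "\<dots> = g y - g x" using sum_Suc_diff'[of a b "\<lambda>k. g (q k)"] ab x y by simp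
  finally show ?thesis .
qed

section \<open>Restriction and common refinement of simple integrands\<close>

context wiener_space
begin

text \<open>Stability under multiplication by the indicator of (a,b] and by a bounded variable known
  at a. Coefficients with \<open>p k > b\<close> are set to zero: their clamped cell is empty, but
  \<open>H k\<close> would not be known at its left end b.\<close>

lemma simple_restrict:
  assumes S: "simple_integrand M \<F> T n p H"
    and X: "X \<in> borel_measurable (\<F> a)" "\<And>\<omega>. \<omega> \<in> space M \<Longrightarrow> \<bar>X \<omega>\<bar> \<le> B"
    and ab: "0 \<le> a" "a \<le> b" "b \<le> T"
  defines "p' \<equiv> \<lambda>k. max a (min b (p k))" and "H' \<equiv> \<lambda>k \<omega>. if p k \<le> b then X \<omega> *\<^sub>R H k \<omega> else 0"
  shows "simple_integrand M \<F> T n p' H'"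
    and "simple_process n p' H' s \<omega> = (indicator {a<..b} s * X \<omega>) *\<^sub>R simple_process n p H s \<omega>"
    and "simple_integral W n p' H' s \<omega> =
      X \<omega> * (simple_integral W n p H (min b s) \<omega> - simple_integral W n p H (min a s) \<omega>)"
proof -
  obtain b' where b': "\<And>k \<omega>. k < n \<Longrightarrow> \<omega> \<in> space M \<Longrightarrow> norm (H k \<omega>) \<le> b'"
    using S unfolding simple_integrand_def by blast
  have p: "p k \<le> p (Suc k)" if "k < n" for k using S that unfolding simple_integrand_def by auto
  show "simple_integrand M \<F> T n p' H'"
    unfolding simple_integrand_def
  proof (intro conjI allI impI)
    fix k assume "k < n"
    show "H' k \<in> borel_measurable (\<F> (p' k))"
    proof (cases "p k \<le> b")
      case True
      have "H k \<in> borel_measurable (\<F> (p k))" using S \<open>k < n\<close> unfolding simple_integrand_def by auto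
      then have [measurable]: "H k \<in> borel_measurable (\<F> (p' k))" "X \<in> borel_measurable (\<F> (p' k))"
        using True X(1) by (auto simp: p'_def elim: measurable_filt_mono)
      show ?thesis using True by (simp add: H'_def)
    qed (simp add: H'_def)
    show "p' k \<le> p' (Suc k)" using p[OF \<open>k < n\<close>] by (auto simp: p'_def)
  next
    show "\<exists>b. \<forall>k<n. \<forall>\<omega>\<in>space M. norm (H' k \<omega>) \<le> b"
    proof (intro exI[of _ "\<bar>B\<bar> * \<bar>b'\<bar>"] allI impI ballI)
      fix k \<omega> assume "k < n" and \<omega>: "\<omega> \<in> space M"
      have "\<bar>X \<omega>\<bar> \<le> \<bar>B\<bar>" "norm (H k \<omega>) \<le> \<bar>b'\<bar>" using X(2)[OF \<omega>] b'[OF \<open>k < n\<close> \<omega>] by linarith+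
      then have "\<bar>X \<omega>\<bar> * norm (H k \<omega>) \<le> \<bar>B\<bar> * \<bar>b'\<bar>" by (intro mult_mono) auto
      then show "norm (H' k \<omega>) \<le> \<bar>B\<bar> * \<bar>b'\<bar>" by (auto simp: H'_def)
    qed
  qed (use ab in \<open>auto simp: p'_def\<close>)
  show "simple_process n p' H' s \<omega> = (indicator {a<..b} s * X \<omega>) *\<^sub>R simple_process n p H s \<omega>"
    unfolding simple_process_def scaleR_sum_right
    by (intro sum.cong refl) (use ab in \<open>auto simp: p'_def H'_def indicator_def\<close>)
  have W: "W (min (p' k) s) \<omega> = W (min (p k) (min b s)) \<omega> + W (min a s) \<omega> - W (min (p k) (min a s)) \<omega>" for k
    unfolding p'_def using clamp_telescope[OF ab(2), of "\<lambda>x. W (min x s) \<omega>" "p k"] by (simp add: min.assoc)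
  have "H' k \<omega> \<bullet> (W (min (p' (Suc k)) s) \<omega> - W (min (p' k) s) \<omega>) =
      X \<omega> * (H k \<omega> \<bullet> (W (min (p (Suc k)) (min b s)) \<omega> - W (min (p k) (min b s)) \<omega>)) -
      X \<omega> * (H k \<omega> \<bullet> (W (min (p (Suc k)) (min a s)) \<omega> - W (min (p k) (min a s)) \<omega>))" if "k < n" for k
  proof (cases "p k \<le> b")
    case True
    then show ?thesis unfolding W by (simp add: H'_def inner_diff_right inner_add_right algebra_simps)
  next
    case False
    then have *: "min (p k) (min b s) = min b s" "min (p k) (min a s) = min a s"
       "min (p (Suc k)) (min b s) = min b s" "min (p (Suc k)) (min a s) = min a s"
      using p[OF that] ab by auto
    show ?thesis using False unfolding * by (simp add: H'_def)
  qed
  then show "simple_integral W n p' H' s \<omega> =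
      X \<omega> * (simple_integral W n p H (min b s) \<omega> - simple_integral W n p H (min a s) \<omega>)"
    unfolding simple_integral_def right_diff_distrib sum_distrib_left sum_subtractf[symmetric]
    by (intro sum.cong) auto
qed

text \<open>The coefficient on a cell of q is the value of the process at the right end, since cells
  are closed on the right. It is nevertheless known at \<open>q k\<close>: a point
  \<open>p j < q (Suc k)\<close> is itself a point of q, hence at most \<open>q k\<close>.\<close>

lemma simple_refine:
  assumes S: "simple_integrand M \<F> T n p H"
    and q: "\<And>k. k < N \<Longrightarrow> q k \<le> q (Suc k)" "\<And>k. k \<le> N \<Longrightarrow> 0 \<le> q k \<and> q k \<le> T"
    and pq: "p ` {..n} \<subseteq> q ` {..N}"
  defines "H' \<equiv> \<lambda>k \<omega>. simple_process n p H (q (Suc k)) \<omega>"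
  shows "simple_integrand M \<F> T N q H'"
    and "simple_process N q H' s \<omega> = simple_process n p H s \<omega>"
    and "simple_integral W N q H' s \<omega> = simple_integral W n p H s \<omega>"
proof -
  obtain b' where b': "\<And>k \<omega>. k < n \<Longrightarrow> \<omega> \<in> space M \<Longrightarrow> norm (H k \<omega>) \<le> b'"
    using S unfolding simple_integrand_def by blast
  have mono: "q j \<le> q k" if "j \<le> k" "k \<le> N" for j k
    using that by (induction k) (auto simp: le_Suc_eq intro: order_trans[OF _ q(1)])
  have p: "p k \<le> p (Suc k)" if "k < n" for k using S that unfolding simple_integrand_def by auto
  have H'_eq: "H' k \<omega> = (\<Sum>j<n. (if p j < q (Suc k) \<and> q (Suc k) \<le> p (Suc j) then 1 else 0) *\<^sub>R H j \<omega>)" for k \<omega>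
    unfolding H'_def simple_process_def by (intro sum.cong) (auto simp: indicator_def)
  show "simple_integrand M \<F> T N q H'"
    unfolding simple_integrand_def
  proof (intro conjI allI impI)
    fix k assume k: "k < N"
    show "H' k \<in> borel_measurable (\<F> (q k))" unfolding H'_eq[abs_def]
    proof (rule borel_measurable_sum)
      fix j assume "j \<in> {..<n}"
      then have j: "j < n" by simp
      show "(\<lambda>\<omega>. (if p j < q (Suc k) \<and> q (Suc k) \<le> p (Suc j) then 1 else 0) *\<^sub>R H j \<omega>) \<in> borel_measurable (\<F> (q k))"
      proof (cases "p j < q (Suc k)")
        case True
        obtain i where i: "p j = q i" "i \<le> N" using pq j by (force simp: image_subset_iff)
        then have "i \<le> k" using True mono[of "Suc k" i] by (metis leD not_less_eq_eq)
        then have "p j \<le> q k" using i mono k by auto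
        moreover have "H j \<in> borel_measurable (\<F> (p j))" using S j unfolding simple_integrand_def by auto
        ultimately have "H j \<in> borel_measurable (\<F> (q k))" by (auto elim: measurable_filt_mono)
        then show ?thesis by simp
      qed simp
    qed
  next
    show "\<exists>b. \<forall>k<N. \<forall>\<omega>\<in>space M. norm (H' k \<omega>) \<le> b"
    proof (intro exI[of _ "\<Sum>j<n. \<bar>b'\<bar>"] allI impI ballI)
      fix k \<omega> assume "k < N" and \<omega>: "\<omega> \<in> space M"
      show "norm (H' k \<omega>) \<le> (\<Sum>j<n. \<bar>b'\<bar>)" unfolding H'_eq
      proof (rule sum_norm_le)
        fix j assume "j \<in> {..<n}"
        then show "norm ((if p j < q (Suc k) \<and> q (Suc k) \<le> p (Suc j) then 1 else 0) *\<^sub>R H j \<omega>) \<le> \<bar>b'\<bar>"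
          using b'[OF _ \<omega>, of j] by auto
      qed
    qed
  qed (use q in auto)
  \<comment> \<open>Left general in g because it is used twice: with step functions it yields the
    process, with stopped Brownian paths the integral.\<close>
  have tele: "(\<Sum>k<N. if p j < q (Suc k) \<and> q (Suc k) \<le> p (Suc j) then g (q (Suc k)) - g (q k) else 0)
      = g (p (Suc j)) - g (p j)" if "j < n" for j and g :: "real \<Rightarrow> 'z::ab_group_add"
  proof -
    have "p j \<in> q ` {..N}" "p (Suc j) \<in> q ` {..N}" using pq that by auto
    then obtain a b where "p j = q a" "a \<le> N" "p (Suc j) = q b" "b \<le> N" by auto
    then show ?thesis
      by (intro partition_telescope[where q=q and N=N and a=a and b=b]) (use q(1) p[OF that] in auto)
  qed
  \<comment> \<open>The indicator of (x,y] at s is written as an increment of the step function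
    equal to -1 before s and 0 from s on.\<close>
  have ind: "indicator {x<..y} s = (if y < s then -1 else 0) - (if x < s then -1 else (0::real))" if "x \<le> y" for x y
    using that by (auto simp: indicator_def)
  have "simple_process N q H' s \<omega> = (\<Sum>k<N. \<Sum>j<n. (if p j < q (Suc k) \<and> q (Suc k) \<le> p (Suc j)
      then indicator {q k<..q (Suc k)} s else 0) *\<^sub>R H j \<omega>)"
    unfolding simple_process_def[of N] H'_eq scaleR_sum_right by (intro sum.cong) auto
  also have "\<dots> = (\<Sum>j<n. (\<Sum>k<N. if p j < q (Suc k) \<and> q (Suc k) \<le> p (Suc j)
      then indicator {q k<..q (Suc k)} s else 0) *\<^sub>R H j \<omega>)"
    by (subst sum.swap) (simp add: scaleR_sum_left)
  also have "\<dots> = simple_process n p H s \<omega>" unfolding simple_process_def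
  proof (intro sum.cong refl arg_cong2[where f=scaleR])
    fix j assume "j \<in> {..<n}"
    then have j: "j < n" by simp
    show "(\<Sum>k<N. if p j < q (Suc k) \<and> q (Suc k) \<le> p (Suc j) then indicator {q k<..q (Suc k)} s else 0)
       = (indicator {p j<..p (Suc j)} s :: real)"
      using tele[OF j, of "\<lambda>y. if y < s then -1 else (0::real)"] p[OF j] q(1) by (simp add: ind cong: if_cong)
  qed
  finally show "simple_process N q H' s \<omega> = simple_process n p H s \<omega>" .
  have "simple_integral W N q H' s \<omega> = (\<Sum>k<N. \<Sum>j<n. H j \<omega> \<bullet> (if p j < q (Suc k) \<and> q (Suc k) \<le> p (Suc j)
      then W (min (q (Suc k)) s) \<omega> - W (min (q k) s) \<omega> else 0))"
    unfolding simple_integral_def H'_eq inner_sum_left by (intro sum.cong) auto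
  also have "\<dots> = (\<Sum>j<n. H j \<omega> \<bullet> (\<Sum>k<N. if p j < q (Suc k) \<and> q (Suc k) \<le> p (Suc j)
      then W (min (q (Suc k)) s) \<omega> - W (min (q k) s) \<omega> else 0))"
    by (subst sum.swap) (simp add: inner_sum_right)
  also have "\<dots> = simple_integral W n p H s \<omega>" unfolding simple_integral_def
    by (intro sum.cong refl) (simp add: tele[of _ "\<lambda>y. W (min y s) \<omega>"])
  finally show "simple_integral W N q H' s \<omega> = simple_integral W n p H s \<omega>" .
qed

text \<open>Both integrands are rewritten on the union of their partition points, listed in
  increasing order; there, linear combinations are formed coefficientwise.\<close>

lemma simple_linear:
  assumes S1: "simple_integrand M \<F> T n1 p1 K1" and S2: "simple_integrand M \<F> T n2 p2 K2"
  shows "\<exists>N q H. simple_integrand M \<F> T N q H \<and>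
    (\<forall>s \<omega>. simple_process N q H s \<omega> = simple_process n1 p1 K1 s \<omega> + c *\<^sub>R simple_process n2 p2 K2 s \<omega>) \<and>
    (\<forall>s \<omega>. simple_integral W N q H s \<omega> = simple_integral W n1 p1 K1 s \<omega> + c * simple_integral W n2 p2 K2 s \<omega>)"
proof -
  define Q where "Q = p1 ` {..n1} \<union> p2 ` {..n2}"
  define l where "l = sorted_list_of_set Q"
  define N where "N = length l - 1"
  define q where "q = (\<lambda>k. l ! k)"
  have Q: "finite Q" "Q \<noteq> {}" by (auto simp: Q_def)
  have l: "set l = Q" "sorted l" "l \<noteq> []" using Q by (auto simp: l_def)
  have len: "length l = Suc N" using l(3) by (cases l) (auto simp: N_def)
  have qQ: "q ` {..N} = Q"
    unfolding l(1)[symmetric] set_conv_nth len q_def by (auto simp: less_Suc_eq_le)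
  have QT: "Q \<subseteq> {0..T}" using S1 S2 unfolding Q_def simple_integrand_def by auto
  have q1: "q k \<le> q (Suc k)" if "k < N" for k
    using l(2) that len unfolding q_def by (intro sorted_nth_mono) auto
  have q2: "0 \<le> q k \<and> q k \<le> T" if "k \<le> N" for k
  proof -
    have "q k \<in> Q" using that qQ by auto
    then show ?thesis using QT by auto
  qed
  note r1 = simple_refine[OF S1, of N q, OF q1 q2]
  note r2 = simple_refine[OF S2, of N q, OF q1 q2]
  have sub: "p1 ` {..n1} \<subseteq> q ` {..N}" "p2 ` {..n2} \<subseteq> q ` {..N}" unfolding qQ by (auto simp: Q_def)
  define G1 where "G1 = (\<lambda>k. simple_process n1 p1 K1 (q (Suc k)))"
  define G2 where "G2 = (\<lambda>k. simple_process n2 p2 K2 (q (Suc k)))"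
  have R1: "simple_integrand M \<F> T N q G1" "\<And>s \<omega>. simple_process N q G1 s \<omega> = simple_process n1 p1 K1 s \<omega>"
     "\<And>s \<omega>. simple_integral W N q G1 s \<omega> = simple_integral W n1 p1 K1 s \<omega>"
    using r1 sub(1) unfolding G1_def by auto
  have R2: "simple_integrand M \<F> T N q G2" "\<And>s \<omega>. simple_process N q G2 s \<omega> = simple_process n2 p2 K2 s \<omega>"
     "\<And>s \<omega>. simple_integral W N q G2 s \<omega> = simple_integral W n2 p2 K2 s \<omega>"
    using r2 sub(2) unfolding G2_def by auto
  define G where "G = (\<lambda>k \<omega>. G1 k \<omega> + c *\<^sub>R G2 k \<omega>)"
  have "simple_integrand M \<F> T N q G"
    unfolding simple_integrand_def
  proof (intro conjI allI impI)
    fix k assume "k < N"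
    then have [measurable]: "G1 k \<in> borel_measurable (\<F> (q k))" "G2 k \<in> borel_measurable (\<F> (q k))"
      using R1(1) R2(1) unfolding simple_integrand_def by auto
    show "G k \<in> borel_measurable (\<F> (q k))" unfolding G_def by measurable
  next
    obtain b1 where b1: "\<And>k \<omega>. k < N \<Longrightarrow> \<omega> \<in> space M \<Longrightarrow> norm (G1 k \<omega>) \<le> b1"
      using R1(1) unfolding simple_integrand_def by blast
    obtain b2 where b2: "\<And>k \<omega>. k < N \<Longrightarrow> \<omega> \<in> space M \<Longrightarrow> norm (G2 k \<omega>) \<le> b2"
      using R2(1) unfolding simple_integrand_def by blast
    show "\<exists>b. \<forall>k<N. \<forall>\<omega>\<in>space M. norm (G k \<omega>) \<le> b"
    proof (intro exI[of _ "b1 + \<bar>c\<bar> * b2"] allI impI ballI)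
      fix k \<omega> assume k: "k < N" and \<omega>: "\<omega> \<in> space M"
      have "norm (G k \<omega>) \<le> norm (G1 k \<omega>) + norm (c *\<^sub>R G2 k \<omega>)" unfolding G_def by (rule norm_triangle_ineq)
      also have "\<dots> \<le> b1 + \<bar>c\<bar> * b2"
        using b1[OF k \<omega>] b2[OF k \<omega>] by (auto intro!: add_mono mult_left_mono)
      finally show "norm (G k \<omega>) \<le> b1 + \<bar>c\<bar> * b2" .
    qed
  qed (use q1 q2 in auto)
  moreover have "simple_process N q G s \<omega> = simple_process n1 p1 K1 s \<omega> + c *\<^sub>R simple_process n2 p2 K2 s \<omega>" for s \<omega>
    unfolding R1(2)[symmetric] R2(2)[symmetric]
    unfolding simple_process_def scaleR_sum_right sum.distrib[symmetric]
    by (intro sum.cong refl) (simp only: G_def scaleR_add_right scaleR_scaleR mult.commute)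
  moreover have "simple_integral W N q G s \<omega> = simple_integral W n1 p1 K1 s \<omega> + c * simple_integral W n2 p2 K2 s \<omega>" for s \<omega>
    unfolding R1(3)[symmetric] R2(3)[symmetric]
    unfolding simple_integral_def sum_distrib_left sum.distrib[symmetric]
    by (intro sum.cong refl) (simp add: G_def inner_add_left)
  ultimately show ?thesis by blast
qed

end

section \<open>The Ito integral\<close>

lemma ennreal_tendsto_zero_lin:
  fixes f g :: "nat \<Rightarrow> ennreal"
  assumes "f \<longlonglongrightarrow> 0" "g \<longlonglongrightarrow> 0" "a < top" "b < top"
  shows "(\<lambda>m. a * f m + b * g m) \<longlonglongrightarrow> 0"
proof -
  have "(\<lambda>m. a * f m) \<longlonglongrightarrow> a * 0" "(\<lambda>m. b * g m) \<longlonglongrightarrow> b * 0"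
    by (rule ennreal_tendsto_cmult[OF assms(3,1)], rule ennreal_tendsto_cmult[OF assms(4,2)])
  from tendsto_add[OF this] show ?thesis by simp
qed

lemma ennreal_tendsto_zero_le:
  fixes f g :: "nat \<Rightarrow> ennreal"
  assumes "g \<longlonglongrightarrow> 0" "\<And>m. f m \<le> g m"
  shows "f \<longlonglongrightarrow> 0"
  by (rule tendsto_sandwich[OF _ _ tendsto_const assms(1)]) (use assms(2) in auto)

lemma nn_integral_add_square_le:
  fixes f g :: "'a \<Rightarrow> real"
  assumes [measurable]: "f \<in> borel_measurable N" "g \<in> borel_measurable N"
  shows "(\<integral>\<^sup>+x. ennreal ((f x + g x)\<^sup>2) \<partial>N) \<le> 2 * (\<integral>\<^sup>+x. ennreal ((f x)\<^sup>2) \<partial>N) + 2 * (\<integral>\<^sup>+x. ennreal ((g x)\<^sup>2) \<partial>N)"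
proof -
  have "(\<integral>\<^sup>+x. ennreal ((f x + g x)\<^sup>2) \<partial>N) \<le> (\<integral>\<^sup>+x. 2 * ennreal ((f x)\<^sup>2) + 2 * ennreal ((g x)\<^sup>2) \<partial>N)"
    using ennreal_norm_add_square_le[of "f _" "g _"] by (intro nn_integral_mono) simp
  then show ?thesis by (simp add: nn_integral_add nn_integral_cmult)
qed

lemma nn_integral_mult_square_le:
  fixes f X :: "'a \<Rightarrow> real"
  assumes [measurable]: "f \<in> borel_measurable N" and X: "\<And>x. x \<in> space N \<Longrightarrow> \<bar>X x\<bar> \<le> B"
  shows "(\<integral>\<^sup>+x. ennreal ((X x * f x)\<^sup>2) \<partial>N) \<le> ennreal (B\<^sup>2) * (\<integral>\<^sup>+x. ennreal ((f x)\<^sup>2) \<partial>N)"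
proof -
  have "(\<integral>\<^sup>+x. ennreal ((X x * f x)\<^sup>2) \<partial>N) \<le> (\<integral>\<^sup>+x. ennreal (B\<^sup>2) * ennreal ((f x)\<^sup>2) \<partial>N)"
  proof (rule nn_integral_mono)
    fix x assume "x \<in> space N"
    then have "(X x)\<^sup>2 \<le> B\<^sup>2" using X[of x] by (simp add: power2_le_iff_abs_le)
    then show "ennreal ((X x * f x)\<^sup>2) \<le> ennreal (B\<^sup>2) * ennreal ((f x)\<^sup>2)"
      by (auto simp: ennreal_mult[symmetric] power_mult_distrib intro!: ennreal_leI mult_right_mono)
  qed
  then show ?thesis by (simp add: nn_integral_cmult)
qed

context wiener_space
begin

abbreviation "ito Z I \<equiv> is_ito_integral M \<F> T W Z I"

lemma itoE:
  assumes "ito Z I"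
  obtains n p H where "\<And>m. simple_integrand M \<F> T (n m) (p m) (H m)"
    "(\<lambda>m. energy (\<lambda>s \<omega>. Z s \<omega> - simple_process (n m) (p m) (H m) s \<omega>)) \<longlonglongrightarrow> 0"
    "\<And>t. t \<in> {0..T} \<Longrightarrow>
      (\<lambda>m. \<integral>\<^sup>+ \<omega>. ennreal ((I t \<omega> - simple_integral W (n m) (p m) (H m) t \<omega>)\<^sup>2) \<partial>M) \<longlonglongrightarrow> 0"
  using assms unfolding is_ito_integral_def energy_def[symmetric] by blast

lemma itoI:
  assumes "progressive M \<F> T I" "AE \<omega> in M. continuous_on {0..T} (\<lambda>t. I t \<omega>)"
    "\<And>m. simple_integrand M \<F> T (n m) (p m) (H m)"
    "(\<lambda>m. energy (\<lambda>s \<omega>. Z s \<omega> - simple_process (n m) (p m) (H m) s \<omega>)) \<longlonglongrightarrow> 0"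
    "\<And>t. t \<in> {0..T} \<Longrightarrow>
      (\<lambda>m. \<integral>\<^sup>+ \<omega>. ennreal ((I t \<omega> - simple_integral W (n m) (p m) (H m) t \<omega>)\<^sup>2) \<partial>M) \<longlonglongrightarrow> 0"
  shows "ito Z I"
  using assms unfolding is_ito_integral_def energy_def[symmetric] by blast

lemma ito_progressive: "ito Z I \<Longrightarrow> progressive M \<F> T I"
  and ito_continuous: "ito Z I \<Longrightarrow> AE \<omega> in M. continuous_on {0..T} (\<lambda>t. I t \<omega>)"
  unfolding is_ito_integral_def by auto

text \<open>Approximating sequences are combined index by index; the squared errors add up with the
  factors 2 and 2 c^2.\<close>

lemma ito_linear:
  assumes I1: "ito Z1 I1" and I2: "ito Z2 I2" and Z1: "progressive M \<F> T Z1" and Z2: "progressive M \<F> T Z2"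
  shows "ito (\<lambda>s \<omega>. Z1 s \<omega> + c *\<^sub>R Z2 s \<omega>) (\<lambda>s \<omega>. I1 s \<omega> + c * I2 s \<omega>)"
proof -
  obtain n1 p1 K1 where 1: "\<And>m. simple_integrand M \<F> T (n1 m) (p1 m) (K1 m)"
    "(\<lambda>m. energy (\<lambda>s \<omega>. Z1 s \<omega> - simple_process (n1 m) (p1 m) (K1 m) s \<omega>)) \<longlonglongrightarrow> 0"
    "\<And>t. t \<in> {0..T} \<Longrightarrow>
      (\<lambda>m. \<integral>\<^sup>+ \<omega>. ennreal ((I1 t \<omega> - simple_integral W (n1 m) (p1 m) (K1 m) t \<omega>)\<^sup>2) \<partial>M) \<longlonglongrightarrow> 0"
    using itoE[OF I1] by blast
  obtain n2 p2 K2 where 2: "\<And>m. simple_integrand M \<F> T (n2 m) (p2 m) (K2 m)"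
    "(\<lambda>m. energy (\<lambda>s \<omega>. Z2 s \<omega> - simple_process (n2 m) (p2 m) (K2 m) s \<omega>)) \<longlonglongrightarrow> 0"
    "\<And>t. t \<in> {0..T} \<Longrightarrow>
      (\<lambda>m. \<integral>\<^sup>+ \<omega>. ennreal ((I2 t \<omega> - simple_integral W (n2 m) (p2 m) (K2 m) t \<omega>)\<^sup>2) \<partial>M) \<longlonglongrightarrow> 0"
    using itoE[OF I2] by blast
  have "\<forall>m. \<exists>n p H. simple_integrand M \<F> T n p H \<and>
    (\<forall>s \<omega>. simple_process n p H s \<omega> = simple_process (n1 m) (p1 m) (K1 m) s \<omega> + c *\<^sub>R simple_process (n2 m) (p2 m) (K2 m) s \<omega>) \<and>
    (\<forall>s \<omega>. simple_integral W n p H s \<omega> = simple_integral W (n1 m) (p1 m) (K1 m) s \<omega> + c * simple_integral W (n2 m) (p2 m) (K2 m) s \<omega>)"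
    using simple_linear[OF 1(1) 2(1)] by blast
  then obtain n p H where S: "\<And>m. simple_integrand M \<F> T (n m) (p m) (H m)"
    and P: "\<And>m s \<omega>. simple_process (n m) (p m) (H m) s \<omega> = simple_process (n1 m) (p1 m) (K1 m) s \<omega> + c *\<^sub>R simple_process (n2 m) (p2 m) (K2 m) s \<omega>"
    and J: "\<And>m s \<omega>. simple_integral W (n m) (p m) (H m) s \<omega> = simple_integral W (n1 m) (p1 m) (K1 m) s \<omega> + c * simple_integral W (n2 m) (p2 m) (K2 m) s \<omega>"
    by metis
  note Pr = progressive_simple_process[OF 1(1)] progressive_simple_process[OF 2(1)]
  show ?thesis
  proof (rule itoI[OF _ _ S])
    have "progressive M \<F> T (\<lambda>s \<omega>. c *\<^sub>R I2 s \<omega>)"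
      using ito_progressive[OF I2] unfolding progressive_def by (auto simp: case_prod_beta')
    from progressive_add[OF ito_progressive[OF I1] this]
    show "progressive M \<F> T (\<lambda>s \<omega>. I1 s \<omega> + c * I2 s \<omega>)" by simp
    show "AE \<omega> in M. continuous_on {0..T} (\<lambda>t. I1 t \<omega> + c * I2 t \<omega>)"
      using ito_continuous[OF I1] ito_continuous[OF I2] by eventually_elim (intro continuous_intros)
    show "(\<lambda>m. energy (\<lambda>s \<omega>. Z1 s \<omega> + c *\<^sub>R Z2 s \<omega> - simple_process (n m) (p m) (H m) s \<omega>)) \<longlonglongrightarrow> 0"
    proof (rule ennreal_tendsto_zero_le[OF ennreal_tendsto_zero_lin[OF 1(2) 2(2), of 2 "2 * ennreal (\<bar>c\<bar>\<^sup>2)"]])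
      fix m
      let ?A = "\<lambda>s \<omega>. Z1 s \<omega> - simple_process (n1 m) (p1 m) (K1 m) s \<omega>"
      let ?B = "\<lambda>s \<omega>. Z2 s \<omega> - simple_process (n2 m) (p2 m) (K2 m) s \<omega>"
      have A: "progressive M \<F> T ?A" and B: "progressive M \<F> T ?B"
        using Z1 Z2 Pr by (auto intro: progressive_diff)
      then have cB: "progressive M \<F> T (\<lambda>s \<omega>. c *\<^sub>R ?B s \<omega>)"
        unfolding progressive_def by (auto simp: case_prod_beta' intro: borel_measurable_scaleR)
      have "energy (\<lambda>s \<omega>. Z1 s \<omega> + c *\<^sub>R Z2 s \<omega> - simple_process (n m) (p m) (H m) s \<omega>)
          = energy (\<lambda>s \<omega>. ?A s \<omega> + c *\<^sub>R ?B s \<omega>)"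
        unfolding P by (intro arg_cong[where f=energy] ext) (simp add: algebra_simps)
      also have "\<dots> \<le> 2 * energy ?A + 2 * energy (\<lambda>s \<omega>. c *\<^sub>R ?B s \<omega>)"
        by (rule energy_add_le[OF A cB])
      also have "energy (\<lambda>s \<omega>. c *\<^sub>R ?B s \<omega>) \<le> ennreal (\<bar>c\<bar>\<^sup>2) * energy ?B"
        by (rule energy_scaleR_le[OF B]) auto
      finally show "energy (\<lambda>s \<omega>. Z1 s \<omega> + c *\<^sub>R Z2 s \<omega> - simple_process (n m) (p m) (H m) s \<omega>)
          \<le> 2 * energy ?A + 2 * ennreal (\<bar>c\<bar>\<^sup>2) * energy ?B"
        by (simp add: mult.assoc mult_left_mono)
    qed (auto simp: ennreal_mult_less_top)
    fix t assume t: "t \<in> {0..T}"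
    show "(\<lambda>m. \<integral>\<^sup>+ \<omega>. ennreal ((I1 t \<omega> + c * I2 t \<omega> - simple_integral W (n m) (p m) (H m) t \<omega>)\<^sup>2) \<partial>M) \<longlonglongrightarrow> 0"
    proof (rule ennreal_tendsto_zero_le[OF ennreal_tendsto_zero_lin[OF 1(3)[OF t] 2(3)[OF t], of 2 "2 * ennreal (\<bar>c\<bar>\<^sup>2)"]])
      fix m
      note [measurable] = progressive_at_events[OF ito_progressive[OF I1] t]
        progressive_at_events[OF ito_progressive[OF I2] t]
        simple_integral_measurable[OF 1(1) t, of m] simple_integral_measurable[OF 2(1) t, of m]
      let ?A = "\<lambda>\<omega>. I1 t \<omega> - simple_integral W (n1 m) (p1 m) (K1 m) t \<omega>"
      let ?B = "\<lambda>\<omega>. I2 t \<omega> - simple_integral W (n2 m) (p2 m) (K2 m) t \<omega>"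
      have "(\<integral>\<^sup>+ \<omega>. ennreal ((I1 t \<omega> + c * I2 t \<omega> - simple_integral W (n m) (p m) (H m) t \<omega>)\<^sup>2) \<partial>M)
         = (\<integral>\<^sup>+ \<omega>. ennreal ((?A \<omega> + c * ?B \<omega>)\<^sup>2) \<partial>M)"
        unfolding J by (simp add: algebra_simps)
      also have "\<dots> \<le> 2 * (\<integral>\<^sup>+ \<omega>. ennreal ((?A \<omega>)\<^sup>2) \<partial>M) + 2 * (\<integral>\<^sup>+ \<omega>. ennreal ((c * ?B \<omega>)\<^sup>2) \<partial>M)"
        by (rule nn_integral_add_square_le) measurable
      also have "(\<integral>\<^sup>+ \<omega>. ennreal ((c * ?B \<omega>)\<^sup>2) \<partial>M) \<le> ennreal (\<bar>c\<bar>\<^sup>2) * (\<integral>\<^sup>+ \<omega>. ennreal ((?B \<omega>)\<^sup>2) \<partial>M)"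
        by (rule nn_integral_mult_square_le) auto
      finally show "(\<integral>\<^sup>+ \<omega>. ennreal ((I1 t \<omega> + c * I2 t \<omega> - simple_integral W (n m) (p m) (H m) t \<omega>)\<^sup>2) \<partial>M)
         \<le> 2 * (\<integral>\<^sup>+ \<omega>. ennreal ((?A \<omega>)\<^sup>2) \<partial>M) + 2 * ennreal (\<bar>c\<bar>\<^sup>2) * (\<integral>\<^sup>+ \<omega>. ennreal ((?B \<omega>)\<^sup>2) \<partial>M)"
        by (simp add: mult.assoc mult_left_mono)
    qed (auto simp: ennreal_mult_less_top)
  qed
qed

lemma ito_zero: "ito (\<lambda>s \<omega>. 0) (\<lambda>s \<omega>. 0)"
proof (rule itoI[where n="\<lambda>_. 0" and p="\<lambda>_ _. 0" and H="\<lambda>_ _ _. 0"])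
  show "simple_integrand M \<F> T 0 (\<lambda>_. 0) (\<lambda>_ _. 0)" using T_pos by (simp add: simple_integrand_def)
qed (auto simp: progressive_zero simple_process_def simple_integral_def energy_def)

lemma ito_sum:
  assumes "finite S" "\<And>x. x \<in> S \<Longrightarrow> ito (Z x) (I x)" "\<And>x. x \<in> S \<Longrightarrow> progressive M \<F> T (Z x)"
  shows "ito (\<lambda>s \<omega>. \<Sum>x\<in>S. Z x s \<omega>) (\<lambda>s \<omega>. \<Sum>x\<in>S. I x s \<omega>)"
  using assms
proof (induction S rule: finite_induct)
  case (insert x S)
  have "ito (\<lambda>s \<omega>. Z x s \<omega> + 1 *\<^sub>R (\<Sum>x\<in>S. Z x s \<omega>)) (\<lambda>s \<omega>. I x s \<omega> + 1 * (\<Sum>x\<in>S. I x s \<omega>))"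
    using insert by (intro ito_linear progressive_sum) auto
  then show ?case using insert by simp
qed (simp add: ito_zero)

lemma ito_diff:
  assumes "ito Z1 I1" "ito Z2 I2" "progressive M \<F> T Z1" "progressive M \<F> T Z2"
  shows "ito (\<lambda>s \<omega>. Z1 s \<omega> - Z2 s \<omega>) (\<lambda>s \<omega>. I1 s \<omega> - I2 s \<omega>)"
  using ito_linear[OF assms, of "-1"] by simp

text \<open>The process is zero up to a, moves with I on (a,b] and is frozen after b; each piece is
  built from variables already known when it is switched on.\<close>

lemma progressive_increment:
  fixes I :: "real \<Rightarrow> 'w \<Rightarrow> real"
  assumes I: "progressive M \<F> T I" and X: "X \<in> borel_measurable (\<F> a)" and ab: "0 \<le> a" "a \<le> b" "b \<le> T"
  shows "progressive M \<F> T (\<lambda>s \<omega>. X \<omega> * (I (min b s) \<omega> - I (min a s) \<omega>))"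
proof -
  note X[measurable]
  have a [measurable]: "I a \<in> borel_measurable (\<F> a)" using progressive_at[OF I] ab by auto
  have b: "I b \<in> borel_measurable (\<F> b)" using progressive_at[OF I] ab by auto
  have [measurable]: "I b \<in> borel_measurable (\<F> b)" "I a \<in> borel_measurable (\<F> b)" "X \<in> borel_measurable (\<F> b)"
    using b measurable_filt_mono[OF a ab(2)] measurable_filt_mono[OF X ab(2)] by auto
  have m1: "(\<lambda>\<omega>. X \<omega> * I a \<omega>) \<in> borel_measurable (\<F> a)" by measurable
  have m2: "(\<lambda>\<omega>. X \<omega> * (I b \<omega> - I a \<omega>)) \<in> borel_measurable (\<F> b)" by measurable
  have "progressive M \<F> T (\<lambda>s \<omega>. ((indicator {a<..b} s *\<^sub>R X \<omega>) *\<^sub>R I s \<omega> - indicator {a<..b} s *\<^sub>R (X \<omega> * I a \<omega>))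
       + indicator {b<..} s *\<^sub>R (X \<omega> * (I b \<omega> - I a \<omega>)))"
    by (intro progressive_add progressive_diff progressive_scaleR progressive_const[OF X]
        progressive_const[OF m1] progressive_const[OF m2] I) auto
  moreover have "(\<lambda>s \<omega>. X \<omega> * (I (min b s) \<omega> - I (min a s) \<omega>)) =
     (\<lambda>s \<omega>. ((indicator {a<..b} s *\<^sub>R X \<omega>) *\<^sub>R I s \<omega> - indicator {a<..b} s *\<^sub>R (X \<omega> * I a \<omega>))
       + indicator {b<..} s *\<^sub>R (X \<omega> * (I b \<omega> - I a \<omega>)))"
    using ab by (intro ext) (auto simp: indicator_def min_def algebra_simps)
  ultimately show ?thesis by simp
qed

text \<open>This reduces questions about an increment of the integral, weighted by a variable known
  at its start, to the terminal value of another Ito integral.\<close>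

lemma ito_restrict:
  assumes I: "ito Z I" and Z: "progressive M \<F> T Z"
    and X: "X \<in> borel_measurable (\<F> a)" "\<And>\<omega>. \<omega> \<in> space M \<Longrightarrow> \<bar>X \<omega>\<bar> \<le> B"
    and ab: "0 \<le> a" "a \<le> b" "b \<le> T"
  shows "ito (\<lambda>s \<omega>. (indicator {a<..b} s * X \<omega>) *\<^sub>R Z s \<omega>) (\<lambda>s \<omega>. X \<omega> * (I (min b s) \<omega> - I (min a s) \<omega>))"
    and "progressive M \<F> T (\<lambda>s \<omega>. (indicator {a<..b} s * X \<omega>) *\<^sub>R Z s \<omega>)"
proof -
  obtain n p H where S: "\<And>m. simple_integrand M \<F> T (n m) (p m) (H m)"
    "(\<lambda>m. energy (\<lambda>s \<omega>. Z s \<omega> - simple_process (n m) (p m) (H m) s \<omega>)) \<longlonglongrightarrow> 0"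
    "\<And>t. t \<in> {0..T} \<Longrightarrow>
      (\<lambda>m. \<integral>\<^sup>+ \<omega>. ennreal ((I t \<omega> - simple_integral W (n m) (p m) (H m) t \<omega>)\<^sup>2) \<partial>M) \<longlonglongrightarrow> 0"
    using itoE[OF I] by blast
  obtain \<omega>0 where "\<omega>0 \<in> space M" using not_empty by blast
  then have B: "0 \<le> B" using X(2) by fastforce
  have pX: "progressive M \<F> T (\<lambda>s \<omega>. indicator {a<..b} s *\<^sub>R X \<omega>)"
    by (rule progressive_const[OF X(1)]) auto
  from progressive_scaleR[OF this Z]
  show "progressive M \<F> T (\<lambda>s \<omega>. (indicator {a<..b} s * X \<omega>) *\<^sub>R Z s \<omega>)" by simp
  let ?p = "\<lambda>m k. max a (min b (p m k))"
  let ?H = "\<lambda>m k \<omega>. if p m k \<le> b then X \<omega> *\<^sub>R H m k \<omega> else 0"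
  have R: "simple_integrand M \<F> T (n m) (?p m) (?H m)"
    "simple_process (n m) (?p m) (?H m) s \<omega> = (indicator {a<..b} s * X \<omega>) *\<^sub>R simple_process (n m) (p m) (H m) s \<omega>"
    "simple_integral W (n m) (?p m) (?H m) s \<omega> =
      X \<omega> * (simple_integral W (n m) (p m) (H m) (min b s) \<omega> - simple_integral W (n m) (p m) (H m) (min a s) \<omega>)"
    for m s \<omega>
    by (rule simple_restrict[OF S(1) X ab]; assumption)+
  show "ito (\<lambda>s \<omega>. (indicator {a<..b} s * X \<omega>) *\<^sub>R Z s \<omega>) (\<lambda>s \<omega>. X \<omega> * (I (min b s) \<omega> - I (min a s) \<omega>))"
  proof (rule itoI[OF _ _ R(1)])
    show "progressive M \<F> T (\<lambda>s \<omega>. X \<omega> * (I (min b s) \<omega> - I (min a s) \<omega>))"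
      by (rule progressive_increment[OF ito_progressive[OF I] X(1) ab])
    show "AE \<omega> in M. continuous_on {0..T} (\<lambda>t. X \<omega> * (I (min b t) \<omega> - I (min a t) \<omega>))"
      using ito_continuous[OF I]
    proof eventually_elim
      case (elim \<omega>)
      have "continuous_on {0..T} (\<lambda>t. I (min c t) \<omega>)" if "0 \<le> c" "c \<le> T" for c
        by (rule continuous_on_compose2[OF elim]) (use that in \<open>auto intro!: continuous_intros\<close>)
      then show ?case using ab by (intro continuous_intros) auto
    qed
    show "(\<lambda>m. energy (\<lambda>s \<omega>. (indicator {a<..b} s * X \<omega>) *\<^sub>R Z s \<omega> -
        simple_process (n m) (?p m) (?H m) s \<omega>)) \<longlonglongrightarrow> 0"
      unfolding R(2) scaleR_diff_right[symmetric]
    \<comment> \<open>A single energy has to be controlled; the weight 0 fits it into the two-term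
      limit lemma.\<close>
    proof (rule ennreal_tendsto_zero_le[OF ennreal_tendsto_zero_lin[OF S(2) S(2), of "ennreal (B\<^sup>2)" 0]])
      fix m
      show "energy (\<lambda>s \<omega>. (indicator {a<..b} s * X \<omega>) *\<^sub>R (Z s \<omega> - simple_process (n m) (p m) (H m) s \<omega>))
        \<le> ennreal (B\<^sup>2) * energy (\<lambda>s \<omega>. Z s \<omega> - simple_process (n m) (p m) (H m) s \<omega>)
          + 0 * energy (\<lambda>s \<omega>. Z s \<omega> - simple_process (n m) (p m) (H m) s \<omega>)"
        using energy_scaleR_le[OF progressive_diff[OF Z progressive_simple_process[OF S(1)]],
            of "\<lambda>s \<omega>. indicator {a<..b} s * X \<omega>" B] X(2) B by (auto simp: indicator_def)
    qed auto
    fix t assume t: "t \<in> {0..T}"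
    have mt: "min b t \<in> {0..T}" "min a t \<in> {0..T}" using t ab by auto
    show "(\<lambda>m. \<integral>\<^sup>+ \<omega>. ennreal ((X \<omega> * (I (min b t) \<omega> - I (min a t) \<omega>) -
        simple_integral W (n m) (?p m) (?H m) t \<omega>)\<^sup>2) \<partial>M) \<longlonglongrightarrow> 0"
      unfolding R(3) right_diff_distrib[symmetric]
    proof (rule ennreal_tendsto_zero_le[OF ennreal_tendsto_zero_lin[OF S(3)[OF mt(1)] S(3)[OF mt(2)],
          of "ennreal (B\<^sup>2) * 2" "ennreal (B\<^sup>2) * 2"]])
      fix m
      note [measurable] = progressive_at_events[OF ito_progressive[OF I] mt(1)]
        progressive_at_events[OF ito_progressive[OF I] mt(2)]
        simple_integral_measurable[OF S(1) mt(1), of m] simple_integral_measurable[OF S(1) mt(2), of m]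
      let ?S = "simple_integral W (n m) (p m) (H m)"
      let ?A = "\<lambda>\<omega>. I (min b t) \<omega> - ?S (min b t) \<omega>"
      let ?B = "\<lambda>\<omega>. I (min a t) \<omega> - ?S (min a t) \<omega>"
      have "(\<integral>\<^sup>+ \<omega>. ennreal ((X \<omega> * (I (min b t) \<omega> - I (min a t) \<omega> - (?S (min b t) \<omega> - ?S (min a t) \<omega>)))\<^sup>2) \<partial>M)
        = (\<integral>\<^sup>+ \<omega>. ennreal ((X \<omega> * (?A \<omega> + - ?B \<omega>))\<^sup>2) \<partial>M)" by (simp add: algebra_simps)
      also have "\<dots> \<le> ennreal (B\<^sup>2) * (\<integral>\<^sup>+ \<omega>. ennreal ((?A \<omega> + - ?B \<omega>)\<^sup>2) \<partial>M)"
        by (rule nn_integral_mult_square_le) (use X(2) in auto)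
      also have "(\<integral>\<^sup>+ \<omega>. ennreal ((?A \<omega> + - ?B \<omega>)\<^sup>2) \<partial>M)
          \<le> 2 * (\<integral>\<^sup>+ \<omega>. ennreal ((?A \<omega>)\<^sup>2) \<partial>M) + 2 * (\<integral>\<^sup>+ \<omega>. ennreal ((- ?B \<omega>)\<^sup>2) \<partial>M)"
        by (rule nn_integral_add_square_le) measurable
      finally show "(\<integral>\<^sup>+ \<omega>. ennreal ((X \<omega> * (I (min b t) \<omega> - I (min a t) \<omega> - (?S (min b t) \<omega> - ?S (min a t) \<omega>)))\<^sup>2) \<partial>M)
         \<le> ennreal (B\<^sup>2) * 2 * (\<integral>\<^sup>+ \<omega>. ennreal ((?A \<omega>)\<^sup>2) \<partial>M) + ennreal (B\<^sup>2) * 2 * (\<integral>\<^sup>+ \<omega>. ennreal ((?B \<omega>)\<^sup>2) \<partial>M)"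
        by (simp add: distrib_left mult.assoc mult_left_mono del: minus_diff_eq)
    qed (auto simp: ennreal_mult_less_top)
  qed
qed

text \<open>The energy bound is a one-sided isometry. Its constant 4 comes from using (x + y)^2 <= 2
  x^2 + 2 y^2 twice: from Z to a simple process, and from the integral of that process back to
  \<open>I T\<close>. The errors vanish in the limit.\<close>

lemma ito_terminal:
  assumes I: "ito Z I" and Z: "progressive M \<F> T Z"
  shows "integrable M (\<lambda>\<omega>. (I T \<omega>)\<^sup>2)" and "(\<integral>\<omega>. I T \<omega> \<partial>M) = 0"
    and "energy Z \<le> 4 * (\<integral>\<^sup>+\<omega>. ennreal ((I T \<omega>)\<^sup>2) \<partial>M)"
proof -
  have T: "T \<in> {0..T}" using T_pos by simp
  obtain n p H where S: "\<And>m. simple_integrand M \<F> T (n m) (p m) (H m)"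
    "(\<lambda>m. energy (\<lambda>s \<omega>. Z s \<omega> - simple_process (n m) (p m) (H m) s \<omega>)) \<longlonglongrightarrow> 0"
    "\<And>t. t \<in> {0..T} \<Longrightarrow>
      (\<lambda>m. \<integral>\<^sup>+ \<omega>. ennreal ((I t \<omega> - simple_integral W (n m) (p m) (H m) t \<omega>)\<^sup>2) \<partial>M) \<longlonglongrightarrow> 0"
    using itoE[OF I] by blast
  let ?S = "\<lambda>m. simple_integral W (n m) (p m) (H m) T"
  let ?P = "\<lambda>m. simple_process (n m) (p m) (H m)"
  note mo = simple_integral_moments[OF S(1)]
  note [measurable] = progressive_at_events[OF ito_progressive[OF I] T] simple_integral_measurable[OF S(1) T]
  have lim: "(\<lambda>m. \<integral>\<^sup>+ \<omega>. ennreal ((I T \<omega> - ?S m \<omega>)\<^sup>2) \<partial>M) \<longlonglongrightarrow> 0" by (rule S(3)[OF T])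
  \<comment> \<open>A single approximant at finite distance suffices to make \<open>I T\<close>
    square integrable.\<close>
  then have "eventually (\<lambda>m. (\<integral>\<^sup>+ \<omega>. ennreal ((I T \<omega> - ?S m \<omega>)\<^sup>2) \<partial>M) < 1) sequentially"
    by (rule order_tendstoD) simp
  then obtain m0 where m0: "\<And>m. m \<ge> m0 \<Longrightarrow> (\<integral>\<^sup>+ \<omega>. ennreal ((I T \<omega> - ?S m \<omega>)\<^sup>2) \<partial>M) < 1"
    unfolding eventually_sequentially by blast
  have d: "integrable M (\<lambda>\<omega>. (I T \<omega> - ?S m \<omega>)\<^sup>2)" if "m \<ge> m0" for m
    using m0[OF that] by (intro integrableI_nonneg) (auto intro: less_trans[of _ 1])
  have "integrable M (\<lambda>\<omega>. 2 * (I T \<omega> - ?S m0 \<omega>)\<^sup>2 + 2 * (?S m0 \<omega>)\<^sup>2)"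
    using d[of m0] mo(3) by auto
  then show *: "integrable M (\<lambda>\<omega>. (I T \<omega>)\<^sup>2)"
  proof (rule Bochner_Integration.integrable_bound)
    show "AE \<omega> in M. norm ((I T \<omega>)\<^sup>2) \<le> norm (2 * (I T \<omega> - ?S m0 \<omega>)\<^sup>2 + 2 * (?S m0 \<omega>)\<^sup>2)"
    proof (rule AE_I2)
      fix \<omega>
      show "norm ((I T \<omega>)\<^sup>2) \<le> norm (2 * (I T \<omega> - ?S m0 \<omega>)\<^sup>2 + 2 * (?S m0 \<omega>)\<^sup>2)"
        using norm_add_square_le[of "I T \<omega> - ?S m0 \<omega>" "?S m0 \<omega>"] by simp
    qed
  qed simp
  have i1: "integrable M (I T)" by (rule square_integrable_imp_integrable[OF _ *]) simp
  \<comment> \<open>The approximants have mean zero, so the mean of \<open>I T\<close> is that of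
    the error, and its square is at most the second moment of the error.\<close>
  have bound: "ennreal ((\<integral>\<omega>. I T \<omega> \<partial>M)\<^sup>2) \<le> (\<integral>\<^sup>+ \<omega>. ennreal ((I T \<omega> - ?S m \<omega>)\<^sup>2) \<partial>M)" if "m \<ge> m0" for m
  proof -
    let ?D = "\<lambda>\<omega>. I T \<omega> - ?S m \<omega>"
    have i: "integrable M ?D" using i1 mo(2) by auto
    have "(\<integral>\<omega>. I T \<omega> \<partial>M)\<^sup>2 = (expectation ?D)\<^sup>2" using i1 mo(2,4) by simp
    also have "\<dots> \<le> expectation (\<lambda>\<omega>. (?D \<omega>)\<^sup>2)"
      using variance_positive[of ?D] variance_eq[OF i d[OF that]] by simp
    finally have "ennreal ((\<integral>\<omega>. I T \<omega> \<partial>M)\<^sup>2) \<le> ennreal (expectation (\<lambda>\<omega>. (?D \<omega>)\<^sup>2))" by (rule ennreal_leI)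
    also have "\<dots> = (\<integral>\<^sup>+ \<omega>. ennreal ((?D \<omega>)\<^sup>2) \<partial>M)"
      by (rule nn_integral_eq_integral[symmetric, OF d[OF that]]) simp
    finally show ?thesis .
  qed
  have "ennreal ((\<integral>\<omega>. I T \<omega> \<partial>M)\<^sup>2) \<le> 0"
    by (rule LIMSEQ_le_const[OF lim]) (use bound in blast)
  then show "(\<integral>\<omega>. I T \<omega> \<partial>M) = 0" by (simp add: ennreal_le_iff2 power2_eq_square)
  have "energy Z \<le> 4 * (\<integral>\<^sup>+\<omega>. ennreal ((I T \<omega>)\<^sup>2) \<partial>M)
       + (2 * energy (\<lambda>s \<omega>. Z s \<omega> - ?P m s \<omega>) + 4 * (\<integral>\<^sup>+ \<omega>. ennreal ((I T \<omega> - ?S m \<omega>)\<^sup>2) \<partial>M))" for m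
  proof -
    have "energy Z = energy (\<lambda>s \<omega>. (Z s \<omega> - ?P m s \<omega>) + ?P m s \<omega>)" by simp
    also have "\<dots> \<le> 2 * energy (\<lambda>s \<omega>. Z s \<omega> - ?P m s \<omega>) + 2 * energy (?P m)"
      by (intro energy_add_le progressive_diff Z progressive_simple_process S(1))
    also have "energy (?P m) = (\<integral>\<^sup>+\<omega>. ennreal ((?S m \<omega>)\<^sup>2) \<partial>M)" by (rule simple_ito_isometry[OF S(1), symmetric])
    also have "\<dots> = (\<integral>\<^sup>+\<omega>. ennreal ((I T \<omega> + - (I T \<omega> - ?S m \<omega>))\<^sup>2) \<partial>M)" by simp
    also have "\<dots> \<le> 2 * (\<integral>\<^sup>+\<omega>. ennreal ((I T \<omega>)\<^sup>2) \<partial>M) + 2 * (\<integral>\<^sup>+\<omega>. ennreal ((- (I T \<omega> - ?S m \<omega>))\<^sup>2) \<partial>M)"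
      by (rule nn_integral_add_square_le) measurable
    finally have "energy Z \<le> 2 * energy (\<lambda>s \<omega>. Z s \<omega> - ?P m s \<omega>) + 2 * (2 * (\<integral>\<^sup>+\<omega>. ennreal ((I T \<omega>)\<^sup>2) \<partial>M)
        + 2 * (\<integral>\<^sup>+\<omega>. ennreal ((I T \<omega> - ?S m \<omega>)\<^sup>2) \<partial>M))"
      by (simp add: power2_commute mult_left_mono)
    also have "\<dots> = 4 * (\<integral>\<^sup>+\<omega>. ennreal ((I T \<omega>)\<^sup>2) \<partial>M)
       + (2 * energy (\<lambda>s \<omega>. Z s \<omega> - ?P m s \<omega>) + 4 * (\<integral>\<^sup>+ \<omega>. ennreal ((I T \<omega> - ?S m \<omega>)\<^sup>2) \<partial>M))"
    proof -
      have "2 * (2 * x + 2 * y) = 4 * x + 4 * (y::ennreal)" for x y by (simp add: distrib_left mult.assoc[symmetric])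
      then show ?thesis by (simp add: ac_simps)
    qed
    finally show ?thesis .
  qed
  moreover have "(\<lambda>m. 4 * (\<integral>\<^sup>+\<omega>. ennreal ((I T \<omega>)\<^sup>2) \<partial>M)
       + (2 * energy (\<lambda>s \<omega>. Z s \<omega> - ?P m s \<omega>) + 4 * (\<integral>\<^sup>+ \<omega>. ennreal ((I T \<omega> - ?S m \<omega>)\<^sup>2) \<partial>M)))
       \<longlonglongrightarrow> 4 * (\<integral>\<^sup>+\<omega>. ennreal ((I T \<omega>)\<^sup>2) \<partial>M) + 0"
    by (intro tendsto_add tendsto_const ennreal_tendsto_zero_lin S(2) lim) auto
  ultimately show "energy Z \<le> 4 * (\<integral>\<^sup>+\<omega>. ennreal ((I T \<omega>)\<^sup>2) \<partial>M)"
    by (intro LIMSEQ_le_const[where X="\<lambda>m. 4 * (\<integral>\<^sup>+\<omega>. ennreal ((I T \<omega>)\<^sup>2) \<partial>M)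
       + (2 * energy (\<lambda>s \<omega>. Z s \<omega> - ?P m s \<omega>) + 4 * (\<integral>\<^sup>+ \<omega>. ennreal ((I T \<omega> - ?S m \<omega>)\<^sup>2) \<partial>M))"]) auto
qed

lemma ito_increment_square_integrable:
  assumes I: "ito Z I" "progressive M \<F> T Z" and uv: "0 \<le> u" "u \<le> v" "v \<le> T"
  shows "integrable M (\<lambda>\<omega>. (I v \<omega> - I u \<omega>)\<^sup>2)"
  using ito_terminal(1)[OF ito_restrict[OF I, of "\<lambda>_. 1" u 1 v]] uv by simp

text \<open>The terminal energy bound, applied to the integral restricted with weight
  \<open>indicator A\<close>.\<close>

lemma ito_increment_energy:
  assumes I: "ito Z I" "progressive M \<F> T Z" and uv: "0 \<le> u" "u \<le> v" "v \<le> T" and A: "A \<in> sets (\<F> u)"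
  shows "(\<integral>\<^sup>+\<omega>\<in>A. (\<integral>\<^sup>+ s\<in>{u<..v}. ennreal ((norm (Z s \<omega>))\<^sup>2) \<partial>lborel) \<partial>M)
    \<le> 4 * (\<integral>\<^sup>+\<omega>\<in>A. ennreal ((I v \<omega> - I u \<omega>)\<^sup>2) \<partial>M)"
proof -
  have "energy (\<lambda>s \<omega>. (indicator {u<..v} s * indicator A \<omega>) *\<^sub>R Z s \<omega>)
      \<le> 4 * (\<integral>\<^sup>+\<omega>. ennreal ((indicator A \<omega> * (I (min v T) \<omega> - I (min u T) \<omega>))\<^sup>2) \<partial>M)"
    using A uv by (intro ito_terminal(3) ito_restrict[OF I, of _ _ 1]) (auto simp: indicator_def)
  also have "(\<integral>\<^sup>+\<omega>. ennreal ((indicator A \<omega> * (I (min v T) \<omega> - I (min u T) \<omega>))\<^sup>2) \<partial>M)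
      = (\<integral>\<^sup>+\<omega>\<in>A. ennreal ((I v \<omega> - I u \<omega>)\<^sup>2) \<partial>M)"
    using uv by (intro nn_integral_cong) (auto simp: indicator_def min_absorb1)
  also have "energy (\<lambda>s \<omega>. (indicator {u<..v} s * indicator A \<omega>) *\<^sub>R Z s \<omega>)
     = (\<integral>\<^sup>+\<omega>\<in>A. (\<integral>\<^sup>+ s\<in>{u<..v}. ennreal ((norm (Z s \<omega>))\<^sup>2) \<partial>lborel) \<partial>M)"
    unfolding energy_def
  proof (rule nn_integral_cong)
    fix \<omega>
    have "(\<integral>\<^sup>+ s\<in>{0..T}. ennreal ((norm ((indicator {u<..v} s * indicator A \<omega>) *\<^sub>R Z s \<omega>))\<^sup>2) \<partial>lborel)
      = (\<integral>\<^sup>+ s. indicator A \<omega> * (ennreal ((norm (Z s \<omega>))\<^sup>2) * indicator {u<..v} s) \<partial>lborel)"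
      using uv by (intro nn_integral_cong) (auto simp: indicator_def)
    also have "\<dots> = (\<integral>\<^sup>+ s\<in>{u<..v}. ennreal ((norm (Z s \<omega>))\<^sup>2) \<partial>lborel) * indicator A \<omega>"
      by (cases "\<omega> \<in> A") auto
    finally show "(\<integral>\<^sup>+ s\<in>{0..T}. ennreal ((norm ((indicator {u<..v} s * indicator A \<omega>) *\<^sub>R Z s \<omega>))\<^sup>2) \<partial>lborel) = \<dots>" .
  qed
  finally show ?thesis .
qed

text \<open>For bounded X this is the mean-zero property of a restricted integral. The general case
  truncates X and uses the majorant X^2 + (increment)^2; it is needed because X will be a difference
  of solutions, which is only square integrable.\<close>

lemma expectation_mult_ito_increment:
  assumes I: "ito Z I" "progressive M \<F> T Z" and uv: "0 \<le> u" "u \<le> v" "v \<le> T"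
    and X: "X \<in> borel_measurable (\<F> u)" "integrable M (\<lambda>\<omega>. (X \<omega>)\<^sup>2)"
  shows "integrable M (\<lambda>\<omega>. X \<omega> * (I v \<omega> - I u \<omega>))" and "(\<integral>\<omega>. X \<omega> * (I v \<omega> - I u \<omega>) \<partial>M) = 0"
proof -
  have uT: "u \<le> T" "u \<in> {0..T}" "v \<in> {0..T}" using uv by auto
  have [measurable]: "X \<in> borel_measurable M" by (rule measurable_filt_events[OF X(1) uT(1)])
  have [measurable]: "I u \<in> borel_measurable M" "I v \<in> borel_measurable M"
    using progressive_at_events[OF ito_progressive[OF I(1)]] uT by auto
  let ?D = "\<lambda>\<omega>. I v \<omega> - I u \<omega>"
  note D2 = ito_increment_square_integrable[OF I uv]
  have dom: "integrable M (\<lambda>\<omega>. (X \<omega>)\<^sup>2 + (?D \<omega>)\<^sup>2)" using X(2) D2 by simp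
  have le: "\<bar>X \<omega> * ?D \<omega>\<bar> \<le> (X \<omega>)\<^sup>2 + (?D \<omega>)\<^sup>2" for \<omega>
  proof -
    have "2 * (\<bar>X \<omega>\<bar> * \<bar>?D \<omega>\<bar>) \<le> (X \<omega>)\<^sup>2 + (?D \<omega>)\<^sup>2"
      using sum_squares_bound[of "\<bar>X \<omega>\<bar>" "\<bar>?D \<omega>\<bar>"] by simp
    then show ?thesis unfolding abs_mult by (smt (verit) mult_nonneg_nonneg abs_ge_zero)
  qed
  show "integrable M (\<lambda>\<omega>. X \<omega> * ?D \<omega>)"
    by (rule Bochner_Integration.integrable_bound[OF dom]) (use le in \<open>auto intro!: AE_I2 order_trans[OF le]\<close>)
  define Xn where "Xn = (\<lambda>n::nat. \<lambda>\<omega>. if \<bar>X \<omega>\<bar> \<le> real n then X \<omega> else 0)"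
  have "(\<integral>\<omega>. Xn n \<omega> * ?D \<omega> \<partial>M) = 0" for n
  proof -
    have "Xn n \<in> borel_measurable (\<F> u)" unfolding Xn_def using X(1) by measurable
    moreover have "\<bar>Xn n \<omega>\<bar> \<le> real n" for \<omega> by (simp add: Xn_def)
    ultimately have "(\<integral>\<omega>. Xn n \<omega> * (I (min v T) \<omega> - I (min u T) \<omega>) \<partial>M) = 0"
      using uv by (intro ito_terminal(2)[OF ito_restrict[OF I, of "Xn n" u "real n" v]]) auto
    then show ?thesis using uv by (simp add: min_absorb1)
  qed
  moreover have "(\<lambda>n. \<integral>\<omega>. Xn n \<omega> * ?D \<omega> \<partial>M) \<longlonglongrightarrow> (\<integral>\<omega>. X \<omega> * ?D \<omega> \<partial>M)"
  proof (rule integral_dominated_convergence[OF _ _ dom])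
    show "AE \<omega> in M. (\<lambda>n. Xn n \<omega> * ?D \<omega>) \<longlonglongrightarrow> X \<omega> * ?D \<omega>"
    proof (rule AE_I2)
      fix \<omega>
      obtain N :: nat where N: "\<bar>X \<omega>\<bar> \<le> real N" using real_arch_simple by blast
      have "eventually (\<lambda>n. Xn n \<omega> * ?D \<omega> = X \<omega> * ?D \<omega>) sequentially"
        using eventually_ge_at_top[of N] by eventually_elim (use N in \<open>auto simp: Xn_def\<close>)
      then show "(\<lambda>n. Xn n \<omega> * ?D \<omega>) \<longlonglongrightarrow> X \<omega> * ?D \<omega>" by (rule tendsto_eventually)
    qed
    fix n
    show "AE \<omega> in M. norm (Xn n \<omega> * ?D \<omega>) \<le> (X \<omega>)\<^sup>2 + (?D \<omega>)\<^sup>2"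
      using le by (auto simp: Xn_def intro!: AE_I2)
    show "(\<lambda>\<omega>. Xn n \<omega> * ?D \<omega>) \<in> borel_measurable M" unfolding Xn_def by measurable
  qed measurable
  ultimately show "(\<integral>\<omega>. X \<omega> * ?D \<omega> \<partial>M) = 0" by (simp add: LIMSEQ_const_iff)
qed

text \<open>Finite expected energy makes almost every path square integrable, which pathwise Bochner
  integrals require before they can be added or split.\<close>

lemma finite_energy_path:
  fixes Z :: "real \<Rightarrow> 'w \<Rightarrow> 'b::{real_normed_vector, second_countable_topology}"
  assumes Z: "progressive M \<F> T Z" and E: "energy Z < \<infinity>"
  shows "AE \<omega> in M. set_integrable lborel {0..T} (\<lambda>s. (norm (Z s \<omega>))\<^sup>2)"
proof -
  have "AE \<omega> in M. (\<integral>\<^sup>+ s\<in>{0..T}. ennreal ((norm (Z s \<omega>))\<^sup>2) \<partial>lborel) \<noteq> \<infinity>"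
    using E measurable_path_energy(2)[OF Z] unfolding energy_def
    by (intro nn_integral_PInf_AE) auto
  moreover have "AE \<omega> in M. \<omega> \<in> space M" by simp
  ultimately show ?thesis
  proof eventually_elim
    case (elim \<omega>)
    have eq: "(norm (indicator {0..T} s *\<^sub>R Z s \<omega>))\<^sup>2 = indicator {0..T} s *\<^sub>R (norm (Z s \<omega>))\<^sup>2" for s
      by (auto simp: indicator_def)
    have m: "(\<lambda>s. (norm (indicator {0..T} s *\<^sub>R Z s \<omega>))\<^sup>2) \<in> borel_measurable lborel"
      using path_measurable[OF Z elim(2)] by (intro borel_measurable_power measurable_compose[OF _ borel_measurable_norm])
    show ?case unfolding set_integrable_def
    proof (rule integrableI_nonneg)
      show "(\<lambda>s. indicator {0..T} s *\<^sub>R (norm (Z s \<omega>))\<^sup>2) \<in> borel_measurable lborel" using m unfolding eq .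
      have "(\<integral>\<^sup>+ s. ennreal (indicator {0..T} s *\<^sub>R (norm (Z s \<omega>))\<^sup>2) \<partial>lborel)
         = (\<integral>\<^sup>+ s\<in>{0..T}. ennreal ((norm (Z s \<omega>))\<^sup>2) \<partial>lborel)"
        by (intro nn_integral_cong) (auto simp: indicator_def)
      then show "(\<integral>\<^sup>+ s. ennreal (indicator {0..T} s *\<^sub>R (norm (Z s \<omega>))\<^sup>2) \<partial>lborel) < \<infinity>"
        using elim(1) by (simp add: less_top)
    qed auto
  qed
qed

text \<open>Left-open intervals occur in the energy bound, closed ones in the pathwise equations;
  the left end is a null set of times and bridges the two.\<close>

lemma path_square_integral:
  fixes Z :: "real \<Rightarrow> 'w \<Rightarrow> 'b::{real_normed_vector, second_countable_topology}"
  assumes Z: "progressive M \<F> T Z" and E: "energy Z < \<infinity>" and uv: "0 \<le> u" "u \<le> v" "v \<le> T"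
  shows "AE \<omega> in M. (\<integral>\<^sup>+ s\<in>{u<..v}. ennreal ((norm (Z s \<omega>))\<^sup>2) \<partial>lborel)
      = ennreal (LINT s:{u..v}|lborel. (norm (Z s \<omega>))\<^sup>2)"
    and "integrable M (\<lambda>\<omega>. LINT s:{u..v}|lborel. (norm (Z s \<omega>))\<^sup>2)"
proof -
  show *: "AE \<omega> in M. (\<integral>\<^sup>+ s\<in>{u<..v}. ennreal ((norm (Z s \<omega>))\<^sup>2) \<partial>lborel)
      = ennreal (LINT s:{u..v}|lborel. (norm (Z s \<omega>))\<^sup>2)"
    using finite_energy_path[OF Z E]
  proof eventually_elim
    case (elim \<omega>)
    have i: "set_integrable lborel {u..v} (\<lambda>s. (norm (Z s \<omega>))\<^sup>2)"
      using elim by (rule set_integrable_subset) (use uv in auto)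
    have "(\<integral>\<^sup>+ s\<in>{u<..v}. ennreal ((norm (Z s \<omega>))\<^sup>2) \<partial>lborel)
      = (\<integral>\<^sup>+ s\<in>{u..v}. ennreal ((norm (Z s \<omega>))\<^sup>2) \<partial>lborel)"
      by (intro nn_integral_cong_AE) (use AE_lborel_singleton[of u] in eventually_elim; auto simp: indicator_def)
    also have "\<dots> = (\<integral>\<^sup>+ s. ennreal (indicator {u..v} s *\<^sub>R (norm (Z s \<omega>))\<^sup>2) \<partial>lborel)"
      by (intro nn_integral_cong) (auto simp: indicator_def)
    also have "\<dots> = ennreal (LINT s:{u..v}|lborel. (norm (Z s \<omega>))\<^sup>2)"
      using i unfolding set_integrable_def set_lebesgue_integral_def
      by (intro nn_integral_eq_integral) auto
    finally show ?case .
  qed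
  have m: "(\<lambda>\<omega>. LINT s:{u..v}|lborel. (norm (Z s \<omega>))\<^sup>2) \<in> borel_measurable M"
  proof -
    have "(\<lambda>\<omega>. \<integral>s. indicator {u..v} s *\<^sub>R (norm (indicator {0..T} s *\<^sub>R Z s \<omega>))\<^sup>2 \<partial>lborel) \<in> borel_measurable M"
    proof (rule lborel.borel_measurable_lebesgue_integral)
      have 1: "(\<lambda>x. indicator {0..T} (snd x) *\<^sub>R Z (snd x) (fst x)) \<in> borel_measurable (M \<Otimes>\<^sub>M lborel)"
        using measurable_path_energy(1)[OF Z] by (simp add: case_prod_beta' del: norm_scaleR)
      have 2: "(\<lambda>x. indicator {u..v} (snd x)) \<in> borel_measurable (M \<Otimes>\<^sub>M lborel)"
        by measurable
      show "(\<lambda>(\<omega>, s). indicator {u..v} s *\<^sub>R (norm (indicator {0..T} s *\<^sub>R Z s \<omega>))\<^sup>2) \<in> borel_measurable (M \<Otimes>\<^sub>M lborel)"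
        unfolding case_prod_beta'
        by (intro borel_measurable_scaleR borel_measurable_power measurable_compose[OF 1 borel_measurable_norm] 2)
    qed
    moreover have "(\<integral>s. indicator {u..v} s *\<^sub>R (norm (indicator {0..T} s *\<^sub>R Z s \<omega>))\<^sup>2 \<partial>lborel)
       = (LINT s:{u..v}|lborel. (norm (Z s \<omega>))\<^sup>2)" for \<omega>
      unfolding set_lebesgue_integral_def
      by (intro Bochner_Integration.integral_cong) (use uv in \<open>auto simp: indicator_def\<close>)
    ultimately show ?thesis by simp
  qed
  show "integrable M (\<lambda>\<omega>. LINT s:{u..v}|lborel. (norm (Z s \<omega>))\<^sup>2)"
  proof (rule integrableI_nonneg[OF m])
    show "AE \<omega> in M. 0 \<le> (LINT s:{u..v}|lborel. (norm (Z s \<omega>))\<^sup>2)"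
      unfolding set_lebesgue_integral_def by (intro AE_I2 Bochner_Integration.integral_nonneg) auto
    have "(\<integral>\<^sup>+ \<omega>. ennreal (LINT s:{u..v}|lborel. (norm (Z s \<omega>))\<^sup>2) \<partial>M)
       = (\<integral>\<^sup>+ \<omega>. (\<integral>\<^sup>+ s\<in>{u<..v}. ennreal ((norm (Z s \<omega>))\<^sup>2) \<partial>lborel) \<partial>M)"
      by (intro nn_integral_cong_AE) (use * in eventually_elim; simp)
    also have "\<dots> \<le> energy Z" unfolding energy_def
      by (intro nn_integral_mono) (use uv in \<open>auto simp: indicator_def intro!: nn_integral_mono\<close>)
    finally show "(\<integral>\<^sup>+ \<omega>. ennreal (LINT s:{u..v}|lborel. (norm (Z s \<omega>))\<^sup>2) \<partial>M) < \<infinity>"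
      using E by simp
  qed
qed

text \<open>The localised energy bound in real-valued form, ready to be combined with the other
  expectations of the square expansion.\<close>

lemma ito_increment_energy_real:
  assumes I: "ito Z I" "progressive M \<F> T Z" and E: "energy Z < \<infinity>"
    and uv: "0 \<le> u" "u \<le> v" "v \<le> T" and A: "A \<in> sets (\<F> u)"
  shows "(\<integral>\<omega>. indicator A \<omega> * (LINT s:{u..v}|lborel. (norm (Z s \<omega>))\<^sup>2) \<partial>M)
     \<le> 4 * (\<integral>\<omega>. indicator A \<omega> * (I v \<omega> - I u \<omega>)\<^sup>2 \<partial>M)"
proof -
  have [measurable]: "A \<in> sets M" using filt_events[OF A] uv by auto
  let ?z = "\<lambda>\<omega>. LINT s:{u..v}|lborel. (norm (Z s \<omega>))\<^sup>2"
  let ?j = "\<lambda>\<omega>. (I v \<omega> - I u \<omega>)\<^sup>2"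
  note z = path_square_integral[OF I(2) E uv]
  note j = ito_increment_square_integrable[OF I uv]
  have zi: "integrable M (\<lambda>\<omega>. indicator A \<omega> * ?z \<omega>)" "integrable M (\<lambda>\<omega>. indicator A \<omega> * ?j \<omega>)"
    using integrable_mult_indicator[OF _ z(2), of A] integrable_mult_indicator[OF _ j, of A] by auto
  have z0: "0 \<le> ?z \<omega>" for \<omega> unfolding set_lebesgue_integral_def by (intro Bochner_Integration.integral_nonneg) auto
  have "ennreal (\<integral>\<omega>. indicator A \<omega> * ?z \<omega> \<partial>M) = (\<integral>\<^sup>+\<omega>. ennreal (indicator A \<omega> * ?z \<omega>) \<partial>M)"
    using z0 by (intro nn_integral_eq_integral[symmetric] zi) auto
  also have "\<dots> = (\<integral>\<^sup>+\<omega>\<in>A. (\<integral>\<^sup>+ s\<in>{u<..v}. ennreal ((norm (Z s \<omega>))\<^sup>2) \<partial>lborel) \<partial>M)"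
    by (intro nn_integral_cong_AE) (use z(1) in eventually_elim; auto simp: indicator_def)
  also have "\<dots> \<le> 4 * (\<integral>\<^sup>+\<omega>\<in>A. ennreal (?j \<omega>) \<partial>M)" by (rule ito_increment_energy[OF I uv A])
  also have "(\<integral>\<^sup>+\<omega>\<in>A. ennreal (?j \<omega>) \<partial>M) = (\<integral>\<^sup>+\<omega>. ennreal (indicator A \<omega> * ?j \<omega>) \<partial>M)"
    by (intro nn_integral_cong) (auto simp: indicator_def)
  also have "\<dots> = ennreal (\<integral>\<omega>. indicator A \<omega> * ?j \<omega> \<partial>M)"
    by (intro nn_integral_eq_integral zi) auto
  also have "4 * \<dots> = ennreal (4 * (\<integral>\<omega>. indicator A \<omega> * ?j \<omega> \<partial>M))" by (simp add: ennreal_mult)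
  finally show ?thesis by (subst (asm) ennreal_le_iff) auto
qed

end

section \<open>A comparison theorem\<close>

text \<open>One time step of the square of a process \<open>x \<mapsto> y\<close> with martingale increment \<open>j\<close>: here
  \<open>h\<close> stands for \<open>\<integral>\<bar>\<zeta>\<bar>\<close> and \<open>z\<close> for \<open>\<integral>\<bar>\<zeta>\<bar>\<^sup>2\<close>. The coefficient of \<open>z\<close> is small enough to be absorbed by \<open>j\<^sup>2\<close>.\<close>

lemma square_step:
  fixes x y j :: real
  assumes y: "\<bar>y - x - j\<bar> \<le> L * (\<Delta> * (x + \<delta>) + h)"
    and h: "0 \<le> h" "h\<^sup>2 \<le> \<Delta> * z" and x: "0 \<le> x" and \<delta>: "0 \<le> \<delta>"
    and \<Delta>: "0 < \<Delta>" "192 * L\<^sup>2 * \<Delta> \<le> 1" and L: "0 \<le> L"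
  shows "x\<^sup>2 + 2 * (x * j) + 3/4 * j\<^sup>2 - z / 8 \<le> y\<^sup>2 + (3 * L + 16 * L\<^sup>2 + 1) * \<Delta> * (x\<^sup>2 + \<delta>\<^sup>2)"
proof -
  define g where "g = L * (\<Delta> * (x + \<delta>) + h)"
  have g0: "0 \<le> g" unfolding g_def using L \<Delta> x \<delta> h by simp
  have z0: "0 \<le> z" using h(2) \<Delta>(1) by (smt (verit) mult_pos_neg zero_le_power2)
  define e where "e = y - x - j"
  have e: "\<bar>e\<bar> \<le> g" using y by (simp add: e_def g_def)
  have "y\<^sup>2 = (x + j)\<^sup>2 + 2 * e * (x + j) + e\<^sup>2" unfolding e_def by (simp add: power2_eq_square algebra_simps)
  moreover have "- (2 * e * (x + j)) \<le> 2 * g * x + 2 * g * \<bar>j\<bar>"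
  proof -
    have "\<bar>e * (x + j)\<bar> \<le> g * (x + \<bar>j\<bar>)" unfolding abs_mult using e x by (intro mult_mono) auto
    then show ?thesis by (simp add: algebra_simps abs_le_iff)
  qed
  ultimately have 1: "x\<^sup>2 + 2 * (x * j) + j\<^sup>2 - 2 * g * x - 2 * g * \<bar>j\<bar> \<le> y\<^sup>2"
    by (simp add: power2_sum) (smt (verit) zero_le_power2)
  \<comment> \<open>A quarter of j^2 is given up here, which leaves the coefficient 3/4.\<close>
  have 2: "2 * g * \<bar>j\<bar> \<le> j\<^sup>2 / 4 + 4 * g\<^sup>2"
    using sum_squares_bound[of "2 * g" "\<bar>j\<bar> / 2"] by (simp add: power_mult_distrib power_divide)
  have x\<delta>: "2 * (x * \<delta>) \<le> x\<^sup>2 + \<delta>\<^sup>2" using sum_squares_bound[of x \<delta>] by simp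
  have 3: "2 * g * x \<le> 2 * L * \<Delta> * x\<^sup>2 + L * \<Delta> * (x\<^sup>2 + \<delta>\<^sup>2) + (z / 16 + 16 * L\<^sup>2 * \<Delta> * x\<^sup>2)"
  proof -
    \<comment> \<open>Multiplied by \<Delta> so that h^2 <= \<Delta> z can be used. The weights h/4
      and 4 L \<Delta> x produce z/16, half of the admissible z/8.\<close>
    have "2 * (L * h * x) * \<Delta> \<le> (z / 16 + 16 * L\<^sup>2 * \<Delta> * x\<^sup>2) * \<Delta>"
    proof -
      have "2 * (L * h * x) * \<Delta> \<le> (h / 4)\<^sup>2 + (4 * L * \<Delta> * x)\<^sup>2"
        using sum_squares_bound[of "h / 4" "4 * L * \<Delta> * x"] by (simp add: mult_ac)
      also have "\<dots> \<le> \<Delta> * z / 16 + 16 * L\<^sup>2 * \<Delta>\<^sup>2 * x\<^sup>2" using h(2) by (simp add: power_mult_distrib power_divide)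
      also have "\<dots> = (z / 16 + 16 * L\<^sup>2 * \<Delta> * x\<^sup>2) * \<Delta>" by (simp add: power2_eq_square algebra_simps)
      finally show ?thesis .
    qed
    then have a: "2 * (L * h * x) \<le> z / 16 + 16 * L\<^sup>2 * \<Delta> * x\<^sup>2" using \<Delta>(1) by simp
    have b: "L * \<Delta> * (2 * (x * \<delta>)) \<le> L * \<Delta> * (x\<^sup>2 + \<delta>\<^sup>2)" using x\<delta> L \<Delta> by (intro mult_left_mono) auto
    have "2 * g * x = 2 * L * \<Delta> * x\<^sup>2 + L * \<Delta> * (2 * (x * \<delta>)) + 2 * (L * h * x)"
      unfolding g_def by (simp add: power2_eq_square algebra_simps)
    then show ?thesis using a b by linarith
  qed
  \<comment> \<open>The other z/16: smallness of 192 L^2 \<Delta> turns the quadratic error into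
    terms linear in \<Delta> and a small multiple of z.\<close>
  have 4: "4 * g\<^sup>2 \<le> \<Delta> * (x\<^sup>2 + \<delta>\<^sup>2) + z / 16"
  proof -
    have "(\<Delta> * (x + \<delta>) + h)\<^sup>2 \<le> 2 * (\<Delta> * (x + \<delta>))\<^sup>2 + 2 * h\<^sup>2"
      using sum_squares_bound[of "\<Delta> * (x + \<delta>)" h] by (simp add: power2_sum)
    also have "\<dots> \<le> 4 * (\<Delta>\<^sup>2 * (x\<^sup>2 + \<delta>\<^sup>2)) + 2 * (\<Delta> * z)"
    proof -
      have "(x + \<delta>)\<^sup>2 \<le> 2 * (x\<^sup>2 + \<delta>\<^sup>2)" using x\<delta> by (simp add: power2_sum)
      then have "\<Delta>\<^sup>2 * (x + \<delta>)\<^sup>2 \<le> \<Delta>\<^sup>2 * (2 * (x\<^sup>2 + \<delta>\<^sup>2))" by (intro mult_left_mono) auto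
      also have "\<dots> = 2 * (\<Delta>\<^sup>2 * (x\<^sup>2 + \<delta>\<^sup>2))" by (rule mult.left_commute)
      finally show ?thesis using h(2) unfolding power_mult_distrib[of \<Delta> "x + \<delta>"] by linarith
    qed
    finally have "4 * L\<^sup>2 * (\<Delta> * (x + \<delta>) + h)\<^sup>2 \<le> 4 * L\<^sup>2 * (4 * (\<Delta>\<^sup>2 * (x\<^sup>2 + \<delta>\<^sup>2)) + 2 * (\<Delta> * z))"
      by (intro mult_left_mono) auto
    then have "4 * g\<^sup>2 \<le> 4 * L\<^sup>2 * (4 * (\<Delta>\<^sup>2 * (x\<^sup>2 + \<delta>\<^sup>2)) + 2 * (\<Delta> * z))"
      unfolding g_def by (simp add: power_mult_distrib)
    also have "\<dots> = (192 * L\<^sup>2 * \<Delta>) * (\<Delta> * (x\<^sup>2 + \<delta>\<^sup>2) / 12 + z / 24)"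
      by (simp add: power2_eq_square algebra_simps)
    also have "\<dots> \<le> 1 * (\<Delta> * (x\<^sup>2 + \<delta>\<^sup>2) / 12 + z / 24)"
      using \<Delta> z0 by (intro mult_right_mono) auto
    also have "\<dots> \<le> \<Delta> * (x\<^sup>2 + \<delta>\<^sup>2) + z / 16"
    proof -
      have "0 \<le> \<Delta> * (x\<^sup>2 + \<delta>\<^sup>2)" using \<Delta> by simp
      then show ?thesis using z0 by simp
    qed
    finally show ?thesis .
  qed
  have 5: "2 * L * \<Delta> * x\<^sup>2 + 16 * L\<^sup>2 * \<Delta> * x\<^sup>2 \<le> (2 * L + 16 * L\<^sup>2) * \<Delta> * (x\<^sup>2 + \<delta>\<^sup>2)"
    using L \<Delta> by (simp add: algebra_simps)
  have "(3 * L + 16 * L\<^sup>2 + 1) * \<Delta> * (x\<^sup>2 + \<delta>\<^sup>2)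
     = (2 * L + 16 * L\<^sup>2) * \<Delta> * (x\<^sup>2 + \<delta>\<^sup>2) + L * \<Delta> * (x\<^sup>2 + \<delta>\<^sup>2) + \<Delta> * (x\<^sup>2 + \<delta>\<^sup>2)"
    by (simp add: algebra_simps)
  then show ?thesis using 1 2 3 4 5 by linarith
qed

text \<open>Expand the nonnegative integral of (f - c)^2, where c is the mean of f over the
  interval.\<close>

lemma set_integral_cauchy_schwarz:
  fixes f :: "real \<Rightarrow> real"
  assumes f: "set_integrable lborel {u..v} f" and f2: "set_integrable lborel {u..v} (\<lambda>s. (f s)\<^sup>2)" and uv: "u < v"
  shows "(LINT s:{u..v}|lborel. f s)\<^sup>2 \<le> (v - u) * (LINT s:{u..v}|lborel. (f s)\<^sup>2)"
proof -
  define h where "h = (LINT s:{u..v}|lborel. f s)"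
  define c where "c = h / (v - u)"
  have k: "(LINT s:{u..v}|lborel. c) = (v - u) * c" for c :: real
    using uv by (simp add: set_lebesgue_integral_def)
  have i: "set_integrable lborel {u..v} (\<lambda>s. c)" for c :: real
    by (rule borel_integrable_atLeastAtMost') simp
  have sq: "(f s - c)\<^sup>2 = ((f s)\<^sup>2 - 2 * c * f s) + c\<^sup>2" for s by (simp add: power2_diff)
  have "0 \<le> (LINT s:{u..v}|lborel. (f s - c)\<^sup>2)"
    unfolding set_lebesgue_integral_def by (intro Bochner_Integration.integral_nonneg) auto
  also have "\<dots> = (LINT s:{u..v}|lborel. (f s)\<^sup>2) - 2 * c * h + (v - u) * c\<^sup>2"
    unfolding sq h_def using f f2 i
    by (simp add: set_integral_add set_integral_diff k)
  also have "\<dots> = (LINT s:{u..v}|lborel. (f s)\<^sup>2) - h\<^sup>2 / (v - u)"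
  proof -
    have hc: "h = c * (v - u)" using uv by (simp add: c_def)
    have "h\<^sup>2 / (v - u) = c * h" by (simp add: c_def power2_eq_square)
    moreover have "(v - u) * c\<^sup>2 = c * h" by (simp add: hc power2_eq_square)
    ultimately show ?thesis by simp
  qed
  finally show ?thesis using uv by (simp add: h_def field_simps)
qed

text \<open>The terms \<open>b k - b (Suc k)\<close> telescope, so the oscillation paid at stopping
  is counted once in total and not once per step. With b below the expected oscillation, the final
  bound is proportional to it uniformly in n.\<close>

lemma backward_gronwall:
  fixes m b :: "nat \<Rightarrow> real"
  assumes step: "\<And>k. k < n \<Longrightarrow> m k * (1 - c) \<le> m (Suc k) + (b k - b (Suc k)) + a"
    and b: "\<And>k. k < n \<Longrightarrow> b (Suc k) \<le> b k" and n: "m n = 0" "b n = 0" and c: "0 \<le> c" "c \<le> 1/2" and a: "0 \<le> a"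
  shows "m 0 \<le> exp (2 * c * n) * (b 0 + n * a)"
proof -
  \<comment> \<open>For c <= 1/2 the factor 1/(1 - c) is at most 1 + 2c, hence at most exp
    (2c).\<close>
  have exp: "1 \<le> exp (2 * c) * (1 - c)"
  proof -
    have "c * c \<le> c * (1/2)" using c by (intro mult_left_mono)
    then have "1 \<le> (1 + 2 * c) * (1 - c)" using c by (simp add: algebra_simps)
    also have "\<dots> \<le> exp (2 * c) * (1 - c)" using c exp_ge_add_one_self[of "2 * c"] by (intro mult_right_mono) auto
    finally show ?thesis .
  qed
  have "0 \<le> b (n - j) \<and> m (n - j) \<le> exp (2 * c * j) * (b (n - j) + j * a)" if "j \<le> n" for j
    using that
  proof (induction j)
    case (Suc j)
    define k where "k = n - Suc j"
    have k: "k < n" "n - j = Suc k" using Suc.prems by (auto simp: k_def)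
    have IH: "0 \<le> b (Suc k)" "m (Suc k) \<le> exp (2 * c * j) * (b (Suc k) + j * a)"
      using Suc k by auto
    have b0: "0 \<le> b k" using IH(1) b[OF k(1)] by simp
    have e1: "1 \<le> exp (2 * c * j)" using c by simp
    have "m k * (1 - c) \<le> exp (2 * c * j) * (b (Suc k) + j * a) + (b k - b (Suc k)) + a"
      using step[OF k(1)] IH(2) by linarith
    also have "\<dots> \<le> exp (2 * c * j) * (b (Suc k) + j * a) + exp (2 * c * j) * (b k - b (Suc k) + a)"
      using mult_right_mono[OF e1, of "b k - b (Suc k) + a"] b[OF k(1)] a by simp
    also have "\<dots> = exp (2 * c * j) * (b k + Suc j * a)" by (simp add: algebra_simps)
    finally have *: "m k * (1 - c) \<le> exp (2 * c * j) * (b k + Suc j * a)" .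
    have "m k \<le> exp (2 * c) * (exp (2 * c * j) * (b k + Suc j * a))"
    \<comment> \<open>Multiplying through by the bound on the factor needs \<open>m k > 0\<close>;
      otherwise the nonnegative right-hand side already suffices.\<close>
    proof (cases "m k \<le> 0")
      case True
      also have "0 \<le> exp (2 * c) * (exp (2 * c * j) * (b k + Suc j * a))" using b0 a by simp
      finally show ?thesis .
    next
      case False
      then have "m k * 1 \<le> m k * (exp (2 * c) * (1 - c))" using exp by (intro mult_left_mono) auto
      also have "\<dots> = exp (2 * c) * (m k * (1 - c))" by simp
      also have "\<dots> \<le> exp (2 * c) * (exp (2 * c * j) * (b k + Suc j * a))" using * by simp
      finally show ?thesis by simp
    qed
    also have "\<dots> = exp (2 * c * Suc j) * (b k + Suc j * a)" by (simp add: exp_add[symmetric] algebra_simps)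
    finally show ?case using b0 unfolding k_def by simp
  qed (use n in simp)
  from this[of n] show ?thesis by simp
qed

lemma closure_rationals_Ioo:
  assumes "a < (b::real)" shows "closure ({a<..<b} \<inter> \<rat>) = {a..b}"
proof -
  have "closure (\<rat> :: real set) = UNIV"
  proof (rule set_eqI, simp)
    fix x :: real show "x \<in> closure \<rat>" unfolding closure_approachable
    proof (intro allI impI)
      fix e :: real assume "0 < e"
      then obtain q where "q \<in> \<rat>" "x < q" "q < x + e" using Rats_dense_in_real[of x "x + e"] by auto
      then show "\<exists>y\<in>\<rat>. dist y x < e" by (intro bexI[of _ q]) (auto simp: dist_real_def)
    qed
  qed
  then have "closure ({a<..<b} \<inter> \<rat>) = closure {a<..<b}" by (intro closure_open_Int_superset) auto
  then show ?thesis using assms by simp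
qed

section \<open>Path oscillation and the comparison on one cell\<close>

context wiener_space
begin

text \<open>There are n + 1 cells, so index \<open>Suc n\<close> is the right end and n = 0 is a
  legitimate partition.\<close>

definition grid :: "real \<Rightarrow> real \<Rightarrow> nat \<Rightarrow> nat \<Rightarrow> real" where
  "grid e r n k = e + real k * ((r - e) / real (Suc n))"

lemma grid_bounds:
  assumes "e < r"
  shows "grid e r n 0 = e" "grid e r n (Suc n) = r" "grid e r n k < grid e r n (Suc k)"
    "grid e r n (Suc k) - grid e r n k = (r - e) / real (Suc n)" "e \<le> grid e r n k"
    "k \<le> n \<Longrightarrow> grid e r n k < r" "k \<le> Suc n \<Longrightarrow> grid e r n k \<le> r"
proof -
  show 1: "grid e r n 0 = e" "e \<le> grid e r n k" using assms by (auto simp: grid_def)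
  show 2: "grid e r n (Suc n) = r" by (simp add: grid_def)
  show d: "grid e r n (Suc k) - grid e r n k = (r - e) / real (Suc n)" for k
    by (simp only: grid_def of_nat_Suc[of k] distrib_right)
  have "0 < (r - e) / real (Suc n)" using assms by simp
  then show lt: "grid e r n k < grid e r n (Suc k)" for k using d[of k] by linarith
  have "strict_mono (grid e r n)" by (rule strict_mono_Suc_iff[THEN iffD2]) (use lt in blast)
  then have "grid e r n k < grid e r n (Suc n)" if "k \<le> n" for k using that by (simp add: strict_mono_less)
  then show "k \<le> n \<Longrightarrow> grid e r n k < r" using 2 by simp
  then show "k \<le> Suc n \<Longrightarrow> grid e r n k \<le> r" using 2 by (cases "k = Suc n") auto
qed

text \<open>A supremum over all times of a cell need not be measurable; it is taken over rational
  interior times, and path continuity extends the bound to the closed cell. Uniform continuity of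
  each path drives it to zero, under the majorant \<open>4 * \<bar>w \<omega>\<bar>\<close>.\<close>

lemma oscillation_control:
  fixes D :: "real \<Rightarrow> 'w \<Rightarrow> real"
  assumes er: "e < r" and A: "A \<in> sets M"
    and D: "\<And>u. u \<in> {e..<r} \<Longrightarrow> D u \<in> borel_measurable M"
    and w: "integrable M w" "AE \<omega> in M. \<omega> \<in> A \<longrightarrow> (\<forall>u\<in>{e..<r}. (D u \<omega>)\<^sup>2 \<le> w \<omega>)"
    and cont: "AE \<omega> in M. \<omega> \<in> A \<longrightarrow> continuous_on {e..r} (\<lambda>u. D u \<omega>)"
  obtains osc where "\<And>n. integrable M (osc n)" "\<And>n \<omega>. 0 \<le> osc n \<omega>" "(\<lambda>n. \<integral>\<omega>. osc n \<omega> \<partial>M) \<longlonglongrightarrow> 0"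
    "\<And>n. AE \<omega> in M. \<omega> \<in> A \<longrightarrow> (\<forall>k\<le>n. \<forall>s\<in>{grid e r n k..grid e r n (Suc k)}. (D s \<omega> - D (grid e r n k) \<omega>)\<^sup>2 \<le> osc n \<omega>)"
proof -
  let ?t = "grid e r"
  note g = grid_bounds[OF er]
  \<comment> \<open>Open cells keep the sampled times away from r, where no measurability of
    \<open>D\<close> is assumed.\<close>
  define Q where "Q = (\<lambda>n k. {?t n k<..<?t n (Suc k)} \<inter> \<rat>)"
  have Q: "countable (Q n k)" for n k using countable_rat unfolding Q_def by (rule countable_subset[rotated]) auto
  have Qin: "q \<in> {e..<r}" if "q \<in> Q n k" "k \<le> n" for q n k
    using that g(5)[of n k] g(7)[of "Suc k" n] by (auto simp: Q_def)
  have tin: "?t n k \<in> {e..<r}" if "k \<le> n" for n k using that g by auto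
  define S where "S = (\<lambda>n \<omega>. SUP k\<in>{..n}. SUP q\<in>Q n k. ennreal ((D q \<omega> - D (?t n k) \<omega>)\<^sup>2))"
  have S [measurable]: "S n \<in> borel_measurable M" for n
    unfolding S_def
  proof (intro borel_measurable_SUP Q)
    fix k q assume "k \<in> {..n}" "q \<in> Q n k"
    then have [measurable]: "D q \<in> borel_measurable M" "D (?t n k) \<in> borel_measurable M"
      using D Qin tin by auto
    show "(\<lambda>\<omega>. ennreal ((D q \<omega> - D (?t n k) \<omega>)\<^sup>2)) \<in> borel_measurable M" by measurable
  qed auto
  \<comment> \<open>\<open>enn2real\<close> maps infinity to 0, which would spoil an upper bound; on
    \<open>A\<close>, however, the supremum is almost surely finite, being at most 4 w.\<close>
  define osc where "osc = (\<lambda>n \<omega>. indicator A \<omega> * enn2real (S n \<omega>))"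
  have m [measurable]: "osc n \<in> borel_measurable M" for n unfolding osc_def using A by measurable
  have SD: "S n \<omega> \<le> ennreal c" if "\<And>k q. k \<le> n \<Longrightarrow> q \<in> Q n k \<Longrightarrow> (D q \<omega> - D (?t n k) \<omega>)\<^sup>2 \<le> c" for n \<omega> c
    unfolding S_def by (intro SUP_least) (use that in \<open>auto intro!: ennreal_leI\<close>)
  have w4: "S n \<omega> \<le> ennreal (4 * w \<omega>)" if "\<forall>u\<in>{e..<r}. (D u \<omega>)\<^sup>2 \<le> w \<omega>" for n \<omega>
  proof (rule SD)
    fix k q assume "k \<le> n" "q \<in> Q n k"
    then have "(D q \<omega>)\<^sup>2 \<le> w \<omega>" "(D (?t n k) \<omega>)\<^sup>2 \<le> w \<omega>" using that Qin tin by auto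
    then show "(D q \<omega> - D (?t n k) \<omega>)\<^sup>2 \<le> 4 * w \<omega>"
      using norm_add_square_le[of "D q \<omega>" "- D (?t n k) \<omega>"] by simp
  qed
  have dom: "AE \<omega> in M. norm (osc n \<omega>) \<le> 4 * \<bar>w \<omega>\<bar>" for n
    using w(2)
  proof eventually_elim
    case (elim \<omega>)
    show ?case
    proof (cases "\<omega> \<in> A")
      case True
      then have "S n \<omega> \<le> ennreal (4 * \<bar>w \<omega>\<bar>)" using w4[of \<omega> n] elim by (auto intro: order_trans ennreal_leI)
      then have "enn2real (S n \<omega>) \<le> 4 * \<bar>w \<omega>\<bar>" by (rule enn2real_leI[rotated]) simp
      then show ?thesis using True by (simp add: osc_def)
    qed (simp add: osc_def)
  qed
  have dw: "integrable M (\<lambda>\<omega>. 4 * \<bar>w \<omega>\<bar>)" using w(1) by simp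
  have i: "integrable M (osc n)" for n
    by (rule Bochner_Integration.integrable_bound[OF dw m]) (use dom[of n] in auto)
  have "(\<lambda>n. \<integral>\<omega>. osc n \<omega> \<partial>M) \<longlonglongrightarrow> (\<integral>\<omega>. 0 \<partial>M)"
  proof (rule integral_dominated_convergence[OF _ m dw _ dom])
    show "AE \<omega> in M. (\<lambda>n. osc n \<omega>) \<longlonglongrightarrow> 0"
      using cont
    proof eventually_elim
      case (elim \<omega>)
      show ?case
      proof (cases "\<omega> \<in> A")
        case True
        then have c: "continuous_on {e..r} (\<lambda>u. D u \<omega>)" using elim by simp
        have uc: "uniformly_continuous_on {e..r} (\<lambda>u. D u \<omega>)"
          by (rule compact_uniformly_continuous[OF c]) simp
        show ?thesis
        proof (rule LIMSEQ_I)
          fix \<epsilon> :: real assume \<epsilon>: "0 < \<epsilon>"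
          then have "0 < sqrt (\<epsilon> / 2)" by simp
          then obtain \<delta> where \<delta>: "0 < \<delta>"
            "\<And>x x'. x \<in> {e..r} \<Longrightarrow> x' \<in> {e..r} \<Longrightarrow> dist x' x < \<delta> \<Longrightarrow> dist (D x' \<omega>) (D x \<omega>) < sqrt (\<epsilon> / 2)"
            using uc unfolding uniformly_continuous_on_def by metis
          obtain N where N: "(r - e) / \<delta> < real N" using reals_Archimedean2 by blast
          show "\<exists>no. \<forall>n\<ge>no. norm (osc n \<omega> - 0) < \<epsilon>"
          proof (intro exI[of _ N] allI impI)
            fix n assume n: "N \<le> n"
            have "(r - e) / real (Suc n) < \<delta>"
            proof -
              have "(r - e) / \<delta> < real (Suc n)" using N n by linarith
              then show ?thesis using \<delta>(1) by (simp add: field_simps)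
            qed
            then have sm: "?t n (Suc k) - ?t n k < \<delta>" for k using g(4) by simp
            have "S n \<omega> \<le> ennreal (\<epsilon> / 2)"
            proof (rule SD)
              fix k q assume k: "k \<le> n" and q: "q \<in> Q n k"
              have "dist q (?t n k) < \<delta>" using q sm[of k] by (auto simp: Q_def dist_real_def)
              then have "\<bar>D q \<omega> - D (?t n k) \<omega>\<bar> < sqrt (\<epsilon> / 2)"
                using \<delta>(2)[of "?t n k" q] Qin[OF q k] tin[OF k] by (auto simp: dist_real_def)
              then have "(D q \<omega> - D (?t n k) \<omega>)\<^sup>2 \<le> (sqrt (\<epsilon> / 2))\<^sup>2"
                using \<open>0 < sqrt (\<epsilon> / 2)\<close> by (subst abs_le_square_iff[symmetric]) auto
              then show "(D q \<omega> - D (?t n k) \<omega>)\<^sup>2 \<le> \<epsilon> / 2" using \<epsilon> by simp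
            qed
            then have "enn2real (S n \<omega>) \<le> \<epsilon> / 2" using \<epsilon> by (intro enn2real_leI) auto
            then show "norm (osc n \<omega> - 0) < \<epsilon>" using \<epsilon> by (auto simp: osc_def indicator_def)
          qed
        qed
      qed (simp add: osc_def)
    qed
  qed simp
  moreover have "AE \<omega> in M. \<omega> \<in> A \<longrightarrow> (\<forall>k\<le>n. \<forall>s\<in>{?t n k..?t n (Suc k)}. (D s \<omega> - D (?t n k) \<omega>)\<^sup>2 \<le> osc n \<omega>)" for n
    using w(2) cont
  proof eventually_elim
    case (elim \<omega>)
    show ?case
    proof (intro impI allI ballI)
      fix k s assume \<omega>: "\<omega> \<in> A" and k: "k \<le> n" and s: "s \<in> {?t n k..?t n (Suc k)}"
      have c: "continuous_on {e..r} (\<lambda>u. D u \<omega>)" using elim \<omega> by simp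
      have fin: "S n \<omega> < top" using w4[of \<omega> n] elim \<omega> by (auto intro: le_less_trans)
      have cl: "closure (Q n k) = {?t n k..?t n (Suc k)}"
        unfolding Q_def by (rule closure_rationals_Ioo[OF g(3)])
      show "(D s \<omega> - D (?t n k) \<omega>)\<^sup>2 \<le> osc n \<omega>"
      proof (rule continuous_le_on_closure[of "Q n k" "\<lambda>s. (D s \<omega> - D (?t n k) \<omega>)\<^sup>2"])
        have "continuous_on {?t n k..?t n (Suc k)} (\<lambda>u. D u \<omega>)"
          using c by (rule continuous_on_subset) (use g(5)[of n k] g(7)[of "Suc k" n] k in auto)
        then show "continuous_on (closure (Q n k)) (\<lambda>s. (D s \<omega> - D (?t n k) \<omega>)\<^sup>2)"
          unfolding cl by (intro continuous_intros)
        show "s \<in> closure (Q n k)" using s cl by simp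
        fix q assume q: "q \<in> Q n k"
        have "ennreal ((D q \<omega> - D (?t n k) \<omega>)\<^sup>2) \<le> S n \<omega>"
          unfolding S_def by (rule SUP_upper2[of k], use k in simp, rule SUP_upper[OF q])
        then have "enn2real (ennreal ((D q \<omega> - D (?t n k) \<omega>)\<^sup>2)) \<le> enn2real (S n \<omega>)"
          using fin by (intro enn2real_mono)
        then show "(D q \<omega> - D (?t n k) \<omega>)\<^sup>2 \<le> osc n \<omega>" using \<omega> by (simp add: osc_def)
      qed
    qed
  qed
  moreover have "0 \<le> osc n \<omega>" for n \<omega> by (simp add: osc_def)
  ultimately show ?thesis using i by (intro that[of osc]) auto
qed

text \<open>On a bounded time interval the first power is dominated by 1 plus the square.\<close>

lemma finite_energy_path_norm:
  fixes Z :: "real \<Rightarrow> 'w \<Rightarrow> 'b::{real_normed_vector, second_countable_topology}"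
  assumes Z: "progressive M \<F> T Z" and E: "energy Z < \<infinity>"
  shows "AE \<omega> in M. set_integrable lborel {0..T} (\<lambda>s. norm (Z s \<omega>))"
proof -
  have "AE \<omega> in M. \<omega> \<in> space M" by simp
  with finite_energy_path[OF Z E] show ?thesis
  proof eventually_elim
    case (elim \<omega>)
    have "set_integrable lborel {0..T} (\<lambda>s. 1 + (norm (Z s \<omega>))\<^sup>2)"
      by (intro set_integral_add(1)[OF _ elim(1)] borel_integrable_atLeastAtMost') auto
    moreover have "set_borel_measurable lborel {0..T} (\<lambda>s. norm (Z s \<omega>))"
    proof -
      have "(\<lambda>s. norm (indicator {0..T} s *\<^sub>R Z s \<omega>)) \<in> borel_measurable lborel"
        by (rule measurable_compose[OF path_measurable[OF Z elim(2)] borel_measurable_norm])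
      then show ?thesis unfolding set_borel_measurable_def by (simp add: abs_indicator)
    qed
    ultimately show ?case
    proof (rule set_integrable_bound, intro AE_I2 impI)
      fix s
      have "norm (Z s \<omega>) \<le> 1 + (norm (Z s \<omega>))\<^sup>2"
        using sum_squares_bound[of 1 "norm (Z s \<omega>)"] norm_ge_zero[of "Z s \<omega>"] by (simp; linarith)
      then show "norm (norm (Z s \<omega>)) \<le> norm (1 + (norm (Z s \<omega>))\<^sup>2)" by simp
    qed
  qed
qed

text \<open>\<open>D\<close> will be a difference of solutions with left limits inserted at r, hence
  measurability is asked before r and continuity up to r. The event \<open>A\<close> localises to
  one mode at time e.\<close>

theorem comparison:
  assumes J: "ito \<zeta> J" and \<zeta>: "progressive M \<F> T \<zeta>" "energy \<zeta> < \<infinity>"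
    and er: "0 \<le> e" "e < r" "r \<le> T" and A: "A \<in> sets (\<F> e)" and L: "0 \<le> L"
    and D: "\<And>u. u \<in> {e..<r} \<Longrightarrow> D u \<in> borel_measurable (\<F> u)"
    and w: "integrable M w" "AE \<omega> in M. \<omega> \<in> A \<longrightarrow> (\<forall>u\<in>{e..<r}. (D u \<omega>)\<^sup>2 \<le> w \<omega>)"
    and cont: "AE \<omega> in M. \<omega> \<in> A \<longrightarrow> continuous_on {e..r} (\<lambda>u. D u \<omega>)"
    and eq: "AE \<omega> in M. \<omega> \<in> A \<longrightarrow> (\<forall>u v. e \<le> u \<longrightarrow> u \<le> v \<longrightarrow> v \<le> r \<longrightarrow>
       \<bar>D v \<omega> - D u \<omega> - (J v \<omega> - J u \<omega>)\<bar> \<le> L * (LINT s:{u..v}|lborel. \<bar>D s \<omega>\<bar> + norm (\<zeta> s \<omega>)))"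
    and fin: "AE \<omega> in M. \<omega> \<in> A \<longrightarrow> D r \<omega> \<le> 0"
  shows "AE \<omega> in M. \<omega> \<in> A \<longrightarrow> D e \<omega> \<le> 0"
proof -
  note g = grid_bounds[OF er(2)]
  have AM: "A \<in> sets M" using filt_events[OF A] er by auto
  have DM: "D u \<in> borel_measurable M" if "u \<in> {e..<r}" for u
    using measurable_filt_events[OF D[OF that]] that er by auto
  obtain osc where osc: "\<And>n. integrable M (osc n)" "\<And>n \<omega>. 0 \<le> osc n \<omega>" "(\<lambda>n. \<integral>\<omega>. osc n \<omega> \<partial>M) \<longlonglongrightarrow> 0"
    "\<And>n. AE \<omega> in M. \<omega> \<in> A \<longrightarrow> (\<forall>k\<le>n. \<forall>s\<in>{grid e r n k..grid e r n (Suc k)}. (D s \<omega> - D (grid e r n k) \<omega>)\<^sup>2 \<le> osc n \<omega>)"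
    using oscillation_control[OF er(2) AM DM w cont] by blast
  define K where "K = 3 * L + 16 * L\<^sup>2 + 1"
  have K: "0 \<le> K" using L by (simp add: K_def)
  define A0 where "A0 = {\<omega>\<in>A. 0 < D e \<omega>}"
  have A0: "A0 \<in> sets M"
  proof -
    have [measurable]: "D e \<in> borel_measurable M" using DM er by simp
    have "A0 = A \<inter> {\<omega>\<in>space M. 0 < D e \<omega>}" using sets.sets_into_space[OF AM] by (auto simp: A0_def)
    then show ?thesis using AM by simp
  qed
  \<comment> \<open>The second moment of the positive part of \<open>D e\<close> on
    \<open>A\<close>; the claim follows once it is shown to vanish.\<close>
  define m0 where "m0 = (\<integral>\<omega>. indicator A0 \<omega> * (D e \<omega>)\<^sup>2 \<partial>M)"
  have sqint: "integrable M (\<lambda>\<omega>. indicator B \<omega> * (D u \<omega>)\<^sup>2)"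
    if "B \<in> sets M" "B \<subseteq> A" "u \<in> {e..<r}" for B u
  proof (rule Bochner_Integration.integrable_bound[OF w(1)])
    note DM[OF that(3), measurable] that(1)[measurable]
    show "(\<lambda>\<omega>. indicator B \<omega> * (D u \<omega>)\<^sup>2) \<in> borel_measurable M" by measurable
    show "AE \<omega> in M. norm (indicator B \<omega> * (D u \<omega>)\<^sup>2) \<le> norm (w \<omega>)"
      using w(2)
    proof eventually_elim
      case (elim \<omega>)
      show ?case
      proof (cases "\<omega> \<in> B")
        case True
        then have "(D u \<omega>)\<^sup>2 \<le> w \<omega>" using elim that by auto
        then show ?thesis using True by simp
      qed simp
    qed
  qed
  \<comment> \<open>The first mesh condition is the smallness c <= 1/2 in the Gronwall argument, the
    second that of \<open>square_step\<close>.\<close>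
  have main: "m0 \<le> exp (2 * K * (r - e)) * (1 + K * (r - e)) * (\<integral>\<omega>. osc n \<omega> \<partial>M)"
    if n1: "K * ((r - e) / real (Suc n)) \<le> 1 / 2" and n2: "192 * L\<^sup>2 * ((r - e) / real (Suc n)) \<le> 1" for n
  proof -
    define \<Delta> where "\<Delta> = (r - e) / real (Suc n)"
    have \<Delta>: "0 < \<Delta>" using er by (simp add: \<Delta>_def)
    define t where "t = grid e r n"
    have t: "t 0 = e" "t (Suc n) = r" "t k < t (Suc k)" "t (Suc k) - t k = \<Delta>" "e \<le> t k" for k
      using g by (auto simp: t_def \<Delta>_def)
    have t2: "t k < r" "t (Suc k) \<le> r" "t k \<in> {e..<r}" if "k \<le> n" for k
      using g(5,6,7) that by (auto simp: t_def)
    \<comment> \<open>The paths not stopped at any of the points 0 to k. The empty set beyond n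
      encodes that everything has stopped at r, where \<open>D\<close> is nonpositive, and gives m
      and b the terminal value 0.\<close>
    define B where "B = (\<lambda>k. if k \<le> n then {\<omega>\<in>A. \<forall>j\<le>k. 0 < D (t j) \<omega>} else {})"
    have tm: "t j \<le> t k" if "j \<le> k" for j k
      by (rule lift_Suc_mono_le[of t j k, OF less_imp_le[OF t(3)] that])
    have BF: "B k \<in> sets (\<F> (t k))" if k: "k \<le> n" for k
    proof -
      have "A \<in> sets (\<F> (t k))" using A filt_mono[OF t(5)[of k]] by auto
      moreover have "{\<omega>\<in>space M. 0 < D (t j) \<omega>} \<in> sets (\<F> (t k))" if "j \<le> k" for j
      proof -
        have "D (t j) \<in> borel_measurable (\<F> (t k))"
          using D[OF t2(3), of j] that k tm by (auto intro: measurable_filt_mono)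
        then have "{\<omega>\<in>space (\<F> (t k)). 0 < D (t j) \<omega>} \<in> sets (\<F> (t k))" by measurable
        then show ?thesis by simp
      qed
      moreover have "B k = A \<inter> (\<Inter>j\<in>{..k}. {\<omega>\<in>space M. 0 < D (t j) \<omega>})"
        using sets.sets_into_space[OF AM] k by (auto simp: B_def)
      ultimately show ?thesis by (auto intro!: sets.Int sets.finite_INT)
    qed
    have BM [measurable]: "B k \<in> sets M" for k
    proof (cases "k \<le> n")
      case True
      then show ?thesis using BF[OF True] filt_events t2(1)[OF True] er by fastforce
    qed (simp add: B_def)
    have BA: "B k \<subseteq> A" for k by (auto simp: B_def)
    have Bdec: "B (Suc k) \<subseteq> B k" for k by (auto simp: B_def)
    define m where "m = (\<lambda>k. \<integral>\<omega>. indicator (B k) \<omega> * (D (t k) \<omega>)\<^sup>2 \<partial>M)"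
    define b where "b = (\<lambda>k. \<integral>\<omega>. indicator (B k) \<omega> * osc n \<omega> \<partial>M)"
    have osci: "integrable M (\<lambda>\<omega>. indicator (B k) \<omega> * osc n \<omega>)" for k
      using integrable_mult_indicator[OF BM osc(1)] by simp
    have m_int: "integrable M (\<lambda>\<omega>. indicator (B k) \<omega> * (D (t k) \<omega>)\<^sup>2)" if "k \<le> Suc n" for k
    proof (cases "k \<le> n")
      case True
      then show ?thesis by (intro sqint BM BA t2)
    qed (simp add: B_def)
    \<comment> \<open>\<open>b k - b (Suc k)\<close> is the expected oscillation on the paths
      stopped exactly at point k + 1; it pays for the squared overshoot there.\<close>
    have step: "m k * (1 - K * \<Delta>) \<le> m (Suc k) + (b k - b (Suc k)) + K * \<Delta> * (\<integral>\<omega>. osc n \<omega> \<partial>M)" if k: "k < Suc n" for k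
    proof -
      have kn: "k \<le> n" using k by simp
      let ?u = "t k" and ?v = "t (Suc k)"
      have uv: "0 \<le> ?u" "?u \<le> ?v" "?v \<le> T" using t(5)[of k] t(3)[of k] t2[OF kn] er by auto
      let ?I = "\<lambda>\<omega>. indicator (B k) \<omega> :: real"
      let ?j = "\<lambda>\<omega>. J ?v \<omega> - J ?u \<omega>"
      let ?z = "\<lambda>\<omega>. LINT s:{?u..?v}|lborel. (norm (\<zeta> s \<omega>))\<^sup>2"
      have XF: "(\<lambda>\<omega>. ?I \<omega> * D ?u \<omega>) \<in> borel_measurable (\<F> ?u)"
        using D[OF t2(3)[OF kn]] BF[OF kn] by measurable
      have sq: "(?I \<omega> * D ?u \<omega>)\<^sup>2 = ?I \<omega> * (D ?u \<omega>)\<^sup>2" for \<omega> by (simp add: indicator_def)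
      have X2: "integrable M (\<lambda>\<omega>. (?I \<omega> * D ?u \<omega>)\<^sup>2)" unfolding sq using m_int kn by simp
      \<comment> \<open>The cross term 2 x j has mean zero because x, cut off by the event of not
        having stopped, is known at the left end.\<close>
      note xj = expectation_mult_ito_increment[OF J \<zeta>(1) uv XF X2]
      have j2: "integrable M (\<lambda>\<omega>. ?I \<omega> * (?j \<omega>)\<^sup>2)"
        using integrable_mult_indicator[OF BM ito_increment_square_integrable[OF J \<zeta>(1) uv]] by simp
      have z: "integrable M (\<lambda>\<omega>. ?I \<omega> * ?z \<omega>)"
        using integrable_mult_indicator[OF BM path_square_integral(2)[OF \<zeta> uv]] by simp
      have zj: "(\<integral>\<omega>. ?I \<omega> * ?z \<omega> \<partial>M) \<le> 4 * (\<integral>\<omega>. ?I \<omega> * (?j \<omega>)\<^sup>2 \<partial>M)"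
        by (rule ito_increment_energy_real[OF J \<zeta> uv BF[OF kn]])
      let ?lhs = "\<lambda>\<omega>. ?I \<omega> * (D ?u \<omega>)\<^sup>2 + 2 * (?I \<omega> * D ?u \<omega> * ?j \<omega>) + 3/4 * (?I \<omega> * (?j \<omega>)\<^sup>2) - 1/8 * (?I \<omega> * ?z \<omega>)"
      let ?rhs = "\<lambda>\<omega>. indicator (B (Suc k)) \<omega> * (D ?v \<omega>)\<^sup>2 + (?I \<omega> * osc n \<omega> - indicator (B (Suc k)) \<omega> * osc n \<omega>)
          + K * \<Delta> * (?I \<omega> * (D ?u \<omega>)\<^sup>2 + osc n \<omega>)"
      have "AE \<omega> in M. ?lhs \<omega> \<le> ?rhs \<omega>"
        using osc(4)[of n] cont eq fin finite_energy_path[OF \<zeta>] finite_energy_path_norm[OF \<zeta>]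
      proof eventually_elim
        case (elim \<omega>)
        show ?case
        proof (cases "\<omega> \<in> B k")
          case False
          then have "\<omega> \<notin> B (Suc k)" using Bdec by auto
          then show ?thesis using False K \<Delta> osc(2)[of n \<omega>] by simp
        next
          case True
          then have \<omega>: "\<omega> \<in> A" using BA by auto
          have x: "0 < D ?u \<omega>" using True kn by (auto simp: B_def)
          have o: "(D s \<omega> - D ?u \<omega>)\<^sup>2 \<le> osc n \<omega>" if "s \<in> {?u..?v}" for s
            using elim(1) \<omega> kn that unfolding t_def by auto
          define \<delta> where "\<delta> = sqrt (osc n \<omega>)"
          have \<delta>: "0 \<le> \<delta>" "\<delta>\<^sup>2 = osc n \<omega>" using osc(2)[of n \<omega>] by (auto simp: \<delta>_def)
          \<comment> \<open>Freezing \<open>D\<close> at the left end costs at most \<delta>, the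
            square root of the oscillation; positivity there makes \<open>D ?u \<omega>\<close> its
            own absolute value.\<close>
          have Ds: "\<bar>D s \<omega>\<bar> \<le> D ?u \<omega> + \<delta>" if "s \<in> {?u..?v}" for s
          proof -
            have "\<bar>D s \<omega> - D ?u \<omega>\<bar> \<le> \<delta>" unfolding \<delta>_def using o[OF that] by (simp add: real_le_rsqrt)
            then show ?thesis using x by linarith
          qed
          define h where "h = (LINT s:{?u..?v}|lborel. norm (\<zeta> s \<omega>))"
          have sub: "{?u..?v} \<subseteq> {0..T}" "{?u..?v} \<subseteq> {e..r}" using uv t(5)[of k] t2[OF kn] by auto
          have i1: "set_integrable lborel {?u..?v} (\<lambda>s. norm (\<zeta> s \<omega>))"
            using elim(6) by (rule set_integrable_subset) (use sub in auto)
          have i2: "set_integrable lborel {?u..?v} (\<lambda>s. (norm (\<zeta> s \<omega>))\<^sup>2)"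
            using elim(5) by (rule set_integrable_subset) (use sub in auto)
          have c: "continuous_on {?u..?v} (\<lambda>s. D s \<omega>)"
            using elim(2) \<omega> sub by (auto intro: continuous_on_subset)
          then have i3: "set_integrable lborel {?u..?v} (\<lambda>s. \<bar>D s \<omega>\<bar>)"
            by (intro borel_integrable_atLeastAtMost' continuous_intros)
          have h0: "0 \<le> h" unfolding h_def set_lebesgue_integral_def
            by (intro Bochner_Integration.integral_nonneg) auto
          have h2: "h\<^sup>2 \<le> \<Delta> * ?z \<omega>"
            using set_integral_cauchy_schwarz[OF i1 i2 t(3)[of k]] t(4)[of k] by (simp add: h_def)
          have "\<bar>D ?v \<omega> - D ?u \<omega> - ?j \<omega>\<bar> \<le> L * (LINT s:{?u..?v}|lborel. \<bar>D s \<omega>\<bar> + norm (\<zeta> s \<omega>))"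
            using elim(3) \<omega> uv t(5)[of k] t2[OF kn] by auto
          also have "(LINT s:{?u..?v}|lborel. \<bar>D s \<omega>\<bar> + norm (\<zeta> s \<omega>)) = (LINT s:{?u..?v}|lborel. \<bar>D s \<omega>\<bar>) + h"
            unfolding h_def by (rule set_integral_add(2)[OF i3 i1])
          also have "(LINT s:{?u..?v}|lborel. \<bar>D s \<omega>\<bar>) \<le> (LINT s:{?u..?v}|lborel. D ?u \<omega> + \<delta>)"
            by (intro set_integral_mono i3 borel_integrable_atLeastAtMost') (use Ds in auto)
          also have "(LINT s:{?u..?v}|lborel. D ?u \<omega> + \<delta>) = \<Delta> * (D ?u \<omega> + \<delta>)"
            using t(3)[of k] t(4)[of k] by (simp add: set_lebesgue_integral_def)
          finally have y: "\<bar>D ?v \<omega> - D ?u \<omega> - ?j \<omega>\<bar> \<le> L * (\<Delta> * (D ?u \<omega> + \<delta>) + h)"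
            using L by (simp add: mult_left_mono)
          have "(D ?u \<omega>)\<^sup>2 + 2 * (D ?u \<omega> * ?j \<omega>) + 3/4 * (?j \<omega>)\<^sup>2 - ?z \<omega> / 8
             \<le> (D ?v \<omega>)\<^sup>2 + K * \<Delta> * ((D ?u \<omega>)\<^sup>2 + osc n \<omega>)"
            using square_step[OF y h0 h2 _ \<delta>(1) \<Delta> _ L] x n2 unfolding K_def \<Delta>_def \<delta>(2) by simp
          moreover have "(D ?v \<omega>)\<^sup>2 \<le> indicator (B (Suc k)) \<omega> * (D ?v \<omega>)\<^sup>2 + (osc n \<omega> - indicator (B (Suc k)) \<omega> * osc n \<omega>)"
          proof (cases "\<omega> \<in> B (Suc k)")
            case False
            \<comment> \<open>Leaving \<open>B\<close> forces \<open>D\<close> to be nonpositive at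
              the next point: by the definition of \<open>B\<close> if that point lies before r, by
              the terminal condition if it is r.\<close>
            have y0: "D ?v \<omega> \<le> 0"
            proof (cases "k = n")
              case True
              then show ?thesis using elim(4) \<omega> t(2) by simp
            next
              case False
              then have "Suc k \<le> n" using kn by simp
              then show ?thesis using \<open>\<omega> \<notin> B (Suc k)\<close> True kn by (auto simp: B_def le_Suc_eq not_less)
            qed
            \<comment> \<open>Because \<open>D\<close> was positive at the left end, its size after
              crossing zero is at most the oscillation over the step.\<close>
            then have "\<bar>D ?v \<omega>\<bar> \<le> \<bar>D ?v \<omega> - D ?u \<omega>\<bar>" using x by linarith
            then have "(D ?v \<omega>)\<^sup>2 \<le> (D ?v \<omega> - D ?u \<omega>)\<^sup>2" by (simp add: abs_le_square_iff)
            also have "\<dots> \<le> osc n \<omega>" using o[of ?v] uv by simp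
            finally show ?thesis using False by simp
          qed simp
          ultimately show ?thesis using True by simp
        qed
      qed
      then have "(\<integral>\<omega>. ?lhs \<omega> \<partial>M) \<le> (\<integral>\<omega>. ?rhs \<omega> \<partial>M)"
        by (intro integral_mono_AE) (use m_int[of k] m_int[of "Suc k"] kn xj j2 z osci osc(1) in auto)
      also have "(\<integral>\<omega>. ?lhs \<omega> \<partial>M) = m k + 3/4 * (\<integral>\<omega>. ?I \<omega> * (?j \<omega>)\<^sup>2 \<partial>M) - 1/8 * (\<integral>\<omega>. ?I \<omega> * ?z \<omega> \<partial>M)"
        using m_int[of k] kn xj j2 z by (simp add: m_def)
      also have "(\<integral>\<omega>. ?rhs \<omega> \<partial>M) = m (Suc k) + (b k - b (Suc k)) + K * \<Delta> * (m k + (\<integral>\<omega>. osc n \<omega> \<partial>M))"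
        using m_int[of k] m_int[of "Suc k"] kn osci osc(1) by (simp add: m_def b_def)
      finally have 1: "m k + 3/4 * (\<integral>\<omega>. ?I \<omega> * (?j \<omega>)\<^sup>2 \<partial>M) - 1/8 * (\<integral>\<omega>. ?I \<omega> * ?z \<omega> \<partial>M)
         \<le> m (Suc k) + (b k - b (Suc k)) + K * \<Delta> * (m k + (\<integral>\<omega>. osc n \<omega> \<partial>M))" .
      have "0 \<le> (\<integral>\<omega>. ?I \<omega> * (?j \<omega>)\<^sup>2 \<partial>M)" by (intro Bochner_Integration.integral_nonneg) auto
      then have "m k \<le> m (Suc k) + (b k - b (Suc k)) + K * \<Delta> * (m k + (\<integral>\<omega>. osc n \<omega> \<partial>M))"
        using 1 zj by linarith
      then show ?thesis by (simp add: algebra_simps)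
    qed
    have b_dec: "b (Suc k) \<le> b k" for k unfolding b_def
    proof (intro integral_mono osci)
      fix \<omega>
      have "indicator (B (Suc k)) \<omega> \<le> (indicator (B k) \<omega> :: real)" using Bdec[of k] by (auto simp: indicator_def)
      then show "indicator (B (Suc k)) \<omega> * osc n \<omega> \<le> indicator (B k) \<omega> * osc n \<omega>"
        using osc(2) by (rule mult_right_mono)
    qed
    have o0: "0 \<le> (\<integral>\<omega>. osc n \<omega> \<partial>M)" by (intro Bochner_Integration.integral_nonneg) (rule osc(2))
    have b0: "b 0 \<le> (\<integral>\<omega>. osc n \<omega> \<partial>M)" unfolding b_def
      by (intro integral_mono osci osc(1)) (use osc(2) in \<open>auto simp: indicator_def\<close>)
    have "m 0 \<le> exp (2 * (K * \<Delta>) * real (Suc n)) * (b 0 + real (Suc n) * (K * \<Delta> * (\<integral>\<omega>. osc n \<omega> \<partial>M)))"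
    proof (rule backward_gronwall[where m=m and b=b, OF step b_dec])
      show "m (Suc n) = 0" "b (Suc n) = 0" by (auto simp: m_def b_def B_def)
      show "0 \<le> K * \<Delta>" using K \<Delta> by simp
      show "K * \<Delta> \<le> 1 / 2" using n1 by (simp add: \<Delta>_def)
      show "0 \<le> K * \<Delta> * (\<integral>\<omega>. osc n \<omega> \<partial>M)" using K \<Delta> o0 by simp
    qed
    also have "2 * (K * \<Delta>) * real (Suc n) = 2 * K * (r - e)" by (simp add: \<Delta>_def)
    also have "real (Suc n) * (K * \<Delta> * (\<integral>\<omega>. osc n \<omega> \<partial>M)) = K * (r - e) * (\<integral>\<omega>. osc n \<omega> \<partial>M)"
      by (simp add: \<Delta>_def)
    also have "exp (2 * K * (r - e)) * (b 0 + K * (r - e) * (\<integral>\<omega>. osc n \<omega> \<partial>M))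
      \<le> exp (2 * K * (r - e)) * ((\<integral>\<omega>. osc n \<omega> \<partial>M) + K * (r - e) * (\<integral>\<omega>. osc n \<omega> \<partial>M))"
      using b0 by simp
    also have "\<dots> = exp (2 * K * (r - e)) * (1 + K * (r - e)) * (\<integral>\<omega>. osc n \<omega> \<partial>M)" by (simp add: algebra_simps)
    finally have "m 0 \<le> \<dots>" .
    moreover have "m 0 = m0" unfolding m_def m0_def using t(1) by (simp add: B_def A0_def)
    ultimately show ?thesis by simp
  qed
  have small: "eventually (\<lambda>n. c * ((r - e) / real (Suc n)) \<le> a) sequentially" if "0 < a" for a c :: real
  proof -
    have "(\<lambda>n. c * ((r - e) / real (Suc n))) \<longlonglongrightarrow> c * 0"
      using LIMSEQ_Suc[OF lim_const_over_n[of "r - e"]] by (intro tendsto_mult tendsto_const) simp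
    then have "eventually (\<lambda>n. c * ((r - e) / real (Suc n)) < a) sequentially"
      by (rule order_tendstoD) (use that in simp)
    then show ?thesis by (rule eventually_mono) simp
  qed
  have "eventually (\<lambda>n. m0 \<le> exp (2 * K * (r - e)) * (1 + K * (r - e)) * (\<integral>\<omega>. osc n \<omega> \<partial>M)) sequentially"
    using small[of "1/2" K] small[of 1 "192 * L\<^sup>2"] by (rule eventually_elim2) (use main in auto)
  moreover have "(\<lambda>n. exp (2 * K * (r - e)) * (1 + K * (r - e)) * (\<integral>\<omega>. osc n \<omega> \<partial>M)) \<longlonglongrightarrow>
      exp (2 * K * (r - e)) * (1 + K * (r - e)) * 0"
    by (intro tendsto_mult tendsto_const osc(3))
  ultimately have "m0 \<le> exp (2 * K * (r - e)) * (1 + K * (r - e)) * 0"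
    by (intro tendsto_lowerbound[rotated]) auto
  then have "m0 \<le> 0" by simp
  moreover have "0 \<le> m0" unfolding m0_def by (intro Bochner_Integration.integral_nonneg) auto
  ultimately have "m0 = 0" by simp
  then have "AE \<omega> in M. indicator A0 \<omega> * (D e \<omega>)\<^sup>2 = 0"
    unfolding m0_def
    by (subst (asm) integral_nonneg_eq_0_iff_AE) (use sqint[OF A0, of e] er in \<open>auto simp: A0_def\<close>)
  then show ?thesis by eventually_elim (auto simp: A0_def indicator_def split: if_splits)
qed

end

section \<open>Comparison for the switched equations\<close>

text \<open>The common end point carries no mass; additivity over adjacent closed intervals is read
  off from the Henstock-Kurzweil integral.\<close>

lemma set_lebesgue_integral_split:
  fixes f :: "real \<Rightarrow> real"
  assumes f: "set_integrable lborel {a..c} f" and abc: "a \<le> b" "b \<le> c"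
  shows "(LINT s:{a..c}|lborel. f s) = (LINT s:{a..b}|lborel. f s) + (LINT s:{b..c}|lborel. f s)"
proof -
  have 1: "set_integrable lborel {a..b} f" "set_integrable lborel {b..c} f"
    using f abc by (auto intro: set_integrable_subset)
  show ?thesis
    using set_borel_integral_eq_integral[OF f] set_borel_integral_eq_integral[OF 1(1)]
      set_borel_integral_eq_integral[OF 1(2)] Henstock_Kurzweil_Integration.integral_combine[OF abc, of f] by simp
qed

lemma continuous_on_set_lebesgue_integral:
  fixes f :: "real \<Rightarrow> real"
  assumes f: "set_integrable lborel {a..b} f"
  shows "continuous_on {a..b} (\<lambda>x. LINT s:{x..b}|lborel. f s)"
proof -
  have "continuous_on {a..b} (\<lambda>x. integral {x..b} f)"
    by (rule indefinite_integral_continuous_1'[OF set_borel_integral_eq_integral(1)[OF f]])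
  moreover have "(LINT s:{x..b}|lborel. f s) = integral {x..b} f" if "x \<in> {a..b}" for x
    by (rule set_borel_integral_eq_integral(2)[OF set_integrable_subset[OF f]]) (use that in auto)
  ultimately show ?thesis
    by (subst continuous_on_cong[where g="\<lambda>x. integral {x..b} f", OF refl]) auto
qed

text \<open>Degenerate intervals occur when a path formula is evaluated at the right end of its
  cell. Off the single point the integrand is zero, whatever f is.\<close>

lemma set_integral_singleton [simp]: "(LINT s:{a}|lborel. f s) = (0::real)" for a :: real
proof -
  have "(LINT s:{a}|lborel. f s) = (\<integral>s. 0 \<partial>(lborel :: real measure))"
    unfolding set_lebesgue_integral_def
  proof (rule Bochner_Integration.integral_cong_AE)
    show "AE s in lborel. indicator {a} s *\<^sub>R f s = 0"
      using AE_lborel_singleton[of a] by eventually_elim (auto simp: indicator_def)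
    have "(\<lambda>s. indicator {a} s *\<^sub>R f s) = (\<lambda>s. indicator {a} s *\<^sub>R f a)" by (auto simp: indicator_def)
    then show "(\<lambda>s. indicator {a} s *\<^sub>R f s) \<in> borel_measurable lborel" by simp
  qed simp
  then show ?thesis by simp
qed

lemma norm_axis_eq: "norm (axis k v :: ('a::real_inner) ^ 'n) = norm v"
proof -
  have "(norm (axis k v :: 'a ^ 'n))\<^sup>2 = (norm v)\<^sup>2"
    by (simp only: power2_norm_eq_inner inner_axis') (simp add: axis_def)
  then show ?thesis by (simp add: power2_eq_iff_nonneg)
qed

lemma axis_diff: "axis k x - axis k y = (axis k (x - y) :: ('a::ab_group_add) ^ 'n)"
  by (auto simp: axis_def vec_eq_iff)

lemma borel_measurable_axis:
  "(axis k :: 'a::euclidean_space \<Rightarrow> 'a ^ 'n) \<in> borel_measurable borel"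
proof (rule borel_measurable_continuous_onI)
  show "continuous_on UNIV (axis k :: 'a \<Rightarrow> 'a ^ 'n)"
    unfolding axis_def
  proof (intro continuous_on_vec_lambda)
    show "continuous_on UNIV (\<lambda>x. if i = k then x else (0::'a))" for i
      by (cases "i = k") (auto intro: continuous_intros)
  qed
qed

context wiener_space
begin

lemma S2_progressive: "S2 M \<F> T X \<Longrightarrow> progressive M \<F> T X"
  unfolding S2_def sup_L2_def by simp

lemma H2_iff: "H2 M \<F> T Z \<longleftrightarrow> progressive M \<F> T Z \<and> energy Z < \<infinity>"
  unfolding H2_def energy_def ..

text \<open>The supremum in \<open>S2\<close> need not be measurable as such; for a right-continuous process it
  is attained along the rational times.\<close>

lemma S2_dominated:
  assumes X: "S2 M \<F> T X"
  obtains w where "integrable M w" "AE \<omega> in M. \<forall>t\<in>{0..T}. (X t \<omega>)\<^sup>2 \<le> w \<omega>"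
proof -
  \<comment> \<open>T is added by hand: right-continuity reaches every earlier time through later
    rationals, but not the right end.\<close>
  define Q where "Q = insert T (\<rat> \<inter> {0..T})"
  have Q: "countable Q" "Q \<subseteq> {0..T}" using countable_rat T_pos unfolding Q_def
    by (auto intro: countable_subset[of _ \<rat>])
  define S where "S = (\<lambda>\<omega>. SUP q\<in>Q. ennreal ((X q \<omega>)\<^sup>2))"
  have S [measurable]: "S \<in> borel_measurable M" unfolding S_def
  proof (intro borel_measurable_SUP Q(1))
    fix q assume "q \<in> Q"
    then have [measurable]: "X q \<in> borel_measurable M"
      using progressive_at_events[OF S2_progressive[OF X]] Q(2) by auto
    show "(\<lambda>\<omega>. ennreal ((X q \<omega>)\<^sup>2)) \<in> borel_measurable M" by measurable
  qed
  have "(\<integral>\<^sup>+\<omega>. S \<omega> \<partial>M) \<le> (\<integral>\<^sup>+\<omega>. (SUP t\<in>{0..T}. ennreal (\<bar>X t \<omega>\<bar>\<^sup>2)) \<partial>M)"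
    unfolding S_def using Q(2) by (intro nn_integral_mono) (auto intro!: SUP_subset_mono)
  also have "\<dots> < \<infinity>" using X unfolding S2_def sup_L2_def by simp
  finally have fin: "(\<integral>\<^sup>+\<omega>. S \<omega> \<partial>M) < \<infinity>" .
  then have AEfin: "AE \<omega> in M. S \<omega> \<noteq> \<infinity>" by (intro nn_integral_PInf_AE) auto
  show ?thesis
  proof (rule that[of "\<lambda>\<omega>. enn2real (S \<omega>)"])
    have "(\<integral>\<^sup>+\<omega>. ennreal (enn2real (S \<omega>)) \<partial>M) = (\<integral>\<^sup>+\<omega>. S \<omega> \<partial>M)"
      by (intro nn_integral_cong_AE) (use AEfin in eventually_elim; simp add: less_top)
    then show "integrable M (\<lambda>\<omega>. enn2real (S \<omega>))" using fin by (intro integrableI_nonneg) auto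
    have "AE \<omega> in M. cadlag T (\<lambda>t. X t \<omega>)" using X unfolding S2_def by simp
    with AEfin show "AE \<omega> in M. \<forall>t\<in>{0..T}. (X t \<omega>)\<^sup>2 \<le> enn2real (S \<omega>)"
    proof eventually_elim
      case (elim \<omega>)
      have q: "(X q \<omega>)\<^sup>2 \<le> enn2real (S \<omega>)" if "q \<in> Q" for q
      proof -
        have "ennreal ((X q \<omega>)\<^sup>2) \<le> S \<omega>" unfolding S_def by (rule SUP_upper[OF that])
        then have "enn2real (ennreal ((X q \<omega>)\<^sup>2)) \<le> enn2real (S \<omega>)"
          using elim(1) by (intro enn2real_mono) (auto simp: less_top)
        then show ?thesis by simp
      qed
      show ?case
      proof (rule ballI, rule ccontr)
        fix t assume t: "t \<in> {0..T}" and n: "\<not> (X t \<omega>)\<^sup>2 \<le> enn2real (S \<omega>)"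
        have "t \<noteq> T" using n q[of T] by (auto simp: Q_def)
        then have tT: "t < T" using t by simp
        have "((\<lambda>t. X t \<omega>) \<longlongrightarrow> X t \<omega>) (at_right t)" using elim(2) t tT unfolding cadlag_def by auto
        then have "((\<lambda>t. (X t \<omega>)\<^sup>2) \<longlongrightarrow> (X t \<omega>)\<^sup>2) (at_right t)" by (rule tendsto_power)
        then have "eventually (\<lambda>u. enn2real (S \<omega>) < (X u \<omega>)\<^sup>2) (at_right t)"
          by (rule order_tendstoD) (use n in simp)
        then obtain b where b: "t < b" "\<And>u. t < u \<Longrightarrow> u < b \<Longrightarrow> enn2real (S \<omega>) < (X u \<omega>)\<^sup>2"
          unfolding eventually_at_right_field by blast
        obtain u where "u \<in> \<rat>" "t < u" "u < min b T" using Rats_dense_in_real[of t "min b T"] b(1) tT by auto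
        then show False using b(2)[of u] q[of u] t by (auto simp: Q_def)
      qed
    qed
  qed
qed

end

section \<open>The switching problem and its scalar drivers\<close>

locale switching_bsde = wiener_space M W T \<F>
  for M :: "'w measure" and W :: "real \<Rightarrow> 'w \<Rightarrow> real ^ ('q::finite)" and T :: real and \<F> :: "real \<Rightarrow> 'w measure" +
  fixes L :: real and C_L :: "real \<Rightarrow> real"
    and C :: "real \<Rightarrow> 'w \<Rightarrow> real ^ ('d::{finite,linorder}) ^ ('d::{finite,linorder})"
    and F :: "'w \<Rightarrow> real \<Rightarrow> real ^ ('d::{finite,linorder}) \<Rightarrow> real ^ 'q ^ ('d::{finite,linorder}) \<Rightarrow> real ^ ('d::{finite,linorder})"
    and \<xi> :: "'w \<Rightarrow> real ^ ('d::{finite,linorder})"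
    and \<beta> :: "'w \<Rightarrow> real"
    and \<kappa> :: nat and r :: "nat \<Rightarrow> real" and R :: "real set"
    and Yt Y :: "real \<Rightarrow> 'w \<Rightarrow> real ^ ('d::{finite,linorder})" and Z :: "real \<Rightarrow> 'w \<Rightarrow> real ^ 'q ^ ('d::{finite,linorder})"
  assumes L_pos: "0 < L"
    and cost: "cost_process M \<F> T L C"
    and driver: "driver M \<F> T L F"
    and terminal: "terminal_value M \<F> T C \<xi>"
    and cond2: "cond_C 2 M T L C_L \<beta> C F \<xi>"
    and grid_r: "reflection_grid T L \<kappa> r" and R_def: "R = r ` {..\<kappa>}"
    and bsde: "reflected_bsde M \<F> T W \<kappa> r C F \<xi> Yt Y Z"
begin

text \<open>The driver component of mode k as a function of a scalar and a row. It puts the switched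
  equation and the components of the reflected one into the same scalar form.\<close>

definition drv :: "('d::{finite,linorder}) \<Rightarrow> (real \<Rightarrow> 'w \<Rightarrow> real) \<Rightarrow> (real \<Rightarrow> 'w \<Rightarrow> real ^ 'q) \<Rightarrow> real \<Rightarrow> 'w \<Rightarrow> real" where
  "drv k U V s \<omega> = F \<omega> s (axis k (U s \<omega>)) (axis k (V s \<omega>)) $ k"

text \<open>\<open>axis k\<close> embeds isometrically, so the constant L is kept. Modes and
  processes are quantified inside a single null set because the mode will be random.\<close>

lemma drv_lipschitz:
  "AE \<omega> in M. \<forall>s\<in>{0..T}. \<forall>k U V U' V'.
     \<bar>drv k U V s \<omega> - drv k U' V' s \<omega>\<bar> \<le> L * (\<bar>U s \<omega> - U' s \<omega>\<bar> + norm (V s \<omega> - V' s \<omega>))"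
proof -
  have "AE \<omega> in M. \<forall>t\<in>{0..T}. \<forall>y y' z z'.
        norm (F \<omega> t y z - F \<omega> t y' z') \<le> L * (norm (y - y') + norm (z - z'))"
    using driver unfolding driver_def by auto
  then show ?thesis
  proof eventually_elim
    case (elim \<omega>)
    show ?case
    proof (intro ballI allI)
      fix s k U V U' V' assume "s \<in> {0..T}"
      then have "norm (F \<omega> s (axis k (U s \<omega>)) (axis k (V s \<omega>)) - F \<omega> s (axis k (U' s \<omega>)) (axis k (V' s \<omega>)))
        \<le> L * (norm (axis k (U s \<omega>) - axis k (U' s \<omega>)) + norm (axis k (V s \<omega>) - axis k (V' s \<omega>)))"
        using elim by blast
      also have "\<dots> = L * (\<bar>U s \<omega> - U' s \<omega>\<bar> + norm (V s \<omega> - V' s \<omega>))"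
        by (simp add: axis_diff norm_axis_eq)
      finally have "norm (F \<omega> s (axis k (U s \<omega>)) (axis k (V s \<omega>)) - F \<omega> s (axis k (U' s \<omega>)) (axis k (V' s \<omega>))) \<le> \<dots>" .
      then show "\<bar>drv k U V s \<omega> - drv k U' V' s \<omega>\<bar> \<le> L * (\<bar>U s \<omega> - U' s \<omega>\<bar> + norm (V s \<omega> - V' s \<omega>))"
        unfolding drv_def vector_minus_component[symmetric]
        by (rule order_trans[OF component_le_norm_cart])
    qed
  qed
qed

text \<open>The i-th driver component sees only the i-th entry and row, so the full vectors may be
  replaced by their embeddings along one axis.\<close>

lemma drv_component:
  "AE \<omega> in M. \<forall>s\<in>{0..T}. \<forall>k. F \<omega> s (Yt s \<omega>) (Z s \<omega>) $ k = drv k (\<lambda>s \<omega>. Yt s \<omega> $ k) (\<lambda>s \<omega>. Z s \<omega> $ k) s \<omega>"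
proof -
  have "AE \<omega> in M. \<forall>t\<in>{0..T}. \<forall>i y y' z z'. y $ i = y' $ i \<and> z $ i = z' $ i \<longrightarrow>
        F \<omega> t y z $ i = F \<omega> t y' z' $ i"
    using driver unfolding driver_def by auto
  then show ?thesis
  proof eventually_elim
    case (elim \<omega>)
    show ?case
    proof (intro ballI allI)
      fix s k assume "s \<in> {0..T}"
      then show "F \<omega> s (Yt s \<omega>) (Z s \<omega>) $ k = drv k (\<lambda>s \<omega>. Yt s \<omega> $ k) (\<lambda>s \<omega>. Z s \<omega> $ k) s \<omega>"
        unfolding drv_def by (intro elim[rule_format]) (auto simp: axis_def)
    qed
  qed
qed

lemma F_measurable:
  fixes y :: "real \<times> 'w \<Rightarrow> real ^ ('d::{finite,linorder})" and z :: "real \<times> 'w \<Rightarrow> real ^ 'q ^ ('d::{finite,linorder})"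
  assumes [measurable]: "y \<in> borel_measurable \<P>" "z \<in> borel_measurable \<P>"
  shows "(\<lambda>x. F (snd x) (fst x) (y x) (z x)) \<in> borel_measurable \<P>"
proof -
  have "(\<lambda>((s, \<omega>), y, z). F \<omega> s y z) \<in> borel_measurable (\<P> \<Otimes>\<^sub>M (borel \<Otimes>\<^sub>M borel))"
    using driver unfolding driver_def by auto
  moreover have "(\<lambda>x. (x, y x, z x)) \<in> measurable \<P> (\<P> \<Otimes>\<^sub>M (borel \<Otimes>\<^sub>M borel))" by measurable
  ultimately have "(\<lambda>x. (\<lambda>((s, \<omega>), y, z). F \<omega> s y z) (x, y x, z x)) \<in> borel_measurable \<P>"
    by (rule measurable_compose[rotated])
  then show ?thesis by (simp add: case_prod_beta')
qed

lemma drv_progressive: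
  assumes U: "progressive M \<F> T U" and V: "progressive M \<F> T V"
  shows "progressive M \<F> T (drv k U V)"
proof -
  have "(\<lambda>x. axis k (U (fst x) (snd x)) :: real ^ ('d::{finite,linorder})) \<in> borel_measurable \<P>"
    using U unfolding progressive_def case_prod_beta' by (rule measurable_compose[OF _ borel_measurable_axis])
  moreover have "(\<lambda>x. axis k (V (fst x) (snd x)) :: real ^ 'q ^ ('d::{finite,linorder})) \<in> borel_measurable \<P>"
    using V unfolding progressive_def case_prod_beta' by (rule measurable_compose[OF _ borel_measurable_axis])
  ultimately have "(\<lambda>x. F (snd x) (fst x) (axis k (U (fst x) (snd x))) (axis k (V (fst x) (snd x)))) \<in> borel_measurable \<P>"
    by (rule F_measurable)
  from measurable_compose[OF this borel_measurable_nth[of k]]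
  show ?thesis unfolding progressive_def drv_def case_prod_beta' .
qed

text \<open>Condition (C_2) bounds the time integral of the squared driver at zero by the integrable
  variable \<beta>.\<close>

lemma F0_integrable: "AE \<omega> in M. set_integrable lborel {0..T} (\<lambda>s. norm (F \<omega> s 0 0))"
proof -
  have "progressive M \<F> T (\<lambda>s \<omega>. F \<omega> s 0 0)"
    using F_measurable[of "\<lambda>_. 0" "\<lambda>_. 0"] unfolding progressive_def case_prod_beta' by simp
  moreover have "energy (\<lambda>s \<omega>. F \<omega> s 0 0) < \<infinity>"
  proof -
    have c: "AE \<omega> in M. 0 < \<beta> \<omega>" "integrable M \<beta>"
      "AE \<omega> in M. ennreal (norm (\<xi> \<omega>) powr 2) + (SUP t\<in>{0..T}. ennreal (norm (C t \<omega>) powr 2))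
          + (\<integral>\<^sup>+ s\<in>{0..T}. ennreal (norm (F \<omega> s 0 0) powr 2) \<partial>lborel) \<le> ennreal (\<beta> \<omega>)"
      using cond2 unfolding cond_C_def by auto
    have "energy (\<lambda>s \<omega>. F \<omega> s 0 0) \<le> (\<integral>\<^sup>+ \<omega>. ennreal (\<beta> \<omega>) \<partial>M)"
      unfolding energy_def
    proof (rule nn_integral_mono_AE)
      show "AE \<omega> in M. (\<integral>\<^sup>+ s\<in>{0..T}. ennreal ((norm (F \<omega> s 0 0))\<^sup>2) \<partial>lborel) \<le> ennreal (\<beta> \<omega>)"
        using c(3)
      proof eventually_elim
        case (elim \<omega>)
        have "(\<integral>\<^sup>+ s\<in>{0..T}. ennreal ((norm (F \<omega> s 0 0))\<^sup>2) \<partial>lborel)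
          = (\<integral>\<^sup>+ s\<in>{0..T}. ennreal (norm (F \<omega> s 0 0) powr 2) \<partial>lborel)" by simp
        also have "\<dots> \<le> ennreal (norm (\<xi> \<omega>) powr 2) + (SUP t\<in>{0..T}. ennreal (norm (C t \<omega>) powr 2))
          + (\<integral>\<^sup>+ s\<in>{0..T}. ennreal (norm (F \<omega> s 0 0) powr 2) \<partial>lborel)" by simp
        finally show ?case using elim by (rule order_trans)
      qed
    qed
    also have "\<dots> = ennreal (\<integral>\<omega>. \<beta> \<omega> \<partial>M)"
      using c by (intro nn_integral_eq_integral) auto
    finally show ?thesis by (simp add: le_less_trans)
  qed
  ultimately show ?thesis by (rule finite_energy_path_norm)
qed

text \<open>Linear growth: the driver is at most |F(s,0,0)| + L (|U| + |V|). Along a path, U is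
  bounded by the dominating variable of \<open>S2_dominated\<close>, and V is integrable by finite
  energy.\<close>

lemma drv_integrable:
  assumes U: "S2 M \<F> T U" and V: "H2 M \<F> T V"
  shows "AE \<omega> in M. \<forall>k. set_integrable lborel {0..T} (\<lambda>s. drv k U V s \<omega>)"
proof -
  obtain w where w: "integrable M w" "AE \<omega> in M. \<forall>t\<in>{0..T}. (U t \<omega>)\<^sup>2 \<le> w \<omega>"
    using S2_dominated[OF U] .
  have V': "progressive M \<F> T V" "energy V < \<infinity>" using V by (auto simp: H2_iff)
  have "AE \<omega> in M. \<omega> \<in> space M" by simp
  with w(2) finite_energy_path_norm[OF V'] F0_integrable drv_lipschitz show ?thesis
  proof eventually_elim
    case (elim \<omega>)
    define c where "c = sqrt (w \<omega>)"
    have c: "\<bar>U s \<omega>\<bar> \<le> c" if "s \<in> {0..T}" for s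
      using elim(1) that unfolding c_def by (simp add: real_le_rsqrt)
    have i: "set_integrable lborel {0..T} (\<lambda>s. norm (F \<omega> s 0 0) + L * (c + norm (V s \<omega>)))"
      by (intro set_integral_add(1)[OF elim(3)] set_integrable_mult_right set_integral_add(1)[OF _ elim(2)]
          borel_integrable_atLeastAtMost') auto
    show ?case
    proof
      fix k
      show "set_integrable lborel {0..T} (\<lambda>s. drv k U V s \<omega>)"
      proof (rule set_integrable_bound[OF i])
        show "set_borel_measurable lborel {0..T} (\<lambda>s. drv k U V s \<omega>)"
          using path_measurable[OF drv_progressive[OF S2_progressive[OF U] V'(1)] elim(5), of k]
          unfolding set_borel_measurable_def .
        show "AE s in lborel. s \<in> {0..T} \<longrightarrow> norm (drv k U V s \<omega>) \<le> norm (norm (F \<omega> s 0 0) + L * (c + norm (V s \<omega>)))"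
        proof (rule AE_I2, rule impI)
          fix s assume s: "s \<in> {0..T}"
          have z: "drv k (\<lambda>_ _. 0) (\<lambda>_ _. 0) s \<omega> = F \<omega> s 0 0 $ k"
          proof -
            have "axis k 0 = (0 :: real ^ ('d::{finite,linorder}))" "axis k 0 = (0 :: real ^ 'q ^ ('d::{finite,linorder}))"
              by (simp_all add: axis_def vec_eq_iff)
            then show ?thesis by (simp only: drv_def)
          qed
          have "\<bar>drv k U V s \<omega>\<bar> \<le> \<bar>F \<omega> s 0 0 $ k\<bar> + \<bar>drv k U V s \<omega> - drv k (\<lambda>_ _. 0) (\<lambda>_ _. 0) s \<omega>\<bar>"
            unfolding z by linarith
          also have "\<dots> \<le> norm (F \<omega> s 0 0) + L * (\<bar>U s \<omega> - 0\<bar> + norm (V s \<omega> - 0))"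
            using elim(4) s by (intro add_mono component_le_norm_cart) blast
          also have "\<dots> \<le> norm (F \<omega> s 0 0) + L * (c + norm (V s \<omega>))"
            using c[OF s] L_pos by simp
          finally show "norm (drv k U V s \<omega>) \<le> norm (norm (F \<omega> s 0 0) + L * (c + norm (V s \<omega>)))" by simp
        qed
      qed
    qed
  qed
qed

text \<open>The end values \<open>x1\<close> and \<open>x2\<close> are the left limits at \<open>v\<close>.\<close>

lemma cell_comparison:
  assumes S1: "S2 M \<F> T U1" "H2 M \<F> T V1" "ito V1 I1" and S2: "S2 M \<F> T U2" "H2 M \<F> T V2" "ito V2 I2"
    and ev: "0 \<le> e" "e < v" "v \<le> T" and A: "A \<in> sets (\<F> e)"
    and E1: "AE \<omega> in M. \<omega> \<in> A \<longrightarrow> (\<forall>u\<in>{e..<v}.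
      U1 u \<omega> = x1 \<omega> + (LINT s:{u..v}|lborel. drv k U1 V1 s \<omega>) - (I1 v \<omega> - I1 u \<omega>))"
    and E2: "AE \<omega> in M. \<omega> \<in> A \<longrightarrow> (\<forall>u\<in>{e..<v}.
      U2 u \<omega> = x2 \<omega> + (LINT s:{u..v}|lborel. drv k U2 V2 s \<omega>) - (I2 v \<omega> - I2 u \<omega>))"
    and le: "AE \<omega> in M. \<omega> \<in> A \<longrightarrow> x1 \<omega> \<le> x2 \<omega>"
  shows "AE \<omega> in M. \<omega> \<in> A \<longrightarrow> U1 e \<omega> \<le> U2 e \<omega>"
proof -
  \<comment> \<open>Both solutions may jump at v, so the value there is replaced by the difference
    of the left limits; this makes \<open>D\<close> continuous up to v.\<close>
  define D where "D = (\<lambda>u \<omega>. if u < v then U1 u \<omega> - U2 u \<omega> else x1 \<omega> - x2 \<omega>)"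
  define \<zeta> where "\<zeta> = (\<lambda>s \<omega>. V1 s \<omega> - V2 s \<omega>)"
  define J where "J = (\<lambda>s \<omega>. I1 s \<omega> - I2 s \<omega>)"
  have V: "progressive M \<F> T V1" "energy V1 < \<infinity>" "progressive M \<F> T V2" "energy V2 < \<infinity>"
    using S1 S2 by (auto simp: H2_iff)
  have J: "ito \<zeta> J" unfolding \<zeta>_def J_def by (rule ito_diff[OF S1(3) S2(3) V(1,3)])
  have \<zeta>: "progressive M \<F> T \<zeta>" unfolding \<zeta>_def by (rule progressive_diff[OF V(1,3)])
  have \<zeta>E: "energy \<zeta> < \<infinity>"
  proof -
    have "progressive M \<F> T (\<lambda>s \<omega>. - V2 s \<omega>)"
      using progressive_diff[OF progressive_zero V(3)] by simp
    from energy_add_le[OF V(1) this] have "energy \<zeta> \<le> 2 * energy V1 + 2 * energy V2"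
      by (simp add: \<zeta>_def energy_def)
    also have "\<dots> < \<infinity>" using V by (simp add: ennreal_mult_less_top)
    finally show ?thesis .
  qed
  obtain w1 where w1: "integrable M w1" "AE \<omega> in M. \<forall>t\<in>{0..T}. (U1 t \<omega>)\<^sup>2 \<le> w1 \<omega>"
    using S2_dominated[OF S1(1)] .
  obtain w2 where w2: "integrable M w2" "AE \<omega> in M. \<forall>t\<in>{0..T}. (U2 t \<omega>)\<^sup>2 \<le> w2 \<omega>"
    using S2_dominated[OF S2(1)] .
  define G where "G = (\<lambda>s \<omega>. drv k U1 V1 s \<omega> - drv k U2 V2 s \<omega>)"
  \<comment> \<open>The difference of the two equations. At u = v the integral over one point
    vanishes and only the left limits remain.\<close>
  have path: "AE \<omega> in M. \<omega> \<in> A \<longrightarrow> set_integrable lborel {e..v} (\<lambda>s. G s \<omega>) \<and>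
     (\<forall>u\<in>{e..v}. D u \<omega> = x1 \<omega> - x2 \<omega> + (LINT s:{u..v}|lborel. G s \<omega>) - (J v \<omega> - J u \<omega>))"
    using E1 E2 drv_integrable[OF S1(1,2)] drv_integrable[OF S2(1,2)]
  proof eventually_elim
    case (elim \<omega>)
    have i: "set_integrable lborel {u..v} (\<lambda>s. drv k U1 V1 s \<omega>)" "set_integrable lborel {u..v} (\<lambda>s. drv k U2 V2 s \<omega>)"
      if "e \<le> u" for u
      using elim(3,4) ev that by (auto intro: set_integrable_subset[of lborel "{0..T}"])
    show ?case
    proof (intro impI conjI ballI)
      show "set_integrable lborel {e..v} (\<lambda>s. G s \<omega>)" unfolding G_def using i[of e] by (intro set_integral_diff) auto
      fix u assume \<omega>: "\<omega> \<in> A" and u: "u \<in> {e..v}"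
      show "D u \<omega> = x1 \<omega> - x2 \<omega> + (LINT s:{u..v}|lborel. G s \<omega>) - (J v \<omega> - J u \<omega>)"
      proof (cases "u < v")
        case True
        have "(LINT s:{u..v}|lborel. G s \<omega>) = (LINT s:{u..v}|lborel. drv k U1 V1 s \<omega>) - (LINT s:{u..v}|lborel. drv k U2 V2 s \<omega>)"
          unfolding G_def using i[of u] u by (intro set_integral_diff) auto
        then show ?thesis using True elim(1,2) \<omega> u by (simp add: D_def J_def)
      next
        case False
        then show ?thesis using u by (simp add: D_def)
      qed
    qed
  qed
  have cont: "AE \<omega> in M. \<omega> \<in> A \<longrightarrow> continuous_on {e..v} (\<lambda>u. D u \<omega>)"
    using path ito_continuous[OF J]
  proof eventually_elim
    case (elim \<omega>)
    show ?case
    proof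
      assume \<omega>: "\<omega> \<in> A"
      have "continuous_on {e..v} (\<lambda>u. x1 \<omega> - x2 \<omega> + (LINT s:{u..v}|lborel. G s \<omega>) - (J v \<omega> - J u \<omega>))"
        using elim \<omega> ev by (intro continuous_intros continuous_on_set_lebesgue_integral)
          (auto intro: continuous_on_subset)
      then show "continuous_on {e..v} (\<lambda>u. D u \<omega>)"
        using elim(1) \<omega> by (subst continuous_on_cong[OF refl]) auto
    qed
  qed
  have "AE \<omega> in M. \<omega> \<in> A \<longrightarrow> D e \<omega> \<le> 0"
  proof (rule comparison[OF J \<zeta> \<zeta>E ev A])
    show "0 \<le> L" using L_pos by simp
    show "D u \<in> borel_measurable (\<F> u)" if "u \<in> {e..<v}" for u
    proof -
      have "u \<in> {0..T}" using that ev by auto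
      then have [measurable]: "U1 u \<in> borel_measurable (\<F> u)" "U2 u \<in> borel_measurable (\<F> u)"
        using progressive_at[OF S2_progressive[OF S1(1)]] progressive_at[OF S2_progressive[OF S2(1)]] by auto
      show ?thesis using that unfolding D_def by simp
    qed
    show "integrable M (\<lambda>\<omega>. 2 * w1 \<omega> + 2 * w2 \<omega>)" using w1 w2 by simp
    show "AE \<omega> in M. \<omega> \<in> A \<longrightarrow> (\<forall>u\<in>{e..<v}. (D u \<omega>)\<^sup>2 \<le> 2 * w1 \<omega> + 2 * w2 \<omega>)"
      using w1(2) w2(2)
    proof eventually_elim
      case (elim \<omega>)
      show ?case
      proof (intro impI ballI)
        fix u assume u: "u \<in> {e..<v}"
        have "(D u \<omega>)\<^sup>2 \<le> 2 * (U1 u \<omega>)\<^sup>2 + 2 * (U2 u \<omega>)\<^sup>2"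
          using norm_add_square_le[of "U1 u \<omega>" "- U2 u \<omega>"] u by (simp add: D_def)
        also have "\<dots> \<le> 2 * w1 \<omega> + 2 * w2 \<omega>" using elim u ev by (intro add_mono mult_left_mono) auto
        finally show "(D u \<omega>)\<^sup>2 \<le> 2 * w1 \<omega> + 2 * w2 \<omega>" .
      qed
    qed
    show "AE \<omega> in M. \<omega> \<in> A \<longrightarrow> continuous_on {e..v} (\<lambda>u. D u \<omega>)" by (rule cont)
    show "AE \<omega> in M. \<omega> \<in> A \<longrightarrow> D v \<omega> \<le> 0" using le by eventually_elim (auto simp: D_def)
    show "AE \<omega> in M. \<omega> \<in> A \<longrightarrow> (\<forall>u u'. e \<le> u \<longrightarrow> u \<le> u' \<longrightarrow> u' \<le> v \<longrightarrow>
       \<bar>D u' \<omega> - D u \<omega> - (J u' \<omega> - J u \<omega>)\<bar> \<le> L * (LINT s:{u..u'}|lborel. \<bar>D s \<omega>\<bar> + norm (\<zeta> s \<omega>)))"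
      using path cont finite_energy_path_norm[OF \<zeta> \<zeta>E] drv_lipschitz
    proof eventually_elim
      case (elim \<omega>)
      show ?case
      proof (intro impI allI)
        fix u u' assume \<omega>: "\<omega> \<in> A" and u: "e \<le> u" "u \<le> u'" "u' \<le> v"
        have sub: "{u..u'} \<subseteq> {e..v}" "{u..v} \<subseteq> {e..v}" "{u..u'} \<subseteq> {0..T}" using u ev by auto
        have iG: "set_integrable lborel {u..u'} (\<lambda>s. G s \<omega>)" "set_integrable lborel {u..v} (\<lambda>s. G s \<omega>)"
          using elim(1) \<omega> sub by (auto intro: set_integrable_subset[of lborel "{e..v}"])
        have i1: "set_integrable lborel {u..u'} (\<lambda>s. \<bar>D s \<omega>\<bar>)"
          using elim(2) \<omega> sub by (intro borel_integrable_atLeastAtMost' continuous_intros) (auto intro: continuous_on_subset)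
        have i2: "set_integrable lborel {u..u'} (\<lambda>s. norm (\<zeta> s \<omega>))"
          using elim(3) sub by (auto intro: set_integrable_subset[of lborel "{0..T}"])
        have i3: "set_integrable lborel {u..u'} (\<lambda>s. L * (\<bar>D s \<omega>\<bar> + norm (\<zeta> s \<omega>)))"
          using i1 i2 by (intro set_integrable_mult_right set_integral_add)
        have "D u' \<omega> - D u \<omega> - (J u' \<omega> - J u \<omega>) = - (LINT s:{u..u'}|lborel. G s \<omega>)"
          using elim(1) \<omega> u set_lebesgue_integral_split[OF iG(2) u(2,3)] by simp
        then have "\<bar>D u' \<omega> - D u \<omega> - (J u' \<omega> - J u \<omega>)\<bar> = \<bar>LINT s:{u..u'}|lborel. G s \<omega>\<bar>" by simp
        also have "\<dots> \<le> (LINT s:{u..u'}|lborel. \<bar>G s \<omega>\<bar>)"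
          using integral_abs_bound[of lborel "\<lambda>s. indicator {u..u'} s *\<^sub>R G s \<omega>"]
          by (simp add: set_lebesgue_integral_def abs_mult)
        also have "\<dots> \<le> (LINT s:{u..u'}|lborel. L * (\<bar>D s \<omega>\<bar> + norm (\<zeta> s \<omega>)))"
        proof (rule set_integral_mono_AE[OF set_integrable_abs[OF iG(1)] i3])
          \<comment> \<open>The time v is left out: there \<open>D\<close> is not the difference of
            the processes that enter the drivers.\<close>
          show "AE s\<in>{u..u'} in lborel. \<bar>G s \<omega>\<bar> \<le> L * (\<bar>D s \<omega>\<bar> + norm (\<zeta> s \<omega>))"
            using AE_lborel_singleton[of v]
          proof eventually_elim
            case (elim s)
            show ?case
            proof
              assume s: "s \<in> {u..u'}"
              then have "s < v" "s \<in> {0..T}" using elim u sub by auto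
              then show "\<bar>G s \<omega>\<bar> \<le> L * (\<bar>D s \<omega>\<bar> + norm (\<zeta> s \<omega>))"
                using \<open>\<forall>s\<in>{0..T}. \<forall>k U V U' V'. \<bar>drv k U V s \<omega> - drv k U' V' s \<omega>\<bar> \<le> L * (\<bar>U s \<omega> - U' s \<omega>\<bar> + norm (V s \<omega> - V' s \<omega>))\<close>
                unfolding G_def D_def \<zeta>_def by simp
            qed
          qed
        qed
        also have "\<dots> = L * (LINT s:{u..u'}|lborel. \<bar>D s \<omega>\<bar> + norm (\<zeta> s \<omega>))" by simp
        finally show "\<bar>D u' \<omega> - D u \<omega> - (J u' \<omega> - J u \<omega>)\<bar> \<le> L * (LINT s:{u..u'}|lborel. \<bar>D s \<omega>\<bar> + norm (\<zeta> s \<omega>))" .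
      qed
    qed
  qed
  then show ?thesis by eventually_elim (use ev in \<open>auto simp: D_def\<close>)
qed

end

section \<open>Strategies along a path\<close>

text \<open>The iterated triangle inequality: a chain of simultaneous switches costs at least the
  direct switch. The zero diagonal covers the empty chain.\<close>

lemma cost_chain:
  fixes c :: "real ^ ('d::finite) ^ ('d::finite)"
  assumes tri: "\<And>i j l. c $ i $ l \<le> c $ i $ j + c $ j $ l" and diag: "\<And>i. c $ i $ i = 0" and "(n::nat) \<le> m"
  shows "c $ \<alpha> n $ \<alpha> m \<le> (\<Sum>j\<in>{n<..m}. c $ \<alpha> (j - 1) $ \<alpha> j)"
  using assms(3)
proof (induction rule: dec_induct)
  case base
  then show ?case using diag by simp
next
  case (step m)
  then have "{n<..Suc m} = insert (Suc m) {n<..m}" by auto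
  then have "(\<Sum>j\<in>{n<..Suc m}. c $ \<alpha> (j - 1) $ \<alpha> j) = c $ \<alpha> m $ \<alpha> (Suc m) + (\<Sum>j\<in>{n<..m}. c $ \<alpha> (j - 1) $ \<alpha> j)"
    by simp
  then show ?case using step.IH tri[of "\<alpha> n" "\<alpha> (Suc m)" "\<alpha> m"] by linarith
qed

text \<open>Collects what admissibility gives on almost every path, so that what follows is
  deterministic reasoning about one \<omega>.\<close>

definition regular_path :: "real \<Rightarrow> real set \<Rightarrow> real \<Rightarrow> ('w, 'd) strategy \<Rightarrow> 'w \<Rightarrow> bool" where
  "regular_path T R t a \<omega> \<longleftrightarrow> (\<forall>j. fst a j \<omega> \<le> fst a (Suc j) \<omega>) \<and> fst a 0 \<omega> = ereal t \<and>
     finite (switches T a \<omega>) \<and> (\<forall>j\<in>switches T a \<omega>. fst a j \<omega> \<in> ereal ` R)"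

context
  fixes T :: real and R :: "real set" and t :: real and a :: "('w, 'd::finite) strategy" and \<omega> :: 'w
  assumes reg: "regular_path T R t a \<omega>"
begin

lemma path_mono: "j \<le> k \<Longrightarrow> fst a j \<omega> \<le> fst a k \<omega>"
  using reg unfolding regular_path_def by (intro lift_Suc_mono_le[of "\<lambda>j. fst a j \<omega>" j k]) auto

lemma path_index_unique:
  assumes "fst a n \<omega> \<le> ereal s" "ereal s < fst a (Suc n) \<omega>" "fst a m \<omega> \<le> ereal s" "ereal s < fst a (Suc m) \<omega>"
  shows "m = n"
proof (rule ccontr)
  assume "m \<noteq> n"
  then consider "Suc m \<le> n" | "Suc n \<le> m" by linarith
  then show False
    using path_mono[of "Suc m" n] path_mono[of "Suc n" m] assms by cases (auto dest: order_trans leD)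
qed

lemma state_eq:
  assumes "fst a n \<omega> \<le> ereal s" "ereal s < fst a (Suc n) \<omega>"
  shows "state a s \<omega> = snd a n \<omega>"
proof -
  have "\<not> ereal s < fst a 0 \<omega>" using path_mono[of 0 n] assms by (auto dest: order_trans leD)
  moreover have "(THE j. fst a j \<omega> \<le> ereal s \<and> ereal s < fst a (Suc j) \<omega>) = n"
    using assms path_index_unique by (intro the_equality) auto
  ultimately show ?thesis by (simp add: state_def case_prod_unfold)
qed

text \<open>Because only finitely many switches occur, there is a last index whose time is at most
  s.\<close>

lemma path_index_exists:
  assumes "t \<le> s" "s \<le> T"
  obtains n where "fst a n \<omega> \<le> ereal s" "ereal s < fst a (Suc n) \<omega>"
proof -
  let ?S = "{j. fst a j \<omega> \<le> ereal s}"
  have "?S \<subseteq> insert 0 (switches T a \<omega>)"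
  proof
    fix j assume "j \<in> ?S"
    then have "fst a j \<omega> \<le> ereal T" using assms by (auto intro: order_trans[of _ "ereal s"])
    then show "j \<in> insert 0 (switches T a \<omega>)" by (cases j) (auto simp: switches_def)
  qed
  then have f: "finite ?S" using reg unfolding regular_path_def by (auto intro: finite_subset)
  have "0 \<in> ?S" using reg assms unfolding regular_path_def by auto
  then have "Max ?S \<in> ?S" using f by (intro Max_in) auto
  moreover have "Suc (Max ?S) \<notin> ?S" using Max_ge[OF f, of "Suc (Max ?S)"] by auto
  ultimately show ?thesis using that by (auto simp: not_le)
qed

lemma state_iff:
  assumes "t \<le> s" "s \<le> T"
  shows "state a s \<omega> = k \<longleftrightarrow> (\<exists>n. fst a n \<omega> \<le> ereal s \<and> ereal s < fst a (Suc n) \<omega> \<and> snd a n \<omega> = k)"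
proof -
  obtain n where "fst a n \<omega> \<le> ereal s" "ereal s < fst a (Suc n) \<omega>" using path_index_exists[OF assms] .
  then show ?thesis using state_eq by metis
qed

text \<open>Switching times up to T lie in \<open>R\<close>, which has no point strictly between e
  and v. Mode and cumulated cost are therefore frozen on [e,v) and can change only at v.\<close>

lemma no_switch_between:
  assumes e: "t \<le> e" and v: "v \<le> T" and gap: "R \<inter> {e<..<v} = {}" and s: "s \<in> {e..<v}"
  shows "state a s \<omega> = state a e \<omega>" and "cum_cost T C a s \<omega> = cum_cost T C a e \<omega>"
proof -
  have sw: "fst a j \<omega> \<le> ereal e" if "1 \<le> j" "fst a j \<omega> \<le> ereal s" for j
  proof -
    have "fst a j \<omega> \<le> ereal T" using that(2) s v by (auto intro: order_trans[of _ "ereal s"])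
    then have "j \<in> switches T a \<omega>" using that by (auto simp: switches_def)
    then obtain x where "x \<in> R" "fst a j \<omega> = ereal x" using reg unfolding regular_path_def by auto
    moreover from this have "x \<le> s" using that by simp
    ultimately show ?thesis using gap s by fastforce
  qed
  obtain n where n: "fst a n \<omega> \<le> ereal e" "ereal e < fst a (Suc n) \<omega>"
    using path_index_exists[of e] e s v by auto
  have "fst a n \<omega> \<le> ereal s" using n(1) s by (auto intro: order_trans[of _ "ereal e"])
  moreover have "ereal s < fst a (Suc n) \<omega>" using sw[of "Suc n"] n(2) by force
  ultimately show "state a s \<omega> = state a e \<omega>" using state_eq n by auto
  have "{j. j \<in> switches T a \<omega> \<and> fst a j \<omega> \<le> ereal s \<and> s \<le> T} = {j. j \<in> switches T a \<omega> \<and> fst a j \<omega> \<le> ereal e \<and> e \<le> T}"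
    using sw s v by (auto simp: switches_def intro: order_trans[of _ "ereal e"])
  then show "cum_cost T C a s \<omega> = cum_cost T C a e \<omega>"
    by (simp add: cum_cost_def case_prod_unfold)
qed

text \<open>Switches after e and up to v all happen at v, possibly several at once. Their costs are
  thus evaluated at one and the same time, as the triangle inequality requires.\<close>

lemma cost_jump:
  assumes e: "t \<le> e" "e < v" and v: "v \<le> T" and gap: "R \<inter> {e<..<v} = {}"
    and n: "fst a n \<omega> \<le> ereal e" "ereal e < fst a (Suc n) \<omega>" and m: "fst a m \<omega> \<le> ereal v" "ereal v < fst a (Suc m) \<omega>"
  shows "n \<le> m" "\<And>j. j \<in> {n<..m} \<Longrightarrow> fst a j \<omega> = ereal v"
    "cum_cost T C a v \<omega> - cum_cost T C a e \<omega> = (\<Sum>j\<in>{n<..m}. C v \<omega> $ snd a (j - 1) \<omega> $ snd a j \<omega>)"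
proof -
  show nm: "n \<le> m"
  proof (rule ccontr)
    assume "\<not> n \<le> m"
    then have "fst a (Suc m) \<omega> \<le> fst a n \<omega>" by (intro path_mono) simp
    then have "ereal v < ereal e" using n m by (meson less_le_trans order_trans)
    then show False using e by simp
  qed
  have fin: "finite (switches T a \<omega>)" using reg unfolding regular_path_def by auto
  have vj: "fst a j \<omega> = ereal v" if "j \<in> {n<..m}" for j
  proof -
    have l: "ereal e < fst a j \<omega>" using n(2) path_mono[of "Suc n" j] that by (auto intro: less_le_trans)
    have u: "fst a j \<omega> \<le> ereal v" using m(1) path_mono[of j m] that by (auto intro: order_trans)
    then have "fst a j \<omega> \<le> ereal T" using v by (auto intro: order_trans[of _ "ereal v"])
    then have "j \<in> switches T a \<omega>" using that by (auto simp: switches_def)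
    then obtain x where "x \<in> R" "fst a j \<omega> = ereal x" using reg unfolding regular_path_def by auto
    then show ?thesis using l u gap by fastforce
  qed
  then show "\<And>j. j \<in> {n<..m} \<Longrightarrow> fst a j \<omega> = ereal v" .
  let ?S = "\<lambda>s. {j. j \<in> switches T a \<omega> \<and> fst a j \<omega> \<le> ereal s \<and> s \<le> T}"
  have S: "?S v = ?S e \<union> {n<..m}"
  proof (intro equalityI subsetI)
    fix j assume j: "j \<in> ?S v"
    show "j \<in> ?S e \<union> {n<..m}"
    proof (cases "j \<le> n")
      case True
      then have "fst a j \<omega> \<le> ereal e" using path_mono[of j n] n by (auto intro: order_trans)
      then show ?thesis using j e v by auto
    next
      case False
      have "j \<le> m"
      proof (rule ccontr)
        assume "\<not> j \<le> m"
        then have "fst a (Suc m) \<omega> \<le> fst a j \<omega>" by (intro path_mono) simp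
        then show False using j m by (auto dest: order_trans leD)
      qed
      then show ?thesis using False by auto
    qed
  next
    fix j assume "j \<in> ?S e \<union> {n<..m}"
    then show "j \<in> ?S v"
    proof
      assume "j \<in> ?S e"
      then show ?thesis using e v by (auto intro: order_trans[of _ "ereal e"])
    next
      assume "j \<in> {n<..m}"
      then show ?thesis using vj[of j] v by (auto simp: switches_def)
    qed
  qed
  have disj: "?S e \<inter> {n<..m} = {}" using vj e by auto
  have "cum_cost T C a v \<omega> = (\<Sum>j\<in>?S e \<union> {n<..m}. C (real_of_ereal (fst a j \<omega>)) \<omega> $ snd a (j - 1) \<omega> $ snd a j \<omega>)"
    unfolding S[symmetric] by (simp add: cum_cost_def case_prod_unfold)
  also have "\<dots> = cum_cost T C a e \<omega> + (\<Sum>j\<in>{n<..m}. C (real_of_ereal (fst a j \<omega>)) \<omega> $ snd a (j - 1) \<omega> $ snd a j \<omega>)"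
    using fin disj by (subst sum.union_disjoint) (auto simp: cum_cost_def case_prod_unfold)
  also have "(\<Sum>j\<in>{n<..m}. C (real_of_ereal (fst a j \<omega>)) \<omega> $ snd a (j - 1) \<omega> $ snd a j \<omega>)
     = (\<Sum>j\<in>{n<..m}. C v \<omega> $ snd a (j - 1) \<omega> $ snd a j \<omega>)"
    by (intro sum.cong refl) (simp add: vj)
  finally show "cum_cost T C a v \<omega> - cum_cost T C a e \<omega> = (\<Sum>j\<in>{n<..m}. C v \<omega> $ snd a (j - 1) \<omega> $ snd a j \<omega>)"
    by simp
qed

text \<open>The mode is constant between consecutive switching times, so a level set is a countable
  union of intervals; this is what makes the switched driver measurable in time.\<close>

lemma state_borel: "{s\<in>{t..T}. state a s \<omega> = k} \<in> sets borel"
proof -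
  have "{s\<in>{t..T}. state a s \<omega> = k} =
    (\<Union>n\<in>{n. snd a n \<omega> = k}. {t..T} \<inter> ({s. fst a n \<omega> \<le> ereal s} \<inter> {s. ereal s < fst a (Suc n) \<omega>}))"
    using state_iff by auto
  moreover have "{s. x \<le> ereal s} \<in> sets borel" "{s. ereal s < x} \<in> sets borel" for x by auto
  ultimately show ?thesis by auto
qed

end

lemma cost_jump_ge:
  fixes C :: "real \<Rightarrow> 'w \<Rightarrow> real ^ ('d::finite) ^ ('d::finite)"
  assumes reg: "regular_path T R t a \<omega>" and ev: "t \<le> e" "e < v" "v \<le> T" and gap: "R \<inter> {e<..<v} = {}"
    and tri: "\<And>i j l. C v \<omega> $ i $ l \<le> C v \<omega> $ i $ j + C v \<omega> $ j $ l" and diag: "\<And>i. C v \<omega> $ i $ i = 0"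
  shows "C v \<omega> $ state a e \<omega> $ state a v \<omega> \<le> cum_cost T C a v \<omega> - cum_cost T C a e \<omega>"
proof -
  obtain n where n: "fst a n \<omega> \<le> ereal e" "ereal e < fst a (Suc n) \<omega>"
    using path_index_exists[OF reg, of e] ev by auto
  obtain m where m: "fst a m \<omega> \<le> ereal v" "ereal v < fst a (Suc m) \<omega>"
    using path_index_exists[OF reg, of v] ev by auto
  note j = cost_jump[OF reg ev gap n m]
  show ?thesis unfolding j(3) state_eq[OF reg n] state_eq[OF reg m]
    by (rule cost_chain[OF tri diag j(1)])
qed

section \<open>Grid cells, costs, and measurability of the mode\<close>

context switching_bsde
begin

lemma grid_facts:
  "0 < \<kappa>" "r 0 = 0" "r \<kappa> = T" "\<And>j. j < \<kappa> \<Longrightarrow> r j < r (Suc j)"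
  using grid_r unfolding reflection_grid_def by auto

lemma r_strict_mono: "j < k \<Longrightarrow> k \<le> \<kappa> \<Longrightarrow> r j < r k"
proof (induction k)
  case (Suc k)
  then show ?case using grid_facts(4)[of k] by (cases "j = k") auto
qed simp

lemma r_mono: "j \<le> k \<Longrightarrow> k \<le> \<kappa> \<Longrightarrow> r j \<le> r k"
  using r_strict_mono[of j k] by (cases "j = k") auto

lemma r_bounds: "j \<le> \<kappa> \<Longrightarrow> 0 \<le> r j \<and> r j \<le> T"
  using r_mono[of 0 j] r_mono[of j \<kappa>] grid_facts by auto

lemma R_facts: "R \<subseteq> {0..T}" "T \<in> R" "finite R"
  using r_bounds grid_facts(3) unfolding R_def by auto

lemma R_gap: "j < \<kappa> \<Longrightarrow> R \<inter> {r j<..<r (Suc j)} = {}"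
proof -
  assume j: "j < \<kappa>"
  have "r k \<notin> {r j<..<r (Suc j)}" if "k \<le> \<kappa>" for k
    using r_mono[of k j] r_mono[of "Suc j" k] that j by (cases "k \<le> j") auto
  then show ?thesis unfolding R_def by auto
qed

lemma cell_exists:
  assumes "t \<in> {0..<T}"
  obtains j where "j < \<kappa>" "r j \<le> t" "t < r (Suc j)"
proof -
  let ?S = "{j. j \<le> \<kappa> \<and> r j \<le> t}"
  have f: "finite ?S" by simp
  have "0 \<in> ?S" using grid_facts assms by auto
  then have M: "Max ?S \<in> ?S" using f by (intro Max_in) auto
  have "Max ?S \<noteq> \<kappa>" using M grid_facts(3) assms by auto
  then have "Max ?S < \<kappa>" using M by simp
  moreover have "Suc (Max ?S) \<notin> ?S"
  proof
    assume "Suc (Max ?S) \<in> ?S"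
    from Max_ge[OF f this] show False by simp
  qed
  ultimately show ?thesis using M by (intro that[of "Max ?S"]) auto
qed

text \<open>The infima over time become pointwise inequalities off one null set. The weak triangle
  inequality serves domination; the strict one excludes an immediate second switch of the optimal
  strategy.\<close>

lemma cost_facts:
  "AE \<omega> in M. \<forall>s\<in>{0..T}. (\<forall>i. C s \<omega> $ i $ i = 0) \<and> (\<forall>i j. i \<noteq> j \<longrightarrow> 0 < C s \<omega> $ i $ j) \<and>
     (\<forall>i j l. i \<noteq> j \<longrightarrow> j \<noteq> l \<longrightarrow> C s \<omega> $ i $ l < C s \<omega> $ i $ j + C s \<omega> $ j $ l) \<and>
     (\<forall>i j l. C s \<omega> $ i $ l \<le> C s \<omega> $ i $ j + C s \<omega> $ j $ l)"
proof -
  have "AE \<omega> in M. \<forall>i. \<forall>t\<in>{0..T}. C t \<omega> $ i $ i = 0"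
    "AE \<omega> in M. \<forall>i j. i \<noteq> j \<longrightarrow> ereal (1 / L) < (INF t\<in>{0..T}. ereal (C t \<omega> $ i $ j))"
    "AE \<omega> in M. \<forall>i j l. i \<noteq> j \<and> j \<noteq> l \<longrightarrow> 0 < (INF t\<in>{0..T}. ereal (C t \<omega> $ i $ j + C t \<omega> $ j $ l - C t \<omega> $ i $ l))"
    using cost unfolding cost_process_def by auto
  then show ?thesis
  proof eventually_elim
    case (elim \<omega>)
    show ?case
    proof
      fix s assume s: "s \<in> {0..T}"
      have 1: "C s \<omega> $ i $ i = 0" for i using elim(1) s by auto
      have 2: "0 < C s \<omega> $ i $ j" if "i \<noteq> j" for i j
      proof -
        have "ereal (1 / L) < ereal (C s \<omega> $ i $ j)"
          by (rule less_le_trans[OF elim(2)[rule_format, OF that] INF_lower[OF s]])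
        then have "1 / L < C s \<omega> $ i $ j" by simp
        then show ?thesis using L_pos by (auto intro: less_trans[of _ "1 / L"])
      qed
      have 3: "C s \<omega> $ i $ l < C s \<omega> $ i $ j + C s \<omega> $ j $ l" if "i \<noteq> j" "j \<noteq> l" for i j l
      proof -
        have "0 < ereal (C s \<omega> $ i $ j + C s \<omega> $ j $ l - C s \<omega> $ i $ l)"
          by (rule less_le_trans[OF elim(3)[rule_format, of i j l] INF_lower[OF s]]) (use that in auto)
        then show ?thesis by simp
      qed
      have 4: "C s \<omega> $ i $ l \<le> C s \<omega> $ i $ j + C s \<omega> $ j $ l" for i j l
        using 1 3[of i j l] by (cases "i = j"; cases "j = l") auto
      show "(\<forall>i. C s \<omega> $ i $ i = 0) \<and> (\<forall>i j. i \<noteq> j \<longrightarrow> 0 < C s \<omega> $ i $ j) \<and>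
     (\<forall>i j l. i \<noteq> j \<longrightarrow> j \<noteq> l \<longrightarrow> C s \<omega> $ i $ l < C s \<omega> $ i $ j + C s \<omega> $ j $ l) \<and>
     (\<forall>i j l. C s \<omega> $ i $ l \<le> C s \<omega> $ i $ j + C s \<omega> $ j $ l)"
        by (intro conjI allI impI) (simp_all add: 1 2 3 4)
    qed
  qed
qed

lemma Yt_S2: "S2 M \<F> T (\<lambda>t \<omega>. Yt t \<omega> $ k)" and Z_H2: "H2 M \<F> T (\<lambda>t \<omega>. Z t \<omega> $ k)"
  using bsde unfolding reflected_bsde_def by blast+

lemma ito_Z_exists:
  "\<exists>I. (\<forall>k. ito (\<lambda>t \<omega>. Z t \<omega> $ k) (I k)) \<and>
    (AE \<omega> in M. \<forall>j<\<kappa>. \<forall>u\<in>{r j..<r (Suc j)}. \<forall>k. Yt u \<omega> $ k = Y (r (Suc j)) \<omega> $ k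
       + (LINT s:{u..r (Suc j)}|lborel. drv k (\<lambda>s \<omega>. Yt s \<omega> $ k) (\<lambda>s \<omega>. Z s \<omega> $ k) s \<omega>)
       - (I k (r (Suc j)) \<omega> - I k u \<omega>))"
proof -
  obtain I where I: "\<And>k. ito (\<lambda>t \<omega>. Z t \<omega> $ k) (I k)"
    "AE \<omega> in M. \<forall>j<\<kappa>. \<forall>t\<in>{r j..<r (Suc j)}.
           (\<forall>i. Yt t \<omega> $ i = Y (r (Suc j)) \<omega> $ i
                + (LINT u:{t..r (Suc j)}|lborel. F \<omega> u (Yt u \<omega>) (Z u \<omega>) $ i)
                - (I i (r (Suc j)) \<omega> - I i t \<omega>)) \<and>
           Y t \<omega> = (if t \<in> r ` {..\<kappa>} then Pmap (C t \<omega>) (Yt t \<omega>) else Yt t \<omega>)"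
    using bsde unfolding reflected_bsde_def by blast
  have "AE \<omega> in M. \<forall>j<\<kappa>. \<forall>u\<in>{r j..<r (Suc j)}. \<forall>k. Yt u \<omega> $ k = Y (r (Suc j)) \<omega> $ k
       + (LINT s:{u..r (Suc j)}|lborel. drv k (\<lambda>s \<omega>. Yt s \<omega> $ k) (\<lambda>s \<omega>. Z s \<omega> $ k) s \<omega>)
       - (I k (r (Suc j)) \<omega> - I k u \<omega>)"
    using I(2) drv_component
  proof eventually_elim
    case (elim \<omega>)
    show ?case
    proof (intro allI impI ballI)
      fix j u k assume j: "j < \<kappa>" and u: "u \<in> {r j..<r (Suc j)}"
      have sub: "{u..r (Suc j)} \<subseteq> {0..T}" using u r_bounds[of j] r_bounds[of "Suc j"] j by auto
      have "(LINT s:{u..r (Suc j)}|lborel. F \<omega> s (Yt s \<omega>) (Z s \<omega>) $ k)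
        = (LINT s:{u..r (Suc j)}|lborel. drv k (\<lambda>s \<omega>. Yt s \<omega> $ k) (\<lambda>s \<omega>. Z s \<omega> $ k) s \<omega>)"
        unfolding set_lebesgue_integral_def
        by (intro Bochner_Integration.integral_cong) (use elim(2) sub in \<open>auto simp: indicator_def\<close>)
      then show "Yt u \<omega> $ k = Y (r (Suc j)) \<omega> $ k
       + (LINT s:{u..r (Suc j)}|lborel. drv k (\<lambda>s \<omega>. Yt s \<omega> $ k) (\<lambda>s \<omega>. Z s \<omega> $ k) s \<omega>)
       - (I k (r (Suc j)) \<omega> - I k u \<omega>)" using elim(1) j u by auto
    qed
  qed
  then show ?thesis using I(1) by blast
qed

lemma Y_reflected:
  "AE \<omega> in M. \<forall>j<\<kappa>. Suc j < \<kappa> \<longrightarrow> Y (r (Suc j)) \<omega> = Pmap (C (r (Suc j)) \<omega>) (Yt (r (Suc j)) \<omega>)"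
proof -
  have "AE \<omega> in M. \<forall>j<\<kappa>. \<forall>t\<in>{r j..<r (Suc j)}.
           Y t \<omega> = (if t \<in> r ` {..\<kappa>} then Pmap (C t \<omega>) (Yt t \<omega>) else Yt t \<omega>)"
    using bsde unfolding reflected_bsde_def by auto
  then show ?thesis
  proof eventually_elim
    case (elim \<omega>)
    show ?case
    proof (intro allI impI)
      fix j assume "j < \<kappa>" "Suc j < \<kappa>"
      then show "Y (r (Suc j)) \<omega> = Pmap (C (r (Suc j)) \<omega>) (Yt (r (Suc j)) \<omega>)"
        using elim grid_facts(4)[of "Suc j"] by auto
    qed
  qed
qed

lemma Y_terminal: "AE \<omega> in M. Y T \<omega> = \<xi> \<omega> \<and> Yt T \<omega> = \<xi> \<omega> \<and> \<xi> \<omega> \<in> Qdom (C T \<omega>)"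
  using bsde terminal unfolding reflected_bsde_def terminal_value_def by auto

text \<open>The terminal value lies in \<open>Qdom\<close>, where the reflection acts as the
  identity. The maximum formula therefore holds at T as well, and the last cell is like the
  others.\<close>

lemma Y_eq:
  "AE \<omega> in M. \<forall>j<\<kappa>. \<forall>k. Y (r (Suc j)) \<omega> $ k = (MAX l. Yt (r (Suc j)) \<omega> $ l - C (r (Suc j)) \<omega> $ k $ l)"
  using Y_reflected Y_terminal cost_facts
proof eventually_elim
  case (elim \<omega>)
  show ?case
  proof (intro allI impI)
    fix j k assume j: "j < \<kappa>"
    show "Y (r (Suc j)) \<omega> $ k = (MAX l. Yt (r (Suc j)) \<omega> $ l - C (r (Suc j)) \<omega> $ k $ l)"
    proof (cases "Suc j < \<kappa>")
      case True
      then show ?thesis using elim(1) j by (simp add: Pmap_def)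
    next
      case False
      then have "Suc j = \<kappa>" using j by simp
      then have T: "r (Suc j) = T" using grid_facts(3) by simp
      have "C T \<omega> $ k $ k = 0" using elim(3) T_pos by auto
      moreover have "\<xi> \<omega> $ k - C T \<omega> $ k $ k \<le> (MAX l. \<xi> \<omega> $ l - C T \<omega> $ k $ l)" by (intro Max_ge) auto
      moreover have "(MAX l. \<xi> \<omega> $ l - C T \<omega> $ k $ l) \<le> \<xi> \<omega> $ k" using elim(2) unfolding Qdom_def by auto
      ultimately show ?thesis using elim(2) unfolding T by simp
    qed
  qed
qed

lemma admissible_regular:
  assumes "a \<in> admissible M \<F> T R C t i"
  shows "AE \<omega> in M. regular_path T R t a \<omega>"
proof -
  have "AE \<omega> in M. \<forall>j. fst a j \<omega> \<le> fst a (Suc j) \<omega>" "AE \<omega> in M. fst a 0 \<omega> = ereal t \<and> snd a 0 \<omega> = i"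
    "AE \<omega> in M. finite (switches T a \<omega>)" "AE \<omega> in M. \<forall>j\<in>switches T a \<omega>. fst a j \<omega> \<in> ereal ` R"
    using assms unfolding admissible_def strategy_def by (auto split: prod.splits)
  then show ?thesis by eventually_elim (simp add: regular_path_def)
qed

lemma filtration_extend: "filtration (space M) (extend_filtration T \<F>)"
proof
  fix i j :: ereal assume "i \<le> j"
  have "max 0 (min i (ereal T)) \<le> max 0 (min j (ereal T))" using \<open>i \<le> j\<close> by (intro max.mono min.mono) auto
  moreover have "max 0 (min j (ereal T)) \<noteq> \<infinity>" "0 \<le> max 0 (min i (ereal T))"
    by (auto simp: min_def max_def)
  ultimately have "real_of_ereal (max 0 (min i (ereal T))) \<le> real_of_ereal (max 0 (min j (ereal T)))"
    by (intro real_of_ereal_positive_mono)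
  then show "sets (extend_filtration T \<F> i) \<subseteq> sets (extend_filtration T \<F> j)"
    unfolding extend_filtration_def by (rule filt_mono)
qed (simp add: extend_filtration_def)

lemma extend_filtration_real: "s \<in> {0..T} \<Longrightarrow> extend_filtration T \<F> (ereal s) = \<F> s"
  by (simp add: extend_filtration_def min_absorb1 max_absorb2)

text \<open>Up to a null set, the event is the union over n of the events that the n-th mode is k
  and that s lies between the n-th and the next switching time; these are known at s by the stopping
  time property.\<close>

lemma state_event:
  assumes a: "a \<in> admissible M \<F> T R C t i" and s: "0 \<le> t" "t \<le> s" "s \<le> T"
  shows "{\<omega>\<in>space M. state a s \<omega> = k} \<in> sets (\<F> s)"
proof -
  interpret ef: filtration "space M" "extend_filtration T \<F>" by (rule filtration_extend)
  have st: "stopping_time (extend_filtration T \<F>) (fst a j)"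
    "snd a j \<in> measurable (ef.pre_sigma (fst a j)) (count_space UNIV)" for j
    using a unfolding admissible_def strategy_def by (auto split: prod.splits)
  have Fs: "extend_filtration T \<F> (ereal s) = \<F> s" using s by (intro extend_filtration_real) auto
  let ?E = "\<lambda>n. {\<omega>\<in>space M. snd a n \<omega> = k \<and> fst a n \<omega> \<le> ereal s} \<inter> {\<omega>\<in>space M. ereal s < fst a (Suc n) \<omega>}"
  have "?E n \<in> sets (\<F> s)" for n
  proof (rule sets.Int)
    have "snd a n -` {k} \<inter> space (ef.pre_sigma (fst a n)) \<in> sets (ef.pre_sigma (fst a n))"
      by (rule measurable_sets[OF st(2)]) simp
    from ef.sets_pre_sigmaD[OF st(1) this, of "ereal s"]
    have "{\<omega> \<in> snd a n -` {k} \<inter> space M. fst a n \<omega> \<le> ereal s} \<in> sets (\<F> s)"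
      unfolding Fs ef.space_pre_sigma .
    moreover have "{\<omega> \<in> snd a n -` {k} \<inter> space M. fst a n \<omega> \<le> ereal s} =
      {\<omega>\<in>space M. snd a n \<omega> = k \<and> fst a n \<omega> \<le> ereal s}" by auto
    ultimately show "{\<omega>\<in>space M. snd a n \<omega> = k \<and> fst a n \<omega> \<le> ereal s} \<in> sets (\<F> s)"
      by (simp only:)
    have "Measurable.pred (\<F> s) (\<lambda>\<omega>. ereal s < fst a (Suc n) \<omega>)"
      using stopping_timeD2[OF st(1), of "ereal s" "Suc n"] unfolding Fs .
    then show "{\<omega>\<in>space M. ereal s < fst a (Suc n) \<omega>} \<in> sets (\<F> s)"
      unfolding Measurable.pred_def by simp
  qed
  then have E: "(\<Union>n. ?E n) \<in> sets (\<F> s)" by auto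
  show ?thesis
  proof (rule AE_eq_sets_filt[OF E])
    have "AE \<omega> in M. \<omega> \<in> space M" by simp
    with admissible_regular[OF a]
    show "AE \<omega> in M. \<omega> \<in> (\<Union>n. ?E n) \<longleftrightarrow> \<omega> \<in> {\<omega>\<in>space M. state a s \<omega> = k}"
    proof eventually_elim
      case (elim \<omega>)
      then show ?case using state_iff[OF elim(1) s(2,3)] by auto
    qed
  qed auto
qed

section \<open>Domination and attainment\<close>

text \<open>Backward induction over the grid points after t, followed by the cell that contains t;
  \<open>max t (r j)\<close> is the left end in both situations.\<close>

lemma backward_cells:
  assumes t: "0 \<le> t" "t \<le> T" and T: "P T"
    and step: "\<And>j. j < \<kappa> \<Longrightarrow> t < r (Suc j) \<Longrightarrow> P (r (Suc j)) \<Longrightarrow> P (max t (r j))"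
  shows "P t"
proof -
  have Q: "t \<le> r j \<longrightarrow> P (r j)" if "j \<le> \<kappa>" for j
    using that
  proof (induction rule: inc_induct)
    case base
    then show ?case using T grid_facts(3) by simp
  next
    case (step j)
    show ?case
    proof
      assume tj: "t \<le> r j"
      then have "t < r (Suc j)" using grid_facts(4)[of j] step.hyps by simp
      then have "P (max t (r j))" using step.IH step.hyps by (intro assms(4)) auto
      then show "P (r j)" using tj by (simp add: max_absorb2)
    qed
  qed
  show ?thesis
  proof (cases "t = T")
    case True
    then show ?thesis using T by simp
  next
    case False
    then obtain j where j: "j < \<kappa>" "r j \<le> t" "t < r (Suc j)" using cell_exists[of t] t by auto
    then have "P (max t (r j))" using Q[of "Suc j"] by (intro step) auto
    then show ?thesis using j by (simp add: max_absorb1)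
  qed
qed

lemma cell_facts:
  assumes j: "j < \<kappa>" and t: "0 \<le> t" "t < r (Suc j)"
  shows "t \<le> max t (r j)" "0 \<le> max t (r j)" "max t (r j) < r (Suc j)" "r (Suc j) \<le> T"
    "R \<inter> {max t (r j)<..<r (Suc j)} = {}" "{max t (r j)..<r (Suc j)} \<subseteq> {r j..<r (Suc j)}" "r (Suc j) \<in> R"
    "max t (r j) \<in> {0..T}"
proof -
  show "r (Suc j) \<le> T" using r_bounds[of "Suc j"] j by auto
  show "max t (r j) < r (Suc j)" using t grid_facts(4)[OF j] by auto
  show "R \<inter> {max t (r j)<..<r (Suc j)} = {}" using R_gap[OF j] by fastforce
  show "r (Suc j) \<in> R" using j by (auto simp: R_def)
  show "max t (r j) \<in> {0..T}" using t grid_facts(4)[OF j] \<open>r (Suc j) \<le> T\<close> by auto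
qed (use t in auto)

text \<open>Time is split into the finitely many measurable level sets of the mode; on each of them
  the driver is that of a fixed mode.\<close>

lemma switched_driver_integrable:
  assumes reg: "regular_path T R t a \<omega>" and t: "0 \<le> t" "t \<le> T"
    and i: "\<forall>k. set_integrable lborel {0..T} (\<lambda>s. drv k U V s \<omega>)"
  shows "set_integrable lborel {t..T} (\<lambda>s. drv (state a s \<omega>) U V s \<omega>)"
proof -
  let ?S = "\<lambda>k. {s\<in>{t..T}. state a s \<omega> = k}"
  have m: "?S k \<in> sets borel" for k by (rule state_borel[OF reg])
  have "set_integrable lborel (\<Union>k\<in>UNIV. ?S k) (\<lambda>s. drv (state a s \<omega>) U V s \<omega>)"
  proof (rule set_integrable_UN)
    fix k
    have "set_integrable lborel (?S k) (\<lambda>s. drv k U V s \<omega>)"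
      using i[rule_format, of k] by (rule set_integrable_subset) (use t m in auto)
    then show "set_integrable lborel (?S k) (\<lambda>s. drv (state a s \<omega>) U V s \<omega>)"
      unfolding set_integrable_def
      by (rule Bochner_Integration.integrable_cong[THEN iffD1, rotated 2]) (auto simp: indicator_def)
  qed (use m in auto)
  moreover have "(\<Union>k\<in>UNIV. ?S k) = {t..T}" by auto
  ultimately show ?thesis by simp
qed

text \<open>Where the mode at e is k, the equation on [e,v) is the scalar equation of mode k. Its
  end value is \<open>U v\<close> minus the cost charged at v, the left limit of U; the mode at v
  itself does not affect the time integral.\<close>

lemma switched_cell:
  assumes a: "a \<in> admissible M \<F> T R C t i" and t: "0 \<le> t" "t \<le> T"
    and sb: "switched_bsde M \<F> T W C F \<xi> t a U V"
  obtains I where "ito V I"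
    "\<And>e v k. t \<le> e \<Longrightarrow> e < v \<Longrightarrow> v \<le> T \<Longrightarrow> R \<inter> {e<..<v} = {} \<Longrightarrow>
      AE \<omega> in M. \<omega> \<in> {\<omega>\<in>space M. state a e \<omega> = k} \<longrightarrow> (\<forall>u\<in>{e..<v}.
        U u \<omega> = (U v \<omega> - (cum_cost T C a v \<omega> - cum_cost T C a e \<omega>))
          + (LINT s:{u..v}|lborel. drv k U V s \<omega>) - (I v \<omega> - I u \<omega>))"
proof -
  have UV: "S2 M \<F> T U" "H2 M \<F> T V" using sb unfolding switched_bsde_def by auto
  obtain I where I: "ito V I"
    "AE \<omega> in M. \<forall>u\<in>{t..T}. U u \<omega> = \<xi> \<omega> $ state a T \<omega>
             + (LINT s:{u..T}|lborel. drv (state a s \<omega>) U V s \<omega>)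
             - (I T \<omega> - I u \<omega>) - cum_cost T C a T \<omega> + cum_cost T C a u \<omega>"
    using sb unfolding switched_bsde_def drv_def by blast
  show ?thesis
  proof (rule that[OF I(1)])
    fix e v k assume ev: "t \<le> e" "e < v" "v \<le> T" and gap: "R \<inter> {e<..<v} = {}"
    show "AE \<omega> in M. \<omega> \<in> {\<omega>\<in>space M. state a e \<omega> = k} \<longrightarrow> (\<forall>u\<in>{e..<v}.
        U u \<omega> = (U v \<omega> - (cum_cost T C a v \<omega> - cum_cost T C a e \<omega>))
          + (LINT s:{u..v}|lborel. drv k U V s \<omega>) - (I v \<omega> - I u \<omega>))"
      using I(2) admissible_regular[OF a] drv_integrable[OF UV]
    proof eventually_elim
      case (elim \<omega>)
      note ns = no_switch_between[OF elim(2) ev(1,3) gap]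
      show ?case
      proof (intro impI ballI)
        fix u assume k: "\<omega> \<in> {\<omega>\<in>space M. state a e \<omega> = k}" and u: "u \<in> {e..<v}"
        let ?f = "\<lambda>s. drv (state a s \<omega>) U V s \<omega>"
        have f: "set_integrable lborel {u..T} ?f"
          using switched_driver_integrable[OF elim(2) t elim(3)] by (rule set_integrable_subset) (use u ev in auto)
        have split: "(LINT s:{u..T}|lborel. ?f s) = (LINT s:{u..v}|lborel. ?f s) + (LINT s:{v..T}|lborel. ?f s)"
          by (rule set_lebesgue_integral_split[OF f]) (use u ev in auto)
        have "(LINT s:{u..v}|lborel. ?f s) = (LINT s:{u..v}|lborel. drv k U V s \<omega>)"
          unfolding set_lebesgue_integral_def
        proof (rule Bochner_Integration.integral_cong_AE)
          have sub: "{u..v} \<subseteq> {0..T}" using u ev t by auto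
          have "set_integrable lborel {u..v} ?f" "set_integrable lborel {u..v} (\<lambda>s. drv k U V s \<omega>)"
            using f elim(3) u ev sub by (auto intro: set_integrable_subset)
          then show "(\<lambda>s. indicator {u..v} s *\<^sub>R ?f s) \<in> borel_measurable lborel"
            "(\<lambda>s. indicator {u..v} s *\<^sub>R drv k U V s \<omega>) \<in> borel_measurable lborel"
            unfolding set_integrable_def by auto
          show "AE s in lborel. indicator {u..v} s *\<^sub>R ?f s = indicator {u..v} s *\<^sub>R drv k U V s \<omega>"
            using AE_lborel_singleton[of v]
          proof eventually_elim
            case (elim s)
            then show ?case using ns(1)[of s] u k by (auto simp: indicator_def)
          qed
        qed
        moreover have "U u \<omega> = \<xi> \<omega> $ state a T \<omega> + (LINT s:{u..T}|lborel. ?f s)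
             - (I T \<omega> - I u \<omega>) - cum_cost T C a T \<omega> + cum_cost T C a u \<omega>"
          "U v \<omega> = \<xi> \<omega> $ state a T \<omega> + (LINT s:{v..T}|lborel. ?f s)
             - (I T \<omega> - I v \<omega>) - cum_cost T C a T \<omega> + cum_cost T C a v \<omega>"
          using elim(1) u ev by auto
        ultimately show "U u \<omega> = (U v \<omega> - (cum_cost T C a v \<omega> - cum_cost T C a e \<omega>))
          + (LINT s:{u..v}|lborel. drv k U V s \<omega>) - (I v \<omega> - I u \<omega>)"
          unfolding split ns(2)[OF u] by simp
      qed
    qed
  qed
qed

lemma switched_terminal:
  assumes a: "a \<in> admissible M \<F> T R C t i" and t: "t \<le> T"
    and sb: "switched_bsde M \<F> T W C F \<xi> t a U V"
  shows "AE \<omega> in M. U T \<omega> = Yt T \<omega> $ state a T \<omega>"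
proof -
  obtain I where I:
    "AE \<omega> in M. \<forall>u\<in>{t..T}. U u \<omega> = \<xi> \<omega> $ state a T \<omega>
             + (LINT s:{u..T}|lborel. drv (state a s \<omega>) U V s \<omega>)
             - (I T \<omega> - I u \<omega>) - cum_cost T C a T \<omega> + cum_cost T C a u \<omega>"
    using sb unfolding switched_bsde_def drv_def by blast
  show ?thesis using I Y_terminal
  proof eventually_elim
    case (elim \<omega>)
    then show ?case using t by auto
  qed
qed

text \<open>Shaped like the conclusion of \<open>switched_cell\<close>, so that both feed the same
  comparison; here the left limit at the end of the cell is the reflected value.\<close>

lemma Yt_cell:
  obtains I where "\<And>k. ito (\<lambda>t \<omega>. Z t \<omega> $ k) (I k)"
    "\<And>j t k A. j < \<kappa> \<Longrightarrow> 0 \<le> t \<Longrightarrow> t < r (Suc j) \<Longrightarrow>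
      AE \<omega> in M. \<omega> \<in> A \<longrightarrow> (\<forall>u\<in>{max t (r j)..<r (Suc j)}. Yt u \<omega> $ k = Y (r (Suc j)) \<omega> $ k
       + (LINT s:{u..r (Suc j)}|lborel. drv k (\<lambda>s \<omega>. Yt s \<omega> $ k) (\<lambda>s \<omega>. Z s \<omega> $ k) s \<omega>)
       - (I k (r (Suc j)) \<omega> - I k u \<omega>))"
proof -
  obtain I where I: "\<And>k. ito (\<lambda>t \<omega>. Z t \<omega> $ k) (I k)"
    "AE \<omega> in M. \<forall>j<\<kappa>. \<forall>u\<in>{r j..<r (Suc j)}. \<forall>k. Yt u \<omega> $ k = Y (r (Suc j)) \<omega> $ k
       + (LINT s:{u..r (Suc j)}|lborel. drv k (\<lambda>s \<omega>. Yt s \<omega> $ k) (\<lambda>s \<omega>. Z s \<omega> $ k) s \<omega>)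
       - (I k (r (Suc j)) \<omega> - I k u \<omega>)"
    using ito_Z_exists by blast
  show ?thesis
  proof (rule that[OF I(1)])
    fix j t k A assume "j < \<kappa>" "0 \<le> t" "t < r (Suc j)"
    note c = cell_facts[OF this]
    show "AE \<omega> in M. \<omega> \<in> A \<longrightarrow> (\<forall>u\<in>{max t (r j)..<r (Suc j)}. Yt u \<omega> $ k = Y (r (Suc j)) \<omega> $ k
       + (LINT s:{u..r (Suc j)}|lborel. drv k (\<lambda>s \<omega>. Yt s \<omega> $ k) (\<lambda>s \<omega>. Z s \<omega> $ k) s \<omega>)
       - (I k (r (Suc j)) \<omega> - I k u \<omega>))"
      using I(2)
    proof eventually_elim
      case (elim \<omega>)
      show ?case using elim[rule_format, OF \<open>j < \<kappa>\<close>] c(6) by (intro impI ballI) (blast dest: subsetD)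
    qed
  qed
qed

text \<open>The mode takes finitely many values, so almost sure statements for fixed modes glue to
  one for the random mode.\<close>

lemma AE_by_state:
  fixes a :: "('w, 'd::{finite,linorder}) strategy"
  assumes "\<And>k. AE \<omega> in M. \<omega> \<in> {\<omega>\<in>space M. state a e \<omega> = k} \<longrightarrow> P k \<omega>"
  shows "AE \<omega> in M. P (state a e \<omega>) \<omega>"
proof -
  have "AE \<omega> in M. \<forall>k\<in>UNIV. \<omega> \<in> {\<omega>\<in>space M. state a e \<omega> = k} \<longrightarrow> P k \<omega>"
    by (rule AE_finite_allI) (use assms in auto)
  moreover have "AE \<omega> in M. \<omega> \<in> space M" by simp
  ultimately show ?thesis by eventually_elim auto
qed

text \<open>An inequality between the left limits at v, both read in the mode held at e, is carried
  to the left end of the cell. Domination uses one direction, attainment the other.\<close>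

lemma cell_step:
  assumes a: "a \<in> admissible M \<F> T R C t i" and t: "0 \<le> t" "t \<le> T"
    and sb: "switched_bsde M \<F> T W C F \<xi> t a U V" and j: "j < \<kappa>" "t < r (Suc j)"
  defines "e \<equiv> max t (r j)" and "v \<equiv> r (Suc j)"
  shows "AE \<omega> in M. U v \<omega> - (cum_cost T C a v \<omega> - cum_cost T C a e \<omega>) \<le> Y v \<omega> $ state a e \<omega> \<Longrightarrow>
      AE \<omega> in M. U e \<omega> \<le> Yt e \<omega> $ state a e \<omega>"
    and "AE \<omega> in M. Y v \<omega> $ state a e \<omega> \<le> U v \<omega> - (cum_cost T C a v \<omega> - cum_cost T C a e \<omega>) \<Longrightarrow>
      AE \<omega> in M. Yt e \<omega> $ state a e \<omega> \<le> U e \<omega>"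
proof -
  have UV: "S2 M \<F> T U" "H2 M \<F> T V" using sb unfolding switched_bsde_def by auto
  obtain I where I: "ito V I"
    "\<And>e v k. t \<le> e \<Longrightarrow> e < v \<Longrightarrow> v \<le> T \<Longrightarrow> R \<inter> {e<..<v} = {} \<Longrightarrow>
      AE \<omega> in M. \<omega> \<in> {\<omega>\<in>space M. state a e \<omega> = k} \<longrightarrow> (\<forall>u\<in>{e..<v}.
        U u \<omega> = (U v \<omega> - (cum_cost T C a v \<omega> - cum_cost T C a e \<omega>))
          + (LINT s:{u..v}|lborel. drv k U V s \<omega>) - (I v \<omega> - I u \<omega>))"
    using switched_cell[OF a t sb] by blast
  obtain J where J: "\<And>k. ito (\<lambda>t \<omega>. Z t \<omega> $ k) (J k)"
    "\<And>j t k A. j < \<kappa> \<Longrightarrow> 0 \<le> t \<Longrightarrow> t < r (Suc j) \<Longrightarrow>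
      AE \<omega> in M. \<omega> \<in> A \<longrightarrow> (\<forall>u\<in>{max t (r j)..<r (Suc j)}. Yt u \<omega> $ k = Y (r (Suc j)) \<omega> $ k
       + (LINT s:{u..r (Suc j)}|lborel. drv k (\<lambda>s \<omega>. Yt s \<omega> $ k) (\<lambda>s \<omega>. Z s \<omega> $ k) s \<omega>)
       - (J k (r (Suc j)) \<omega> - J k u \<omega>))"
    using Yt_cell by blast
  note c = cell_facts[OF j(1) t(1) j(2), folded e_def v_def]
  have A: "{\<omega>\<in>space M. state a e \<omega> = k} \<in> sets (\<F> e)" for k
    using state_event[OF a t(1) c(1)] c(8) by auto
  note EU = I(2)[OF c(1,3,4,5)] and EY = J(2)[OF j(1) t(1) j(2), folded e_def v_def]
  show "AE \<omega> in M. U e \<omega> \<le> Yt e \<omega> $ state a e \<omega>"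
    if le: "AE \<omega> in M. U v \<omega> - (cum_cost T C a v \<omega> - cum_cost T C a e \<omega>) \<le> Y v \<omega> $ state a e \<omega>"
  proof (rule AE_by_state, rule cell_comparison[OF UV I(1) Yt_S2 Z_H2 J(1) c(2,3,4) A EU EY])
    show "AE \<omega> in M. \<omega> \<in> {\<omega>\<in>space M. state a e \<omega> = k} \<longrightarrow>
        U v \<omega> - (cum_cost T C a v \<omega> - cum_cost T C a e \<omega>) \<le> Y v \<omega> $ k" for k
      using le by eventually_elim auto
  qed
  show "AE \<omega> in M. Yt e \<omega> $ state a e \<omega> \<le> U e \<omega>"
    if ge: "AE \<omega> in M. Y v \<omega> $ state a e \<omega> \<le> U v \<omega> - (cum_cost T C a v \<omega> - cum_cost T C a e \<omega>)"
  proof (rule AE_by_state, rule cell_comparison[OF Yt_S2 Z_H2 J(1) UV I(1) c(2,3,4) A EY EU])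
    show "AE \<omega> in M. \<omega> \<in> {\<omega>\<in>space M. state a e \<omega> = k} \<longrightarrow>
        Y v \<omega> $ k \<le> U v \<omega> - (cum_cost T C a v \<omega> - cum_cost T C a e \<omega>)" for k
      using ge by eventually_elim auto
  qed
qed

lemma domination:
  assumes a: "a \<in> admissible M \<F> T R C t i" and t: "0 \<le> t" "t \<le> T"
    and sb: "switched_bsde M \<F> T W C F \<xi> t a U V"
  shows "AE \<omega> in M. U t \<omega> \<le> Yt t \<omega> $ i"
proof -
  have "AE \<omega> in M. U t \<omega> \<le> Yt t \<omega> $ state a t \<omega>"
  proof (rule backward_cells[OF t])
    show "AE \<omega> in M. U T \<omega> \<le> Yt T \<omega> $ state a T \<omega>"
      using switched_terminal[OF a t(2) sb] by eventually_elim simp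
    fix j assume j: "j < \<kappa>" "t < r (Suc j)"
      and IH: "AE \<omega> in M. U (r (Suc j)) \<omega> \<le> Yt (r (Suc j)) \<omega> $ state a (r (Suc j)) \<omega>"
    note c = cell_facts[OF j(1) t(1) j(2)]
    let ?e = "max t (r j)" and ?v = "r (Suc j)"
    show "AE \<omega> in M. U ?e \<omega> \<le> Yt ?e \<omega> $ state a ?e \<omega>"
    proof (rule cell_step(1)[OF a t sb j])
      show "AE \<omega> in M. U ?v \<omega> - (cum_cost T C a ?v \<omega> - cum_cost T C a ?e \<omega>) \<le> Y ?v \<omega> $ state a ?e \<omega>"
        using IH admissible_regular[OF a] cost_facts Y_eq
      proof eventually_elim
        case (elim \<omega>)
        have v: "?v \<in> {0..T}" using c by auto
        \<comment> \<open>The left limit of U is at most \<open>Yt\<close> in the new mode minus the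
          direct switching cost, and that is one of the candidates in the maximum defining
          \<open>Y\<close> in the old mode.\<close>
        have "C ?v \<omega> $ state a ?e \<omega> $ state a ?v \<omega> \<le> cum_cost T C a ?v \<omega> - cum_cost T C a ?e \<omega>"
          by (rule cost_jump_ge[OF elim(2) c(1,3,4,5)]) (use elim(3) v in auto)
        moreover have "Yt ?v \<omega> $ state a ?v \<omega> - C ?v \<omega> $ state a ?e \<omega> $ state a ?v \<omega> \<le> Y ?v \<omega> $ state a ?e \<omega>"
          unfolding elim(4)[rule_format, OF j(1)] by (intro Max_ge) auto
        ultimately show ?case using elim(1) by simp
      qed
    qed
  qed
  moreover have "AE \<omega> in M. state a t \<omega> = i" using a unfolding admissible_def by auto
  ultimately show ?thesis by eventually_elim simp
qed

text \<open>\<open>opt\<close> says that at every reflection time the strategy realises the maximum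
  in the reflection. The left limits then compare in the opposite direction as well, and so does the
  whole backward induction.\<close>

lemma attainment:
  assumes a: "a \<in> admissible M \<F> T R C t i" and t: "0 \<le> t" "t \<le> T"
    and sb: "switched_bsde M \<F> T W C F \<xi> t a U V"
    and opt: "\<And>j. j < \<kappa> \<Longrightarrow> t < r (Suc j) \<Longrightarrow> AE \<omega> in M. Y (r (Suc j)) \<omega> $ state a (max t (r j)) \<omega> =
       Yt (r (Suc j)) \<omega> $ state a (r (Suc j)) \<omega> - (cum_cost T C a (r (Suc j)) \<omega> - cum_cost T C a (max t (r j)) \<omega>)"
  shows "AE \<omega> in M. Yt t \<omega> $ i \<le> U t \<omega>"
proof -
  have "AE \<omega> in M. Yt t \<omega> $ state a t \<omega> \<le> U t \<omega>"
  proof (rule backward_cells[OF t])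
    show "AE \<omega> in M. Yt T \<omega> $ state a T \<omega> \<le> U T \<omega>"
      using switched_terminal[OF a t(2) sb] by eventually_elim simp
    fix j assume j: "j < \<kappa>" "t < r (Suc j)"
      and IH: "AE \<omega> in M. Yt (r (Suc j)) \<omega> $ state a (r (Suc j)) \<omega> \<le> U (r (Suc j)) \<omega>"
    show "AE \<omega> in M. Yt (max t (r j)) \<omega> $ state a (max t (r j)) \<omega> \<le> U (max t (r j)) \<omega>"
      by (rule cell_step(2)[OF a t sb j]) (use IH opt[OF j] in eventually_elim; simp)
  qed
  moreover have "AE \<omega> in M. state a t \<omega> = i" using a unfolding admissible_def by auto
  ultimately show ?thesis by eventually_elim simp
qed

end

section \<open>The optimal strategy\<close>

text \<open>Over a nonempty finite set the supremum is attained; over the empty set it is minus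
  infinity. Either way the switching criterion becomes the existence of a mode.\<close>

lemma ereal_le_SUP_finite:
  fixes f :: "'a \<Rightarrow> real"
  assumes "finite A"
  shows "ereal x \<le> (SUP m\<in>A. ereal (f m)) \<longleftrightarrow> (\<exists>m\<in>A. x \<le> f m)"
proof
  assume le: "ereal x \<le> (SUP m\<in>A. ereal (f m))"
  show "\<exists>m\<in>A. x \<le> f m"
  proof (cases "A = {}")
    case True
    then show ?thesis using le by (simp add: bot_ereal_def)
  next
    case False
    have "(SUP m\<in>A. ereal (f m)) = Max ((\<lambda>m. ereal (f m)) ` A)"
      using assms False by (intro cSup_eq_Max) auto
    then have "(SUP m\<in>A. ereal (f m)) \<in> (\<lambda>m. ereal (f m)) ` A"
      using assms False by (metis Max_in finite_imageI image_is_empty)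
    then show ?thesis using le by auto
  qed
next
  assume "\<exists>m\<in>A. x \<le> f m"
  then show "ereal x \<le> (SUP m\<in>A. ereal (f m))" by (auto intro: SUP_upper2)
qed

context switching_bsde
begin

text \<open>Together with \<open>best\<close> (the maximisers among the other modes) and
  \<open>trigger\<close> (the times that qualify for the next switch), this restates the recursion
  of the optimal strategy through finite sets and their minima.\<close>

definition better :: "real \<Rightarrow> ('d::{finite,linorder}) \<Rightarrow> 'w \<Rightarrow> ('d::{finite,linorder}) set" where
  "better \<rho> k \<omega> = {m. m \<noteq> k \<and> Yt \<rho> \<omega> $ k \<le> Yt \<rho> \<omega> $ m - C \<rho> \<omega> $ k $ m}"

definition best :: "real \<Rightarrow> ('d::{finite,linorder}) \<Rightarrow> 'w \<Rightarrow> ('d::{finite,linorder}) set" where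
  "best \<rho> k \<omega> = {l. l \<noteq> k \<and> (\<forall>m. m \<noteq> k \<longrightarrow> Yt \<rho> \<omega> $ m - C \<rho> \<omega> $ k $ m \<le> Yt \<rho> \<omega> $ l - C \<rho> \<omega> $ k $ l)}"

definition trigger :: "real \<Rightarrow> ereal \<Rightarrow> ('d::{finite,linorder}) \<Rightarrow> 'w \<Rightarrow> real set" where
  "trigger t \<theta> k \<omega> = {\<rho>\<in>R. \<theta> \<le> ereal \<rho> \<and> t < \<rho> \<and> better \<rho> k \<omega> \<noteq> {}}"

text \<open>The grid is finite, so the infimum is a minimum if some time qualifies and infinity
  otherwise.\<close>

lemma opt_pair_Suc:
  fixes t i j \<omega>
  defines "\<theta> \<equiv> fst (opt_pair T R C Yt t i j \<omega>)" and "\<alpha> \<equiv> snd (opt_pair T R C Yt t i j \<omega>)"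
  shows "trigger t \<theta> \<alpha> \<omega> = {} \<Longrightarrow> opt_pair T R C Yt t i (Suc j) \<omega> = (\<infinity>, \<alpha>)"
    and "trigger t \<theta> \<alpha> \<omega> \<noteq> {} \<Longrightarrow> opt_pair T R C Yt t i (Suc j) \<omega> =
       (ereal (Min (trigger t \<theta> \<alpha> \<omega>)), Min (best (Min (trigger t \<theta> \<alpha> \<omega>)) \<alpha> \<omega>))"
proof -
  have eq: "opt_pair T R C Yt t i j \<omega> = (\<theta>, \<alpha>)" by (simp add: \<theta>_def \<alpha>_def)
  have RT: "s \<le> T" if "s \<in> R" for s using R_facts(1) that by auto
  have B: "ereal (Yt s \<omega> $ \<alpha>) \<le> (SUP k\<in>- {\<alpha>}. ereal (Yt s \<omega> $ k - C s \<omega> $ \<alpha> $ k)) \<longleftrightarrow> better s \<alpha> \<omega> \<noteq> {}" for s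
    unfolding better_def by (subst ereal_le_SUP_finite, simp) blast
  have "{ereal s | s. s \<in> R \<and> \<theta> \<le> ereal s \<and> s \<le> T \<and> t < s \<and>
          ereal (Yt s \<omega> $ \<alpha>) \<le> (SUP k\<in>- {\<alpha>}. ereal (Yt s \<omega> $ k - C s \<omega> $ \<alpha> $ k))}
      = ereal ` trigger t \<theta> \<alpha> \<omega>"
    unfolding B trigger_def using RT by auto
  note step = opt_pair.simps(2)[of T R C Yt t i j \<omega>, unfolded eq prod.case this Let_def]
  show "opt_pair T R C Yt t i (Suc j) \<omega> = (\<infinity>, \<alpha>)" if "trigger t \<theta> \<alpha> \<omega> = {}"
    unfolding step that by (simp add: top_ereal_def)
  show "opt_pair T R C Yt t i (Suc j) \<omega> =
       (ereal (Min (trigger t \<theta> \<alpha> \<omega>)), Min (best (Min (trigger t \<theta> \<alpha> \<omega>)) \<alpha> \<omega>))"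
    if ne: "trigger t \<theta> \<alpha> \<omega> \<noteq> {}"
  proof -
    have fin: "finite (trigger t \<theta> \<alpha> \<omega>)" using R_facts(3) unfolding trigger_def by auto
    define \<rho> where "\<rho> = Min (trigger t \<theta> \<alpha> \<omega>)"
    have \<rho>: "\<rho> \<in> trigger t \<theta> \<alpha> \<omega>" "\<And>s. s \<in> trigger t \<theta> \<alpha> \<omega> \<Longrightarrow> \<rho> \<le> s"
      using fin ne by (auto simp: \<rho>_def)
    have inf: "Inf (ereal ` trigger t \<theta> \<alpha> \<omega>) = ereal \<rho>"
      by (rule Inf_eqI) (use \<rho> in auto)
    let ?f = "\<lambda>m. Yt \<rho> \<omega> $ m - C \<rho> \<omega> $ \<alpha> $ m"
    \<comment> \<open>At a qualifying time some other mode is better, so the maximum over the other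
      modes is over a nonempty set.\<close>
    have "- {\<alpha>} \<noteq> {}" using \<rho>(1) by (auto simp: trigger_def better_def)
    then have "?f l = (MAX k\<in>- {\<alpha>}. ?f k) \<longleftrightarrow> (\<forall>m\<in>- {\<alpha>}. ?f m \<le> ?f l)" if "l \<noteq> \<alpha>" for l
      using that by (subst eq_commute, subst Max_eq_iff) auto
    then have "{l. l \<noteq> \<alpha> \<and> ?f l = (MAX k\<in>- {\<alpha>}. ?f k)} = best \<rho> \<alpha> \<omega>" unfolding best_def by auto
    then show ?thesis unfolding step inf \<rho>_def[symmetric] by simp
  qed
qed

context
  fixes t :: real and i :: "'d::{finite,linorder}"
  assumes t: "0 \<le> t" "t \<le> T"
begin

definition opt_time :: "nat \<Rightarrow> 'w \<Rightarrow> ereal" where "opt_time j \<omega> = fst (opt_pair T R C Yt t i j \<omega>)"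
definition opt_mode :: "nat \<Rightarrow> 'w \<Rightarrow> ('d::{finite,linorder})" where "opt_mode j \<omega> = snd (opt_pair T R C Yt t i j \<omega>)"

lemma opt_strategy_eq: "opt_strategy T R C Yt t i = (opt_time, opt_mode)"
  by (simp add: opt_strategy_def opt_time_def[abs_def] opt_mode_def[abs_def])

lemma opt_0: "opt_time 0 \<omega> = ereal t" "opt_mode 0 \<omega> = i"
  by (auto simp: opt_time_def opt_mode_def)

abbreviation "trig j \<omega> \<equiv> trigger t (opt_time j \<omega>) (opt_mode j \<omega>) \<omega>"

lemma finite_trig: "finite (trig j \<omega>)"
  using R_facts(3) unfolding trigger_def by auto

lemma opt_Suc:
  "trig j \<omega> = {} \<Longrightarrow> opt_time (Suc j) \<omega> = \<infinity>" "trig j \<omega> = {} \<Longrightarrow> opt_mode (Suc j) \<omega> = opt_mode j \<omega>"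
  "trig j \<omega> \<noteq> {} \<Longrightarrow> opt_time (Suc j) \<omega> = ereal (Min (trig j \<omega>))"
  "trig j \<omega> \<noteq> {} \<Longrightarrow> opt_mode (Suc j) \<omega> = Min (best (Min (trig j \<omega>)) (opt_mode j \<omega>) \<omega>)"
  using opt_pair_Suc[of t i j \<omega>] unfolding opt_time_def opt_mode_def by auto

text \<open>A finite next time certifies that some time qualified. The maximisers then exist, so the
  minimum taken over them is one of them.\<close>

lemma opt_Suc_real:
  assumes "opt_time (Suc j) \<omega> = ereal \<rho>"
  shows "\<rho> \<in> trig j \<omega>" "\<rho> = Min (trig j \<omega>)" "opt_mode (Suc j) \<omega> \<in> best \<rho> (opt_mode j \<omega>) \<omega>"
    "opt_mode (Suc j) \<omega> = Min (best \<rho> (opt_mode j \<omega>) \<omega>)"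
proof -
  have ne: "trig j \<omega> \<noteq> {}" using opt_Suc(1)[of j \<omega>] assms by auto
  then show \<rho>: "\<rho> = Min (trig j \<omega>)" using opt_Suc(3)[OF ne] assms by simp
  then show "\<rho> \<in> trig j \<omega>" using Min_in[OF finite_trig ne] by simp
  then have nb: "- {opt_mode j \<omega>} \<noteq> {}" by (auto simp: trigger_def better_def)
  let ?f = "\<lambda>m. Yt \<rho> \<omega> $ m - C \<rho> \<omega> $ opt_mode j \<omega> $ m"
  have "Max (?f ` (- {opt_mode j \<omega>})) \<in> ?f ` (- {opt_mode j \<omega>})" using nb by (intro Max_in) auto
  then obtain l where "Max (?f ` (- {opt_mode j \<omega>})) = ?f l" "l \<in> - {opt_mode j \<omega>}" by (rule imageE)
  then have l: "l \<noteq> opt_mode j \<omega>" "?f l = Max (?f ` (- {opt_mode j \<omega>}))" by auto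
  have "l \<in> best \<rho> (opt_mode j \<omega>) \<omega>" unfolding best_def
  proof (intro CollectI conjI allI impI l(1))
    fix m assume "m \<noteq> opt_mode j \<omega>"
    then show "?f m \<le> ?f l" unfolding l(2) by (intro Max_ge) auto
  qed
  then have "best \<rho> (opt_mode j \<omega>) \<omega> \<noteq> {}" by auto
  moreover show "opt_mode (Suc j) \<omega> = Min (best \<rho> (opt_mode j \<omega>) \<omega>)" using opt_Suc(4)[OF ne] \<rho> by simp
  ultimately show "opt_mode (Suc j) \<omega> \<in> best \<rho> (opt_mode j \<omega>) \<omega>" using Min_in[of "best \<rho> (opt_mode j \<omega>) \<omega>"] by simp
qed

lemma opt_mono: "opt_time j \<omega> \<le> opt_time (Suc j) \<omega>"
proof (cases "trig j \<omega> = {}")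
  case False
  then have "Min (trig j \<omega>) \<in> trig j \<omega>" using Min_in[OF finite_trig] by blast
  then show ?thesis using opt_Suc(3)[OF False] by (simp add: trigger_def)
qed (simp add: opt_Suc)

lemma opt_Suc_cases:
  obtains "opt_time (Suc j) \<omega> = \<infinity>" "trig j \<omega> = {}" "opt_mode (Suc j) \<omega> = opt_mode j \<omega>"
  | \<rho> where "opt_time (Suc j) \<omega> = ereal \<rho>" "\<rho> \<in> R" "t < \<rho>" "opt_time j \<omega> \<le> ereal \<rho>"
proof (cases "trig j \<omega> = {}")
  case True
  then show ?thesis using that(1) opt_Suc by blast
next
  case False
  have "Min (trig j \<omega>) \<in> trig j \<omega>" using Min_in[OF finite_trig False] .
  then show ?thesis using that(2)[OF opt_Suc(3)[OF False]] by (auto simp: trigger_def)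
qed

text \<open>By the strict triangle inequality for the costs, the mode chosen at a switch is not left at
  the same time.\<close>

lemma opt_strict:
  "AE \<omega> in M. \<forall>j \<rho>. opt_time (Suc j) \<omega> = ereal \<rho> \<longrightarrow> ereal \<rho> < opt_time (Suc (Suc j)) \<omega>"
  using cost_facts
proof eventually_elim
  case (elim \<omega>)
  show ?case
  proof (intro allI impI, rule ccontr)
    fix j \<rho> assume \<rho>: "opt_time (Suc j) \<omega> = ereal \<rho>" and n: "\<not> ereal \<rho> < opt_time (Suc (Suc j)) \<omega>"
    have eq: "opt_time (Suc (Suc j)) \<omega> = ereal \<rho>" using n opt_mono[of "Suc j" \<omega>] \<rho> by simp
    let ?k = "opt_mode j \<omega>" and ?l = "opt_mode (Suc j) \<omega>"
    note 1 = opt_Suc_real[OF \<rho>] and 2 = opt_Suc_real[OF eq]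
    have \<rho>T: "\<rho> \<in> {0..T}" using 1(1) R_facts(1) by (auto simp: trigger_def)
    have c: "0 < C \<rho> \<omega> $ i $ j" if "i \<noteq> j" for i j using elim \<rho>T that by blast
    have tr: "C \<rho> \<omega> $ i $ l < C \<rho> \<omega> $ i $ j + C \<rho> \<omega> $ j $ l" if "i \<noteq> j" "j \<noteq> l" for i j l
      using elim \<rho>T that by blast
    obtain k' where k': "k' \<noteq> ?k" "Yt \<rho> \<omega> $ ?k \<le> Yt \<rho> \<omega> $ k' - C \<rho> \<omega> $ ?k $ k'"
      using 1(1) by (auto simp: trigger_def better_def)
    have l: "?l \<noteq> ?k" "\<And>m. m \<noteq> ?k \<Longrightarrow> Yt \<rho> \<omega> $ m - C \<rho> \<omega> $ ?k $ m \<le> Yt \<rho> \<omega> $ ?l - C \<rho> \<omega> $ ?k $ ?l"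
      using 1(3) by (auto simp: best_def)
    obtain m where m: "m \<noteq> ?l" "Yt \<rho> \<omega> $ ?l \<le> Yt \<rho> \<omega> $ m - C \<rho> \<omega> $ ?l $ m"
      using 2(1) by (auto simp: trigger_def better_def)
    show False
    proof (cases "m = ?k")
      \<comment> \<open>Switching from k to l was no loss, and straight back would be no loss
        either, although the round trip has positive cost.\<close>
      case True
      have "Yt \<rho> \<omega> $ ?k \<le> Yt \<rho> \<omega> $ ?l - C \<rho> \<omega> $ ?k $ ?l" using k' l(2)[OF k'(1)] by linarith
      then show False using m True c[of ?k ?l] c[of ?l ?k] l(1) by auto
    next
      \<comment> \<open>By the strict triangle inequality, going from k to m directly would have
        beaten l, against the maximality of l.\<close>
      case False
      then show False using l(2)[OF False] m tr[of ?k ?l m] l(1) by auto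
    qed
  qed
qed

text \<open>Strictly increasing switching times inject the switches into the grid. The resulting
  uniform bound, more than mere finiteness, is what controls the second moment of the cost.\<close>

lemma opt_switches:
  "AE \<omega> in M. finite (switches T (opt_time, opt_mode) \<omega>) \<and> card (switches T (opt_time, opt_mode) \<omega>) \<le> card R \<and>
     (\<forall>j\<in>switches T (opt_time, opt_mode) \<omega>. opt_time j \<omega> \<in> ereal ` R)"
  using opt_strict
proof eventually_elim
  case (elim \<omega>)
  let ?S = "switches T (opt_time, opt_mode) \<omega>"
  have R: "opt_time j \<omega> \<in> ereal ` R" if "j \<in> ?S" for j
  proof -
    have "j \<noteq> 0" using that by (auto simp: switches_def)
    then obtain j' where j': "j = Suc j'" using not0_implies_Suc by blast
    show ?thesis using that unfolding j' by (cases rule: opt_Suc_cases[of j' \<omega>]) (auto simp: switches_def)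
  qed
  have mono: "opt_time j \<omega> \<le> opt_time k \<omega>" if "j \<le> k" for j k
    using that opt_mono by (rule lift_Suc_mono_le[of "\<lambda>j. opt_time j \<omega>" j k, rotated])
  have lt: "opt_time j \<omega> < opt_time k \<omega>" if jk: "j < k" and jS: "j \<in> ?S" for j k
  proof -
    have "j \<noteq> 0" using jS by (auto simp: switches_def)
    then obtain j' where j': "j = Suc j'" using not0_implies_Suc by blast
    obtain \<rho> where "opt_time j \<omega> = ereal \<rho>" using R[OF jS] by auto
    then have "opt_time j \<omega> < opt_time (Suc j) \<omega>" using elim unfolding j' by auto
    also have "\<dots> \<le> opt_time k \<omega>" using jk by (intro mono) simp
    finally show ?thesis .
  qed
  have inj: "inj_on (\<lambda>j. opt_time j \<omega>) ?S"
  proof (rule inj_onI, rule ccontr)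
    fix j k assume "j \<in> ?S" "k \<in> ?S" "opt_time j \<omega> = opt_time k \<omega>" "j \<noteq> k"
    then show False using lt[of j k] lt[of k j] by (metis less_irrefl linorder_neqE_nat)
  qed
  have img: "(\<lambda>j. opt_time j \<omega>) ` ?S \<subseteq> ereal ` R" using R by auto
  have fin: "finite (ereal ` R)" using R_facts(3) by simp
  have "finite ?S" using finite_subset[OF img fin] inj by (rule finite_imageD)
  moreover have "card ?S \<le> card (ereal ` R)" using card_inj_on_le[OF inj img fin] .
  moreover have "card (ereal ` R) \<le> card R" by (rule card_image_le[OF R_facts(3)])
  ultimately show ?case using R by auto
qed

lemma opt_regular: "AE \<omega> in M. regular_path T R t (opt_time, opt_mode) \<omega>"
  using opt_switches by eventually_elim (auto simp: regular_path_def opt_mono opt_0)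

lemma Yt_measurable: "\<rho> \<in> {0..T} \<Longrightarrow> (\<lambda>\<omega>. Yt \<rho> \<omega> $ k) \<in> borel_measurable (\<F> \<rho>)"
  using progressive_at[OF S2_progressive[OF Yt_S2]] .

lemma C_measurable: "\<rho> \<in> {0..T} \<Longrightarrow> (\<lambda>\<omega>. C \<rho> \<omega> $ k $ l) \<in> borel_measurable (\<F> \<rho>)"
proof -
  have "S2 M \<F> T (\<lambda>t \<omega>. C t \<omega> $ k $ l)" using cost unfolding cost_process_def by blast
  then show "\<rho> \<in> {0..T} \<Longrightarrow> (\<lambda>\<omega>. C \<rho> \<omega> $ k $ l) \<in> borel_measurable (\<F> \<rho>)"
    using progressive_at[OF S2_progressive] by blast
qed

lemma better_event: "\<rho> \<in> {0..T} \<Longrightarrow> {\<omega>\<in>space M. better \<rho> k \<omega> \<noteq> {}} \<in> sets (\<F> \<rho>)"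
proof -
  assume \<rho>: "\<rho> \<in> {0..T}"
  note [measurable] = Yt_measurable[OF \<rho>] C_measurable[OF \<rho>]
  have "{\<omega>\<in>space (\<F> \<rho>). Yt \<rho> \<omega> $ k \<le> Yt \<rho> \<omega> $ m - C \<rho> \<omega> $ k $ m} \<in> sets (\<F> \<rho>)" for m by measurable
  then have "(\<Union>m\<in>- {k}. {\<omega>\<in>space M. Yt \<rho> \<omega> $ k \<le> Yt \<rho> \<omega> $ m - C \<rho> \<omega> $ k $ m}) \<in> sets (\<F> \<rho>)"
    by (intro sets.finite_UN) auto
  moreover have "{\<omega>\<in>space M. better \<rho> k \<omega> \<noteq> {}} = (\<Union>m\<in>- {k}. {\<omega>\<in>space M. Yt \<rho> \<omega> $ k \<le> Yt \<rho> \<omega> $ m - C \<rho> \<omega> $ k $ m})"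
    by (auto simp: better_def)
  ultimately show ?thesis by simp
qed

text \<open>The set of maximisers has finitely many possible values, and each value is taken on an
  event.\<close>

lemma best_event: "\<rho> \<in> {0..T} \<Longrightarrow> {\<omega>\<in>space M. Min (best \<rho> k \<omega>) = l} \<in> sets (\<F> \<rho>)"
proof -
  assume \<rho>: "\<rho> \<in> {0..T}"
  note [measurable] = Yt_measurable[OF \<rho>] C_measurable[OF \<rho>]
  have m: "{\<omega>\<in>space M. x \<in> best \<rho> k \<omega>} \<in> sets (\<F> \<rho>)" for x
  proof (cases "x = k")
    case False
    have "{\<omega>\<in>space (\<F> \<rho>). \<forall>m\<in>- {k}. Yt \<rho> \<omega> $ m - C \<rho> \<omega> $ k $ m \<le> Yt \<rho> \<omega> $ x - C \<rho> \<omega> $ k $ x} \<in> sets (\<F> \<rho>)"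
    proof (intro sets.sets_Collect_finite_All)
      fix m
      show "{\<omega>\<in>space (\<F> \<rho>). Yt \<rho> \<omega> $ m - C \<rho> \<omega> $ k $ m \<le> Yt \<rho> \<omega> $ x - C \<rho> \<omega> $ k $ x} \<in> sets (\<F> \<rho>)"
        by measurable
    qed simp
    moreover have "{\<omega>\<in>space M. x \<in> best \<rho> k \<omega>} = {\<omega>\<in>space (\<F> \<rho>). \<forall>m\<in>- {k}. Yt \<rho> \<omega> $ m - C \<rho> \<omega> $ k $ m \<le> Yt \<rho> \<omega> $ x - C \<rho> \<omega> $ k $ x}"
      using False by (auto simp: best_def)
    ultimately show ?thesis by simp
  qed (simp add: best_def)
  have "{\<omega>\<in>space M. best \<rho> k \<omega> = S} \<in> sets (\<F> \<rho>)" for S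
  proof -
    have "{\<omega>\<in>space (\<F> \<rho>). \<forall>x\<in>UNIV. x \<in> best \<rho> k \<omega> \<longleftrightarrow> x \<in> S} \<in> sets (\<F> \<rho>)"
    proof (intro sets.sets_Collect_finite_All)
      fix x
      show "{\<omega>\<in>space (\<F> \<rho>). x \<in> best \<rho> k \<omega> \<longleftrightarrow> x \<in> S} \<in> sets (\<F> \<rho>)"
      proof (cases "x \<in> S")
        case False
        then have "{\<omega>\<in>space (\<F> \<rho>). x \<in> best \<rho> k \<omega> \<longleftrightarrow> x \<in> S} = space (\<F> \<rho>) - {\<omega>\<in>space M. x \<in> best \<rho> k \<omega>}" by auto
        then show ?thesis using sets.compl_sets[OF m[of x]] by simp
      qed (use m[of x] in simp)
    qed simp
    moreover have "{\<omega>\<in>space M. best \<rho> k \<omega> = S} = {\<omega>\<in>space (\<F> \<rho>). \<forall>x\<in>UNIV. x \<in> best \<rho> k \<omega> \<longleftrightarrow> x \<in> S}" by auto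
    ultimately show ?thesis by simp
  qed
  then have "(\<Union>S\<in>{S. Min S = l}. {\<omega>\<in>space M. best \<rho> k \<omega> = S}) \<in> sets (\<F> \<rho>)"
    by (intro sets.finite_UN) auto
  moreover have "{\<omega>\<in>space M. Min (best \<rho> k \<omega>) = l} = (\<Union>S\<in>{S. Min S = l}. {\<omega>\<in>space M. best \<rho> k \<omega> = S})" by auto
  ultimately show ?thesis by simp
qed

text \<open>Time and mode go through the induction jointly, since the next time depends on the
  current mode. These events yield at once the stopping time property and the measurability of the
  mode at that time.\<close>

lemma opt_event: "{\<omega>\<in>space M. opt_time j \<omega> \<le> s \<and> opt_mode j \<omega> = k} \<in> sets (extend_filtration T \<F> s)"
proof (induction j arbitrary: s k)
  case 0
  have "space M \<in> sets (extend_filtration T \<F> s)"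
    using sets.top[of "extend_filtration T \<F> s"] by (simp add: extend_filtration_def)
  then show ?case unfolding opt_0 by (cases "ereal t \<le> s \<and> i = k") simp_all
next
  case (Suc j)
  interpret ef: filtration "space M" "extend_filtration T \<F>" by (rule filtration_extend)
  have RT: "\<rho> \<in> {0..T}" if "\<rho> \<in> R" for \<rho> using that R_facts(1) by auto
  \<comment> \<open>The time \<rho> qualifies in mode k, without necessarily being the first to do
    so.\<close>
  define E where "E = (\<lambda>\<rho> k. {\<omega>\<in>space M. opt_mode j \<omega> = k \<and> \<rho> \<in> trig j \<omega>})"
  have E: "E \<rho> k \<in> sets (\<F> \<rho>)" if \<rho>: "\<rho> \<in> R" for \<rho> k
  proof (cases "t < \<rho>")
    case True
    have "{\<omega>\<in>space M. opt_time j \<omega> \<le> ereal \<rho> \<and> opt_mode j \<omega> = k} \<in> sets (\<F> \<rho>)"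
      using Suc.IH[of "ereal \<rho>" k] extend_filtration_real[OF RT[OF \<rho>]] by simp
    from sets.Int[OF this better_event[OF RT[OF \<rho>], of k]]
    have "{\<omega>\<in>space M. opt_time j \<omega> \<le> ereal \<rho> \<and> opt_mode j \<omega> = k} \<inter> {\<omega>\<in>space M. better \<rho> k \<omega> \<noteq> {}} \<in> sets (\<F> \<rho>)" .
    moreover have "E \<rho> k = {\<omega>\<in>space M. opt_time j \<omega> \<le> ereal \<rho> \<and> opt_mode j \<omega> = k} \<inter> {\<omega>\<in>space M. better \<rho> k \<omega> \<noteq> {}}"
      using True \<rho> by (auto simp: E_def trigger_def)
    ultimately show ?thesis by simp
  next
    case False
    then have "E \<rho> k = {}" by (auto simp: E_def trigger_def)
    then show ?thesis by simp
  qed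
  \<comment> \<open>Removing the earlier qualifying grid points leaves the event that \<rho> is the
    next switching time.\<close>
  define G where "G = (\<lambda>\<rho> k. E \<rho> k - (\<Union>\<rho>'\<in>{\<rho>'\<in>R. \<rho>' < \<rho>}. E \<rho>' k))"
  have G: "G \<rho> k \<in> sets (\<F> \<rho>)" if \<rho>: "\<rho> \<in> R" for \<rho> k
    unfolding G_def
  proof (intro sets.Diff E \<rho> sets.finite_UN)
    fix \<rho>' assume "\<rho>' \<in> {\<rho>'\<in>R. \<rho>' < \<rho>}"
    then show "E \<rho>' k \<in> sets (\<F> \<rho>)" using E[of \<rho>' k] filt_mono[of \<rho>' \<rho>] by auto
  qed (use R_facts(3) in auto)
  have G_iff: "\<omega> \<in> G \<rho> k \<longleftrightarrow> \<omega> \<in> space M \<and> opt_mode j \<omega> = k \<and> opt_time (Suc j) \<omega> = ereal \<rho>" if "\<rho> \<in> R" for \<omega> \<rho> k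
  proof -
    have "opt_time (Suc j) \<omega> = ereal \<rho> \<longleftrightarrow> \<rho> \<in> trig j \<omega> \<and> (\<forall>\<rho>'\<in>R. \<rho>' < \<rho> \<longrightarrow> \<rho>' \<notin> trig j \<omega>)"
    proof
      assume "opt_time (Suc j) \<omega> = ereal \<rho>"
      note 1 = opt_Suc_real[OF this]
      show "\<rho> \<in> trig j \<omega> \<and> (\<forall>\<rho>'\<in>R. \<rho>' < \<rho> \<longrightarrow> \<rho>' \<notin> trig j \<omega>)"
        using 1(1) Min_le[OF finite_trig, of _ j \<omega>] unfolding 1(2)[symmetric] by (auto dest: leD)
    next
      assume a: "\<rho> \<in> trig j \<omega> \<and> (\<forall>\<rho>'\<in>R. \<rho>' < \<rho> \<longrightarrow> \<rho>' \<notin> trig j \<omega>)"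
      then have "Min (trig j \<omega>) = \<rho>"
        by (intro Min_eqI finite_trig) (auto simp: trigger_def not_less[symmetric])
      then show "opt_time (Suc j) \<omega> = ereal \<rho>" using a opt_Suc(3)[of j \<omega>] by auto
    qed
    then show ?thesis unfolding G_def E_def by auto
  qed
  define H where "H = (\<Union>\<rho>\<in>{\<rho>\<in>R. ereal \<rho> \<le> s}. \<Union>k'\<in>UNIV. G \<rho> k' \<inter> {\<omega>\<in>space M. Min (best \<rho> k' \<omega>) = k})"
  have H: "H \<in> sets (extend_filtration T \<F> s)"
    unfolding H_def
  proof (intro sets.finite_UN)
    fix \<rho> k' assume "\<rho> \<in> {\<rho>\<in>R. ereal \<rho> \<le> s}"
    then have \<rho>: "\<rho> \<in> R" "ereal \<rho> \<le> s" by auto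
    have "G \<rho> k' \<inter> {\<omega>\<in>space M. Min (best \<rho> k' \<omega>) = k} \<in> sets (\<F> \<rho>)"
      using G[OF \<rho>(1)] best_event[OF RT[OF \<rho>(1)]] by auto
    then show "G \<rho> k' \<inter> {\<omega>\<in>space M. Min (best \<rho> k' \<omega>) = k} \<in> sets (extend_filtration T \<F> s)"
      using ef.sets_F_mono[OF \<rho>(2)] extend_filtration_real[OF RT[OF \<rho>(1)]] by auto
  qed (use R_facts(3) in auto)
  have H_iff: "\<omega> \<in> H \<longleftrightarrow> \<omega> \<in> space M \<and> (\<exists>\<rho>\<in>R. opt_time (Suc j) \<omega> = ereal \<rho> \<and> ereal \<rho> \<le> s) \<and> opt_mode (Suc j) \<omega> = k" for \<omega>
    unfolding H_def using G_iff opt_Suc_real(4) by auto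
  show ?case
  \<comment> \<open>At s = infinity the paths without a further switch count too; they keep their
    mode and form the extra event \<open>N\<close>.\<close>
  proof (cases "s = \<infinity>")
    case False
    have "{\<omega>\<in>space M. opt_time (Suc j) \<omega> \<le> s \<and> opt_mode (Suc j) \<omega> = k} = H"
    proof (intro set_eqI)
      fix \<omega>
      show "\<omega> \<in> {\<omega>\<in>space M. opt_time (Suc j) \<omega> \<le> s \<and> opt_mode (Suc j) \<omega> = k} \<longleftrightarrow> \<omega> \<in> H"
        unfolding H_iff using False by (cases rule: opt_Suc_cases[of j \<omega>]) auto
    qed
    then show ?thesis using H by simp
  next
    case True
    define N where "N = {\<omega>\<in>space M. opt_time j \<omega> \<le> s \<and> opt_mode j \<omega> = k} - (\<Union>\<rho>\<in>R. E \<rho> k)"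
    have N: "N \<in> sets (extend_filtration T \<F> s)"
      unfolding N_def
    proof (intro sets.Diff Suc.IH sets.finite_UN R_facts(3))
      fix \<rho> assume \<rho>: "\<rho> \<in> R"
      then show "E \<rho> k \<in> sets (extend_filtration T \<F> s)"
        using E[OF \<rho>, of k] ef.sets_F_mono[of "ereal \<rho>" s] extend_filtration_real[OF RT[OF \<rho>]] True by auto
    qed
    have "{\<omega>\<in>space M. opt_time (Suc j) \<omega> \<le> s \<and> opt_mode (Suc j) \<omega> = k} = H \<union> N"
    proof (intro set_eqI)
      fix \<omega>
      show "\<omega> \<in> {\<omega>\<in>space M. opt_time (Suc j) \<omega> \<le> s \<and> opt_mode (Suc j) \<omega> = k} \<longleftrightarrow> \<omega> \<in> H \<union> N"
      proof (cases rule: opt_Suc_cases[of j \<omega>])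
        case 1
        then show ?thesis unfolding Un_iff H_iff using True by (auto simp: N_def E_def)
      next
        case (2 \<rho>)
        have "\<rho> \<in> trig j \<omega>" using opt_Suc_real(1)[OF 2(1)] .
        then have "\<omega> \<notin> N" using 2 by (auto simp: N_def E_def)
        then show ?thesis unfolding Un_iff H_iff using True 2 by auto
      qed
    qed
    then show ?thesis using H N by auto
  qed
qed

lemma opt_strategy_strategy: "strategy M \<F> T (opt_time, opt_mode)"
proof -
  interpret ef: filtration "space M" "extend_filtration T \<F>" by (rule filtration_extend)
  have st: "stopping_time (extend_filtration T \<F>) (opt_time j)" for j
  proof
    fix s
    have "(\<Union>k\<in>UNIV. {\<omega>\<in>space M. opt_time j \<omega> \<le> s \<and> opt_mode j \<omega> = k}) \<in> sets (extend_filtration T \<F> s)"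
      by (intro sets.finite_UN opt_event) auto
    moreover have "(\<Union>k\<in>UNIV. {\<omega>\<in>space M. opt_time j \<omega> \<le> s \<and> opt_mode j \<omega> = k}) = {\<omega>\<in>space M. opt_time j \<omega> \<le> s}" by auto
    ultimately show "Measurable.pred (extend_filtration T \<F> s) (\<lambda>\<omega>. opt_time j \<omega> \<le> s)"
      by (simp add: pred_def ef.space_F)
  qed
  have "opt_mode j \<in> measurable (ef.pre_sigma (opt_time j)) (count_space UNIV)" for j
  proof (subst measurable_count_space_eq2_countable, intro conjI ballI)
    fix k
    show "opt_mode j -` {k} \<inter> space (ef.pre_sigma (opt_time j)) \<in> sets (ef.pre_sigma (opt_time j))"
    proof (rule ef.sets_pre_sigmaI[OF st])
      fix s
      have "{\<omega> \<in> opt_mode j -` {k} \<inter> space (ef.pre_sigma (opt_time j)). opt_time j \<omega> \<le> s} = {\<omega>\<in>space M. opt_time j \<omega> \<le> s \<and> opt_mode j \<omega> = k}"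
        by (auto simp: ef.space_pre_sigma)
      then show "{\<omega> \<in> opt_mode j -` {k} \<inter> space (ef.pre_sigma (opt_time j)). opt_time j \<omega> \<le> s} \<in> sets (extend_filtration T \<F> s)"
        using opt_event by simp
    qed
  qed auto
  then show ?thesis unfolding strategy_def prod.case using st opt_mono by auto
qed

text \<open>The condition \<open>t < s\<close> in \<open>opt_pair\<close> puts the first switch
  strictly after t.\<close>

lemma opt_state_initial: "AE \<omega> in M. state (opt_time, opt_mode) t \<omega> = i"
  using opt_regular
proof eventually_elim
  case (elim \<omega>)
  have "ereal t < opt_time (Suc 0) \<omega>" by (cases rule: opt_Suc_cases[of 0 \<omega>]) auto
  then show ?case using state_eq[OF elim, of 0 t] by (simp add: opt_0)
qed

text \<open>There are at most \<open>card R\<close> switches, each costing at most the square root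
  of \<beta> by condition (C_2); the squared total cost is thus at most the integrable variable
  \<open>(real (card R))\<^sup>2 * \<beta> \<omega>\<close>.\<close>

lemma opt_admissible: "(opt_time, opt_mode) \<in> admissible M \<F> T R C t i"
proof -
  have c: "AE \<omega> in M. 0 < \<beta> \<omega>" "integrable M \<beta>"
    "AE \<omega> in M. ennreal (norm (\<xi> \<omega>) powr 2) + (SUP t\<in>{0..T}. ennreal (norm (C t \<omega>) powr 2))
          + (\<integral>\<^sup>+ s\<in>{0..T}. ennreal (norm (F \<omega> s 0 0) powr 2) \<partial>lborel) \<le> ennreal (\<beta> \<omega>)"
    using cond2 unfolding cond_C_def by auto
  have "(\<integral>\<^sup>+ \<omega>. ennreal (\<bar>cum_cost T C (opt_time, opt_mode) T \<omega>\<bar>\<^sup>2) \<partial>M) \<le> (\<integral>\<^sup>+ \<omega>. ennreal ((real (card R))\<^sup>2 * \<beta> \<omega>) \<partial>M)"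
  proof (rule nn_integral_mono_AE)
    show "AE \<omega> in M. ennreal (\<bar>cum_cost T C (opt_time, opt_mode) T \<omega>\<bar>\<^sup>2) \<le> ennreal ((real (card R))\<^sup>2 * \<beta> \<omega>)"
      using c(1,3) opt_switches
    proof eventually_elim
      case (elim \<omega>)
      have b: "\<bar>C s \<omega> $ k $ l\<bar> \<le> sqrt (\<beta> \<omega>)" if "s \<in> {0..T}" for s k l
      proof -
        have "ennreal (norm (C s \<omega>) powr 2) \<le> (SUP t\<in>{0..T}. ennreal (norm (C t \<omega>) powr 2))"
          by (rule SUP_upper[OF that])
        also have "\<dots> \<le> (SUP t\<in>{0..T}. ennreal (norm (C t \<omega>) powr 2))
            + (ennreal (norm (\<xi> \<omega>) powr 2) + (\<integral>\<^sup>+ s\<in>{0..T}. ennreal (norm (F \<omega> s 0 0) powr 2) \<partial>lborel))"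
          by (rule le_iff_add[THEN iffD2]) blast
        also have "\<dots> \<le> ennreal (\<beta> \<omega>)" using elim(2) by (simp add: ac_simps)
        finally have "(norm (C s \<omega>))\<^sup>2 \<le> \<beta> \<omega>" using elim(1) by (simp add: ennreal_le_iff)
        then have "norm (C s \<omega>) \<le> sqrt (\<beta> \<omega>)" by (rule real_le_rsqrt)
        moreover have "\<bar>C s \<omega> $ k $ l\<bar> \<le> norm (C s \<omega> $ k)" by (rule component_le_norm_cart)
        moreover have "norm (C s \<omega> $ k) \<le> norm (C s \<omega>)" by (rule Finite_Cartesian_Product.norm_nth_le)
        ultimately show ?thesis by linarith
      qed
      let ?S = "{j. j \<in> switches T (opt_time, opt_mode) \<omega> \<and> opt_time j \<omega> \<le> ereal T \<and> T \<le> T}"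
      have sub: "?S \<subseteq> switches T (opt_time, opt_mode) \<omega>" by auto
      have "\<bar>cum_cost T C (opt_time, opt_mode) T \<omega>\<bar> \<le> (\<Sum>j\<in>?S. \<bar>C (real_of_ereal (opt_time j \<omega>)) \<omega> $ opt_mode (j - 1) \<omega> $ opt_mode j \<omega>\<bar>)"
        unfolding cum_cost_def prod.case by (rule sum_abs)
      also have "\<dots> \<le> real (card ?S) * sqrt (\<beta> \<omega>)"
      proof (rule sum_bounded_above)
        fix j assume "j \<in> ?S"
        then obtain \<rho> where "\<rho> \<in> R" "opt_time j \<omega> = ereal \<rho>" using elim(3) by auto
        then show "\<bar>C (real_of_ereal (opt_time j \<omega>)) \<omega> $ opt_mode (j - 1) \<omega> $ opt_mode j \<omega>\<bar> \<le> sqrt (\<beta> \<omega>)"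
          using b R_facts(1) by auto
      qed
      also have "\<dots> \<le> real (card R) * sqrt (\<beta> \<omega>)"
      proof (rule mult_right_mono)
        have "card ?S \<le> card (switches T (opt_time, opt_mode) \<omega>)" using elim(3) sub by (intro card_mono) auto
        then show "real (card ?S) \<le> real (card R)" using elim(3) by linarith
      qed (use elim(1) in simp)
      finally have "\<bar>cum_cost T C (opt_time, opt_mode) T \<omega>\<bar>\<^sup>2 \<le> (real (card R) * sqrt (\<beta> \<omega>))\<^sup>2"
        by (intro power_mono) auto
      also have "\<dots> = (real (card R))\<^sup>2 * \<beta> \<omega>" using elim(1) by (simp add: power_mult_distrib)
      finally show ?case by (rule ennreal_leI)
    qed
  qed
  also have "\<dots> = ennreal (\<integral>\<omega>. (real (card R))\<^sup>2 * \<beta> \<omega> \<partial>M)"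
    using c by (intro nn_integral_eq_integral) auto
  also have "\<dots> < \<infinity>" by simp
  finally have "(\<integral>\<^sup>+ \<omega>. ennreal (\<bar>cum_cost T C (opt_time, opt_mode) T \<omega>\<bar>\<^sup>2) \<partial>M) < \<infinity>" .
  moreover have "AE \<omega> in M. finite (switches T (opt_time, opt_mode) \<omega>)"
    "AE \<omega> in M. \<forall>j\<in>switches T (opt_time, opt_mode) \<omega>. opt_time j \<omega> \<in> ereal ` R"
    using opt_switches by (eventually_elim, auto)+
  moreover have "AE \<omega> in M. opt_time 0 \<omega> = ereal t \<and> opt_mode 0 \<omega> = i" by (simp add: opt_0)
  ultimately show ?thesis
    unfolding admissible_def mem_Collect_eq fst_conv snd_conv
    by (intro conjI opt_strategy_strategy opt_state_initial)
qed

text \<open>The equality case required for attainment: either no mode is better and the reflection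
  is inactive, or the strategy moves to a maximiser of the reflection.\<close>

lemma opt_cell:
  assumes j: "j < \<kappa>" "t < r (Suc j)"
  shows "AE \<omega> in M. Y (r (Suc j)) \<omega> $ state (opt_time, opt_mode) (max t (r j)) \<omega> =
       Yt (r (Suc j)) \<omega> $ state (opt_time, opt_mode) (r (Suc j)) \<omega>
       - (cum_cost T C (opt_time, opt_mode) (r (Suc j)) \<omega> - cum_cost T C (opt_time, opt_mode) (max t (r j)) \<omega>)"
  using opt_regular opt_strict cost_facts Y_eq
proof eventually_elim
  case (elim \<omega>)
  note c = cell_facts[OF j(1) t(1) j(2)]
  let ?e = "max t (r j)" and ?v = "r (Suc j)" and ?a = "(opt_time, opt_mode)"
  have v: "?v \<in> {0..T}" using c by auto
  obtain n where n: "fst ?a n \<omega> \<le> ereal ?e" "ereal ?e < fst ?a (Suc n) \<omega>"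
    using path_index_exists[OF elim(1) c(1)] c(8) by auto
  obtain m where m: "fst ?a m \<omega> \<le> ereal ?v" "ereal ?v < fst ?a (Suc m) \<omega>"
    using path_index_exists[OF elim(1), of ?v] c(4) j(2) by auto
  note jump = cost_jump[OF elim(1) c(1,3,4,5) n m]
  let ?k = "opt_mode n \<omega>"
  have se: "state ?a ?e \<omega> = ?k" "state ?a ?v \<omega> = opt_mode m \<omega>" using state_eq[OF elim(1) n] state_eq[OF elim(1) m] by auto
  have diag: "C ?v \<omega> $ ?k $ ?k = 0" using conjunct1[OF bspec[OF elim(3) v]] by simp
  let ?f = "\<lambda>l. Yt ?v \<omega> $ l - C ?v \<omega> $ ?k $ l"
  have Y: "Y ?v \<omega> $ ?k = (MAX l. ?f l)" using elim(4) j(1) by blast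
  have "m \<le> Suc n"
  proof (rule ccontr)
    assume "\<not> m \<le> Suc n"
    then have "opt_time (Suc n) \<omega> = ereal ?v" "opt_time (Suc (Suc n)) \<omega> = ereal ?v"
      using jump(2)[of "Suc n"] jump(2)[of "Suc (Suc n)"] by auto
    then show False using elim(2) by fastforce
  qed
  then consider "m = n" | "m = Suc n" using jump(1) by linarith
  then show ?case
  proof cases
    case 1
    \<comment> \<open>A better mode at this time would have made the next switch happen no later
      than it.\<close>
    have "better ?v ?k \<omega> = {}"
    proof (rule ccontr)
      assume b: "better ?v ?k \<omega> \<noteq> {}"
      have "opt_time n \<omega> \<le> ereal ?v" using m(1) 1 by simp
      then have "?v \<in> trig n \<omega>" using b c(7) j(2) by (auto simp: trigger_def)
      then have "opt_time (Suc n) \<omega> \<le> ereal ?v" using opt_Suc(3)[of n \<omega>] Min_le[OF finite_trig] by fastforce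
      then show False using m(2) 1 by simp
    qed
    then have lt: "?f l \<le> Yt ?v \<omega> $ ?k" if "l \<noteq> ?k" for l using that by (auto simp: better_def not_le)
    have "(MAX l. ?f l) = Yt ?v \<omega> $ ?k"
    proof (rule Max_eqI)
      fix y assume "y \<in> range ?f"
      then obtain l where "y = ?f l" by auto
      then show "y \<le> Yt ?v \<omega> $ ?k" using lt[of l] diag by (cases "l = ?k") auto
    qed (use diag in \<open>auto intro!: image_eqI[of _ _ ?k]\<close>)
    then show ?thesis using se jump(3) Y 1 by simp
  next
    case 2
    let ?l = "opt_mode (Suc n) \<omega>"
    have opt_time: "opt_time (Suc n) \<omega> = ereal ?v" using jump(2)[of "Suc n"] 2 by simp
    note o = opt_Suc_real[OF opt_time]
    have l: "?l \<noteq> ?k" "\<And>m. m \<noteq> ?k \<Longrightarrow> ?f m \<le> ?f ?l" using o(3) by (auto simp: best_def)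
    obtain k' where k': "k' \<noteq> ?k" "Yt ?v \<omega> $ ?k \<le> ?f k'" using o(1) by (auto simp: trigger_def better_def)
    \<comment> \<open>The maximum includes the old mode, which \<open>best\<close> leaves out of its
      comparison; the mode k' that triggered the switch covers it.\<close>
    have "(MAX l. ?f l) = ?f ?l"
    proof (rule Max_eqI)
      fix y assume "y \<in> range ?f"
      then obtain x where "y = ?f x" by auto
      then show "y \<le> ?f ?l" using l(2)[of x] l(2)[OF k'(1)] k'(2) diag by (cases "x = ?k") auto
    qed auto
    moreover have "{n<..m} = {Suc n}" using 2 by auto
    ultimately show ?thesis using se jump(3) Y 2 by simp
  qed
qed

end

end

section \<open>Realisation of the optimal strategy\<close>

lemma cadlag_add: "cadlag T f \<Longrightarrow> cadlag T g \<Longrightarrow> cadlag T (\<lambda>s. f s + g s)"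
  unfolding cadlag_def by (blast intro: tendsto_add)

lemma cadlag_mult: "cadlag T f \<Longrightarrow> cadlag T g \<Longrightarrow> cadlag T (\<lambda>s. f s * g s)"
  unfolding cadlag_def by (blast intro: tendsto_mult)

lemma cadlag_const: "cadlag T (\<lambda>s. c)"
  unfolding cadlag_def by (blast intro: tendsto_const)

lemma cadlag_sum: "(\<And>x. x \<in> S \<Longrightarrow> cadlag T (f x)) \<Longrightarrow> cadlag T (\<lambda>s. \<Sum>x\<in>S. f x s)"
  by (induction S rule: infinite_finite_induct) (auto intro: cadlag_add cadlag_const)

lemma cadlag_indicator_Ico: "cadlag T (indicator {a..<b})"
  unfolding cadlag_def
proof (intro conjI ballI)
  fix t :: real
  have "eventually (\<lambda>s. indicator {a..<b} s = (indicator {a..<b} t :: real)) (at_right t)"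
  proof -
    consider "t < a" | "a \<le> t" "t < b" | "b \<le> t" by linarith
    then show ?thesis
    proof cases
      case 1
      show ?thesis unfolding eventually_at_right_field by (rule exI[of _ a]) (use 1 in \<open>auto simp: indicator_def\<close>)
    next
      case 2
      show ?thesis unfolding eventually_at_right_field by (rule exI[of _ b]) (use 2 in \<open>auto simp: indicator_def\<close>)
    next
      case 3
      show ?thesis unfolding eventually_at_right_field by (rule exI[of _ "t + 1"]) (use 3 in \<open>auto simp: indicator_def\<close>)
    qed
  qed
  then show "(indicator {a..<b} \<longlongrightarrow> (indicator {a..<b} t :: real)) (at_right t)" by (rule tendsto_eventually)
  show "\<exists>l::real. (indicator {a..<b} \<longlongrightarrow> l) (at_left t)"
  proof -
    consider "t \<le> a" | "a < t" "t \<le> b" | "b < t" by linarith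
    then obtain l :: real where "eventually (\<lambda>s. indicator {a..<b} s = l) (at_left t)"
    proof cases
      case 1
      have "eventually (\<lambda>s. indicator {a..<b} s = (0::real)) (at_left t)"
        unfolding eventually_at_left_field by (rule exI[of _ "t - 1"]) (use 1 in \<open>auto simp: indicator_def\<close>)
      then show ?thesis by (rule that)
    next
      case 2
      have "eventually (\<lambda>s. indicator {a..<b} s = (1::real)) (at_left t)"
        unfolding eventually_at_left_field by (rule exI[of _ a]) (use 2 in \<open>auto simp: indicator_def\<close>)
      then show ?thesis by (rule that)
    next
      case 3
      have "eventually (\<lambda>s. indicator {a..<b} s = (0::real)) (at_left t)"
        unfolding eventually_at_left_field by (rule exI[of _ b]) (use 3 in \<open>auto simp: indicator_def\<close>)
      then show ?thesis by (rule that)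
    qed
    then show ?thesis by (intro exI[of _ l] tendsto_eventually)
  qed
qed

text \<open>The function vanishes before T, and at T only a left limit is required, so any value may
  be placed there.\<close>

lemma cadlag_indicator_terminal: "cadlag T (\<lambda>s. indicator {T} s * f s)"
  unfolding cadlag_def
proof (intro conjI ballI)
  fix t assume t: "t \<in> {0..<T}"
  have "eventually (\<lambda>s. indicator {T} s * f s = indicator {T} t * f t) (at_right t)"
    unfolding eventually_at_right_field by (rule exI[of _ T]) (use t in \<open>auto simp: indicator_def\<close>)
  then show "((\<lambda>s. indicator {T} s * f s) \<longlongrightarrow> indicator {T} t * f t) (at_right t)" by (rule tendsto_eventually)
next
  fix t assume t: "t \<in> {0<..T}"
  have "eventually (\<lambda>s. indicator {T} s * f s = 0) (at_left t)"
    unfolding eventually_at_left_field by (rule exI[of _ 0]) (use t in \<open>auto simp: indicator_def\<close>)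
  then show "\<exists>l. ((\<lambda>s. indicator {T} s * f s) \<longlongrightarrow> l) (at_left t)" by (intro exI[of _ 0] tendsto_eventually)
qed

context wiener_space
begin

lemma H2_sum:
  fixes Z :: "'i \<Rightarrow> real \<Rightarrow> 'w \<Rightarrow> real ^ 'q"
  assumes "\<And>x. x \<in> S \<Longrightarrow> H2 M \<F> T (Z x)"
  shows "H2 M \<F> T (\<lambda>s \<omega>. \<Sum>x\<in>S. Z x s \<omega>)"
  using assms
proof (induction S rule: infinite_finite_induct)
  case (insert x S)
  have "progressive M \<F> T (Z x)" "progressive M \<F> T (\<lambda>s \<omega>. \<Sum>x\<in>S. Z x s \<omega>)"
    "energy (Z x) < \<infinity>" "energy (\<lambda>s \<omega>. \<Sum>x\<in>S. Z x s \<omega>) < \<infinity>"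
    using insert by (auto simp: H2_iff)
  then show ?case
    using energy_add_le[of "Z x" "\<lambda>s \<omega>. \<Sum>x\<in>S. Z x s \<omega>"] insert.hyps
    by (auto simp: H2_iff ennreal_mult_less_top intro!: progressive_add elim: le_less_trans)
qed (auto simp: H2_iff progressive_zero energy_def)

lemma H2_restrict:
  assumes Z: "H2 M \<F> T Z" and A: "A \<in> sets (\<F> a)"
  shows "H2 M \<F> T (\<lambda>s \<omega>. (indicator {a<..b} s * indicator A \<omega>) *\<^sub>R Z s \<omega>)"
proof -
  have Z': "progressive M \<F> T Z" "energy Z < \<infinity>" using Z by (auto simp: H2_iff)
  have "progressive M \<F> T (\<lambda>s \<omega>. indicator {a<..b} s *\<^sub>R (indicator A \<omega> :: real))"
    by (rule progressive_const[where a=a]) (use A in auto)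
  from progressive_scaleR[OF this Z'(1)]
  have "progressive M \<F> T (\<lambda>s \<omega>. (indicator {a<..b} s * indicator A \<omega>) *\<^sub>R Z s \<omega>)" by simp
  moreover have "energy (\<lambda>s \<omega>. (indicator {a<..b} s * indicator A \<omega>) *\<^sub>R Z s \<omega>) \<le> ennreal (1\<^sup>2) * energy Z"
    by (rule energy_scaleR_le[OF Z'(1)]) (auto simp: indicator_def)
  ultimately show ?thesis using Z'(2) by (auto simp: H2_iff)
qed

end

context switching_bsde
begin

text \<open>The solution of the switched BSDE is assembled from \<open>Yt\<close>, \<open>Z\<close> by following the mode of the
  strategy from one reflection time to the next.\<close>

lemma realisation:
  assumes a: "a \<in> admissible M \<F> T R C t i" and t: "0 \<le> t" "t \<le> T"
    and opt: "\<And>j. j < \<kappa> \<Longrightarrow> t < r (Suc j) \<Longrightarrow> AE \<omega> in M. Y (r (Suc j)) \<omega> $ state a (max t (r j)) \<omega> =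
       Yt (r (Suc j)) \<omega> $ state a (r (Suc j)) \<omega> - (cum_cost T C a (r (Suc j)) \<omega> - cum_cost T C a (max t (r j)) \<omega>)"
  shows "\<exists>U V. switched_bsde M \<F> T W C F \<xi> t a U V"
proof -
  obtain J where J: "\<And>k. ito (\<lambda>t \<omega>. Z t \<omega> $ k) (J k)"
    "AE \<omega> in M. \<forall>j<\<kappa>. \<forall>u\<in>{r j..<r (Suc j)}. \<forall>k. Yt u \<omega> $ k = Y (r (Suc j)) \<omega> $ k
       + (LINT s:{u..r (Suc j)}|lborel. drv k (\<lambda>s \<omega>. Yt s \<omega> $ k) (\<lambda>s \<omega>. Z s \<omega> $ k) s \<omega>)
       - (J k (r (Suc j)) \<omega> - J k u \<omega>)"
    using ito_Z_exists by blast
  \<comment> \<open>Left ends of the cells, cut off at t: cells before t become degenerate and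
    contribute nothing.\<close>
  define e where "e = (\<lambda>j. max t (r j))"
  have e_mono: "e j \<le> e k" if "j \<le> k" "k \<le> \<kappa>" for j k using r_mono[OF that] by (auto simp: e_def)
  have e_T: "e \<kappa> = T" using t grid_facts by (auto simp: e_def)
  have e_b: "t \<le> e j" "0 \<le> e j" "e j \<le> T" if "j \<le> \<kappa>" for j using t r_bounds[OF that] by (auto simp: e_def)
  have e_0: "e 0 = t" using t grid_facts by (simp add: e_def)
  define A where "A = (\<lambda>j k. {\<omega>\<in>space M. state a (e j) \<omega> = k})"
  have A: "A j k \<in> sets (\<F> (e j))" if "j \<le> \<kappa>" for j k
    unfolding A_def using state_event[OF a t(1) e_b(1,3)[OF that]] .
  \<comment> \<open>Cells are closed on the left and open on the right, which makes U cadlag; T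
    belongs to none of them and gets its own term.\<close>
  define U where "U = (\<lambda>s \<omega>. (\<Sum>j<\<kappa>. \<Sum>k\<in>UNIV. indicator {e j..<e (Suc j)} s * (indicator (A j k) \<omega> * Yt s \<omega> $ k))
      + indicator {T} s * (\<Sum>k\<in>UNIV. indicator (A \<kappa> k) \<omega> * Yt s \<omega> $ k))"
  \<comment> \<open>Cells are left-open here, to match the restriction of Ito integrals. The two
    conventions differ only at the ends of cells, a null set of times.\<close>
  define V where "V = (\<lambda>s \<omega>. \<Sum>j<\<kappa>. \<Sum>k\<in>UNIV. (indicator {e j<..e (Suc j)} s * indicator (A j k) \<omega>) *\<^sub>R Z s \<omega> $ k)"
  define I where "I = (\<lambda>s \<omega>. \<Sum>j<\<kappa>. \<Sum>k\<in>UNIV. indicator (A j k) \<omega> * (J k (min (e (Suc j)) s) \<omega> - J k (min (e j) s) \<omega>))"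
  \<comment> \<open>For each j exactly one of the events \<open>A j k\<close> contains the path, so
    the sum selects the current mode.\<close>
  have pick: "(\<Sum>k\<in>UNIV. indicator (A j k) \<omega> *\<^sub>R f k) = f (state a (e j) \<omega>)"
    if "\<omega> \<in> space M" for f :: "('d::{finite,linorder}) \<Rightarrow> 'b::real_vector" and j \<omega>
  proof -
    have "(\<Sum>k\<in>UNIV. indicator (A j k) \<omega> *\<^sub>R f k) = (\<Sum>k\<in>UNIV. if k = state a (e j) \<omega> then f k else 0)"
      using that by (intro sum.cong) (auto simp: A_def indicator_def)
    then show ?thesis by simp
  qed
  have cell: "s \<notin> {e j'..<e (Suc j')}" "s \<notin> {e j'<..<e (Suc j')}"
    if "s \<in> {e j..<e (Suc j)}" "j < \<kappa>" "j' < \<kappa>" "j' \<noteq> j" for s j j'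
    using that e_mono[of "Suc j'" j] e_mono[of "Suc j" j'] by (auto simp: neq_iff Suc_le_eq)
  have U_cell: "U s \<omega> = Yt s \<omega> $ state a (e j) \<omega>" if s: "s \<in> {e j..<e (Suc j)}" and j: "j < \<kappa>" and \<omega>: "\<omega> \<in> space M" for s j \<omega>
  proof -
    have "s \<noteq> T" using s e_b[of "Suc j"] j by auto
    have "(\<Sum>j'<\<kappa>. \<Sum>k\<in>UNIV. indicator {e j'..<e (Suc j')} s * (indicator (A j' k) \<omega> * Yt s \<omega> $ k))
        = (\<Sum>j'<\<kappa>. if j' = j then \<Sum>k\<in>UNIV. indicator (A j' k) \<omega> *\<^sub>R Yt s \<omega> $ k else 0)"
      using s cell(1)[OF s j] by (intro sum.cong) (auto simp: indicator_def intro!: sum.neutral)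
    then show ?thesis using \<open>s \<noteq> T\<close> j pick[OF \<omega>, of j "\<lambda>k. Yt s \<omega> $ k"] by (simp add: U_def)
  qed
  have U_T: "U T \<omega> = Yt T \<omega> $ state a T \<omega>" if \<omega>: "\<omega> \<in> space M" for \<omega>
  proof -
    have "T \<notin> {e j..<e (Suc j)}" if "j < \<kappa>" for j using e_b[of "Suc j"] that by auto
    then have "(\<Sum>j'<\<kappa>. \<Sum>k\<in>UNIV. indicator {e j'..<e (Suc j')} T * (indicator (A j' k) \<omega> * Yt T \<omega> $ k)) = 0"
      by (intro sum.neutral ballI) auto
    then show ?thesis using pick[OF \<omega>, of \<kappa> "\<lambda>k. Yt T \<omega> $ k"] by (simp add: U_def e_T)
  qed
  have V_cell: "V s \<omega> = Z s \<omega> $ state a (e j) \<omega>" if s: "s \<in> {e j<..<e (Suc j)}" and j: "j < \<kappa>" and \<omega>: "\<omega> \<in> space M" for s j \<omega>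
  proof -
    have n: "s \<notin> {e j'<..e (Suc j')}" if "j' < \<kappa>" "j' \<noteq> j" for j'
      using that s e_mono[of "Suc j'" j] e_mono[of "Suc j" j'] j by (auto simp: neq_iff Suc_le_eq)
    have "V s \<omega> = (\<Sum>j'<\<kappa>. if j' = j then \<Sum>k\<in>UNIV. indicator (A j' k) \<omega> *\<^sub>R Z s \<omega> $ k else 0)"
      unfolding V_def using s n by (intro sum.cong) (auto simp: indicator_def intro!: sum.neutral)
    then show ?thesis using j pick[OF \<omega>, of j "\<lambda>k. Z s \<omega> $ k"] by simp
  qed
  \<comment> \<open>Between u and v only the summand of cell j moves: earlier ones are frozen at
    their right end, later ones have not started.\<close>
  have I_cell: "I v \<omega> - I u \<omega> = J (state a (e j) \<omega>) v \<omega> - J (state a (e j) \<omega>) u \<omega>"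
    if u: "e j \<le> u" "u \<le> v" "v = e (Suc j)" and j: "j < \<kappa>" and \<omega>: "\<omega> \<in> space M" for u v j \<omega>
  proof -
    have "I s \<omega> = (\<Sum>j'<\<kappa>. J (state a (e j') \<omega>) (min (e (Suc j')) s) \<omega> - J (state a (e j') \<omega>) (min (e j') s) \<omega>)" for s
      unfolding I_def using pick[OF \<omega>, of _ "\<lambda>k. J k _ \<omega> - J k _ \<omega>"] by (intro sum.cong) auto
    then have "I v \<omega> - I u \<omega> = (\<Sum>j'<\<kappa>. (J (state a (e j') \<omega>) (min (e (Suc j')) v) \<omega> - J (state a (e j') \<omega>) (min (e j') v) \<omega>)
        - (J (state a (e j') \<omega>) (min (e (Suc j')) u) \<omega> - J (state a (e j') \<omega>) (min (e j') u) \<omega>))"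
      by (simp add: sum_subtractf)
    also have "\<dots> = (\<Sum>j'<\<kappa>. if j' = j then J (state a (e j') \<omega>) v \<omega> - J (state a (e j') \<omega>) u \<omega> else 0)"
    proof (rule sum.cong[OF refl])
      fix j' assume "j' \<in> {..<\<kappa>}"
      then have j': "j' < \<kappa>" by simp
      consider "j' < j" | "j' = j" | "j < j'" by linarith
      then show "(J (state a (e j') \<omega>) (min (e (Suc j')) v) \<omega> - J (state a (e j') \<omega>) (min (e j') v) \<omega>)
        - (J (state a (e j') \<omega>) (min (e (Suc j')) u) \<omega> - J (state a (e j') \<omega>) (min (e j') u) \<omega>)
        = (if j' = j then J (state a (e j') \<omega>) v \<omega> - J (state a (e j') \<omega>) u \<omega> else 0)"
      proof cases
        case 1
        then have "e (Suc j') \<le> e j" "e j' \<le> e (Suc j')" using e_mono[of "Suc j'" j] e_mono[of j' "Suc j'"] j j' by auto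
        then have "min (e (Suc j')) v = e (Suc j')" "min (e (Suc j')) u = e (Suc j')"
          "min (e j') v = e j'" "min (e j') u = e j'" using u by auto
        then show ?thesis using 1 by simp
      next
        case 2
        then have "min (e (Suc j')) v = v" "min (e (Suc j')) u = u" "min (e j') v = e j'" "min (e j') u = e j'"
          using u by auto
        then show ?thesis using 2 by simp
      next
        case 3
        then have "e (Suc j) \<le> e j'" "e j' \<le> e (Suc j')" using e_mono[of "Suc j" j'] e_mono[of j' "Suc j'"] j j' by auto
        then have "min (e (Suc j')) v = v" "min (e (Suc j')) u = u" "min (e j') v = v" "min (e j') u = u"
          using u by auto
        then show ?thesis using 3 by simp
      qed
    qed
    also have "\<dots> = J (state a (e j) \<omega>) v \<omega> - J (state a (e j) \<omega>) u \<omega>" using j by simp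
    finally show ?thesis .
  qed
  have find: "\<exists>j<\<kappa>. s \<in> {e j..<e (Suc j)}" if "s \<in> {t..<T}" for s
  proof -
    have "s \<in> {0..<T}" using that t by auto
    then obtain j where "j < \<kappa>" "r j \<le> s" "s < r (Suc j)" using cell_exists by blast
    then show ?thesis using that by (intro exI[of _ j]) (auto simp: e_def)
  qed
  have US2: "S2 M \<F> T U"
  proof -
    have p1: "progressive M \<F> T (\<lambda>s \<omega>. indicator {e j..<e (Suc j)} s * (indicator (A j k) \<omega> * Yt s \<omega> $ k))" if j: "j < \<kappa>" for j k
    proof -
      have "progressive M \<F> T (\<lambda>s \<omega>. indicator {e j..<e (Suc j)} s *\<^sub>R (indicator (A j k) \<omega> :: real))"
        by (rule progressive_const[where a="e j"]) (use A j in auto)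
      from progressive_scaleR[OF this S2_progressive[OF Yt_S2]] show ?thesis by (simp add: mult.assoc)
    qed
    have p2: "progressive M \<F> T (\<lambda>s \<omega>. indicator {T} s * (\<Sum>k\<in>UNIV. indicator (A \<kappa> k) \<omega> * Yt s \<omega> $ k))"
    proof -
      have "progressive M \<F> T (\<lambda>s \<omega>. indicator {T} s *\<^sub>R (indicator (A \<kappa> k) \<omega> :: real))" for k
        by (rule progressive_const[where a=T]) (use A[of \<kappa>] e_T in auto)
      from progressive_scaleR[OF this S2_progressive[OF Yt_S2]]
      have "progressive M \<F> T (\<lambda>s \<omega>. \<Sum>k\<in>UNIV. (indicator {T} s *\<^sub>R (indicator (A \<kappa> k) \<omega> :: real)) *\<^sub>R Yt s \<omega> $ k)"
        by (intro progressive_sum)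
      then show ?thesis by (simp only: sum_distrib_left mult.assoc real_scaleR_def)
    qed
    have p: "progressive M \<F> T U" unfolding U_def
      by (intro progressive_add progressive_sum p1 p2) auto
    have "AE \<omega> in M. \<forall>k\<in>UNIV. cadlag T (\<lambda>t. Yt t \<omega> $ k)"
      by (rule AE_finite_allI) (use Yt_S2 in \<open>auto simp: S2_def\<close>)
    then have c: "AE \<omega> in M. cadlag T (\<lambda>s. U s \<omega>)"
    proof eventually_elim
      case (elim \<omega>)
      show ?case unfolding U_def
        by (intro cadlag_add cadlag_sum cadlag_mult[OF cadlag_indicator_Ico] cadlag_mult[OF cadlag_const]
            cadlag_indicator_terminal) (use elim in auto)
    qed
    have "\<forall>k. \<exists>w. integrable M w \<and> (AE \<omega> in M. \<forall>t\<in>{0..T}. (Yt t \<omega> $ k)\<^sup>2 \<le> w \<omega>)"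
    proof
      fix k
      obtain w where "integrable M w" "AE \<omega> in M. \<forall>t\<in>{0..T}. (Yt t \<omega> $ k)\<^sup>2 \<le> w \<omega>"
        using S2_dominated[OF Yt_S2] .
      then show "\<exists>w. integrable M w \<and> (AE \<omega> in M. \<forall>t\<in>{0..T}. (Yt t \<omega> $ k)\<^sup>2 \<le> w \<omega>)" by blast
    qed
    from choice[OF this] obtain w
      where w: "\<And>k. integrable M (w k)" "\<And>k. AE \<omega> in M. \<forall>t\<in>{0..T}. (Yt t \<omega> $ k)\<^sup>2 \<le> w k \<omega>" by blast
    have wAE: "AE \<omega> in M. \<forall>k\<in>UNIV. \<forall>t\<in>{0..T}. (Yt t \<omega> $ k)\<^sup>2 \<le> w k \<omega>"
      by (rule AE_finite_allI) (use w(2) in auto)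
    have "(\<integral>\<^sup>+ \<omega>. (SUP s\<in>{0..T}. ennreal (\<bar>U s \<omega>\<bar>\<^sup>2)) \<partial>M) \<le> (\<integral>\<^sup>+ \<omega>. ennreal (\<Sum>k\<in>UNIV. \<bar>w k \<omega>\<bar>) \<partial>M)"
    proof (rule nn_integral_mono_AE)
      have "AE \<omega> in M. \<omega> \<in> space M" by simp
      with wAE show "AE \<omega> in M. (SUP s\<in>{0..T}. ennreal (\<bar>U s \<omega>\<bar>\<^sup>2)) \<le> ennreal (\<Sum>k\<in>UNIV. \<bar>w k \<omega>\<bar>)"
      proof eventually_elim
        case (elim \<omega>)
        show ?case
        proof (intro SUP_least ennreal_leI)
          fix s assume s: "s \<in> {0..T}"
          have b: "(Yt s \<omega> $ k)\<^sup>2 \<le> (\<Sum>k\<in>UNIV. \<bar>w k \<omega>\<bar>)" for k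
          proof -
            have "(Yt s \<omega> $ k)\<^sup>2 \<le> \<bar>w k \<omega>\<bar>" using elim(1) s by (auto intro: order_trans[OF _ abs_ge_self])
            also have "\<dots> \<le> (\<Sum>k\<in>UNIV. \<bar>w k \<omega>\<bar>)" by (rule member_le_sum) auto
            finally show ?thesis .
          qed
          consider "s < t" | "s \<in> {t..<T}" | "s = T" using s by fastforce
          then show "\<bar>U s \<omega>\<bar>\<^sup>2 \<le> (\<Sum>k\<in>UNIV. \<bar>w k \<omega>\<bar>)"
          proof cases
            case 1
            then have "indicator {e j..<e (Suc j)} s = (0::real)" if "j < \<kappa>" for j using e_b[of j] that by auto
            then have "(\<Sum>j<\<kappa>. \<Sum>k\<in>UNIV. indicator {e j..<e (Suc j)} s * (indicator (A j k) \<omega> * Yt s \<omega> $ k)) = 0"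
              by (intro sum.neutral ballI) simp
            then have "U s \<omega> = 0" using 1 t unfolding U_def by simp
            then show ?thesis by (auto intro: sum_nonneg)
          next
            case 2
            then obtain j where "j < \<kappa>" "s \<in> {e j..<e (Suc j)}" using find by blast
            then show ?thesis using U_cell[OF _ _ elim(2)] b by simp
          next
            case 3
            then show ?thesis using U_T[OF elim(2)] b by simp
          qed
        qed
      qed
    qed
    also have "\<dots> = ennreal (\<integral>\<omega>. (\<Sum>k\<in>UNIV. \<bar>w k \<omega>\<bar>) \<partial>M)"
      using w by (intro nn_integral_eq_integral) (auto intro!: AE_I2 sum_nonneg)
    also have "\<dots> < \<infinity>" by simp
    finally show ?thesis unfolding S2_def sup_L2_def using p c by simp
  qed
  have VH2: "H2 M \<F> T V" unfolding V_def
    by (intro H2_sum H2_restrict Z_H2 A) auto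
  have prog: "progressive M \<F> T (\<lambda>s \<omega>. (indicator {e j<..e (Suc j)} s * indicator (A j k) \<omega>) *\<^sub>R Z s \<omega> $ k)"
    if "j < \<kappa>" for j k
    using H2_restrict[OF Z_H2 A[OF less_imp_le[OF that]]] by (simp add: H2_iff)
  have itoV: "ito V I" unfolding V_def I_def
  proof (intro ito_sum progressive_sum)
    fix j k assume "j \<in> {..<\<kappa>}"
    then have j: "j < \<kappa>" "j \<le> \<kappa>" "Suc j \<le> \<kappa>" by auto
    have Zp: "progressive M \<F> T (\<lambda>t \<omega>. Z t \<omega> $ k)" using Z_H2[of k] by (simp add: H2_iff)
    have X: "(indicator (A j k) :: 'w \<Rightarrow> real) \<in> borel_measurable (\<F> (e j))" using A[OF j(2)] by simp
    show "ito (\<lambda>s \<omega>. (indicator {e j<..e (Suc j)} s * indicator (A j k) \<omega>) *\<^sub>R Z s \<omega> $ k)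
       (\<lambda>s \<omega>. indicator (A j k) \<omega> * (J k (min (e (Suc j)) s) \<omega> - J k (min (e j) s) \<omega>))"
      using e_b j e_mono[of j "Suc j"]
      by (intro ito_restrict(1)[OF J(1) Zp X, of 1]) (auto simp: indicator_def)
  qed (use prog in auto)
  have optAE: "AE \<omega> in M. \<forall>j\<in>{..<\<kappa>}. t < r (Suc j) \<longrightarrow> Y (r (Suc j)) \<omega> $ state a (max t (r j)) \<omega> =
       Yt (r (Suc j)) \<omega> $ state a (r (Suc j)) \<omega> - (cum_cost T C a (r (Suc j)) \<omega> - cum_cost T C a (max t (r j)) \<omega>)"
    by (rule AE_finite_allI) (use opt in auto)
  have yzAE: "AE \<omega> in M. \<forall>k\<in>UNIV. \<forall>l. set_integrable lborel {0..T} (\<lambda>s. drv l (\<lambda>s \<omega>. Yt s \<omega> $ k) (\<lambda>s \<omega>. Z s \<omega> $ k) s \<omega>)"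
    by (rule AE_finite_allI) (use drv_integrable[OF Yt_S2 Z_H2] in auto)
  have "AE \<omega> in M. \<omega> \<in> space M" by simp
  with J(2) optAE admissible_regular[OF a] drv_integrable[OF US2 VH2] Y_terminal yzAE
  have "AE \<omega> in M. \<forall>u\<in>{t..T}. U u \<omega> = \<xi> \<omega> $ state a T \<omega>
             + (LINT s:{u..T}|lborel. drv (state a s \<omega>) U V s \<omega>)
             - (I T \<omega> - I u \<omega>) - cum_cost T C a T \<omega> + cum_cost T C a u \<omega>"
  proof eventually_elim
    case (elim \<omega>)
    let ?f = "\<lambda>s. drv (state a s \<omega>) U V s \<omega>"
    let ?P = "\<lambda>u. U u \<omega> = \<xi> \<omega> $ state a T \<omega> + (LINT s:{u..T}|lborel. ?f s)
             - (I T \<omega> - I u \<omega>) - cum_cost T C a T \<omega> + cum_cost T C a u \<omega>"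
    have f: "set_integrable lborel {t..T} ?f" by (rule switched_driver_integrable[OF elim(3) t elim(4)])
    have PT: "?P T" using U_T[OF elim(7)] elim(5) by simp
    \<comment> \<open>The hypothesis \<open>opt\<close> replaces the reflected value at the right
      end by the component of the new mode minus the cost, which is exactly the jump of the switched
      equation.\<close>
    have step: "?P u" if j: "j < \<kappa>" and P: "?P (e (Suc j))" and u: "u \<in> {e j..<e (Suc j)}" for j u
    proof -
      define v where "v = e (Suc j)"
      have tv: "t < r (Suc j)" using u e_b[of j] j by (auto simp: e_def)
      then have v: "v = r (Suc j)" by (simp add: v_def e_def)
      define k where "k = state a (e j) \<omega>"
      have te: "t \<le> e j" using e_b[of j] j by simp
      have vT: "v \<le> T" and gap: "R \<inter> {e j<..<v} = {}"
        using cell_facts(4,5)[OF j t(1) tv] unfolding v e_def by auto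
      have ns: "state a s \<omega> = k" "cum_cost T C a s \<omega> = cum_cost T C a (e j) \<omega>" if "s \<in> {e j..<v}" for s
        using no_switch_between[OF elim(3) te vT gap that] unfolding k_def by auto
      have uv: "e j \<le> u" "u < v" "v \<le> T" "t \<le> u" using u e_b[of j] e_b[of "Suc j"] j by (auto simp: v_def)
      have Yu: "Yt u \<omega> $ k = Y v \<omega> $ k
         + (LINT s:{u..v}|lborel. drv k (\<lambda>s \<omega>. Yt s \<omega> $ k) (\<lambda>s \<omega>. Z s \<omega> $ k) s \<omega>) - (J k v \<omega> - J k u \<omega>)"
        using elim(1) j u tv unfolding v by (auto simp: e_def)
      have Yv: "Y v \<omega> $ k = Yt v \<omega> $ state a v \<omega> - (cum_cost T C a v \<omega> - cum_cost T C a (e j) \<omega>)"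
        using elim(2) j tv unfolding v k_def by (auto simp: e_def)
      \<comment> \<open>The next cell starts at v, so U already follows the new mode there.\<close>
      have Uv: "U v \<omega> = Yt v \<omega> $ state a v \<omega>"
      proof (cases "v = T")
        case True
        then show ?thesis using U_T[OF elim(7)] by simp
      next
        case False
        then have "Suc j < \<kappa>" using j grid_facts(3) v by (metis Suc_lessI)
        moreover have "v \<in> {e (Suc j)..<e (Suc (Suc j))}"
          using tv grid_facts(4)[OF \<open>Suc j < \<kappa>\<close>] by (auto simp: v e_def)
        ultimately show ?thesis using U_cell[of v "Suc j"] elim(7) by (simp add: v_def)
      qed
      have Uu: "U u \<omega> = Yt u \<omega> $ k" using U_cell[OF u j elim(7)] by (simp add: k_def)
      have fu: "set_integrable lborel {u..T} ?f" using f by (rule set_integrable_subset) (use uv in auto)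
      have split: "(LINT s:{u..T}|lborel. ?f s) = (LINT s:{u..v}|lborel. ?f s) + (LINT s:{v..T}|lborel. ?f s)"
        by (rule set_lebesgue_integral_split[OF fu]) (use uv in auto)
      have "(LINT s:{u..v}|lborel. ?f s) = (LINT s:{u..v}|lborel. drv k (\<lambda>s \<omega>. Yt s \<omega> $ k) (\<lambda>s \<omega>. Z s \<omega> $ k) s \<omega>)"
        unfolding set_lebesgue_integral_def
      proof (rule Bochner_Integration.integral_cong_AE)
        have sub: "{u..v} \<subseteq> {u..T}" "{u..v} \<subseteq> {0..T}" using uv t by auto
        have "set_integrable lborel {u..v} ?f" using fu by (rule set_integrable_subset) (use sub in auto)
        moreover have "set_integrable lborel {u..v} (\<lambda>s. drv k (\<lambda>s \<omega>. Yt s \<omega> $ k) (\<lambda>s \<omega>. Z s \<omega> $ k) s \<omega>)"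
          by (rule set_integrable_subset[of lborel "{0..T}"]) (use elim(6) sub in auto)
        ultimately show "(\<lambda>s. indicator {u..v} s *\<^sub>R ?f s) \<in> borel_measurable lborel"
          "(\<lambda>s. indicator {u..v} s *\<^sub>R drv k (\<lambda>s \<omega>. Yt s \<omega> $ k) (\<lambda>s \<omega>. Z s \<omega> $ k) s \<omega>) \<in> borel_measurable lborel"
          unfolding set_integrable_def by auto
        \<comment> \<open>Both ends are dropped: V follows the mode of the cell on its interior, U
          on the half-open cell.\<close>
        show "AE s in lborel. indicator {u..v} s *\<^sub>R ?f s = indicator {u..v} s *\<^sub>R drv k (\<lambda>s \<omega>. Yt s \<omega> $ k) (\<lambda>s \<omega>. Z s \<omega> $ k) s \<omega>"
          using AE_lborel_singleton[of v] AE_lborel_singleton[of "e j"]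
        proof eventually_elim
          case (elim s)
          show ?case
          proof (cases "s \<in> {u..v}")
            case True
            then have s: "s \<in> {e j<..<e (Suc j)}" "s \<in> {e j..<v}" using elim uv by (auto simp: v_def)
            then show ?thesis using ns(1)[OF s(2)] U_cell[of s j] V_cell[of s j] j \<open>\<omega> \<in> space M\<close>
              by (simp add: drv_def k_def)
          qed simp
        qed
      qed
      moreover have "I v \<omega> - I u \<omega> = J k v \<omega> - J k u \<omega>"
        unfolding k_def by (rule I_cell) (use uv j elim(7) in \<open>auto simp: v_def\<close>)
      moreover have "cum_cost T C a u \<omega> = cum_cost T C a (e j) \<omega>" using ns(2)[of u] uv by auto
      ultimately show ?thesis using P Uu Uv Yu Yv split unfolding v_def[symmetric] by linarith
    qed
    have Q: "?P (e j)" if "j \<le> \<kappa>" for j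
      using that
    proof (induction rule: inc_induct)
      case base
      then show ?case using PT unfolding e_T .
    next
      case (step j)
      \<comment> \<open>A degenerate cell has equal ends and passes the claim on unchanged.\<close>
      then show ?case using \<open>\<And>u j. j < \<kappa> \<Longrightarrow> ?P (e (Suc j)) \<Longrightarrow> u \<in> {e j..<e (Suc j)} \<Longrightarrow> ?P u\<close>[of j "e j"] e_mono[of j "Suc j"]
        by (cases "e j = e (Suc j)") auto
    qed
    show ?case
    proof
      fix u assume u: "u \<in> {t..T}"
      show "?P u"
      proof (cases "u = T")
        case False
        then obtain j where "j < \<kappa>" "u \<in> {e j..<e (Suc j)}" using find[of u] u by auto
        then show ?thesis using step Q[of "Suc j"] by auto
      qed (use PT in simp)
    qed
  qed
  then show ?thesis unfolding switched_bsde_def using US2 VH2 itoV by (auto simp: drv_def)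
qed

text \<open>The solution built for the optimal strategy belongs to the family and equals the
  component of \<open>Yt\<close> at time t. Every almost sure upper bound of the family therefore
  dominates that component, which together with domination gives the essential supremum.\<close>

theorem verification:
  assumes t: "t \<in> {0..T}"
  shows "(\<forall>a \<in> admissible M \<F> T R C t i. \<forall>U V.
            switched_bsde M \<F> T W C F \<xi> t a U V \<longrightarrow> (AE \<omega> in M. U t \<omega> \<le> Yt t \<omega> $ i))
       \<and> (let a' = opt_strategy T R C Yt t i in
            a' \<in> admissible M \<F> T R C t i \<and>
            (\<exists>U V. switched_bsde M \<F> T W C F \<xi> t a' U V) \<and>
            (\<forall>U V. switched_bsde M \<F> T W C F \<xi> t a' U V \<longrightarrow> (AE \<omega> in M. Yt t \<omega> $ i = U t \<omega>)))
       \<and> is_ess_sup_family M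
            {\<lambda>\<omega>. ereal (U t \<omega>) | a U V.
               a \<in> admissible M \<F> T R C t i \<and> switched_bsde M \<F> T W C F \<xi> t a U V}
            (\<lambda>\<omega>. ereal (Yt t \<omega> $ i))"
proof -
  have t': "0 \<le> t" "t \<le> T" using t by auto
  let ?a = "opt_strategy T R C Yt t i"
  have adm: "?a \<in> admissible M \<F> T R C t i"
    unfolding opt_strategy_eq[OF t'] by (rule opt_admissible[OF t'])
  have cell: "AE \<omega> in M. Y (r (Suc j)) \<omega> $ state ?a (max t (r j)) \<omega> =
       Yt (r (Suc j)) \<omega> $ state ?a (r (Suc j)) \<omega> - (cum_cost T C ?a (r (Suc j)) \<omega> - cum_cost T C ?a (max t (r j)) \<omega>)"
    if "j < \<kappa>" "t < r (Suc j)" for j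
    unfolding opt_strategy_eq[OF t'] by (rule opt_cell[OF t' that])
  have dom: "AE \<omega> in M. U t \<omega> \<le> Yt t \<omega> $ i"
    if "a \<in> admissible M \<F> T R C t i" "switched_bsde M \<F> T W C F \<xi> t a U V" for a U V
    by (rule domination[OF that(1) t' that(2)])
  have att: "AE \<omega> in M. Yt t \<omega> $ i = U t \<omega>" if sb: "switched_bsde M \<F> T W C F \<xi> t ?a U V" for U V
  proof -
    have "AE \<omega> in M. Yt t \<omega> $ i \<le> U t \<omega>" by (rule attainment[OF adm t' sb]) (rule cell)
    with dom[OF adm sb] show ?thesis by eventually_elim simp
  qed
  obtain U V where UV: "switched_bsde M \<F> T W C F \<xi> t ?a U V"
    using realisation[OF adm t' cell] by blast
  have "is_ess_sup_family M
            {\<lambda>\<omega>. ereal (U t \<omega>) | a U V.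
               a \<in> admissible M \<F> T R C t i \<and> switched_bsde M \<F> T W C F \<xi> t a U V}
            (\<lambda>\<omega>. ereal (Yt t \<omega> $ i))"
    unfolding is_ess_sup_family_def
  proof (intro conjI ballI impI)
    have [measurable]: "(\<lambda>\<omega>. Yt t \<omega> $ i) \<in> borel_measurable M"
      using progressive_at_events[OF S2_progressive[OF Yt_S2] t] .
    show "(\<lambda>\<omega>. ereal (Yt t \<omega> $ i)) \<in> borel_measurable M" by measurable
    fix \<phi> assume "\<phi> \<in> {\<lambda>\<omega>. ereal (U t \<omega>) | a U V.
               a \<in> admissible M \<F> T R C t i \<and> switched_bsde M \<F> T W C F \<xi> t a U V}"
    then obtain a U V where \<phi>: "\<phi> = (\<lambda>\<omega>. ereal (U t \<omega>))" "a \<in> admissible M \<F> T R C t i"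
      "switched_bsde M \<F> T W C F \<xi> t a U V" by blast
    show "AE \<omega> in M. \<phi> \<omega> \<le> ereal (Yt t \<omega> $ i)"
      using dom[OF \<phi>(2,3)] unfolding \<phi>(1) by eventually_elim simp
  next
    fix X' :: "'w \<Rightarrow> ereal"
    assume X': "\<forall>\<phi>\<in>{\<lambda>\<omega>. ereal (U t \<omega>) | a U V.
               a \<in> admissible M \<F> T R C t i \<and> switched_bsde M \<F> T W C F \<xi> t a U V}. AE \<omega> in M. \<phi> \<omega> \<le> X' \<omega>"
    have "(\<lambda>\<omega>. ereal (U t \<omega>)) \<in> {\<lambda>\<omega>. ereal (U t \<omega>) | a U V.
               a \<in> admissible M \<F> T R C t i \<and> switched_bsde M \<F> T W C F \<xi> t a U V}"
      using adm UV by blast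
    from bspec[OF X' this] att[OF UV] show "AE \<omega> in M. ereal (Yt t \<omega> $ i) \<le> X' \<omega>"
      by eventually_elim simp
  qed
  then show ?thesis using dom adm UV att unfolding Let_def by blast
qed

end

theorem theorem2p1:
  fixes M :: "'w measure"
    and W :: "real \<Rightarrow> 'w \<Rightarrow> real ^ ('q::finite)"
    and T L :: real
    and C_L :: "real \<Rightarrow> real"
    and \<F> :: "real \<Rightarrow> 'w measure"
    and C :: "real \<Rightarrow> 'w \<Rightarrow> real ^ ('d::{finite,linorder}) ^ ('d::{finite,linorder})"
    and F :: "'w \<Rightarrow> real \<Rightarrow> real ^ ('d::{finite,linorder}) \<Rightarrow> real ^ 'q ^ ('d::{finite,linorder}) \<Rightarrow> real ^ ('d::{finite,linorder})"
    and \<xi> :: "'w \<Rightarrow> real ^ ('d::{finite,linorder})"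
    and \<beta> :: "'w \<Rightarrow> real"
    and \<kappa> :: nat
    and r :: "nat \<Rightarrow> real"
    and R :: "real set"
    and Yt Y :: "real \<Rightarrow> 'w \<Rightarrow> real ^ ('d::{finite,linorder})"
    and Z :: "real \<Rightarrow> 'w \<Rightarrow> real ^ 'q ^ ('d::{finite,linorder})"
    and i :: "'d::{finite,linorder}"
    and t :: real
  assumes "prob_space M" and "complete_measure M"
    and "0 < T" and "0 < L"
    and "brownian_motion M T W"
    and "\<F> = augmented_filtration M W"
    and "cost_process M \<F> T L C"
    and "driver M \<F> T L F"
    and "terminal_value M \<F> T C \<xi>"
    and "cond_C 2 M T L C_L \<beta> C F \<xi>"
    and "reflection_grid T L \<kappa> r" and "R = r ` {..\<kappa>}"
    and "reflected_bsde M \<F> T W \<kappa> r C F \<xi> Yt Y Z"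
    and "t \<in> {0..T}"
  shows "(\<forall>a \<in> admissible M \<F> T R C t i. \<forall>U V.
            switched_bsde M \<F> T W C F \<xi> t a U V \<longrightarrow> (AE \<omega> in M. U t \<omega> \<le> Yt t \<omega> $ i))
       \<and> (let a' = opt_strategy T R C Yt t i in
            a' \<in> admissible M \<F> T R C t i \<and>
            (\<exists>U V. switched_bsde M \<F> T W C F \<xi> t a' U V) \<and>
            (\<forall>U V. switched_bsde M \<F> T W C F \<xi> t a' U V \<longrightarrow> (AE \<omega> in M. Yt t \<omega> $ i = U t \<omega>)))
       \<and> is_ess_sup_family M
            {\<lambda>\<omega>. ereal (U t \<omega>) | a U V.
               a \<in> admissible M \<F> T R C t i \<and> switched_bsde M \<F> T W C F \<xi> t a U V}
            (\<lambda>\<omega>. ereal (Yt t \<omega> $ i))"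
proof -
  interpret switching_bsde M W T \<F> L C_L C F \<xi> \<beta> \<kappa> r R Yt Y Z
    by (intro switching_bsde.intro wiener_space.intro wiener_space_axioms.intro
        switching_bsde_axioms.intro assms)
  show ?thesis by (rule verification[OF \<open>t \<in> {0..T}\<close>])
qed

end
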